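(* The counting measure $N_{\mathrm{PPP}(1,1)}$ is stationary for the bullet model with parameter $\mathfrak{p}_{\mathrm{CBMC}}=(0,1,1,0,0,0,0,1)$ (that is, $\lambda_0=0$, $\lambda_V=\lambda_H=1$, $\tau_V=\tau_H=0$, $p_V=p_H=0$, $p_0=1$).
   Context: Bullet model. A parameter is $\mathfrak{p}=(\lambda_0,\lambda_V,\lambda_H,\tau_V,\tau_H,p_V,p_H,p_0)$ with $\lambda_0,\lambda_V,\lambda_H,\tau_V,\tau_H\in[0,\infty)$, $p_V,p_H,p_0\in[0,1]$ and $p_V+p_H+p_0\le 1$. An initial condition is a pair $(\mathcal{C}_X,\mathcal{C}_Y)$ of locally finite sets $\mathcal{C}_X\subset[0,\infty)\times\{0\}$, $\mathcal{C}_Y\subset\{0\}\times[0,\infty)$. Let $\Xi_0$ be a Poisson point process on $(0,\infty)^2$ with intensity $\lambda_0\,dx\,dy$. The bullet model is the random set of horizontal and vertical segments and half-lines in $[0,\infty)^2$ built as follows (all random choices being independent). A vertical line going up starts from each point of $\mathcal{C}_X$; a horizontal line going right starts from each point of $\mathcal{C}_Y$; from each point of $\Xi_0$ both a vertical line going up and a horizontal line going right start. Along a vertical line: at rate $\lambda_V$ (per unit length) a new horizontal line going right starts and the vertical line continues (split); at rate $\tau_V$ the vertical line turns right and becomes a horizontal line (turn). Along a horizontal line: at rate $\lambda_H$ a new vertical line going up starts and the horizontal line continues; at rate $\tau_H$ the horizontal line turns up and becomes a vertical line. When a vertical and a horizontal line meet: with probability $p_V$ the horizontal line stops and the vertical one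 continues; with probability $p_H$ the vertical line stops and the horizontal one continues; with probability $p_0$ both stop; with probability $1-p_V-p_H-p_0$ both continue. Random initial conditions. A counting measure $N$ denotes the law of a locally finite random point process $X$ on $\mathbb{R}$ ($N([a,b])$ being the number of points in $[a,b]$). The initial condition $(\mathcal{C}_X,\mathcal{C}_Y)$ is distributed according to $N$ if $\mathcal{C}_X=\{(x,0):x\in X,x\ge 0\}$ and $\mathcal{C}_Y=\{(0,-x):x\in X,x<0\}$ with $X\sim N$. $N_{\mathrm{PPP}(\nu_H,\nu_V)}$ is the case where $\mathcal{C}_X$ and $\mathcal{C}_Y$ are independent homogeneous Poisson point processes, $\mathcal{C}_X$ with intensity $\nu_V$ and $\mathcal{C}_Y$ with intensity $\nu_H$. Space-time diagrams and stationarity. $\mathcal{L}_{[0,\infty)^2}(\mathfrak{p},N)$ is the random set of segments obtained from initial condition $(\mathcal{C}_X,\mathcal{C}_Y)\sim N$; $\mathcal{L}_{[a,\infty)\times[b,\infty)}(\mathfrak{p},N)$ is its translate by the vector $(a,b)$; $|_R$ denotes restriction to a rectangle (possibly unbounded) $R$. $N$ is stationary for the bullet model with parameter $\mathfrak{p}$ if for almost every $(a,b)\in\mathbb{R}_+^2$, $\mathcal{L}_{[0,\infty)^2}(\mathfrak{p},N)|_{[a,\infty)\times[b,\infty)}\overset{(d)}{=}\mathcal{L}_{[a,\infty)\times[b,\infty)}(\mathfrak{p},N)$. *)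

theory Defs
  imports "HOL-Probability.Probability"
begin

text \<open>Locally finite subsets of \<open>S\<close>, with the \<open>\<sigma>\<close>-algebra generated by the counting variables
  \<open>X \<mapsto> card (X \<inter> B)\<close>, \<open>B\<close> bounded Borel; all these counts are finite.\<close>

definition config_space :: "'a::euclidean_space set \<Rightarrow> 'a set measure" where
  "config_space S =
     (let \<Omega> = {X. X \<subseteq> S \<and> (\<forall>B. bounded B \<longrightarrow> finite (X \<inter> B))}
      in sigma \<Omega> {{X \<in> \<Omega>. card (X \<inter> B) = n} | B n. B \<in> sets borel \<and> bounded B})"

definition poisson_process ::
  "'w measure \<Rightarrow> 'a::euclidean_space set \<Rightarrow> real \<Rightarrow> ('w \<Rightarrow> 'a set) \<Rightarrow> bool" where
  "poisson_process M S r C \<longleftrightarrow>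
     prob_space M \<and> C \<in> measurable M (config_space S) \<and>
     (\<forall>A. A \<in> sets borel \<and> bounded A \<and> A \<subseteq> S \<longrightarrow>
        (\<forall>n. measure M {\<omega> \<in> space M. card (C \<omega> \<inter> A) = n} =
             (r * measure lborel A) ^ n / fact n * exp (- (r * measure lborel A)))) \<and>
     (\<forall>(A :: nat \<Rightarrow> 'a set) m.
        (\<forall>i<m. A i \<in> sets borel \<and> bounded (A i) \<and> A i \<subseteq> S) \<and> disjoint_family_on A {..<m} \<longrightarrow>
        prob_space.indep_vars M (\<lambda>_. count_space UNIV) (\<lambda>i \<omega>. card (C \<omega> \<inter> A i)) {..<m})"

text \<open>A law \<open>N\<close> of a locally finite subset of the real line is what is called a counting measure;
  \<open>X \<ge> 0\<close> encodes the initial points on the horizontal axis, \<open>X < 0\<close> (reflected) those on the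
  vertical axis.\<close>

definition point_process_law :: "real set measure \<Rightarrow> bool" where
  "point_process_law N \<longleftrightarrow> prob_space N \<and> sets N = sets (config_space UNIV)"

definition init_X :: "real set \<Rightarrow> (real \<times> real) set" where
  "init_X X = {(x, 0) | x. x \<in> X \<and> 0 \<le> x}"

definition init_Y :: "real set \<Rightarrow> (real \<times> real) set" where
  "init_Y X = {(0, - x) | x. x \<in> X \<and> x < 0}"

definition is_N_PPP :: "real \<Rightarrow> real \<Rightarrow> real set measure \<Rightarrow> bool" where
  "is_N_PPP \<nu>H \<nu>V N \<longleftrightarrow>
     point_process_law N \<and>
     poisson_process N {0..} \<nu>V (\<lambda>X. fst ` init_X X) \<and>
     poisson_process N {0..} \<nu>H (\<lambda>X. snd ` init_Y X) \<and>
     prob_space.indep_var N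
       (config_space {0..}) (\<lambda>X. fst ` init_X X) (config_space {0..}) (\<lambda>X. snd ` init_Y X)"

record bullet_param =
  lam0 :: real
  lamV :: real
  lamH :: real
  tauV :: real
  tauH :: real
  pV :: real
  pH :: real
  p0 :: real

definition valid_param :: "bullet_param \<Rightarrow> bool" where
  "valid_param p \<longleftrightarrow>
     0 \<le> lam0 p \<and> 0 \<le> lamV p \<and> 0 \<le> lamH p \<and> 0 \<le> tauV p \<and> 0 \<le> tauH p \<and>
     0 \<le> pV p \<and> 0 \<le> pH p \<and> 0 \<le> p0 p \<and> pV p + pH p + p0 p \<le> 1"

text \<open>Genealogical labels of the lines: \<open>FromX n\<close>, \<open>FromY n\<close> start at the \<open>n\<close>-th point of the
  initial condition on the respective axis, \<open>NucV n\<close>, \<open>NucH n\<close> at the \<open>n\<close>-th point of the planar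
  Poisson process; \<open>Split l k\<close> is the line created by the \<open>k\<close>-th split of \<open>l\<close>, and \<open>Turn l\<close> is the
  continuation of \<open>l\<close> after it turns.\<close>

datatype line = FromX nat | FromY nat | NucV nat | NucH nat | Split line nat | Turn line

instance line :: countable
  by countable_datatype

primrec vert :: "line \<Rightarrow> bool" where
  "vert (FromX n) = True"
| "vert (FromY n) = False"
| "vert (NucV n) = True"
| "vert (NucH n) = False"
| "vert (Split l k) = (\<not> vert l)"
| "vert (Turn l) = (\<not> vert l)"

text \<open>The points of a locally finite subset of the quadrant are enumerated along increasing \<open>x + y\<close>
  (on the two axes there are no ties, and for a planar Poisson process there are almost surely
  none); the value \<open>(\<infinity>, \<infinity>)\<close> means that there is no \<open>n\<close>-th point.\<close>

definition diag_rank :: "(real \<times> real) set \<Rightarrow> real \<times> real \<Rightarrow> nat" where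
  "diag_rank C z = card {w \<in> C. fst w + snd w < fst z + snd z}"

definition nth_point :: "(real \<times> real) set \<Rightarrow> nat \<Rightarrow> ereal \<times> ereal" where
  "nth_point C n =
     (if \<exists>!z. z \<in> C \<and> diag_rank C z = n
      then map_prod ereal ereal (THE z. z \<in> C \<and> diag_rank C z = n) else (\<infinity>, \<infinity>))"

text \<open>A segment is the pair of its lower left and upper right end points; the latter has an infinite
  coordinate for half-lines. As a subset of the plane, \<open>((x, y), (x', y'))\<close> is the degenerate
  rectangle \<open>[x, x'] \<times> [y, y']\<close>.\<close>

type_synonym segment = "(ereal \<times> ereal) \<times> (ereal \<times> ereal)"

text \<open>The graphical construction. The parameters are: the initial points \<open>X\<close>, the planar points
  \<open>\<Xi>\<close>, the waiting time \<open>g (l, k)\<close> between the splits \<open>k - 1\<close> and \<open>k\<close> of \<open>l\<close>, the waiting time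
  \<open>w l\<close> until \<open>l\<close> turns, and the mark \<open>u (v, h)\<close> deciding the outcome of a meeting of the vertical
  line \<open>v\<close> and the horizontal line \<open>h\<close>.\<close>

locale bullet_graph =
  fixes p :: bullet_param
    and X :: "real set"
    and \<Xi> :: "(real \<times> real) set"
    and g :: "line \<times> nat \<Rightarrow> ereal"
    and w :: "line \<Rightarrow> ereal"
    and u :: "line \<times> line \<Rightarrow> real"
begin

text \<open>\<open>route l = (c, s)\<close>: a vertical line \<open>l\<close> has constant abscissa \<open>c\<close> and starts at height \<open>s\<close>; a
  horizontal one has constant height \<open>c\<close> and starts at abscissa \<open>s\<close>. Lines are not parametrized by
  their length but by the coordinate that increases along them. All labels get a path here; which
  of them really carry a line, and how far, is decided below.\<close>

primrec route :: "line \<Rightarrow> ereal \<times> ereal" where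
  "route (FromX n) = nth_point (init_X X) n"
| "route (FromY n) = prod.swap (nth_point (init_Y X) n)"
| "route (NucV n) = nth_point \<Xi> n"
| "route (NucH n) = prod.swap (nth_point \<Xi> n)"
| "route (Split l k) = (snd (route l) + (\<Sum>j\<le>k. g (l, j)), fst (route l))"
| "route (Turn l) = (snd (route l) + w l, fst (route l))"

definition track :: "line \<Rightarrow> ereal" where
  "track l = fst (route l)"

definition orig :: "line \<Rightarrow> ereal" where
  "orig l = snd (route l)"

text \<open>If the trajectories of \<open>l\<close> and \<open>l'\<close> cross, then \<open>l\<close> is at coordinate \<open>track l'\<close> and \<open>l'\<close> at
  coordinate \<open>track l\<close>. The strict inequalities exclude that a line meets its parent at birth, or
  the line that starts together with it.\<close>

definition crosses :: "line \<Rightarrow> line \<Rightarrow> bool" where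
  "crosses l l' \<longleftrightarrow> vert l \<noteq> vert l' \<and> orig l < track l' \<and> orig l' < track l"

text \<open>\<open>l\<close> is stopped if it meets \<open>l'\<close>. For a uniform mark, \<open>[0, pV)\<close> is the event that only the
  horizontal line stops, \<open>[pV, pV + pH)\<close> that only the vertical one stops, and
  \<open>[pV + pH, pV + pH + p0)\<close> that both stop.\<close>

definition stopped_by :: "line \<Rightarrow> line \<Rightarrow> bool" where
  "stopped_by l l' \<longleftrightarrow>
     (if vert l then u (l, l') \<in> {pV p ..< pV p + pH p + p0 p}
      else u (l', l) \<in> {..< pV p} \<union> {pV p + pH p ..< pV p + pH p + p0 p})"

primrec born :: "(line \<Rightarrow> ereal \<Rightarrow> bool) \<Rightarrow> line \<Rightarrow> bool" where
  "born A (FromX n) = True"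
| "born A (FromY n) = True"
| "born A (NucV n) = True"
| "born A (NucH n) = True"
| "born A (Split l k) = A l (track (Split l k))"
| "born A (Turn l) = A l (track (Turn l))"

text \<open>\<open>A l t\<close> is read as: line \<open>l\<close> exists and its head arrives at coordinate \<open>t\<close>. The model is the
  fixed point of \<open>evolve\<close>. Almost surely only finitely many trajectories enter a bounded region and
  what happens at a point depends only on what happens below and to the left of it, so that this
  fixed point is unique and each \<open>A l t\<close>, \<open>t < \<infinity>\<close>, is constant after finitely many iterations.\<close>

definition evolve :: "(line \<Rightarrow> ereal \<Rightarrow> bool) \<Rightarrow> line \<Rightarrow> ereal \<Rightarrow> bool" where
  "evolve A l t \<longleftrightarrow>
     born A l \<and> track l < \<infinity> \<and> orig l \<le> t \<and> t \<le> orig l + w l \<and>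
     (\<forall>l'. crosses l l' \<and> track l' < t \<and> stopped_by l l' \<longrightarrow> \<not> A l' (track l))"

definition arrives :: "line \<Rightarrow> ereal \<Rightarrow> bool" where
  "arrives l t \<longleftrightarrow> (\<forall>\<^sub>F n in sequentially. (evolve ^^ n) (\<lambda>_ _. False) l t)"

definition tip :: "line \<Rightarrow> ereal" where
  "tip l = Sup {t. arrives l t}"

definition segment_of :: "line \<Rightarrow> segment" where
  "segment_of l =
     (if vert l then ((track l, orig l), (track l, tip l))
      else ((orig l, track l), (tip l, track l)))"

definition segments :: "segment set" where
  "segments = segment_of ` {l. \<exists>t. arrives l t}"

end

text \<open>At rate \<open>0\<close> the event never occurs.\<close>

definition waiting_time :: "real \<Rightarrow> ereal measure" where
  "waiting_time r =
     (if r = 0 then return borel \<infinity>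
      else distr (density lborel (exponential_density r)) borel ereal)"

definition split_rate :: "bullet_param \<Rightarrow> line \<Rightarrow> real" where
  "split_rate p l = (if vert l then lamV p else lamH p)"

definition turn_rate :: "bullet_param \<Rightarrow> line \<Rightarrow> real" where
  "turn_rate p l = (if vert l then tauV p else tauH p)"

type_synonym driving =
  "real set \<times> (real \<times> real) set \<times>
   (line \<times> nat \<Rightarrow> ereal) \<times> (line \<Rightarrow> ereal) \<times> (line \<times> line \<Rightarrow> real)"

definition driving_measure ::
  "bullet_param \<Rightarrow> real set measure \<Rightarrow> (real \<times> real) set measure \<Rightarrow> driving measure" where
  "driving_measure p N Q =
     N \<Otimes>\<^sub>M Q \<Otimes>\<^sub>M
     (\<Pi>\<^sub>M lk\<in>UNIV. waiting_time (split_rate p (fst lk))) \<Otimes>\<^sub>M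
     (\<Pi>\<^sub>M l\<in>UNIV. waiting_time (turn_rate p l)) \<Otimes>\<^sub>M
     (\<Pi>\<^sub>M vh\<in>UNIV. uniform_measure lborel {0..1})"

definition diagram :: "bullet_param \<Rightarrow> driving \<Rightarrow> segment set" where
  "diagram p = (\<lambda>(X, \<Xi>, g, w, u). bullet_graph.segments p X \<Xi> g w u)"

definition restrict_quadrant :: "real \<Rightarrow> real \<Rightarrow> segment set \<Rightarrow> segment set" where
  "restrict_quadrant a b L =
     {((max (ereal a) x, max (ereal b) y), (x', y')) | x y x' y'.
        ((x, y), (x', y')) \<in> L \<and> ereal a \<le> x' \<and> ereal b \<le> y'}"

definition translate :: "real \<Rightarrow> real \<Rightarrow> segment set \<Rightarrow> segment set" where
  "translate a b L =
     {((x + ereal a, y + ereal b), (x' + ereal a, y' + ereal b)) | x y x' y'.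
        ((x, y), (x', y')) \<in> L}"

text \<open>Sets of segments, with the \<open>\<sigma>\<close>-algebra generated by the (possibly infinite) numbers of
  segments in Borel sets of segments.\<close>

definition segments_space :: "segment set measure" where
  "segments_space =
     sigma UNIV {{L. finite (L \<inter> B) \<and> card (L \<inter> B) = n} | B n. B \<in> sets borel}"

text \<open>Measurability is demanded explicitly, because \<^const>\<open>distr\<close> is meaningless without it.\<close>

definition eq_in_law :: "'w measure \<Rightarrow> 'b measure \<Rightarrow> ('w \<Rightarrow> 'b) \<Rightarrow> ('w \<Rightarrow> 'b) \<Rightarrow> bool" where
  "eq_in_law M S f f' \<longleftrightarrow>
     f \<in> measurable M S \<and> f' \<in> measurable M S \<and> distr M S f = distr M S f'"

text \<open>The law \<open>Q\<close> of the planar Poisson process is determined by its intensity.\<close>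

definition stationary :: "bullet_param \<Rightarrow> real set measure \<Rightarrow> bool" where
  "stationary p N \<longleftrightarrow>
     valid_param p \<and> point_process_law N \<and>
     (\<forall>Q. sets Q = sets (config_space ({0<..} \<times> {0<..})) \<and>
          poisson_process Q ({0<..} \<times> {0<..}) (lam0 p) (\<lambda>\<Xi>. \<Xi>) \<longrightarrow>
        (AE (a, b) in lborel. 0 \<le> a \<and> 0 \<le> b \<longrightarrow>
           eq_in_law (driving_measure p N Q) segments_space
             (\<lambda>\<omega>. restrict_quadrant a b (diagram p \<omega>))
             (\<lambda>\<omega>. translate a b (diagram p \<omega>))))"

definition p_CBMC :: bullet_param where
  "p_CBMC = \<lparr>lam0 = 0, lamV = 1, lamH = 1, tauV = 0, tauH = 0, pV = 0, pH = 0, p0 = 1\<rparr>"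

end

theory Submission
  imports Defs "HOL-Library.Nat_Bijection"
begin

text \<open>For the CBMC parameter the two axes can be regarded as two further lines that are never stopped
  and that split at rate 1, the initial points being their splits. So the model is a deterministic
  function of independent sequences of exponential waiting times, one for each label in a tree.

  It suffices to restrict to \<open>[a, \<infinity>) \<times> [0, \<infinity>)\<close> and then to \<open>[0, \<infinity>) \<times> [b, \<infinity>)\<close>. Follow
  the heights \<open>y\<close> upwards and look at the rightmost vertical line in the strip \<open>[0, a) \<times> [0, \<infinity>)\<close>,
  the \<open>y\<close>-axis included. A horizontal line born on any other vertical line runs into a vertical line
  further to the right and is annihilated within the strip, so that the horizontal lines that reach the
  cut \<open>{a} \<times> [0, \<infinity>)\<close> are precisely the splits of the line that is rightmost at that height. The
  identity of this line at height \<open>y\<close> depends on the past only, hence by the memoryless property these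
  splits form a Poisson process of rate 1. It is determined by what happens to the left of the cut, and
  again by the memoryless property the waiting times behind the cut are fresh. Thus the system behind
  the cut is a copy of the original one, with the cut in the role of the \<open>y\<close>-axis.\<close>

section \<open>Sequences of exponential waiting times\<close>

text \<open>The memoryless property is needed along a boundary that depends on the configuration:
  crossing lines are cut at noise dependent points of their sequences, and the rightmost line
  changes at random times. Instead of stopping times, two independent noises \<open>z1\<close>
  (past) and \<open>z2\<close> (future) are recombined by \<open>cut_noise\<close>. Labels are
  ordered by \<open>code\<close>, and where a label is cut depends on its ancestors only, so the
  result again has law \<open>noise\<close>. On this coupling the cut becomes a pathwise identity
  between two trees, and \<open>new_noise\<close> reads fresh coordinates of \<open>z2\<close>
  through an injective relabelling fixed by \<open>z1\<close>. The random change times of the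
  rightmost line are avoided by updating it on a grid only: the resulting count is exactly Poisson
  for every mesh, and for a fixed realisation it equals the true count once the mesh is fine enough.
  That bounded regions meet finitely many lines follows from the weight
  \<open>exp (- 2 * (track + origin))\<close>, whose expectation is multiplied by 1/3 + 1/9 + ... =
  1/2 from one generation to the next.\<close>

definition exp_law :: "real measure" where
  "exp_law = density lborel (exponential_density 1)"

abbreviation gap_law :: "(nat \<Rightarrow> real) measure" where
  "gap_law \<equiv> (\<Pi>\<^sub>M _\<in>UNIV. exp_law)"

lemma sets_exp_law [simp, measurable_cong]: "sets exp_law = sets borel"
  by (simp add: exp_law_def)

lemma space_exp_law [simp]: "space exp_law = UNIV"
  by (simp add: exp_law_def)

lemma prob_space_exp_law: "prob_space exp_law"
  unfolding exp_law_def by (rule prob_space_exponential_density) simp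

interpretation exp_law: prob_space exp_law by (rule prob_space_exp_law)

lemma space_gap_law [simp]: "space gap_law = UNIV"
  by (simp add: space_PiM PiE_UNIV_domain)

lemma prob_space_gap_law: "prob_space gap_law"
  by (intro prob_space_PiM prob_space_exp_law)

interpretation gap_law: prob_space gap_law by (rule prob_space_gap_law)

lemma measurable_gap_lawI:
  "(\<And>k. (\<lambda>\<omega>. f \<omega> k) \<in> borel_measurable M) \<Longrightarrow> f \<in> measurable M gap_law"
  using measurable_PiM_single'[of UNIV "\<lambda>k \<omega>. f \<omega> k" M "\<lambda>_. exp_law"]
  by (simp add: PiE_UNIV_domain measurable_cong_sets[OF refl sets_exp_law])

lemma measurable_gap_app:
  fixes k :: nat
  assumes "f \<in> measurable N gap_law"
  shows "(\<lambda>\<omega>. f \<omega> k) \<in> borel_measurable N"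
  using measurable_component_singleton'[OF assms measurable_ident_sets, of N k] by (simp add: measurable_cong_sets[OF refl sets_exp_law])

lemma measurable_gap_component [measurable (raw)]:
  fixes k :: nat shows "(\<lambda>x. x k) \<in> borel_measurable gap_law"
  by (rule measurable_gap_app) simp

section \<open>Almost sure statements and equality of measures on product spaces\<close>

lemma AE_pair_fst:
  assumes "prob_space N" "AE x in M. P x" shows "AE z in M \<Otimes>\<^sub>M N. P (fst z)"
proof -
  interpret N: prob_space N by fact
  obtain A where A: "{x \<in> space M. \<not> P x} \<subseteq> A" "A \<in> null_sets M"
    using assms(2) by (auto simp: eventually_ae_filter)
  then have "A \<times> space N \<in> null_sets (M \<Otimes>\<^sub>M N)"
    by (auto simp: null_sets_def N.emeasure_pair_measure_Times)
  then show ?thesis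
    by (rule AE_I') (use A(1) in \<open>auto simp: space_pair_measure\<close>)
qed

lemma AE_pair_snd:
  assumes "prob_space M" "prob_space N" "AE x in N. P x" shows "AE z in M \<Otimes>\<^sub>M N. P (snd z)"
proof -
  interpret N: prob_space N by fact
  obtain A where A: "{x \<in> space N. \<not> P x} \<subseteq> A" "A \<in> null_sets N"
    using assms(3) by (auto simp: eventually_ae_filter)
  then have "space M \<times> A \<in> null_sets (M \<Otimes>\<^sub>M N)"
    by (auto simp: null_sets_def N.emeasure_pair_measure_Times)
  then show ?thesis
    by (rule AE_I') (use A(1) in \<open>auto simp: space_pair_measure\<close>)
qed

text \<open>Rectangles constraining finitely many coordinates generate the product sigma-algebra and
  are stable under intersection. Later identifications of independent families, such as
  \<open>distr_glue\<close>, \<open>distr_triangular\<close> and \<open>distr_new_noise\<close>, are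
  reduced to this test.\<close>

lemma PiM_UNIV_eqI:
  assumes M: "prob_space M" and sets: "sets Q = sets (PiM UNIV (\<lambda>_::'i. M))"
    and eq: "\<And>J A. finite J \<Longrightarrow> (\<And>i. i \<in> J \<Longrightarrow> A i \<in> sets M) \<Longrightarrow>
      emeasure Q {\<omega> \<in> space Q. \<forall>i\<in>J. \<omega> i \<in> A i} = (\<Prod>i\<in>J. emeasure M (A i))"
  shows "Q = PiM UNIV (\<lambda>_::'i. M)"
proof -
  interpret M: prob_space M by fact
  interpret product_prob_space "\<lambda>_::'i. M" UNIV ..
  show ?thesis
  proof (rule PiM_eq[OF sets])
    fix J :: "'i set" and F assume J: "finite J" "\<And>j. j \<in> J \<Longrightarrow> F j \<in> sets M"
    have "space Q = space (PiM UNIV (\<lambda>_::'i. M))"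
      by (rule sets_eq_imp_space_eq[OF sets])
    then have "prod_emb UNIV (\<lambda>_. M) J (\<Pi>\<^sub>E j\<in>J. F j) = {\<omega> \<in> space Q. \<forall>i\<in>J. \<omega> i \<in> F i}"
      by (auto simp: prod_emb_def space_PiM PiE_iff)
    then show "emeasure Q (prod_emb UNIV (\<lambda>_. M) J (\<Pi>\<^sub>E j\<in>J. F j)) = (\<Prod>j\<in>J. emeasure M (F j))"
      using eq[OF J] by simp
  qed
qed

lemma emeasure_PiM_UNIV_Collect:
  assumes "prob_space M" "finite J" "\<And>i. i \<in> J \<Longrightarrow> A i \<in> sets M"
  shows "emeasure (PiM UNIV (\<lambda>_::'i. M)) {\<omega> \<in> space (PiM UNIV (\<lambda>_. M)). \<forall>i\<in>J. \<omega> i \<in> A i} =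
    (\<Prod>i\<in>J. emeasure M (A i))"
proof -
  interpret M: prob_space M by fact
  interpret product_prob_space "\<lambda>_::'i. M" UNIV ..
  show ?thesis using assms by (intro emeasure_PiM_Collect) auto
qed

text \<open>Substitute s = t + r: for r > 0 the density factors as exp (- t) times the density at r,
  and for r < 0 both sides vanish.\<close>

lemma exp_law_memoryless:
  assumes [measurable]: "f \<in> borel_measurable borel" and t: "0 \<le> t"
  shows "(\<integral>\<^sup>+s. indicator {t<..} s * f s \<partial>exp_law) = ennreal (exp (- t)) * (\<integral>\<^sup>+r. f (t + r) \<partial>exp_law)"
proof -
  have "(\<integral>\<^sup>+s. indicator {t<..} s * f s \<partial>exp_law) =
      (\<integral>\<^sup>+s. ennreal (exponential_density 1 s) * (indicator {t<..} s * f s) \<partial>lborel)"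
    unfolding exp_law_def by (subst nn_integral_density) auto
  also have "\<dots> = (\<integral>\<^sup>+r. ennreal (exponential_density 1 (t + r)) * (indicator {t<..} (t + r) * f (t + r)) \<partial>lborel)"
    by (subst nn_integral_real_affine[where t=t and c=1]) auto
  also have "\<dots> = (\<integral>\<^sup>+r. ennreal (exp (- t)) * (ennreal (exponential_density 1 r) * f (t + r)) \<partial>lborel)"
  proof (rule nn_integral_cong_AE)
    \<comment> \<open>At r = 0 the strict indicator vanishes while the density does not, so this
      single point has to be discarded.\<close>
    have "AE r::real in lborel. r \<noteq> 0" by (rule AE_lborel_singleton)
    then show "AE r in lborel. ennreal (exponential_density 1 (t + r)) * (indicator {t<..} (t + r) * f (t + r)) =
        ennreal (exp (- t)) * (ennreal (exponential_density 1 r) * f (t + r))"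
    proof eventually_elim
      case (elim r)
      show ?case
      proof (cases "r < 0")
        case False
        then have "exponential_density 1 (t + r) = exp (- t) * exponential_density 1 r"
          using t by (simp add: exponential_density_def exp_diff exp_minus field_simps exp_add)
        then show ?thesis using False elim by (simp add: ennreal_mult' mult.assoc)
      qed (simp add: exponential_density_def)
    qed
  qed
  also have "\<dots> = ennreal (exp (- t)) * (\<integral>\<^sup>+r. f (t + r) \<partial>exp_law)"
    unfolding exp_law_def by (subst nn_integral_cmult) (auto simp: nn_integral_density)
  finally show ?thesis .
qed

lemma exp_law_greaterThan: "0 \<le> t \<Longrightarrow> emeasure exp_law {t<..} = ennreal (exp (- t))"
  using exp_law_memoryless[of "\<lambda>_. 1" t] exp_law.emeasure_space_1 by simp

lemma exp_law_singleton: "emeasure exp_law {c} = 0"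
  unfolding exp_law_def by (subst emeasure_density) (auto intro!: nn_integral_0_iff_AE[THEN iffD2] eventually_mono[OF AE_lborel_singleton[of c]])

lemma AE_exp_law_pos: "AE s in exp_law. 0 < s"
  using exp_law_greaterThan[of 0] by (intro exp_law.AE_in_set_eq_1[THEN iffD2, of "{0<..}", simplified]) (auto simp: measure_def)

text \<open>The first waiting time is independent of the shifted sequence, which has the law of the
  whole sequence. Inductions over sequences below condition on the first waiting time in this
  way.\<close>

lemma nn_integral_gap_law_Suc:
  assumes [measurable]: "f \<in> borel_measurable gap_law"
  shows "(\<integral>\<^sup>+x. f x \<partial>gap_law) = (\<integral>\<^sup>+s. (\<integral>\<^sup>+x. f (case_nat s x) \<partial>gap_law) \<partial>exp_law)"
proof -
  interpret sequence_space exp_law ..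
  have m: "(\<lambda>(s, \<omega>). case_nat s \<omega>) \<in> measurable (exp_law \<Otimes>\<^sub>M gap_law) gap_law"
    by (rule measurable_gap_lawI) (auto simp: split_beta' split: nat.split)
  have "(\<integral>\<^sup>+x. f x \<partial>gap_law) = (\<integral>\<^sup>+x. f x \<partial>distr (exp_law \<Otimes>\<^sub>M gap_law) gap_law (\<lambda>(s, \<omega>). case_nat s \<omega>))"
    using PiM_iter by simp
  also have "\<dots> = (\<integral>\<^sup>+z. f (case z of (s, \<omega>) \<Rightarrow> case_nat s \<omega>) \<partial>(exp_law \<Otimes>\<^sub>M gap_law))"
    using m by (subst nn_integral_distr) auto
  also have "\<dots> = (\<integral>\<^sup>+s. (\<integral>\<^sup>+x. f (case_nat s x) \<partial>gap_law) \<partial>exp_law)"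
    using m by (subst gap_law.nn_integral_fst[symmetric]) (auto simp: measurable_split_conv split_beta')
  finally show ?thesis .
qed

text \<open>Gaps of the arrival sequence that follows \<open>x\<close> up to time \<open>t\<close>
  and afterwards the arrivals of \<open>y\<close>, counted from \<open>t\<close>. In the recursion
  \<open>t\<close> is the time left; the gap of \<open>x\<close> that is running at time
  \<open>t\<close> is replaced by \<open>t + y 0\<close>, measured from the last arrival of
  \<open>x\<close>.\<close>

primrec glue :: "real \<Rightarrow> (nat \<Rightarrow> real) \<Rightarrow> (nat \<Rightarrow> real) \<Rightarrow> nat \<Rightarrow> real" where
  "glue t x y 0 = (if x 0 \<le> t then x 0 else t + y 0)"
| "glue t x y (Suc k) = (if x 0 \<le> t then glue (t - x 0) (\<lambda>j. x (Suc j)) y k else y (Suc k))"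

lemma measurable_gap_tail: "(\<lambda>x j. x (Suc j)) \<in> measurable gap_law gap_law"
  by (rule measurable_gap_lawI) simp

lemma measurable_glue_component [measurable (raw)]:
  assumes "t \<in> borel_measurable M" "x \<in> measurable M gap_law" "y \<in> measurable M gap_law"
  shows "(\<lambda>\<omega>. glue (t \<omega>) (x \<omega>) (y \<omega>) k) \<in> borel_measurable M"
  using assms
proof (induction k arbitrary: t x)
  case 0
  note [measurable] = 0 0(2,3)[THEN measurable_gap_app]
  show ?case by simp
next
  case (Suc k)
  note [measurable] = Suc.prems Suc.prems(2,3)[THEN measurable_gap_app]
  have [measurable]: "(\<lambda>\<omega>. glue (t \<omega> - x \<omega> 0) (\<lambda>j. x \<omega> (Suc j)) (y \<omega>) k) \<in> borel_measurable M"
  proof (rule Suc.IH)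
    show "(\<lambda>\<omega> j. x \<omega> (Suc j)) \<in> measurable M gap_law"
      by (rule measurable_gap_lawI) simp
  qed simp_all
  show ?case by simp
qed

lemma measurable_glue [measurable (raw)]:
  assumes "t \<in> borel_measurable M" "x \<in> measurable M gap_law" "y \<in> measurable M gap_law"
  shows "(\<lambda>\<omega>. glue (t \<omega>) (x \<omega>) (y \<omega>)) \<in> measurable M gap_law"
  using measurable_glue_component[OF assms] by (rule measurable_gap_lawI)

lemma nn_integral_gap_law_prod:
  assumes [measurable]: "\<And>k. B k \<in> sets borel"
  shows "(\<integral>\<^sup>+x. (\<Prod>k<n. indicator (B k) (x k)) \<partial>gap_law) = (\<Prod>k<n. emeasure exp_law (B k))"
proof -
  have "(\<Prod>k<n. indicator (B k) (x k)) = (indicator {x. \<forall>k\<in>{..<n}. x k \<in> B k} x :: ennreal)" for x :: "nat \<Rightarrow> real"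
    by (induction n) (auto split: split_indicator simp: less_Suc_eq)
  moreover have "{x. \<forall>k\<in>{..<n}. x k \<in> B k} \<in> sets gap_law"
  proof -
    have "{x \<in> space gap_law. \<forall>k\<in>{..<n}. x k \<in> B k} \<in> sets gap_law" by measurable
    then show ?thesis by simp
  qed
  ultimately have "(\<integral>\<^sup>+x. (\<Prod>k<n. indicator (B k) (x k)) \<partial>gap_law) = emeasure gap_law {x. \<forall>k\<in>{..<n}. x k \<in> B k}"
    by simp
  also have "\<dots> = (\<Prod>k<n. emeasure exp_law (B k))"
    using emeasure_PiM_UNIV_Collect[OF prob_space_exp_law, of "{..<n}" B] space_gap_law
    by simp
  finally show ?thesis .
qed

text \<open>Induct on \<open>n\<close>, conditioning on the first gap \<open>s\<close> of
  \<open>x\<close>. If s \<le> t the same situation recurs with time left \<open>t - s\<close>; if s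
  > t the outcome is \<open>t + y 0\<close> followed by fresh gaps of \<open>y\<close>, which by
  memorylessness contributes what a first gap beyond \<open>t\<close> would contribute.\<close>

lemma nn_integral_glue:
  assumes "\<And>k. B k \<in> sets borel" and "0 \<le> t"
  shows "(\<integral>\<^sup>+x. (\<integral>\<^sup>+y. (\<Prod>k<n. indicator (B k) (glue t x y k)) \<partial>gap_law) \<partial>gap_law) =
    (\<Prod>k<n. emeasure exp_law (B k))"
  using assms
proof (induction n arbitrary: t B)
  case 0
  then show ?case by (simp add: gap_law.emeasure_space_1[simplified])
next
  case (Suc n)
  note [measurable] = Suc.prems(1)
  let ?R = "\<Prod>k<n. emeasure exp_law (B (Suc k))"
  have step: "(\<integral>\<^sup>+x. (\<integral>\<^sup>+y. (\<Prod>k<Suc n. indicator (B k) (glue t (case_nat s x) y k)) \<partial>gap_law) \<partial>gap_law) =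
      indicator {..t} s * indicator (B 0) s * ?R +
      indicator {t<..} s * ((\<integral>\<^sup>+r. indicator (B 0) (t + r) \<partial>exp_law) * ?R)" for s
  proof (cases "s \<le> t")
    case True
    have "(\<integral>\<^sup>+x. (\<integral>\<^sup>+y. (\<Prod>k<Suc n. indicator (B k) (glue t (case_nat s x) y k)) \<partial>gap_law) \<partial>gap_law) =
      (\<integral>\<^sup>+x. (\<integral>\<^sup>+y. indicator (B 0) s * (\<Prod>k<n. indicator (B (Suc k)) (glue (t - s) x y k)) \<partial>gap_law) \<partial>gap_law)"
      using True by (simp add: prod.lessThan_Suc_shift del: prod.lessThan_Suc)
    also have "\<dots> = indicator (B 0) s * (\<integral>\<^sup>+x. (\<integral>\<^sup>+y. (\<Prod>k<n. indicator (B (Suc k)) (glue (t - s) x y k)) \<partial>gap_law) \<partial>gap_law)"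
      by (simp add: nn_integral_cmult)
    also have "(\<integral>\<^sup>+x. (\<integral>\<^sup>+y. (\<Prod>k<n. indicator (B (Suc k)) (glue (t - s) x y k)) \<partial>gap_law) \<partial>gap_law) = ?R"
      using True by (intro Suc.IH) auto
    finally show ?thesis using True by simp
  next
    case False
    then have "(\<integral>\<^sup>+x. (\<integral>\<^sup>+y. (\<Prod>k<Suc n. indicator (B k) (glue t (case_nat s x) y k)) \<partial>gap_law) \<partial>gap_law) =
      (\<integral>\<^sup>+x. (\<integral>\<^sup>+y. indicator (B 0) (t + y 0) * (\<Prod>k<n. indicator (B (Suc k)) (y (Suc k))) \<partial>gap_law) \<partial>gap_law)"
      by (simp add: prod.lessThan_Suc_shift del: prod.lessThan_Suc)
    also have "\<dots> = (\<integral>\<^sup>+y. indicator (B 0) (t + y 0) * (\<Prod>k<n. indicator (B (Suc k)) (y (Suc k))) \<partial>gap_law)"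
      by (simp add: gap_law.emeasure_space_1[simplified])
    also have "\<dots> = (\<integral>\<^sup>+r. (\<integral>\<^sup>+y. indicator (B 0) (t + r) * (\<Prod>k<n. indicator (B (Suc k)) (y k)) \<partial>gap_law) \<partial>exp_law)"
      by (subst nn_integral_gap_law_Suc) auto
    also have "\<dots> = (\<integral>\<^sup>+r. indicator (B 0) (t + r) * ?R \<partial>exp_law)"
      by (simp add: nn_integral_cmult nn_integral_gap_law_prod)
    also have "\<dots> = (\<integral>\<^sup>+r. indicator (B 0) (t + r) \<partial>exp_law) * ?R"
      by (rule nn_integral_multc) measurable
    finally show ?thesis using False by simp
  qed
  have "(\<integral>\<^sup>+x. (\<integral>\<^sup>+y. (\<Prod>k<Suc n. indicator (B k) (glue t x y k)) \<partial>gap_law) \<partial>gap_law) =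
     (\<integral>\<^sup>+s. indicator {..t} s * indicator (B 0) s * ?R +
      indicator {t<..} s * ((\<integral>\<^sup>+r. indicator (B 0) (t + r) \<partial>exp_law) * ?R) \<partial>exp_law)"
    by (subst nn_integral_gap_law_Suc) (auto simp: step simp del: prod.lessThan_Suc)
  also have "\<dots> = (\<integral>\<^sup>+s. indicator {..t} s * indicator (B 0) s \<partial>exp_law) * ?R +
      emeasure exp_law {t<..} * ((\<integral>\<^sup>+r. indicator (B 0) (t + r) \<partial>exp_law) * ?R)"
    by (subst nn_integral_add) (auto simp: nn_integral_multc)
  \<comment> \<open>Here \<open>exp_law_memoryless\<close> is read from right to left: the result is
    the part of the law of a single gap beyond \<open>t\<close>, which completes the part up to
    \<open>t\<close>.\<close>
  also have "emeasure exp_law {t<..} * ((\<integral>\<^sup>+r. indicator (B 0) (t + r) \<partial>exp_law) * ?R) =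
      (\<integral>\<^sup>+s. indicator {t<..} s * indicator (B 0) s \<partial>exp_law) * ?R"
    using Suc.prems(2) by (simp add: exp_law_memoryless exp_law_greaterThan mult.assoc)
  also have "(\<integral>\<^sup>+s. indicator {..t} s * indicator (B 0) s \<partial>exp_law) * ?R + \<dots> =
     (\<integral>\<^sup>+s. indicator {..t} s * indicator (B 0) s + indicator {t<..} s * indicator (B 0) s \<partial>exp_law) * ?R"
    by (subst nn_integral_add) (auto simp: distrib_right)
  also have "(\<lambda>s. indicator {..t} s * indicator (B 0) s + indicator {t<..} s * indicator (B 0) s :: ennreal) = indicator (B 0)"
    by (auto split: split_indicator)
  finally show ?case by (simp add: prod.lessThan_Suc_shift del: prod.lessThan_Suc)
qed

text \<open>The memoryless property for whole sequences of waiting times.\<close>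

proposition distr_glue:
  assumes "0 \<le> t"
  shows "distr (gap_law \<Otimes>\<^sub>M gap_law) gap_law (\<lambda>(x, y). glue t x y) = gap_law"
proof -
  let ?D = "distr (gap_law \<Otimes>\<^sub>M gap_law) gap_law (\<lambda>(x, y). glue t x y)"
  have "?D = PiM UNIV (\<lambda>_. exp_law)"
  proof (rule PiM_UNIV_eqI[OF prob_space_exp_law])
    fix J :: "nat set" and A :: "nat \<Rightarrow> real set"
    assume J: "finite J" and A: "\<And>i. i \<in> J \<Longrightarrow> A i \<in> sets exp_law"
    obtain n where n: "J \<subseteq> {..<n}" using finite_nat_iff_bounded J by auto
    \<comment> \<open>Coordinates outside \<open>J\<close> are padded by \<open>UNIV\<close>,
      because \<open>nn_integral_glue\<close> treats initial segments of the index set.\<close>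
    define B where "B k = (if k \<in> J then A k else UNIV)" for k
    have B [measurable]: "B k \<in> sets borel" for k using A by (auto simp: B_def)
    have "emeasure ?D {\<omega> \<in> space ?D. \<forall>i\<in>J. \<omega> i \<in> A i} = (\<integral>\<^sup>+z. indicator {\<omega>. \<forall>i\<in>J. \<omega> i \<in> A i} (case z of (x, y) \<Rightarrow> glue t x y) \<partial>(gap_law \<Otimes>\<^sub>M gap_law))"
    proof -
      have "{\<omega>. \<forall>i\<in>J. \<omega> i \<in> A i} \<in> sets gap_law"
      proof -
        have "{\<omega> \<in> space gap_law. \<forall>i\<in>J. \<omega> i \<in> B i} \<in> sets gap_law" by measurable
        then show ?thesis by (simp add: B_def)
      qed
      note [measurable] = this
      have "emeasure ?D {\<omega> \<in> space ?D. \<forall>i\<in>J. \<omega> i \<in> A i} = (\<integral>\<^sup>+w. indicator {\<omega>. \<forall>i\<in>J. \<omega> i \<in> A i} w \<partial>?D)"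
        by simp
      also have "\<dots> = (\<integral>\<^sup>+z. indicator {\<omega>. \<forall>i\<in>J. \<omega> i \<in> A i} (case z of (x, y) \<Rightarrow> glue t x y) \<partial>(gap_law \<Otimes>\<^sub>M gap_law))"
        by (rule nn_integral_distr) measurable
      finally show ?thesis .
    qed
    also have "\<dots> = (\<integral>\<^sup>+z. (\<Prod>k<n. indicator (B k) (glue t (fst z) (snd z) k)) \<partial>(gap_law \<Otimes>\<^sub>M gap_law))"
    proof (rule nn_integral_cong)
      fix z :: "(nat \<Rightarrow> real) \<times> (nat \<Rightarrow> real)"
      have "(\<Prod>k<n. indicator (B k) (w k)) = (indicator {\<omega>. \<forall>i\<in>J. \<omega> i \<in> A i} w :: ennreal)" for w :: "nat \<Rightarrow> real"
      proof -
        have "(\<Prod>k<n. indicator (B k) (w k)) = (indicator {\<omega>. \<forall>k<n. \<omega> k \<in> B k} w :: ennreal)"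
          by (induction n) (auto split: split_indicator simp: less_Suc_eq)
        moreover have "(\<forall>k<n. w k \<in> B k) \<longleftrightarrow> (\<forall>i\<in>J. w i \<in> A i)"
          using n by (auto simp: B_def)
        ultimately show ?thesis by (simp add: indicator_def)
      qed
      then show "indicator {\<omega>. \<forall>i\<in>J. \<omega> i \<in> A i} (case z of (x, y) \<Rightarrow> glue t x y) = (\<Prod>k<n. indicator (B k) (glue t (fst z) (snd z) k) :: ennreal)"
        by (simp add: split_beta)
    qed
    also have "\<dots> = (\<Prod>k<n. emeasure exp_law (B k))"
      by (subst gap_law.nn_integral_fst[symmetric]) (auto simp: nn_integral_glue[OF B assms])
    also have "\<dots> = (\<Prod>k\<in>J. emeasure exp_law (A k))"
      using n by (intro prod.mono_neutral_cong_right) (auto simp: B_def exp_law.emeasure_space_1[simplified])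
    finally show "emeasure ?D {\<omega> \<in> space ?D. \<forall>i\<in>J. \<omega> i \<in> A i} = (\<Prod>k\<in>J. emeasure exp_law (A k))" .
  qed simp
  then show ?thesis .
qed

section \<open>Arrival times and counting functions of a sequence of gaps\<close>

definition psum :: "(nat \<Rightarrow> real) \<Rightarrow> nat \<Rightarrow> real" where
  "psum x k = (\<Sum>j\<le>k. x j)"

text \<open>Almost sure by \<open>AE_good_seq\<close>. Unboundedness keeps the set in
  \<open>nb\<close> finite; on an infinite set \<open>card\<close> would return the default
  0.\<close>

definition good_seq :: "(nat \<Rightarrow> real) \<Rightarrow> bool" where
  "good_seq x \<longleftrightarrow> (\<forall>k. 0 < x k) \<and> (\<forall>c. \<exists>k. c < psum x k)"

definition nb :: "(nat \<Rightarrow> real) \<Rightarrow> real \<Rightarrow> nat" where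
  "nb x t = card {k. psum x k \<le> t}"

lemma measurable_psum [measurable (raw)]:
  assumes "x \<in> measurable M gap_law" shows "(\<lambda>\<omega>. psum (x \<omega>) k) \<in> borel_measurable M"
  using measurable_gap_app[OF assms] unfolding psum_def by measurable

lemma measurable_good_seq [measurable]: "Measurable.pred gap_law good_seq"
proof -
  have "good_seq x \<longleftrightarrow> (\<forall>k. 0 < x k) \<and> (\<forall>n::nat. \<exists>k. real n < psum x k)" for x
    unfolding good_seq_def using reals_Archimedean2 by (meson less_trans)
  then have *: "good_seq = (\<lambda>x. (\<forall>k. 0 < x k) \<and> (\<forall>n::nat. \<exists>k. real n < psum x k))" by (rule ext)
  show ?thesis unfolding * by measurable
qed

lemma measurable_nb [measurable (raw)]:
  assumes [measurable]: "x \<in> measurable M gap_law" "t \<in> borel_measurable M"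
  shows "(\<lambda>\<omega>. nb (x \<omega>) (t \<omega>)) \<in> measurable M (count_space UNIV)"
  unfolding nb_def by measurable

lemma psum_0 [simp]: "psum x 0 = x 0" by (simp add: psum_def)

lemma psum_Suc: "psum x (Suc k) = psum x k + x (Suc k)" by (simp add: psum_def)

lemma psum_Suc_shift: "psum x (Suc k) = x 0 + psum (\<lambda>j. x (Suc j)) k"
  unfolding psum_def by (rule sum.atMost_Suc_shift)

lemma good_seq_strict_mono: "good_seq x \<Longrightarrow> strict_mono (psum x)"
  by (auto simp: strict_mono_Suc_iff psum_Suc good_seq_def)

lemma good_seq_psum_pos: "good_seq x \<Longrightarrow> 0 < psum x k"
  unfolding psum_def good_seq_def by (intro sum_pos) auto

lemma good_seq_tail:
  assumes "good_seq x" shows "good_seq (\<lambda>j. x (Suc j))"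
proof -
  have "\<exists>k. c < psum (\<lambda>j. x (Suc j)) k" for c
  proof -
    obtain k where "c + x 0 < psum x k" using assms by (auto simp: good_seq_def)
    also have "psum x k < psum x (Suc k)" using good_seq_strict_mono[OF assms] by (auto dest: strict_monoD)
    finally show ?thesis by (auto simp: psum_Suc_shift)
  qed
  then show ?thesis using assms by (auto simp: good_seq_def)
qed

text \<open>Arrival times increase strictly and are unbounded, so the indices with arrival up to
  \<open>t\<close> form an initial segment. Indices start at 0, so \<open>psum x k\<close> is the
  arrival number \<open>k + 1\<close>.\<close>

lemma less_nb_iff:
  assumes "good_seq x" shows "k < nb x t \<longleftrightarrow> psum x k \<le> t"
proof -
  obtain m where m: "t < psum x m" using assms by (auto simp: good_seq_def)
  let ?m = "LEAST m. t < psum x m"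
  have "{k. psum x k \<le> t} = {..<?m}"
  proof -
    have "psum x k \<le> t \<longleftrightarrow> k < ?m" for k
    proof
      assume "psum x k \<le> t"
      moreover have "t < psum x ?m" using m by (rule LeastI)
      ultimately have "psum x k < psum x ?m" by simp
      then show "k < ?m" using strict_mono_less[OF good_seq_strict_mono[OF assms]] by simp
    qed (auto dest: not_less_Least)
    then show ?thesis by auto
  qed
  then show ?thesis unfolding nb_def by (metis card_lessThan lessThan_iff mem_Collect_eq)
qed

lemma nb_eqI: "good_seq x \<Longrightarrow> (\<And>k. k < n \<longleftrightarrow> psum x k \<le> t) \<Longrightarrow> nb x t = n"
  using less_nb_iff by (metis linorder_neqE_nat nat_less_le)

lemma nb_rec:
  assumes "good_seq x"
  shows "nb x t = (if x 0 \<le> t then Suc (nb (\<lambda>j. x (Suc j)) (t - x 0)) else 0)"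
proof (rule nb_eqI[OF assms])
  fix k
  have "x 0 \<le> psum x k" using strict_mono_less_eq[OF good_seq_strict_mono[OF assms], of 0 k] by simp
  then show "k < (if x 0 \<le> t then Suc (nb (\<lambda>j. x (Suc j)) (t - x 0)) else 0) \<longleftrightarrow> psum x k \<le> t"
    by (cases k) (auto simp: less_nb_iff[OF good_seq_tail[OF assms]] psum_Suc_shift)
qed

text \<open>Confirms that \<open>glue\<close> splices arrivals at time \<open>t\<close>. Removing
  the first gap lowers the time left by \<open>x 0\<close> and, by \<open>nb_rec\<close>, the number
  of old arrivals by one.\<close>

lemma psum_glue:
  assumes "good_seq x"
  shows "psum (glue t x y) k = (if k < nb x t then psum x k else t + psum y (k - nb x t))"
  using assms
proof (induction k arbitrary: t x)
  case 0
  then show ?case by (auto simp: nb_rec)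
next
  case (Suc k)
  have "psum (glue t x y) (Suc k) = glue t x y 0 + psum (\<lambda>j. glue t x y (Suc j)) k"
    by (rule psum_Suc_shift)
  then show ?case
    using Suc.IH[OF good_seq_tail[OF Suc.prems], of "t - x 0"]
    by (auto simp: nb_rec[OF Suc.prems] psum_Suc_shift)
qed

lemma good_seq_glue:
  assumes "good_seq x" "good_seq y" "0 \<le> t" shows "good_seq (glue t x y)"
proof -
  have "0 < glue t x y k" for k
    using assms
  proof (induction k arbitrary: t x)
    case (Suc k)
    then show ?case using good_seq_tail[OF Suc.prems(1)] by (auto simp: good_seq_def)
  qed (auto simp: good_seq_def add_nonneg_pos)
  moreover have "\<exists>k. c < psum (glue t x y) k" for c
  proof -
    obtain k where "c - t < psum y k" using assms(2) unfolding good_seq_def by blast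
    then have "c < psum (glue t x y) (nb x t + k)" by (simp add: psum_glue[OF assms(1)])
    then show ?thesis ..
  qed
  ultimately show ?thesis by (simp add: good_seq_def)
qed

lemma nb_glue_le:
  assumes "good_seq x" "good_seq y" "0 \<le> t" "s \<le> t" shows "nb (glue t x y) s = nb x s"
proof (rule nb_eqI[OF good_seq_glue[OF assms(1-3)]])
  fix k
  have "0 < psum y (k - nb x t)" by (rule good_seq_psum_pos) fact
  then show "k < nb x s \<longleftrightarrow> psum (glue t x y) k \<le> s"
    using assms(4) by (auto simp: less_nb_iff[OF assms(1)] psum_glue[OF assms(1)])
qed

lemma nb_glue_ge:
  assumes "good_seq x" "good_seq y" "0 \<le> t" "t \<le> s"
  shows "nb (glue t x y) s = nb x t + nb y (s - t)"
proof (rule nb_eqI[OF good_seq_glue[OF assms(1-3)]])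
  fix k
  have "k - nb x t < nb y (s - t) \<longleftrightarrow> t + psum y (k - nb x t) \<le> s"
    by (auto simp: less_nb_iff[OF assms(2)])
  moreover have "k < nb x t \<Longrightarrow> psum x k \<le> s"
    using assms(4) by (auto simp: less_nb_iff[OF assms(1)])
  ultimately show "k < nb x t + nb y (s - t) \<longleftrightarrow> psum (glue t x y) k \<le> s"
    by (auto simp: psum_glue[OF assms(1)])
qed

lemma nb_nonpos: "good_seq x \<Longrightarrow> t \<le> 0 \<Longrightarrow> nb x t = 0"
  using less_nb_iff[of x 0 t] good_seq_psum_pos[of x 0] by auto

text \<open>The Laplace transform of the rate 1 exponential law at 2 is 1/(1 + 2), and
  \<open>Suc k\<close> independent gaps are added. With the argument 2 the sum over \<open>k\<close>
  is 1/2 (\<open>suminf_third\<close>); being below 1, it makes the tree of lines subcritical in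
  this weight.\<close>

lemma nn_integral_exp_psum:
  "(\<integral>\<^sup>+x. ennreal (exp (- 2 * psum x k)) \<partial>gap_law) = (1/3) ^ Suc k"
proof (induction k)
  have *: "(\<integral>\<^sup>+s. ennreal (exp (- (2 * s))) \<partial>exp_law) = 1/3"
  proof -
    \<comment> \<open>The product of exp (- s) and exp (- 2 s) is one third of the density of the
      exponential law of rate 3, which has mass 1.\<close>
    interpret E3: prob_space "density lborel (exponential_density 3)"
      by (rule prob_space_exponential_density) simp
    have "(\<integral>\<^sup>+s. ennreal (exp (- (2 * s))) \<partial>exp_law) =
        (\<integral>\<^sup>+s. ennreal (exponential_density 1 s) * ennreal (exp (- 2 * s)) \<partial>lborel)"
      unfolding exp_law_def by (subst nn_integral_density) auto
    also have "\<dots> = (\<integral>\<^sup>+s. ennreal (1/3) * ennreal (exponential_density 3 s) \<partial>lborel)"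
      by (intro nn_integral_cong)
        (auto simp: exponential_density_def ennreal_mult'[symmetric] exp_add[symmetric] simp del: ennreal_divide_numeral)
    also have "\<dots> = ennreal (1/3) * (\<integral>\<^sup>+s. ennreal (exponential_density 3 s) \<partial>lborel)"
      by (rule nn_integral_cmult) simp
    also have "(\<integral>\<^sup>+s. ennreal (exponential_density 3 s) \<partial>lborel) = 1"
      using E3.emeasure_space_1 by (simp add: emeasure_density)
    finally show ?thesis by (simp add: divide_ennreal[symmetric] ennreal_divide_numeral)
  qed
  case 0
  show ?case
    using * by (subst nn_integral_gap_law_Suc) (auto simp: gap_law.emeasure_space_1[simplified])
  case (Suc k)
  have "(\<integral>\<^sup>+x. ennreal (exp (- 2 * psum x (Suc k))) \<partial>gap_law) =
    (\<integral>\<^sup>+s. (\<integral>\<^sup>+x. ennreal (exp (- 2 * psum (case_nat s x) (Suc k))) \<partial>gap_law) \<partial>exp_law)"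
    by (rule nn_integral_gap_law_Suc) measurable
  also have "\<dots> = (\<integral>\<^sup>+s. (\<integral>\<^sup>+x. ennreal (exp (- (2 * s))) * ennreal (exp (- 2 * psum x k)) \<partial>gap_law) \<partial>exp_law)"
  proof -
    have "exp (- 2 * psum (case_nat s x) (Suc k)) = exp (- (2 * s)) * exp (- 2 * psum x k)" for s x
      by (simp add: psum_Suc_shift exp_add[symmetric])
    then show ?thesis by (simp only: ennreal_mult' exp_ge_zero)
  qed
  also have "\<dots> = (\<integral>\<^sup>+s. ennreal (exp (- (2 * s))) \<partial>exp_law) * (\<integral>\<^sup>+x. ennreal (exp (- 2 * psum x k)) \<partial>gap_law)"
    by (simp add: nn_integral_cmult nn_integral_multc)
  also have "\<dots> = (1/3) ^ Suc (Suc k)" unfolding * Suc by simp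
  finally show ?case .
qed

lemma suminf_third: "(\<Sum>k. (1/3) ^ Suc k :: ennreal) = 1/2"
proof -
  have "(\<lambda>k. (1/3) ^ Suc k :: real) sums (1/3 * (1 / (1 - 1/3)))"
    using sums_mult[OF geometric_sums[of "1/3::real"], of "1/3"] by simp
  then have "(\<Sum>k. ennreal ((1/3) ^ Suc k)) = ennreal (1/2)"
    by (intro sums_unique[symmetric] sums_ennreal[THEN iffD2]) (auto simp: field_simps)
  moreover have "ennreal ((1/3) ^ Suc k) = (1/3) ^ Suc k" for k
    by (subst ennreal_power[symmetric]) (auto simp: divide_ennreal[symmetric])
  moreover have "ennreal (1/2) = 1/2"
    using divide_ennreal[of 1 2] by simp
  ultimately show ?thesis by (simp only:)
qed

text \<open>Markov's inequality for the counting measure.\<close>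

lemma finite_level_set_of_nn_integral:
  fixes f :: "'b \<Rightarrow> ennreal"
  assumes "(\<integral>\<^sup>+i. f i \<partial>count_space UNIV) < \<top>" and c: "0 < c" "c < \<top>"
  shows "finite {i. c \<le> f i}"
proof -
  have "c * emeasure (count_space UNIV) {i. c \<le> f i} = (\<integral>\<^sup>+i. c * indicator {i. c \<le> f i} i \<partial>count_space UNIV)"
    by (simp add: nn_integral_cmult_indicator)
  also have "\<dots> \<le> (\<integral>\<^sup>+i. f i \<partial>count_space UNIV)"
    by (intro nn_integral_mono) (auto split: split_indicator)
  finally have "c * emeasure (count_space UNIV) {i. c \<le> f i} < \<top>" using assms by auto
  then show ?thesis
    using c by (cases "finite {i. c \<le> f i}") (auto simp: ennreal_mult_top split: if_splits)
qed

text \<open>The sum of \<open>exp (- 2 * psum x k)\<close> over \<open>k\<close> has expectation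
  1/2, so it is almost surely finite; bounded arrival times would give infinitely many terms bounded
  away from 0.\<close>

lemma AE_good_seq: "AE x in gap_law. good_seq x"
proof -
  have "AE x in gap_law. 0 < x k" for k
    by (rule AE_PiM_component[OF prob_space_exp_law _ AE_exp_law_pos]) simp
  then have pos: "AE x in gap_law. \<forall>k. 0 < x k" by (simp add: AE_all_countable)
  have "(\<integral>\<^sup>+x. (\<integral>\<^sup>+k. ennreal (exp (- 2 * psum x k)) \<partial>count_space UNIV) \<partial>gap_law) = (\<Sum>k. (1/3) ^ Suc k)"
    unfolding nn_integral_count_space_nat
    by (subst nn_integral_suminf) (simp_all only: nn_integral_exp_psum, measurable)
  also have "\<dots> \<noteq> \<infinity>" unfolding suminf_third by (simp add: ennreal_divide_eq_top_iff)
  finally have "AE x in gap_law. (\<integral>\<^sup>+k. ennreal (exp (- 2 * psum x k)) \<partial>count_space UNIV) \<noteq> \<infinity>"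
    by (intro nn_integral_noteq_infinite) (auto simp: nn_integral_count_space_nat)
  with pos show ?thesis
  proof eventually_elim
    case (elim x)
    have "\<exists>k. c < psum x k" for c
    proof (rule ccontr)
      assume "\<nexists>k. c < psum x k"
      then have "{k. ennreal (exp (- 2 * c)) \<le> ennreal (exp (- 2 * psum x k))} = UNIV"
        by (auto simp: not_less)
      moreover have "finite {k. ennreal (exp (- 2 * c)) \<le> ennreal (exp (- 2 * psum x k))}"
        using elim(2) by (intro finite_level_set_of_nn_integral) (auto simp: less_top)
      ultimately show False by simp
    qed
    then show ?case using elim by (simp add: good_seq_def)
  qed
qed

section \<open>Counting processes\<close>

abbreviation cnt_space :: "(real \<Rightarrow> nat) measure" where
  "cnt_space \<equiv> (\<Pi>\<^sub>M _\<in>UNIV. count_space UNIV)"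

text \<open>The law of the rate 1 Poisson counting function. The product sigma-algebra controls only
  countably many times at once, which is why statements about whole paths later go through rational
  times.\<close>

definition count_law :: "(real \<Rightarrow> nat) measure" where
  "count_law = distr gap_law cnt_space nb"

definition pois :: "real \<Rightarrow> nat \<Rightarrow> real" where
  "pois d n = d ^ n / fact n * exp (- d)"

lemma space_cnt_space [simp]: "space cnt_space = UNIV"
  by (simp add: space_PiM PiE_UNIV_domain)

lemma measurable_cnt_spaceI:
  assumes "\<And>t. (\<lambda>\<omega>. c \<omega> t) \<in> measurable M (count_space UNIV)"
  shows "c \<in> measurable M cnt_space"
proof (rule measurable_PiM_single'[of UNIV "\<lambda>t \<omega>. c \<omega> t" M "\<lambda>_. count_space UNIV"])
  show "(\<lambda>t \<omega>. c \<omega> t) t \<in> measurable M (count_space UNIV)" for t by (rule assms)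
  show "(\<lambda>\<omega> t. c \<omega> t) \<in> space M \<rightarrow> (\<Pi>\<^sub>E t\<in>UNIV. space (count_space UNIV))"
    by (simp only: PiE_UNIV_domain space_count_space) blast
qed

lemma measurable_nb_cnt: "nb \<in> measurable gap_law cnt_space"
proof (rule measurable_cnt_spaceI)
  show "(\<lambda>x. nb x t) \<in> measurable gap_law (count_space UNIV)" for t by measurable
qed

text \<open>One renewal step: a first arrival at s \<le> t, then \<open>n\<close> arrivals in the
  remaining time \<open>t - s\<close>. The exponentials combine to the constant exp (- t), leaving
  the integral of a power.\<close>

lemma pois_integral:
  assumes t: "0 \<le> t"
  shows "(\<integral>\<^sup>+s. indicator {..t} s * ennreal (pois (t - s) n) \<partial>exp_law) = ennreal (pois t (Suc n))"
proof -
  define f where "f s = (t - s) ^ n / fact n * exp (- t)" for s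
  define F where "F s = - ((t - s) ^ Suc n / fact (Suc n) * exp (- t))" for s
  have [measurable]: "f \<in> borel_measurable borel" unfolding f_def by measurable
  have p [measurable]: "(\<lambda>s. pois (t - s) n) \<in> borel_measurable borel" unfolding pois_def by measurable
  have "(\<integral>\<^sup>+s. indicator {..t} s * ennreal (pois (t - s) n) \<partial>exp_law) =
      (\<integral>\<^sup>+s. ennreal (exponential_density 1 s) * (indicator {..t} s * ennreal (pois (t - s) n)) \<partial>lborel)"
    unfolding exp_law_def by (subst nn_integral_density) auto
  also have "\<dots> = (\<integral>\<^sup>+s. ennreal (f s) * indicator {0..t} s \<partial>lborel)"
  proof (rule nn_integral_cong)
    fix s
    have *: "exp (- s) * pois (t - s) n = f s"
      unfolding pois_def f_def by (simp add: exp_add[symmetric])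
    consider "s < 0" | "t < s" | "0 \<le> s" "s \<le> t" by linarith
    then show "ennreal (exponential_density 1 s) * (indicator {..t} s * ennreal (pois (t - s) n)) = ennreal (f s) * indicator {0..t} s"
    proof cases
      case 3
      then have "ennreal (exponential_density 1 s) * ennreal (pois (t - s) n) = ennreal (exp (- s) * pois (t - s) n)"
        by (subst ennreal_mult') (simp_all add: exponential_density_def)
      then show ?thesis using 3 by (simp add: *)
    qed (simp_all add: exponential_density_def)
  qed
  also have "\<dots> = F t - F 0"
  proof (rule nn_integral_FTC_Icc)
    fix s assume s: "s \<in> {0..t}"
    have "((\<lambda>s. (t - s) ^ Suc n) has_real_derivative (0 - 1) * (real (Suc n) * (t - s) ^ n)) (at s)"
      by (auto intro!: derivative_eq_intros simp del: power_Suc)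
    from DERIV_cmult[OF this, of "- (exp (- t) / fact (Suc n))"]
    have "((\<lambda>s. - (exp (- t) / fact (Suc n)) * (t - s) ^ Suc n) has_real_derivative
        exp (- t) * (real (Suc n) * (t - s) ^ n / fact (Suc n))) (at s)"
      by (simp del: power_Suc fact_Suc)
    also have "real (Suc n) * (t - s) ^ n / fact (Suc n) = (t - s) ^ n / fact n"
      by (simp add: divide_simps)
    also have "(\<lambda>s. - (exp (- t) / fact (Suc n)) * (t - s) ^ Suc n) = F"
      by (auto simp: F_def)
    finally have "(F has_real_derivative f s) (at s)"
      by (simp add: f_def mult_ac)
    then show "(F has_real_derivative f s) (at s)" .
    show "0 \<le> f s" using s by (simp add: f_def)
  qed (use t in simp_all)
  also have "F t - F 0 = pois t (Suc n)"
    by (simp add: F_def pois_def)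
  finally show ?thesis .
qed

declare sets_exp_law [measurable_cong del]

text \<open>Induct on \<open>n\<close>: by \<open>nb_rec\<close> a first gap \<open>s\<close> leaves
  \<open>n\<close> arrivals for the remaining time, and \<open>pois_integral\<close> evaluates the
  resulting integral.\<close>

lemma emeasure_nb_eq:
  "0 \<le> t \<Longrightarrow> emeasure gap_law {x. nb x t = n} = ennreal (pois t n)"
proof (induction n arbitrary: t)
  case 0
  have "emeasure gap_law {x. nb x t = 0} = (\<integral>\<^sup>+x. indicator {x. nb x t = 0} x \<partial>gap_law)"
  proof -
    have "{x \<in> space gap_law. nb x t = 0} \<in> sets gap_law" by measurable
    then show ?thesis by simp
  qed
  also have "\<dots> = (\<integral>\<^sup>+x. indicator {t<..} (x 0) \<partial>gap_law)"
    by (rule nn_integral_cong_AE, rule eventually_mono[OF AE_good_seq])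
      (auto simp: nb_rec split: split_indicator)
  also have "\<dots> = emeasure exp_law {t<..}"
    by (subst nn_integral_gap_law_Suc) (auto simp: gap_law.emeasure_space_1[simplified])
  finally show ?case using 0 by (simp add: exp_law_greaterThan pois_def)
next
  case (Suc n)
  have m: "{x. nb x s = k} \<in> sets gap_law" for s k
  proof -
    have "{x \<in> space gap_law. nb x s = k} \<in> sets gap_law" by measurable
    then show ?thesis by simp
  qed
  have "emeasure gap_law {x. nb x t = Suc n} = (\<integral>\<^sup>+x. indicator {x. nb x t = Suc n} x \<partial>gap_law)"
    using m by simp
  also have "\<dots> = (\<integral>\<^sup>+x. indicator {x. x 0 \<le> t \<and> nb (\<lambda>j. x (Suc j)) (t - x 0) = n} x \<partial>gap_law)"
    by (rule nn_integral_cong_AE, rule eventually_mono[OF AE_good_seq])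
      (auto simp: nb_rec split: split_indicator)
  also have "\<dots> = (\<integral>\<^sup>+s. (\<integral>\<^sup>+x. indicator {..t} s * indicator {x. nb x (t - s) = n} x \<partial>gap_law) \<partial>exp_law)"
  proof (subst nn_integral_gap_law_Suc)
    have [measurable (raw)]: "(\<lambda>x. nb (\<lambda>j. x (Suc j)) (t - x 0)) \<in> measurable gap_law (count_space UNIV)"
      by (intro measurable_nb measurable_gap_tail borel_measurable_diff measurable_gap_component) simp
    have "{x \<in> space gap_law. x 0 \<le> t} \<in> sets gap_law"
      by (rule borel_measurable_le[OF measurable_gap_component]) simp
    moreover have "{x \<in> space gap_law. nb (\<lambda>j. x (Suc j)) (t - x 0) = n} \<in> sets gap_law"
      by measurable
    ultimately have "{x \<in> space gap_law. x 0 \<le> t} \<inter> {x \<in> space gap_law. nb (\<lambda>j. x (Suc j)) (t - x 0) = n} \<in> sets gap_law"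
      by (rule sets.Int)
    then have "{x \<in> space gap_law. x 0 \<le> t \<and> nb (\<lambda>j. x (Suc j)) (t - x 0) = n} \<in> sets gap_law"
      by (simp add: Int_def)
    then show "indicator {x. x 0 \<le> t \<and> nb (\<lambda>j. x (Suc j)) (t - x 0) = n} \<in> borel_measurable gap_law"
      by simp
  qed (auto intro!: nn_integral_cong split: split_indicator)
  also have "\<dots> = (\<integral>\<^sup>+s. indicator {..t} s * emeasure gap_law {x. nb x (t - s) = n} \<partial>exp_law)"
    by (simp add: nn_integral_cmult m)
  also have "\<dots> = (\<integral>\<^sup>+s. indicator {..t} s * ennreal (pois (t - s) n) \<partial>exp_law)"
    by (intro nn_integral_cong) (auto simp: Suc.IH split: split_indicator)
  finally show ?case using Suc.prems by (simp add: pois_integral)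
qed

text \<open>Independence of increments comes from \<open>distr_glue\<close> at the first positive
  index: the count at \<open>t 1\<close> is read from \<open>x\<close>, all later increments from
  the independent \<open>y\<close>, to which the induction hypothesis applies with the shifted
  times.\<close>

lemma emeasure_nb_increments:
  fixes t :: "nat \<Rightarrow> real"
  assumes "t 0 = 0" "mono t"
  shows "emeasure gap_law {x. \<forall>i<m. nb x (t (Suc i)) = (\<Sum>j\<le>i. k j)} =
    (\<Prod>i<m. ennreal (pois (t (Suc i) - t i) (k i)))"
  using assms
proof (induction m arbitrary: t k)
  case 0
  then show ?case by (simp add: gap_law.emeasure_space_1[simplified])
next
  case (Suc m)
  let ?a = "t (Suc 0)"
  define t' where "t' i = t (Suc i) - ?a" for i
  have a: "0 \<le> ?a" using Suc.prems monoD[of t 0 "Suc 0"] by simp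
  have m: "{x. \<forall>i<m. nb x (r i) = k i} \<in> sets gap_law" for m r and k :: "nat \<Rightarrow> nat"
  proof -
    have "{x \<in> space gap_law. \<forall>i\<in>{..<m}. nb x (r i) = k i} \<in> sets gap_law" by measurable
    then show ?thesis by (simp add: Ball_def)
  qed
  let ?A = "{x. \<forall>i<Suc m. nb x (t (Suc i)) = (\<Sum>j\<le>i. k j)}"
  let ?B = "{x. nb x ?a = k 0}" and ?C = "{x. \<forall>i<m. nb x (t' (Suc i)) = (\<Sum>j\<le>i. k (Suc j))}"
  have "emeasure gap_law ?A = emeasure (distr (gap_law \<Otimes>\<^sub>M gap_law) gap_law (\<lambda>(x, y). glue ?a x y)) ?A"
    by (simp add: distr_glue[OF a])
  also have "\<dots> = emeasure (gap_law \<Otimes>\<^sub>M gap_law) ((\<lambda>(x, y). glue ?a x y) -` ?A \<inter> space (gap_law \<Otimes>\<^sub>M gap_law))"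
    by (rule emeasure_distr[OF _ m]) measurable
  also have "\<dots> = emeasure (gap_law \<Otimes>\<^sub>M gap_law) (?B \<times> ?C)"
  proof (rule emeasure_eq_AE)
    have g1: "AE z in gap_law \<Otimes>\<^sub>M gap_law. good_seq (fst z)"
      by (rule AE_pair_fst[OF prob_space_gap_law AE_good_seq])
    have g2: "AE z in gap_law \<Otimes>\<^sub>M gap_law. good_seq (snd z)"
      by (rule AE_pair_snd[OF prob_space_gap_law prob_space_gap_law AE_good_seq])
    show "AE z in gap_law \<Otimes>\<^sub>M gap_law. z \<in> (\<lambda>(x, y). glue ?a x y) -` ?A \<inter> space (gap_law \<Otimes>\<^sub>M gap_law) \<longleftrightarrow> z \<in> ?B \<times> ?C"
      using g1 g2
    proof eventually_elim
      case (elim z)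
      obtain x y where z: "z = (x, y)" by (cases z)
      have *: "nb (glue ?a x y) (t (Suc i)) = nb x ?a + nb y (t (Suc i) - ?a)" for i
        using elim a Suc.prems(2) by (intro nb_glue_ge) (auto simp: z dest: monoD)
      have 0: "nb y 0 = 0" using elim by (simp add: z nb_nonpos)
      have "(\<forall>i<Suc m. nb (glue ?a x y) (t (Suc i)) = (\<Sum>j\<le>i. k j)) \<longleftrightarrow>
        nb x ?a = k 0 \<and> (\<forall>i<m. nb x ?a + nb y (t' (Suc i)) = (\<Sum>j\<le>Suc i. k j))"
        unfolding * t'_def by (auto simp: All_less_Suc2 0)
      then show ?case
        by (auto simp: z space_pair_measure sum.atMost_Suc_shift simp del: sum.atMost_Suc)
    qed
  next
    have "(\<lambda>(x, y). glue ?a x y) \<in> measurable (gap_law \<Otimes>\<^sub>M gap_law) gap_law" by measurable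
    then show "(\<lambda>(x, y). glue ?a x y) -` ?A \<inter> space (gap_law \<Otimes>\<^sub>M gap_law) \<in> sets (gap_law \<Otimes>\<^sub>M gap_law)"
      using m by (rule measurable_sets)
    show "?B \<times> ?C \<in> sets (gap_law \<Otimes>\<^sub>M gap_law)"
      using m[of "Suc 0" "\<lambda>_. ?a" k] m by (intro pair_measureI) auto
  qed
  also have "\<dots> = emeasure gap_law ?B * emeasure gap_law ?C"
    using m[of "Suc 0" "\<lambda>_. ?a" k] m by (intro gap_law.emeasure_pair_measure_Times) auto
  also have "emeasure gap_law ?B = ennreal (pois ?a (k 0))"
    using a by (rule emeasure_nb_eq)
  also have "emeasure gap_law ?C = (\<Prod>i<m. ennreal (pois (t' (Suc i) - t' i) (k (Suc i))))"
    using Suc.prems(2) by (intro Suc.IH) (auto simp: t'_def mono_def)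
  finally show ?case
    using Suc.prems(1) by (simp add: prod.lessThan_Suc_shift t'_def del: prod.lessThan_Suc)
qed

text \<open>Counts are integers, so a cylinder over finitely many times is a countable disjoint
  union of events that prescribe exact values.\<close>

lemma cnt_measure_eqI:
  assumes sets: "sets Q1 = sets cnt_space" "sets Q2 = sets cnt_space" and fin: "finite_measure Q1"
    and eq: "\<And>J K. finite J \<Longrightarrow> emeasure Q1 {c. \<forall>t\<in>J. c t = K t} = emeasure Q2 {c. \<forall>t\<in>J. c t = K t}"
  shows "Q1 = Q2"
proof (rule measure_eqI_PiM_infinite[OF sets _ fin])
  fix A :: "real \<Rightarrow> nat set" and J :: "real set" assume J: "finite J"
  have m: "{c. \<forall>t\<in>J. c t = K t} \<in> sets cnt_space" for K
  proof -
    have "{c \<in> space cnt_space. \<forall>t\<in>J. c t = K t} \<in> sets cnt_space"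
      using J by (intro sets.sets_Collect_finite_All) measurable
    then show ?thesis by simp
  qed
  have *: "prod_emb UNIV (\<lambda>_. count_space UNIV) J (Pi\<^sub>E J A) = (\<Union>K\<in>Pi\<^sub>E J A. {c. \<forall>t\<in>J. c t = K t})"
  proof (intro equalityI subsetI)
    fix c assume "c \<in> prod_emb UNIV (\<lambda>_. count_space UNIV) J (Pi\<^sub>E J A)"
    then have "restrict c J \<in> Pi\<^sub>E J A" by (simp add: prod_emb_def)
    then show "c \<in> (\<Union>K\<in>Pi\<^sub>E J A. {c. \<forall>t\<in>J. c t = K t})" by (intro UN_I[of "restrict c J"]) auto
  qed (auto simp: prod_emb_def PiE_iff)
  have cnt: "countable (Pi\<^sub>E J A)" using J by (intro countable_PiE) auto
  have dis: "disjoint_family_on (\<lambda>K. {c. \<forall>t\<in>J. c t = K t}) (Pi\<^sub>E J A)"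
  unfolding disjoint_family_on_def
  proof safe
    fix K K' assume K: "K \<in> Pi\<^sub>E J A" "K' \<in> Pi\<^sub>E J A" "K \<noteq> K'"
    then have "\<exists>t\<in>J. K t \<noteq> K' t" by (metis PiE_ext)
    then have "{c. \<forall>t\<in>J. c t = K t} \<inter> {c. \<forall>t\<in>J. c t = K' t} = {}" by auto
    then show "c \<in> {}" if "\<forall>t\<in>J. c t = K t" "\<forall>t\<in>J. c t = K' t" for c using that by blast
  qed
  show "Q1 (prod_emb UNIV (\<lambda>_. count_space UNIV) J (Pi\<^sub>E J A)) = Q2 (prod_emb UNIV (\<lambda>_. count_space UNIV) J (Pi\<^sub>E J A))"
    unfolding * using cnt dis m
    by (subst (1 2) emeasure_UN_countable) (auto simp: sets eq[OF J])
qed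

text \<open>The finite dimensional probabilities of a rate 1 Poisson counting function.
  \<open>xs\<close> lists the positive times of \<open>J\<close>, and \<open>min i n\<close> freezes
  the time sequence after its last entry, so that it is monotone on all indices. The guard makes the
  natural number subtraction in \<open>k\<close> exact.\<close>

definition counts_prob :: "real set \<Rightarrow> (real \<Rightarrow> nat) \<Rightarrow> ennreal" where
  "counts_prob J K =
    (let xs = sorted_list_of_set (J \<inter> {0<..}); n = length xs; t = (\<lambda>i. (0 # xs) ! min i n);
         k = (\<lambda>i. K (t (Suc i)) - (if i = 0 then 0 else K (t i)))
     in if (\<forall>s\<in>J. s \<le> 0 \<longrightarrow> K s = 0) \<and> (\<forall>s\<in>J. \<forall>s'\<in>J. 0 < s \<and> s \<le> s' \<longrightarrow> K s \<le> K s')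
        then \<Prod>i<n. ennreal (pois (t (Suc i) - t i) (k i)) else 0)"

text \<open>Passes from an unordered finite set of times to an increasing time sequence, the form in
  which \<open>inc\<close> is stated. The counting process is general because
  \<open>distr_counts_eq\<close> uses this for \<open>c\<close> and for \<open>nb\<close>.\<close>

lemma emeasure_counts_eq:
  fixes K :: "real \<Rightarrow> nat"
  assumes M: "prob_space M" and c: "c \<in> measurable M cnt_space"
    and mono: "\<And>s t. s \<le> t \<Longrightarrow> AE \<omega> in M. c \<omega> s \<le> c \<omega> t"
    and zero: "\<And>t. t \<le> 0 \<Longrightarrow> AE \<omega> in M. c \<omega> t = 0"
    and inc: "\<And>t m k. t 0 = 0 \<Longrightarrow> mono t \<Longrightarrow>
      emeasure M {\<omega> \<in> space M. \<forall>i<m. c \<omega> (t (Suc i)) = (\<Sum>j\<le>i. k j)} =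
      (\<Prod>i<m. ennreal (pois (t (Suc i) - t i) (k i)))"
    and J: "finite J"
  shows "emeasure M {\<omega> \<in> space M. \<forall>s\<in>J. c \<omega> s = K s} = counts_prob J K"
proof -
  define xs where "xs = sorted_list_of_set (J \<inter> {0<..})"
  define n where "n = length xs"
  define t where "t = (\<lambda>i. (0 # xs) ! min i n)"
  define k where "k = (\<lambda>i. K (t (Suc i)) - (if i = 0 then 0 else K (t i)))"
  have counts_prob: "counts_prob J K =
    (if (\<forall>s\<in>J. s \<le> 0 \<longrightarrow> K s = 0) \<and> (\<forall>s\<in>J. \<forall>s'\<in>J. 0 < s \<and> s \<le> s' \<longrightarrow> K s \<le> K s')
     then \<Prod>i<n. ennreal (pois (t (Suc i) - t i) (k i)) else 0)"
    unfolding counts_prob_def Let_def k_def t_def n_def xs_def ..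
  have set_xs: "set xs = J \<inter> {0<..}" and sorted: "sorted xs" using J by (auto simp: xs_def)
  then have sorted0: "sorted (0 # xs)" by auto
  have t0: "t 0 = 0" by (simp add: t_def)
  have tmono: "mono t"
    unfolding t_def mono_def n_def by (auto intro!: sorted_nth_mono[OF sorted0])
  have tSuc: "t (Suc i) = xs ! i" if "i < n" for i using that by (simp add: t_def)
  have c_app [measurable]: "(\<lambda>\<omega>. c \<omega> s) \<in> measurable M (count_space UNIV)" for s
    using measurable_component_singleton'[OF c measurable_ident_sets, of M s] by simp
  have AEJ: "AE \<omega> in M. (\<forall>s\<in>J. s \<le> 0 \<longrightarrow> c \<omega> s = 0) \<and> (\<forall>s\<in>J. \<forall>s'\<in>J. s \<le> s' \<longrightarrow> c \<omega> s \<le> c \<omega> s')"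
    using J mono zero by (auto intro!: AE_conjI AE_finite_allI AE_impI)
  have mJ: "{\<omega> \<in> space M. \<forall>s\<in>J. c \<omega> s = K s} \<in> sets M"
    using J by (intro sets.sets_Collect_finite_All) measurable
  show ?thesis
  proof (cases "(\<forall>s\<in>J. s \<le> 0 \<longrightarrow> K s = 0) \<and> (\<forall>s\<in>J. \<forall>s'\<in>J. 0 < s \<and> s \<le> s' \<longrightarrow> K s \<le> K s')")
    case True
    have xsJ: "xs ! i \<in> J" "0 < xs ! i" if "i < n" for i
      using that set_xs nth_mem[of i xs] by (auto simp: n_def)
    have sumk: "(\<Sum>j\<le>i. k j) = K (t (Suc i))" if "i < n" for i
      using that
    proof (induction i)
      case (Suc i)
      have "xs ! i \<le> xs ! Suc i" using sorted_nth_mono[OF sorted, of i "Suc i"] Suc.prems by (simp add: n_def)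
      then have "K (xs ! i) \<le> K (xs ! Suc i)" using True xsJ[of i] xsJ[of "Suc i"] Suc.prems by simp
      then have "K (t (Suc i)) \<le> K (t (Suc (Suc i)))" using Suc.prems by (simp add: tSuc)
      then show ?case using Suc by (simp add: k_def)
    qed (simp add: k_def)
    have "emeasure M {\<omega> \<in> space M. \<forall>s\<in>J. c \<omega> s = K s} =
      emeasure M {\<omega> \<in> space M. \<forall>i<n. c \<omega> (t (Suc i)) = (\<Sum>j\<le>i. k j)}"
    proof (rule emeasure_eq_AE[OF _ mJ])
      show "AE \<omega> in M. \<omega> \<in> {\<omega> \<in> space M. \<forall>s\<in>J. c \<omega> s = K s} \<longleftrightarrow>
          \<omega> \<in> {\<omega> \<in> space M. \<forall>i<n. c \<omega> (t (Suc i)) = (\<Sum>j\<le>i. k j)}"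
        using AEJ
      proof eventually_elim
        case (elim \<omega>)
        have "(\<forall>s\<in>J. c \<omega> s = K s) \<longleftrightarrow> (\<forall>s\<in>set xs. c \<omega> s = K s)"
        proof -
          have "c \<omega> s = K s" if "s \<in> J" "s \<le> 0" for s using that elim True by simp
          then show ?thesis by (metis set_xs IntE IntI greaterThan_iff not_le)
        qed
        also have "\<dots> \<longleftrightarrow> (\<forall>i<n. c \<omega> (t (Suc i)) = K (t (Suc i)))"
          by (simp add: all_set_conv_all_nth n_def[symmetric] tSuc)
        also have "\<dots> \<longleftrightarrow> (\<forall>i<n. c \<omega> (t (Suc i)) = (\<Sum>j\<le>i. k j))"
          by (simp add: sumk)
        finally show ?case by simp
      qed
      have "{\<omega> \<in> space M. \<forall>i\<in>{..<n}. c \<omega> (t (Suc i)) = (\<Sum>j\<le>i. k j)} \<in> sets M"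
        by measurable
      then show "{\<omega> \<in> space M. \<forall>i<n. c \<omega> (t (Suc i)) = (\<Sum>j\<le>i. k j)} \<in> sets M"
        by (simp add: Ball_def)
    qed
    also have "\<dots> = (\<Prod>i<n. ennreal (pois (t (Suc i) - t i) (k i)))"
      by (rule inc[where m = n and k = k, OF t0 tmono])
    also have "\<dots> = counts_prob J K"
      by (rule trans[OF if_P[OF True, symmetric] counts_prob[symmetric]])
    finally show ?thesis .
  next
    case False
    have "emeasure M {\<omega> \<in> space M. \<forall>s\<in>J. c \<omega> s = K s} = emeasure M {}"
    proof (rule emeasure_eq_AE[OF _ mJ])
      show "AE \<omega> in M. \<omega> \<in> {\<omega> \<in> space M. \<forall>s\<in>J. c \<omega> s = K s} \<longleftrightarrow> \<omega> \<in> {}"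
        using AEJ
      proof eventually_elim
        case (elim \<omega>)
        have "\<not> (\<forall>s\<in>J. c \<omega> s = K s)"
        proof
          assume *: "\<forall>s\<in>J. c \<omega> s = K s"
          then have "\<forall>s\<in>J. s \<le> 0 \<longrightarrow> K s = 0" using elim by auto
          moreover have "\<forall>s\<in>J. \<forall>s'\<in>J. 0 < s \<and> s \<le> s' \<longrightarrow> K s \<le> K s'" using elim * by auto
          ultimately show False using False by blast
        qed
        then show ?case by blast
      qed
    qed simp
    also have "\<dots> = counts_prob J K"
      by (rule trans[OF emeasure_empty trans[OF if_not_P[OF False, symmetric] counts_prob[symmetric]]])
    finally show ?thesis .
  qed
qed

lemma nb_mono: "good_seq x \<Longrightarrow> s \<le> t \<Longrightarrow> nb x s \<le> nb x t"
  by (metis less_nb_iff linorder_not_less order_trans order.irrefl)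

text \<open>Characterisation of the Poisson counting function by its increments: both laws have the
  finite dimensional probabilities \<open>counts_prob\<close>.\<close>

lemma distr_counts_eq:
  assumes "prob_space M" "c \<in> measurable M cnt_space"
    and "\<And>s t. s \<le> t \<Longrightarrow> AE \<omega> in M. c \<omega> s \<le> c \<omega> t"
    and "\<And>t. t \<le> 0 \<Longrightarrow> AE \<omega> in M. c \<omega> t = 0"
    and "\<And>t m k. t 0 = 0 \<Longrightarrow> mono t \<Longrightarrow>
      emeasure M {\<omega> \<in> space M. \<forall>i<m. c \<omega> (t (Suc i)) = (\<Sum>j\<le>i. k j)} =
      (\<Prod>i<m. ennreal (pois (t (Suc i) - t i) (k i)))"
  shows "distr M cnt_space c = count_law"
proof (rule cnt_measure_eqI)
  interpret prob_space M by fact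
  show "finite_measure (distr M cnt_space c)"
    using assms(2) by (rule finite_measure_distr)
  fix J :: "real set" and K :: "real \<Rightarrow> nat" assume J: "finite J"
  have m: "{c. \<forall>t\<in>J. c t = K t} \<in> sets cnt_space"
  proof -
    have "{c \<in> space cnt_space. \<forall>t\<in>J. c t = K t} \<in> sets cnt_space"
      using J by (intro sets.sets_Collect_finite_All) measurable
    then show ?thesis by simp
  qed
  have "emeasure (distr M cnt_space c) {c. \<forall>t\<in>J. c t = K t} = emeasure M {\<omega> \<in> space M. \<forall>s\<in>J. c \<omega> s = K s}"
    by (subst emeasure_distr[OF assms(2) m]) (auto intro!: arg_cong2[where f=emeasure])
  also have "\<dots> = emeasure gap_law {x \<in> space gap_law. \<forall>s\<in>J. nb x s = K s}"
  proof -
    have 1: "emeasure M {\<omega> \<in> space M. \<forall>s\<in>J. c \<omega> s = K s} = counts_prob J K"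
      by (rule emeasure_counts_eq[OF assms J])
    have 2: "AE x in gap_law. nb x s \<le> nb x t" if "s \<le> t" for s t
      by (rule eventually_mono[OF AE_good_seq]) (simp add: nb_mono that)
    have 3: "AE x in gap_law. nb x t = 0" if "t \<le> 0" for t
      by (rule eventually_mono[OF AE_good_seq]) (simp add: nb_nonpos that)
    have 4: "emeasure gap_law {x \<in> space gap_law. \<forall>s\<in>J. nb x s = K s} = counts_prob J K"
      by (rule emeasure_counts_eq[OF prob_space_gap_law measurable_nb_cnt 2 3 _ J])
        (use emeasure_nb_increments in simp_all)
    show ?thesis unfolding 1 4 ..
  qed
  also have "\<dots> = emeasure count_law {c. \<forall>t\<in>J. c t = K t}"
    unfolding count_law_def
    by (subst emeasure_distr[OF measurable_nb_cnt m]) (auto intro!: arg_cong2[where f=emeasure])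
  finally show "emeasure (distr M cnt_space c) {c. \<forall>t\<in>J. c t = K t} = emeasure count_law {c. \<forall>t\<in>J. c t = K t}" .
qed (simp_all add: count_law_def)

text \<open>The infimum runs over rational times so that it is measurable on
  \<open>cnt_space\<close>; by density it is still the arrival time (\<open>arrival_nb\<close>). If
  there is no such time, the infimum is infinite and \<open>real_of_ereal\<close> returns 0.\<close>

definition arrival :: "(real \<Rightarrow> nat) \<Rightarrow> nat \<Rightarrow> real" where
  "arrival c k = real_of_ereal (INF q::rat. if k < c (of_rat q) then ereal (of_rat q) else \<infinity>)"

definition gap_seq :: "(real \<Rightarrow> nat) \<Rightarrow> nat \<Rightarrow> real" where
  "gap_seq c k = arrival c k - (case k of 0 \<Rightarrow> 0 | Suc j \<Rightarrow> arrival c j)"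

lemma measurable_gap_seq: "gap_seq \<in> measurable cnt_space gap_law"
proof (rule measurable_gap_lawI)
  have [measurable (raw)]: "(\<lambda>c. c s) \<in> measurable cnt_space (count_space UNIV)" for s :: real
    by (rule measurable_component_singleton) simp
  have "(\<lambda>c. INF q::rat. if k < c (of_rat q) then ereal (of_rat q) else \<infinity>) \<in> borel_measurable cnt_space" for k
    by (rule borel_measurable_INF) measurable
  then have [measurable (raw)]: "(\<lambda>c. arrival c k) \<in> borel_measurable cnt_space" for k
    unfolding arrival_def by measurable
  show "(\<lambda>c. gap_seq c k) \<in> borel_measurable cnt_space" for k
    unfolding gap_seq_def by (cases k) simp_all
qed

lemma arrival_nb:
  assumes "good_seq x" shows "arrival (nb x) k = psum x k"
proof -
  have "(INF q::rat. if k < nb x (of_rat q) then ereal (of_rat q) else \<infinity>) = ereal (psum x k)"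
  proof (rule antisym)
    show "ereal (psum x k) \<le> (INF q::rat. if k < nb x (of_rat q) then ereal (of_rat q) else \<infinity>)"
      by (rule INF_greatest) (simp add: less_nb_iff[OF assms])
    show "(INF q::rat. if k < nb x (of_rat q) then ereal (of_rat q) else \<infinity>) \<le> ereal (psum x k)"
      unfolding INF_le_iff
    proof safe
      fix y assume "ereal (psum x k) < y"
      then obtain q where "ereal (psum x k) < ereal (of_rat q)" "ereal (of_rat q) < y"
        using ereal_dense3[of "ereal (psum x k)" y] by auto
      then show "\<exists>q\<in>UNIV. (if k < nb x (of_rat q) then ereal (of_rat q) else \<infinity>) < y"
        by (intro bexI[of _ q]) (auto simp: less_nb_iff[OF assms])
    qed
  qed
  then show ?thesis by (simp add: arrival_def)
qed

lemma gap_seq_nb: "good_seq x \<Longrightarrow> gap_seq (nb x) = x"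
  by (auto simp: gap_seq_def arrival_nb psum_Suc split: nat.split)

lemma distr_gap_seq:
  assumes c: "c \<in> measurable M cnt_space" and law: "distr M cnt_space c = count_law"
  shows "distr M gap_law (\<lambda>\<omega>. gap_seq (c \<omega>)) = gap_law"
proof -
  have "distr M gap_law (\<lambda>\<omega>. gap_seq (c \<omega>)) = distr (distr M cnt_space c) gap_law gap_seq"
    using c measurable_gap_seq by (subst distr_distr) (auto simp: comp_def)
  also have "\<dots> = distr gap_law gap_law (\<lambda>x. gap_seq (nb x))"
    unfolding law count_law_def using measurable_nb_cnt measurable_gap_seq
    by (subst distr_distr) (auto simp: comp_def)
  also have "\<dots> = distr gap_law gap_law (\<lambda>x. x)"
    using measurable_compose[OF measurable_nb_cnt measurable_gap_seq]
    by (intro distr_cong_AE) (auto intro: eventually_mono[OF AE_good_seq] simp: gap_seq_nb)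
  finally show ?thesis by (simp add: distr_id)
qed

text \<open>Agreement at rational times is a countable intersection, hence an event of
  \<open>cnt_space\<close> that can be transported from \<open>gap_law\<close>. For locally finite
  sets this is enough, by \<open>locally_finite_eqI\<close>.\<close>

lemma AE_gap_seq:
  assumes c: "c \<in> measurable M cnt_space" and law: "distr M cnt_space c = count_law"
  shows "AE \<omega> in M. good_seq (gap_seq (c \<omega>)) \<and> (\<forall>q::rat. c \<omega> (of_rat q) = nb (gap_seq (c \<omega>)) (of_rat q))"
proof -
  note [measurable] = measurable_gap_seq
  have [measurable (raw)]: "(\<lambda>c. c s) \<in> measurable cnt_space (count_space UNIV)" for s :: real
    by (rule measurable_component_singleton) simp
  have "AE c in count_law. good_seq (gap_seq c) \<and> (\<forall>q::rat. c (of_rat q) = nb (gap_seq c) (of_rat q))"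
    unfolding count_law_def
  proof (subst AE_distr_iff[OF measurable_nb_cnt])
    show "{c \<in> space cnt_space. good_seq (gap_seq c) \<and> (\<forall>q::rat. c (of_rat q) = nb (gap_seq c) (of_rat q))} \<in> sets cnt_space"
      by measurable
    show "AE x in gap_law. good_seq (gap_seq (nb x)) \<and> (\<forall>q::rat. nb x (of_rat q) = nb (gap_seq (nb x)) (of_rat q))"
      by (rule eventually_mono[OF AE_good_seq]) (simp add: gap_seq_nb)
  qed
  then show ?thesis unfolding law[symmetric] by (rule AE_distrD[OF c])
qed

text \<open>Conditioning on all coordinates but one: replacing coordinate \<open>i\<close> by an
  independent copy preserves the law.\<close>

lemma nn_integral_PiM_resample:
  fixes i :: 'i
  assumes E: "prob_space E" and f: "f \<in> borel_measurable (PiM UNIV (\<lambda>_. E))"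
  shows "(\<integral>\<^sup>+\<omega>. f \<omega> \<partial>PiM UNIV (\<lambda>_::'i. E)) = (\<integral>\<^sup>+\<omega>. (\<integral>\<^sup>+z. f (fun_upd \<omega> i z) \<partial>E) \<partial>PiM UNIV (\<lambda>_. E))"
proof -
  interpret E: prob_space E by fact
  let ?P = "PiM UNIV (\<lambda>_::'i. E)"
  interpret P: prob_space ?P by (intro prob_space_PiM E)
  interpret pair_sigma_finite E ?P ..
  have m: "(\<lambda>(z, \<omega>). fun_upd \<omega> i z) \<in> measurable (E \<Otimes>\<^sub>M ?P) ?P"
    unfolding split_beta' by (rule measurable_fun_upd[where J=UNIV]) simp_all
  have "?P = distr (E \<Otimes>\<^sub>M ?P) ?P (\<lambda>(z, \<omega>). fun_upd \<omega> i z)"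
    using distr_pair_PiM_eq_PiM[of UNIV "\<lambda>_::'i. E" i] E by simp
  then have "(\<integral>\<^sup>+\<omega>. f \<omega> \<partial>?P) = (\<integral>\<^sup>+\<omega>. f \<omega> \<partial>distr (E \<Otimes>\<^sub>M ?P) ?P (\<lambda>(z, \<omega>). fun_upd \<omega> i z))"
    by simp
  also have "\<dots> = (\<integral>\<^sup>+x. f (case x of (z, \<omega>) \<Rightarrow> fun_upd \<omega> i z) \<partial>(E \<Otimes>\<^sub>M ?P))"
    by (rule nn_integral_distr[OF m]) (use f in simp)
  also have "\<dots> = (\<integral>\<^sup>+\<omega>. (\<integral>\<^sup>+z. f (case (z, \<omega>) of (z, \<omega>) \<Rightarrow> fun_upd \<omega> i z) \<partial>E) \<partial>?P)"
    by (rule nn_integral_snd[symmetric]) (rule measurable_compose[OF m f])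
  finally show ?thesis by simp
qed

text \<open>If the \<open>i\<close>-th coordinate of the image is obtained from the \<open>i\<close>-th coordinate of the argument
  by a law preserving map that may depend on coordinates of smaller rank, then the image is again
  independent and identically distributed.\<close>

proposition distr_triangular:
  fixes r :: "'i \<Rightarrow> nat" and H :: "'i \<Rightarrow> ('i \<Rightarrow> 'a) \<Rightarrow> 'b"
  assumes E: "prob_space E" and E': "prob_space E'" and r: "inj r"
    and meas: "\<And>i. H i \<in> measurable (PiM UNIV (\<lambda>_. E)) E'"
    and dep: "\<And>i \<omega> \<omega>'. (\<And>j. r j \<le> r i \<Longrightarrow> \<omega> j = \<omega>' j) \<Longrightarrow> H i \<omega> = H i \<omega>'"
    and law: "\<And>i \<omega>. \<omega> \<in> space (PiM UNIV (\<lambda>_. E)) \<Longrightarrow> distr E E' (\<lambda>z. H i (fun_upd \<omega> i z)) = E'"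
  shows "distr (PiM UNIV (\<lambda>_. E)) (PiM UNIV (\<lambda>_. E')) (\<lambda>\<omega> i. H i \<omega>) = PiM UNIV (\<lambda>_. E')"
proof (rule PiM_UNIV_eqI[OF E'])
  interpret E: prob_space E by fact
  interpret E': prob_space E' by fact
  let ?P = "PiM UNIV (\<lambda>_::'i. E)" and ?P' = "PiM UNIV (\<lambda>_::'i. E')"
  interpret P: prob_space ?P by (intro prob_space_PiM E)
  have mH: "(\<lambda>\<omega> i. H i \<omega>) \<in> measurable ?P ?P'"
  proof (rule measurable_PiM_single')
    show "(\<lambda>\<omega> i. H i \<omega>) \<in> space ?P \<rightarrow> (\<Pi>\<^sub>E i\<in>UNIV. space E')"
      using measurable_space[OF meas] by (auto simp: PiE_UNIV_domain)
  qed (rule meas)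
  have main: "(\<integral>\<^sup>+\<omega>. (\<Prod>j\<in>J. indicator (A j) (H j \<omega>)) \<partial>?P) = (\<Prod>j\<in>J. emeasure E' (A j))"
    if "finite J" "\<And>j. j \<in> J \<Longrightarrow> A j \<in> sets E'" for J :: "'i set" and A
    using that
  proof (induction "card J" arbitrary: J)
    case 0
    then show ?case by (simp add: P.emeasure_space_1)
  next
    case (Suc n)
    then have "J \<noteq> {}" by auto
    \<comment> \<open>The coordinate of largest rank is integrated out first: by \<open>dep\<close>
      the other factors do not see it, and by \<open>law\<close> its factor integrates to
      \<open>emeasure E' (A i)\<close> whatever the others are.\<close>
    then have "Max (r ` J) \<in> r ` J" using Suc.prems(1) by (intro Max_in) auto
    then obtain i where i: "i \<in> J" "r i = Max (r ` J)" by (metis imageE)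
    define J' where "J' = J - {i}"
    have J: "J = insert i J'" "i \<notin> J'" "finite J'" "n = card J'"
      using i Suc by (auto simp: J'_def)
    have less: "r j < r i" if "j \<in> J'" for j
    proof -
      have "r j \<le> r i" using that i Suc.prems(1) by (auto simp: J'_def)
      moreover have "r j \<noteq> r i" using that injD[OF r, of j i] by (auto simp: J'_def)
      ultimately show ?thesis by simp
    qed
    have Ai: "A i \<in> sets E'" using Suc.prems(2) i by simp
    have mI: "(\<lambda>\<omega>. indicator (A j) (H j \<omega>) :: ennreal) \<in> borel_measurable ?P" if "j \<in> J" for j
      using Suc.prems(2)[OF that] by (intro measurable_compose[OF meas]) simp
    have "(\<integral>\<^sup>+\<omega>. (\<Prod>j\<in>J. indicator (A j) (H j \<omega>)) \<partial>?P) =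
        (\<integral>\<^sup>+\<omega>. (\<integral>\<^sup>+z. (\<Prod>j\<in>J. indicator (A j) (H j (fun_upd \<omega> i z))) \<partial>E) \<partial>?P)"
      by (rule nn_integral_PiM_resample[OF E]) (rule borel_measurable_prod_ennreal, rule mI)
    also have "\<dots> = (\<integral>\<^sup>+\<omega>. (\<Prod>j\<in>J'. indicator (A j) (H j \<omega>)) * emeasure E' (A i) \<partial>?P)"
    proof (rule nn_integral_cong)
      fix \<omega> assume \<omega>: "\<omega> \<in> space ?P"
      have up: "H j (fun_upd \<omega> i z) = H j \<omega>" if "j \<in> J'" for j z
      proof (rule dep)
        fix k assume "r k \<le> r j"
        then show "fun_upd \<omega> i z k = \<omega> k" using less[OF that] by auto
      qed
      have mu: "(\<lambda>z. fun_upd \<omega> i z) \<in> measurable E ?P"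
        by (rule measurable_fun_upd[where J=UNIV]) (use \<omega> in simp_all)
      have mz: "(\<lambda>z. H i (fun_upd \<omega> i z)) \<in> measurable E E'"
        by (rule measurable_compose[OF mu meas])
      have "(\<integral>\<^sup>+z. (\<Prod>j\<in>J. indicator (A j) (H j (fun_upd \<omega> i z))) \<partial>E) =
        (\<integral>\<^sup>+z. (\<Prod>j\<in>J'. indicator (A j) (H j \<omega>)) * indicator (A i) (H i (fun_upd \<omega> i z)) \<partial>E)"
        unfolding J(1) using J(2,3) by (simp add: up mult.commute)
      also have "\<dots> = (\<Prod>j\<in>J'. indicator (A j) (H j \<omega>)) * (\<integral>\<^sup>+z. indicator (A i) (H i (fun_upd \<omega> i z)) \<partial>E)"
        by (rule nn_integral_cmult) (rule measurable_compose[OF mz], use Ai in simp)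
      also have "(\<integral>\<^sup>+z. indicator (A i) (H i (fun_upd \<omega> i z)) \<partial>E) = (\<integral>\<^sup>+y. indicator (A i) y \<partial>distr E E' (\<lambda>z. H i (fun_upd \<omega> i z)))"
        by (rule nn_integral_distr[symmetric, OF mz]) (use Ai in simp)
      also have "\<dots> = emeasure E' (A i)"
        unfolding law[OF \<omega>] using Ai by simp
      finally show "(\<integral>\<^sup>+z. (\<Prod>j\<in>J. indicator (A j) (H j (fun_upd \<omega> i z))) \<partial>E) =
        (\<Prod>j\<in>J'. indicator (A j) (H j \<omega>)) * emeasure E' (A i)" .
    qed
    also have "\<dots> = (\<integral>\<^sup>+\<omega>. (\<Prod>j\<in>J'. indicator (A j) (H j \<omega>)) \<partial>?P) * emeasure E' (A i)"
      by (rule nn_integral_multc) (rule borel_measurable_prod_ennreal, rule mI, simp add: J'_def)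
    also have "(\<integral>\<^sup>+\<omega>. (\<Prod>j\<in>J'. indicator (A j) (H j \<omega>)) \<partial>?P) = (\<Prod>j\<in>J'. emeasure E' (A j))"
      by (rule Suc.hyps(1)[OF J(4) J(3)]) (use Suc.prems(2) in \<open>simp add: J'_def\<close>)
    finally show ?case unfolding J(1) using J(2,3) by (simp add: mult.commute)
  qed
  fix J :: "'i set" and A assume J: "finite J" and A: "\<And>i. i \<in> J \<Longrightarrow> A i \<in> sets E'"
  let ?D = "distr ?P ?P' (\<lambda>\<omega> i. H i \<omega>)"
  have ind: "(\<Prod>j\<in>J. indicator (A j) (x j)) = (indicator {x. \<forall>i\<in>J. x i \<in> A i} x :: ennreal)" for x
    using J by induction (auto split: split_indicator)
  have "{\<omega> \<in> space ?D. \<forall>i\<in>J. \<omega> i \<in> A i} \<in> sets ?P'"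
    using J A by (auto intro!: sets.sets_Collect_finite_All sets_Collect_single')
  then have "emeasure ?D {\<omega> \<in> space ?D. \<forall>i\<in>J. \<omega> i \<in> A i} =
      (\<integral>\<^sup>+x. indicator {\<omega> \<in> space ?D. \<forall>i\<in>J. \<omega> i \<in> A i} x \<partial>?D)"
    by simp
  also have "\<dots> = (\<integral>\<^sup>+x. (\<Prod>j\<in>J. indicator (A j) (x j)) \<partial>?D)"
    by (rule nn_integral_cong) (simp only: ind, simp add: indicator_def)
  also have "\<dots> = (\<integral>\<^sup>+\<omega>. (\<Prod>j\<in>J. indicator (A j) (H j \<omega>)) \<partial>?P)"
  proof (rule nn_integral_distr[OF mH])
    have "(\<lambda>x. \<Prod>j\<in>J. indicator (A j) (x j) :: ennreal) \<in> borel_measurable ?P'"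
    proof (rule borel_measurable_prod_ennreal)
      fix j assume "j \<in> J"
      then show "(\<lambda>x. indicator (A j) (x j) :: ennreal) \<in> borel_measurable ?P'"
        using A by (intro measurable_compose[OF measurable_component_singleton]) simp_all
    qed
    then show "(\<lambda>x. \<Prod>j\<in>J. indicator (A j) (x j) :: ennreal) \<in> borel_measurable ?D" by simp
  qed
  also have "\<dots> = (\<Prod>i\<in>J. emeasure E' (A i))" by (rule main[OF J A])
  finally show "emeasure ?D {\<omega> \<in> space ?D. \<forall>i\<in>J. \<omega> i \<in> A i} = (\<Prod>i\<in>J. emeasure E' (A i))" .
qed simp

text \<open>By local finiteness there are rationals p < x < q such that (p, q] contains no point of
  either set other than \<open>x\<close>. Membership of \<open>x\<close> is then the difference of
  the counts at \<open>q\<close> and \<open>p\<close>.\<close>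

lemma locally_finite_eqI:
  fixes A B :: "real set"
  assumes fin: "\<And>t. finite (A \<inter> {..t})" "\<And>t. finite (B \<inter> {..t})"
    and card: "\<And>q::rat. card (A \<inter> {..of_rat q}) = card (B \<inter> {..of_rat q})"
  shows "A = B"
proof (rule set_eqI)
  fix x
  define F where "F = ((A \<union> B) \<inter> {..x + 1}) - {x}"
  have "finite F" using fin[of "x + 1"] by (simp add: F_def Int_Un_distrib2)
  then obtain e where e: "0 < e" "\<And>y. y \<in> F \<Longrightarrow> e \<le> dist x y"
    using finite_set_avoid[of F x] by (auto simp: F_def)
  obtain p where p: "x - min e 1 < of_rat p" "of_rat p < x" using of_rat_dense[of "x - min e 1" x] e by auto
  obtain q where q: "x < of_rat q" "of_rat q < x + min e 1" using of_rat_dense[of x "x + min e 1"] e by auto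
  have near: "y = x" if "y \<in> A \<union> B" "of_rat p < y" "y \<le> of_rat q" for y
  proof (rule ccontr)
    assume "y \<noteq> x"
    then have "y \<in> F" using that q by (auto simp: F_def)
    then have "e \<le> dist x y" by (rule e)
    then show False using that p q by (auto simp: dist_real_def)
  qed
  have "card (C \<inter> {..of_rat q}) = card (C \<inter> {..of_rat p}) + (if x \<in> C then 1 else 0)"
    if "C = A \<or> C = B" for C
  proof -
    have "C \<inter> {..of_rat q} = (C \<inter> {..of_rat p}) \<union> (C \<inter> {x})"
    proof -
      have "y \<le> of_rat p" if "y \<in> A \<union> B" "y \<le> of_rat q" "y \<noteq> x" for y using near[of y] that by fastforce
      then show ?thesis using p q that by auto
    qed
    moreover have "(C \<inter> {..of_rat p}) \<inter> (C \<inter> {x}) = {}" using p by auto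
    moreover have "finite (C \<inter> {..of_rat p})" using that fin by auto
    ultimately show ?thesis by (simp add: card_Un_disjoint)
  qed
  from this[of A] this[of B] card[of q] card[of p] show "x \<in> A \<longleftrightarrow> x \<in> B"
    by (auto split: if_splits)
qed

lemma card_range_psum:
  assumes "good_seq x"
  shows "finite (range (psum x) \<inter> {..t})" "card (range (psum x) \<inter> {..t}) = nb x t"
proof -
  have *: "range (psum x) \<inter> {..t} = psum x ` {..<nb x t}"
    by (auto simp: less_nb_iff[OF assms])
  have "inj (psum x)" by (rule strict_mono_imp_inj_on[OF good_seq_strict_mono[OF assms]])
  then have "inj_on (psum x) {..<nb x t}" by (rule inj_on_subset) simp
  then show "finite (range (psum x) \<inter> {..t})" "card (range (psum x) \<inter> {..t}) = nb x t"
    unfolding * by (simp_all add: card_image)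
qed

lemma eq_range_psum:
  assumes "good_seq x" "\<And>t. finite (C \<inter> {..t})" "\<And>q::rat. card (C \<inter> {..of_rat q}) = nb x (of_rat q)"
  shows "C = range (psum x)"
  using assms card_range_psum[OF assms(1)] by (intro locally_finite_eqI) auto

section \<open>Poisson processes given by their counts in Borel sets\<close>

lemma space_config_space:
  "space (config_space S) = {X. X \<subseteq> S \<and> (\<forall>B. bounded B \<longrightarrow> finite (X \<inter> B))}"
  unfolding config_space_def Let_def by (rule space_measure_of_conv)

lemma measurable_card_config_space:
  assumes "B \<in> sets borel" "bounded B"
  shows "(\<lambda>X. card (X \<inter> B)) \<in> measurable (config_space S) (count_space UNIV)"
proof (rule measurable_count_space_eq2_countable[THEN iffD2])
  let ?\<Omega> = "{X. X \<subseteq> S \<and> (\<forall>B. bounded B \<longrightarrow> finite (X \<inter> B))}"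
  have "{X \<in> ?\<Omega>. card (X \<inter> B) = n} \<in> sets (config_space S)" for n
    unfolding config_space_def Let_def using assms
    by (intro in_measure_of) auto
  moreover have "(\<lambda>X. card (X \<inter> B)) -` {n} \<inter> space (config_space S) = {X \<in> ?\<Omega>. card (X \<inter> B) = n}" for n
    by (auto simp: space_config_space)
  ultimately show "(\<lambda>X. card (X \<inter> B)) \<in> space (config_space S) \<rightarrow> UNIV \<and>
      (\<forall>n\<in>UNIV. (\<lambda>X. card (X \<inter> B)) -` {n} \<inter> space (config_space S) \<in> sets (config_space S))"
    by simp
qed

lemma halfline_config:
  assumes "X \<in> space (config_space {0::real..})"
  shows "X \<inter> {..t} = X \<inter> {0..t}" "finite (X \<inter> {..t})"
proof -
  show *: "X \<inter> {..t} = X \<inter> {0..t}" using assms by (auto simp: space_config_space)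
  show "finite (X \<inter> {..t})" unfolding * using assms by (auto simp: space_config_space)
qed

lemma measurable_halfline_counts:
  assumes "C \<in> measurable M (config_space {0::real..})"
  shows "(\<lambda>\<omega> t. card (C \<omega> \<inter> {..t})) \<in> measurable M cnt_space"
proof (rule measurable_cnt_spaceI)
  fix t :: real
  have "(\<lambda>\<omega>. card (C \<omega> \<inter> {0..t})) \<in> measurable M (count_space UNIV)"
    by (rule measurable_compose[OF assms measurable_card_config_space]) auto
  then show "(\<lambda>\<omega>. card (C \<omega> \<inter> {..t})) \<in> measurable M (count_space UNIV)"
    using halfline_config(1)[OF measurable_space[OF assms]] by (subst measurable_cong) auto
qed

lemma sum_atMost_eq_iff:
  fixes f k :: "nat \<Rightarrow> nat"
  shows "(\<forall>i<m. (\<Sum>j\<le>i. f j) = (\<Sum>j\<le>i. k j)) \<longleftrightarrow> (\<forall>i<m. f i = k i)"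
proof (induction m)
  case (Suc m)
  show ?case
  proof (cases "\<forall>i<m. f i = k i")
    case True
    have "(\<Sum>j\<le>m. f j) = (\<Sum>j\<le>m. k j) \<longleftrightarrow> f m = k m"
    proof (cases m)
      case (Suc n)
      then have "(\<Sum>j\<le>n. f j) = (\<Sum>j\<le>n. k j)" using True by (intro sum.cong) auto
      then show ?thesis by (simp add: Suc)
    qed simp
    then show ?thesis using Suc.IH True by (auto simp: less_Suc_eq)
  qed (use Suc.IH in \<open>auto simp: less_Suc_eq\<close>)
qed simp

text \<open>Disjoint cells between successive times turn independence over Borel sets into
  independent Poisson increments, which \<open>distr_counts_eq\<close> recognises.\<close>

lemma distr_poisson_process:
  assumes "poisson_process M {0..} 1 C"
  shows "distr M cnt_space (\<lambda>\<omega> t. card (C \<omega> \<inter> {..t})) = count_law"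
proof -
  from assms have M: "prob_space M" and C: "C \<in> measurable M (config_space {0..})"
    and pois: "\<And>A n. A \<in> sets borel \<Longrightarrow> bounded A \<Longrightarrow> A \<subseteq> {0..} \<Longrightarrow>
      measure M {\<omega> \<in> space M. card (C \<omega> \<inter> A) = n} = pois (measure lborel A) n"
    and ind: "\<And>(A :: nat \<Rightarrow> real set) m. (\<forall>i<m. A i \<in> sets borel \<and> bounded (A i) \<and> A i \<subseteq> {0..}) \<Longrightarrow>
      disjoint_family_on A {..<m} \<Longrightarrow>
      prob_space.indep_vars M (\<lambda>_. count_space UNIV) (\<lambda>i \<omega>. card (C \<omega> \<inter> A i)) {..<m}"
    by (auto simp: poisson_process_def pois_def)
  interpret prob_space M by (rule M)
  have Csp: "C \<omega> \<in> space (config_space {0..})" if "\<omega> \<in> space M" for \<omega>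
    using measurable_space[OF C that] .
  note meas = measurable_halfline_counts[OF C]
  have zero: "AE \<omega> in M. card (C \<omega> \<inter> {..t}) = 0" if "t \<le> 0" for t
  proof -
    \<comment> \<open>The point 0 has Lebesgue measure 0, so almost surely it is not occupied;
      points below 0 are excluded by the configuration space.\<close>
    have "measure M {\<omega> \<in> space M. card (C \<omega> \<inter> {0..0}) = 0} = 1"
      using pois[of "{0..0}" 0] by (simp add: pois_def)
    moreover have "{\<omega> \<in> space M. card (C \<omega> \<inter> {0..0}) = 0} \<in> sets M"
      using measurable_sets[OF measurable_compose[OF C measurable_card_config_space[of "{0..0}"]], of "{0}"]
      by (simp add: vimage_def Int_def conj_commute del: atLeastAtMost_singleton)
    ultimately have "AE \<omega> in M. \<omega> \<in> {\<omega> \<in> space M. card (C \<omega> \<inter> {0..0}) = 0}"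
      using AE_in_set_eq_1 by blast
    then show ?thesis
    proof eventually_elim
      case (elim \<omega>)
      have "card (C \<omega> \<inter> {..t}) \<le> card (C \<omega> \<inter> {..0})"
        using that halfline_config(2)[OF Csp, of \<omega> 0] elim by (intro card_mono) auto
      then show ?case using elim halfline_config(1)[OF Csp, of \<omega> 0] by simp
    qed
  qed
  show ?thesis
  proof (rule distr_counts_eq[OF M meas _ zero])
    show "AE \<omega> in M. card (C \<omega> \<inter> {..s}) \<le> card (C \<omega> \<inter> {..t})" if "s \<le> t" for s t
      using that halfline_config(2)[OF Csp] by (intro AE_I2 card_mono) auto
    fix t :: "nat \<Rightarrow> real" and m and k :: "nat \<Rightarrow> nat"
    assume t: "t 0 = 0" "mono t"
    \<comment> \<open>Half-open cells partition the time axis; only the first one is closed on the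
      left, so that a point at 0 is counted as well.\<close>
    define A where "A i = (if i = 0 then {0..t 1} else {t i<..t (Suc i)})" for i
    have t_nonneg: "0 \<le> t i" for i using t monoD[of t 0 i] by simp
    have tS: "t i \<le> t (Suc i)" for i by (rule monoD[OF t(2)]) simp
    have A: "A i \<in> sets borel" "bounded (A i)" "A i \<subseteq> {0..}" for i
    proof -
      show "A i \<in> sets borel" by (cases "i = 0") (simp_all add: A_def)
      have sub: "A i \<subseteq> {0..t (Suc i)}" using t_nonneg[of i] by (cases "i = 0") (auto simp: A_def)
      then show "bounded (A i)" using bounded_subset bounded_closed_interval by blast
      show "A i \<subseteq> {0..}" using sub by auto
    qed
    have disj: "disjoint_family_on A {..<m}"
      unfolding disjoint_family_on_def
    proof (intro ballI impI)
      have *: "A i \<inter> A j = {}" if "i < j" for i j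
      proof -
        have "t (Suc i) \<le> t j" by (rule monoD[OF t(2)]) (use that in simp)
        then show ?thesis using that by (auto simp: A_def)
      qed
      fix i j :: nat assume "i \<noteq> j"
      then consider "i < j" | "j < i" by linarith
      then show "A i \<inter> A j = {}" using *[of i j] *[of j i] by cases auto
    qed
    have lb: "measure lborel (A i) = t (Suc i) - t i" for i
      using tS[of i] t_nonneg[of 1] by (auto simp: A_def t)
    have cardsum: "card (C \<omega> \<inter> {..t (Suc i)}) = (\<Sum>j\<le>i. card (C \<omega> \<inter> A j))" if "\<omega> \<in> space M" for \<omega> i
    proof (induction i)
      case 0
      show ?case using halfline_config(1)[OF Csp[OF that], of "t 1"] by (simp add: A_def)
    next
      case (Suc i)
      have "C \<omega> \<inter> {..t (Suc (Suc i))} = (C \<omega> \<inter> {..t (Suc i)}) \<union> (C \<omega> \<inter> A (Suc i))"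
        using tS[of "Suc i"] by (auto simp: A_def)
      moreover have "(C \<omega> \<inter> {..t (Suc i)}) \<inter> (C \<omega> \<inter> A (Suc i)) = {}" by (auto simp: A_def)
      moreover have "finite (C \<omega> \<inter> A (Suc i))"
        by (rule finite_subset[OF _ halfline_config(2)[OF Csp[OF that], of "t (Suc (Suc i))"]]) (auto simp: A_def)
      ultimately show ?case using Suc halfline_config(2)[OF Csp[OF that], of "t (Suc i)"]
        by (simp add: card_Un_disjoint)
    qed
    have "{\<omega> \<in> space M. \<forall>i<m. card (C \<omega> \<inter> {..t (Suc i)}) = (\<Sum>j\<le>i. k j)} =
        {\<omega> \<in> space M. \<forall>i<m. card (C \<omega> \<inter> A i) = k i}"
      using cardsum by (auto simp: sum_atMost_eq_iff)
    also have "emeasure M \<dots> = (\<Prod>i<m. ennreal (pois (t (Suc i) - t i) (k i)))"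
    proof (cases "m = 0")
      case True
      then show ?thesis by (simp add: emeasure_space_1)
    next
      case False
      have "prob (\<Inter>i\<in>{..<m}. (\<lambda>\<omega>. card (C \<omega> \<inter> A i)) -` {k i} \<inter> space M) =
        (\<Prod>i\<in>{..<m}. prob ((\<lambda>\<omega>. card (C \<omega> \<inter> A i)) -` {k i} \<inter> space M))"
        using False A by (intro indep_varsD_finite[OF ind[OF _ disj]]) auto
      also have "(\<Inter>i\<in>{..<m}. (\<lambda>\<omega>. card (C \<omega> \<inter> A i)) -` {k i} \<inter> space M) =
          {\<omega> \<in> space M. \<forall>i<m. card (C \<omega> \<inter> A i) = k i}"
        using False by auto
      also have "(\<Prod>i\<in>{..<m}. prob ((\<lambda>\<omega>. card (C \<omega> \<inter> A i)) -` {k i} \<inter> space M)) = (\<Prod>i<m. pois (t (Suc i) - t i) (k i))"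
      proof (rule prod.cong[OF refl])
        fix i
        have "(\<lambda>\<omega>. card (C \<omega> \<inter> A i)) -` {k i} \<inter> space M = {\<omega> \<in> space M. card (C \<omega> \<inter> A i) = k i}"
          by auto
        then show "prob ((\<lambda>\<omega>. card (C \<omega> \<inter> A i)) -` {k i} \<inter> space M) = pois (t (Suc i) - t i) (k i)"
          by (simp add: pois A lb)
      qed
      finally have "prob {\<omega> \<in> space M. \<forall>i<m. card (C \<omega> \<inter> A i) = k i} = (\<Prod>i<m. pois (t (Suc i) - t i) (k i))" .
      then show ?thesis
        using tS by (simp add: emeasure_eq_measure prod_ennreal pois_def)
    qed
    finally show "emeasure M {\<omega> \<in> space M. \<forall>i<m. card (C \<omega> \<inter> {..t (Suc i)}) = (\<Sum>j\<le>i. k j)} =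
      (\<Prod>i<m. ennreal (pois (t (Suc i) - t i) (k i)))" .
  qed
qed

section \<open>Systems of lines\<close>

text \<open>Common abstraction of \<open>bullet_graph\<close> and of the label tree below, so that
  fixed point and measurability are treated once. \<open>step\<close> and \<open>arr\<close> copy
  \<open>evolve\<close> and \<open>arrives\<close>; a parent \<open>None\<close> marks lines that
  are born unconditionally.\<close>

locale line_system =
  fixes vt :: "'l::countable \<Rightarrow> bool" and par :: "'l \<Rightarrow> 'l option"
    and trk org w :: "'l \<Rightarrow> ereal" and stp :: "'l \<Rightarrow> 'l \<Rightarrow> bool"
begin

definition step :: "('l \<Rightarrow> ereal \<Rightarrow> bool) \<Rightarrow> 'l \<Rightarrow> ereal \<Rightarrow> bool" where
  "step A l t \<longleftrightarrow>
     (case par l of None \<Rightarrow> True | Some p \<Rightarrow> A p (trk l)) \<and> trk l < \<infinity> \<and> org l \<le> t \<and> t \<le> org l + w l \<and>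
     (\<forall>l'. (vt l \<noteq> vt l' \<and> org l < trk l' \<and> org l' < trk l) \<and> trk l' < t \<and> stp l l' \<longrightarrow> \<not> A l' (trk l))"

definition arr :: "'l \<Rightarrow> ereal \<Rightarrow> bool" where
  "arr l t \<longleftrightarrow> (\<forall>\<^sub>F n in sequentially. (step ^^ n) (\<lambda>_ _. False) l t)"

definition tp :: "'l \<Rightarrow> ereal" where
  "tp l = Sup {t. arr l t}"

definition sg :: "'l \<Rightarrow> segment" where
  "sg l = (if vt l then ((trk l, org l), (trk l, tp l)) else ((org l, trk l), (tp l, trk l)))"

text \<open>Agreement is demanded only where \<open>step\<close> consults its argument, at the
  parent and at crossing lines. The additional premises are those under which the rank below
  decreases.\<close>

lemma step_cong:
  assumes "\<And>p. par l = Some p \<Longrightarrow> trk l < \<infinity> \<Longrightarrow> org l \<le> t \<Longrightarrow> A p (trk l) = A' p (trk l)"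
    and "\<And>l'. vt l \<noteq> vt l' \<Longrightarrow> org l < trk l' \<Longrightarrow> org l' < trk l \<Longrightarrow> trk l' < t \<Longrightarrow> trk l < \<infinity> \<Longrightarrow> org l \<le> t \<Longrightarrow>
      A l' (trk l) = A' l' (trk l)"
  shows "step A l t = step A' l t"
proof (cases "trk l < \<infinity> \<and> org l \<le> t")
  case True
  have 1: "(case par l of None \<Rightarrow> True | Some p \<Rightarrow> A p (trk l)) = (case par l of None \<Rightarrow> True | Some p \<Rightarrow> A' p (trk l))"
    using assms(1) True by (cases "par l") simp_all
  have 2: "(\<forall>l'. (vt l \<noteq> vt l' \<and> org l < trk l' \<and> org l' < trk l) \<and> trk l' < t \<and> stp l l' \<longrightarrow> \<not> A l' (trk l)) =
    (\<forall>l'. (vt l \<noteq> vt l' \<and> org l < trk l' \<and> org l' < trk l) \<and> trk l' < t \<and> stp l l' \<longrightarrow> \<not> A' l' (trk l))"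
    using assms(2) True by blast
  show ?thesis unfolding step_def 1 2 ..
qed (auto simp: step_def)

lemma step_downward: "step A l t \<Longrightarrow> org l \<le> s \<Longrightarrow> s \<le> t \<Longrightarrow> step A l s"
  unfolding step_def by (meson order_trans less_le_trans)

lemma arr_Suc: "arr l t \<longleftrightarrow> (\<forall>\<^sub>F n in sequentially. step ((step ^^ n) (\<lambda>_ _. False)) l t)"
  unfolding arr_def using eventually_sequentially_Suc[of "\<lambda>n. (step ^^ n) (\<lambda>_ _. False) l t"] by simp

lemma arr_downward: "arr l t \<Longrightarrow> org l \<le> s \<Longrightarrow> s \<le> t \<Longrightarrow> arr l s"
  unfolding arr_Suc by (elim eventually_mono) (rule step_downward)

lemma arrD: assumes "arr l t" shows "org l \<le> t" "trk l < \<infinity>"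
proof -
  have "\<exists>n. step ((step ^^ n) (\<lambda>_ _. False)) l t"
    using assms unfolding arr_Suc by (rule eventually_happens'[OF sequentially_bot])
  then show "org l \<le> t" "trk l < \<infinity>" by (auto simp: step_def)
qed

lemma arr_ex_iff: "(\<exists>t. arr l t) \<longleftrightarrow> arr l (org l)"
  using arr_downward arrD(1) by blast

end

locale regular_lines = line_system vt par trk org w stp
  for vt :: "'l::countable \<Rightarrow> bool" and par trk org w stp +
  fixes depth :: "'l \<Rightarrow> nat"
  assumes fin: "\<And>R::real. finite {l. trk l < R \<and> org l < R}"
    and par: "\<And>l p. par l = Some p \<Longrightarrow> depth p < depth l \<and> org l = trk p"
    and nonneg: "\<And>l. 0 \<le> trk l" "\<And>l. 0 \<le> org l"
begin

definition near :: "real \<Rightarrow> 'l set" where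
  "near R = {l. trk l < R \<and> org l < R}"

definition rank :: "real \<Rightarrow> 'l \<Rightarrow> ereal \<Rightarrow> nat" where
  "rank R l t = card {x \<in> near R \<times> near R. trk (fst x) + trk (snd x) < t + trk l} * Suc (Max (depth ` near R)) + depth l"

lemma finite_near: "finite (near R)" unfolding near_def by (rule fin)

lemma rank_par:
  assumes "par l = Some p" "org l \<le> t"
  shows "rank R p (trk l) < rank R l t"
proof -
  have "trk l + trk p \<le> t + trk l"
    using par[OF assms(1)] assms(2) add_left_mono[of "trk p" t "trk l"] by (simp add: add.commute)
  then have "card {x \<in> near R \<times> near R. trk (fst x) + trk (snd x) < trk l + trk p} \<le>
    card {x \<in> near R \<times> near R. trk (fst x) + trk (snd x) < t + trk l}"
    using finite_near by (intro card_mono) auto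
  then show ?thesis using par[OF assms(1)] unfolding rank_def
    by (intro add_le_less_mono mult_right_mono) auto
qed

lemma rank_crosses:
  assumes "org l \<le> t" "t < ereal R" "trk l < ereal R" "trk l' < t" "org l' < trk l"
  shows "rank R l' (trk l) < rank R l t"
proof -
  let ?S = "\<lambda>s. {x \<in> near R \<times> near R. trk (fst x) + trk (snd x) < s}"
  have l: "l \<in> near R" "l' \<in> near R" using assms by (auto simp: near_def)
  have "\<bar>trk l\<bar> \<noteq> \<infinity>" using nonneg(1)[of l] assms(3) by auto
  then have less: "trk l + trk l' < t + trk l"
    using assms(4) unfolding add.commute[of t] by (rule ereal_less_add)
  \<comment> \<open>The pair \<open>(l, l')\<close> is itself counted for \<open>l\<close> but no
    longer for \<open>l'\<close>, so the count drops strictly.\<close>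
  then have "(l, l') \<in> ?S (t + trk l) - ?S (trk l + trk l')" using l by simp
  moreover have "?S (trk l + trk l') \<subseteq> ?S (t + trk l)" using less by auto
  ultimately have "?S (trk l + trk l') \<subset> ?S (t + trk l)" by blast
  moreover have "finite (?S (t + trk l))"
    by (rule finite_subset[of _ "near R \<times> near R"]) (use finite_near in auto)
  ultimately have "card (?S (trk l + trk l')) < card (?S (t + trk l))" by (rule psubset_card_mono[rotated])
  then have "Suc (card (?S (trk l + trk l'))) * Suc (Max (depth ` near R)) \<le> card (?S (t + trk l)) * Suc (Max (depth ` near R))"
    by (intro mult_right_mono) auto
  moreover have "depth l' \<le> Max (depth ` near R)" using l finite_near by simp
  ultimately show ?thesis unfolding rank_def by simp
qed

text \<open>Each application of \<open>step\<close> consults only values of smaller rank, so after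
  more than \<open>rank R l t\<close> applications nothing of the starting function is left.\<close>

lemma funpow_step_indep:
  assumes "trk l < ereal R" "t < ereal R" "rank R l t < n"
  shows "(step ^^ n) A l t = (step ^^ n) A' l t"
  using assms
proof (induction n arbitrary: l t)
  case (Suc n)
  have "step ((step ^^ n) A) l t = step ((step ^^ n) A') l t"
  proof (rule step_cong)
    fix p assume p: "par l = Some p" "org l \<le> t"
    have "trk p < ereal R" using par[OF p(1)] p(2) Suc.prems(2) by auto
    then show "(step ^^ n) A p (trk l) = (step ^^ n) A' p (trk l)"
      using Suc.prems rank_par[OF p, of R] by (intro Suc.IH) auto
  next
    fix l' assume *: "org l \<le> t" "trk l' < t" "org l' < trk l"
    show "(step ^^ n) A l' (trk l) = (step ^^ n) A' l' (trk l)"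
      using Suc.prems * rank_crosses[OF *(1) Suc.prems(2) Suc.prems(1) *(2,3)] by (intro Suc.IH) auto
  qed
  then show ?case by simp
qed simp

text \<open>All iterates beyond the rank agree, so the limit in the definition of \<open>arr\<close>
  is decided after finitely many steps.\<close>

lemma arr_eq_funpow:
  assumes "trk l < ereal R" "t < ereal R" "rank R l t < n"
  shows "arr l t = (step ^^ n) A l t"
proof -
  have "(step ^^ m) (\<lambda>_ _. False) l t = (step ^^ n) A l t" if "n \<le> m" for m
  proof -
    have "(step ^^ m) (\<lambda>_ _. False) = (step ^^ n) ((step ^^ (m - n)) (\<lambda>_ _. False))"
      using that funpow_add[of n "m - n" step] by simp
    then show ?thesis using funpow_step_indep[OF assms] by metis
  qed
  then have "\<forall>\<^sub>F m in sequentially. (step ^^ m) (\<lambda>_ _. False) l t = (step ^^ n) A l t"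
    by (auto simp: eventually_sequentially)
  then have "arr l t \<longleftrightarrow> (\<forall>\<^sub>F m::nat in sequentially. (step ^^ n) A l t)"
    unfolding arr_def by (rule eventually_cong) simp
  then show ?thesis by simp
qed

lemma ex_real_bound: "(x::ereal) < \<infinity> \<Longrightarrow> y < \<infinity> \<Longrightarrow> \<exists>R. x < ereal R \<and> y < ereal R"
proof -
  assume "x < \<infinity>" "y < \<infinity>"
  then have "max x y < \<infinity>" by (simp add: max_def)
  then obtain n :: nat where "max x y < ereal (real n)" using less_PInf_Ex_of_nat[of "max x y"] by auto
  then show ?thesis by (intro exI[of _ "real n"]) simp
qed

lemma arr_step:
  assumes "t < \<infinity>" shows "arr l t = step arr l t"
proof (cases "trk l < \<infinity>")
  case False
  then show ?thesis using arrD(2)[of l t] by (auto simp: step_def)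
next
  case True
  obtain R where R: "trk l < ereal R" "t < ereal R" using ex_real_bound[OF True assms] by blast
  have "arr l t = (step ^^ Suc (rank R l t)) (\<lambda>_ _. False) l t"
    by (rule arr_eq_funpow[OF R]) simp
  also have "\<dots> = step ((step ^^ rank R l t) (\<lambda>_ _. False)) l t" by simp
  also have "\<dots> = step arr l t"
  proof (rule step_cong)
    fix p assume p: "par l = Some p" "org l \<le> t"
    have "trk p < ereal R" using par[OF p(1)] p(2) R(2) by auto
    from arr_eq_funpow[OF this R(1) rank_par[OF p]]
    show "(step ^^ rank R l t) (\<lambda>_ _. False) p (trk l) = arr p (trk l)" by metis
  next
    fix l' assume *: "org l \<le> t" "trk l' < t" "org l' < trk l"
    have "trk l' < ereal R" using * R by auto
    from arr_eq_funpow[OF this R(1) rank_crosses[OF *(1) R(2,1) *(2,3)]]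
    show "(step ^^ rank R l t) (\<lambda>_ _. False) l' (trk l) = arr l' (trk l)" by metis
  qed
  finally show ?thesis .
qed

text \<open>A fixed point is unchanged by iteration, while the iterates forget where they started.
  This is the tool for recognising the states of one system inside another: only the evolution
  equation has to be checked.\<close>

lemma arr_unique:
  assumes A: "\<And>l t. t < \<infinity> \<Longrightarrow> A l t = step A l t" and t: "t < \<infinity>"
  shows "A l t = arr l t"
proof (cases "trk l < \<infinity>")
  case False
  then show ?thesis using A[OF t, of l] arrD(2)[of l t] by (auto simp: step_def)
next
  case True
  obtain R where R: "trk l < ereal R" "t < ereal R" using ex_real_bound[OF True t] by blast
  have "A l t = (step ^^ n) A l t" if "t < \<infinity>" for n l t
    using that
  proof (induction n arbitrary: l t)
    case (Suc n)
    have "A l t = step A l t" by (rule A) fact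
    also have "\<dots> = step ((step ^^ n) A) l t"
      by (rule step_cong) (simp_all add: Suc.IH[symmetric])
    finally show ?case by simp
  qed simp
  with t have "A l t = (step ^^ Suc (rank R l t)) A l t" by blast
  also have "\<dots> = arr l t" by (rule arr_eq_funpow[OF R, symmetric]) simp
  finally show ?thesis .
qed

end

lemma measurable_line_system:
  fixes trk org w :: "'w \<Rightarrow> 'l::countable \<Rightarrow> ereal"
  assumes [measurable]: "\<And>l. (\<lambda>\<omega>. trk \<omega> l) \<in> borel_measurable M" "\<And>l. (\<lambda>\<omega>. org \<omega> l) \<in> borel_measurable M"
    "\<And>l. (\<lambda>\<omega>. w \<omega> l) \<in> borel_measurable M" "\<And>l l'. Measurable.pred M (\<lambda>\<omega>. stp \<omega> l l')"
  shows measurable_arr: "\<And>l \<tau>. \<tau> \<in> borel_measurable M \<Longrightarrow>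
      Measurable.pred M (\<lambda>\<omega>. line_system.arr vt par (trk \<omega>) (org \<omega>) (w \<omega>) (stp \<omega>) l (\<tau> \<omega>))"
    and measurable_sg: "\<And>l. (\<lambda>\<omega>. line_system.sg vt par (trk \<omega>) (org \<omega>) (w \<omega>) (stp \<omega>) l) \<in> borel_measurable M"
proof -
  let ?step = "\<lambda>\<omega>. line_system.step vt par (trk \<omega>) (org \<omega>) (w \<omega>) (stp \<omega>)"
  let ?arr = "\<lambda>\<omega>. line_system.arr vt par (trk \<omega>) (org \<omega>) (w \<omega>) (stp \<omega>)"
  let ?tp = "\<lambda>\<omega>. line_system.tp vt par (trk \<omega>) (org \<omega>) (w \<omega>) (stp \<omega>)"
  have iter: "Measurable.pred M (\<lambda>\<omega>. (?step \<omega> ^^ n) (\<lambda>_ _. False) l (\<tau> \<omega>))"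
    if "\<tau> \<in> borel_measurable M" for n l \<tau>
    using that
  proof (induction n arbitrary: l \<tau>)
    case (Suc n)
    note [measurable] = Suc.prems
    define B where "B \<omega> = (?step \<omega> ^^ n) (\<lambda>_ _. False)" for \<omega>
    have [measurable]: "Measurable.pred M (\<lambda>\<omega>. B \<omega> l' (trk \<omega> l))" for l'
      unfolding B_def by (rule Suc.IH) measurable
    have [measurable]: "Measurable.pred M (\<lambda>\<omega>. case par l of None \<Rightarrow> True | Some p \<Rightarrow> B \<omega> p (trk \<omega> l))"
      by (cases "par l") simp_all
    have "Measurable.pred M (\<lambda>\<omega>. ?step \<omega> (B \<omega>) l (\<tau> \<omega>))"
      unfolding line_system.step_def by measurable
    then show ?case by (simp add: B_def)
  qed simp
  show arr: "Measurable.pred M (\<lambda>\<omega>. ?arr \<omega> l (\<tau> \<omega>))" if "\<tau> \<in> borel_measurable M" for l \<tau>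
  proof -
    note [measurable] = iter[OF that]
    show ?thesis unfolding line_system.arr_def eventually_sequentially by measurable
  qed
  have tp [measurable]: "(\<lambda>\<omega>. ?tp \<omega> l) \<in> borel_measurable M" for l
  proof (rule borel_measurableI_greater)
    fix c :: ereal
    \<comment> \<open>The supremum is reduced to countably many events. \<open>arr\<close> is closed
      downwards above the origin, so a rational witness exists if \<open>c\<close> is at least the
      origin; for smaller \<open>c\<close> the origin itself is the witness.\<close>
    have *: "c < ?tp \<omega> l \<longleftrightarrow> (c < org \<omega> l \<and> ?arr \<omega> l (org \<omega> l)) \<or> (\<exists>q::rat. c < ereal (of_rat q) \<and> ?arr \<omega> l (ereal (of_rat q)))" for \<omega>
    proof -
      interpret line_system vt par "trk \<omega>" "org \<omega>" "w \<omega>" "stp \<omega>" .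
      show ?thesis
      proof
        assume "c < tp l"
        then obtain t where t: "arr l t" "c < t" unfolding tp_def by (auto simp: less_Sup_iff)
        show "(c < org \<omega> l \<and> arr l (org \<omega> l)) \<or> (\<exists>q::rat. c < ereal (of_rat q) \<and> arr l (ereal (of_rat q)))"
        proof (cases "c < org \<omega> l")
          case True
          then show ?thesis using t arr_ex_iff by blast
        next
          case False
          obtain q where q: "c < ereal (of_rat q)" "ereal (of_rat q) < t" using ereal_dense3[OF t(2)] by auto
          then have "arr l (ereal (of_rat q))" using False by (intro arr_downward[OF t(1)]) auto
          then show ?thesis using q by blast
        qed
      next
        assume "(c < org \<omega> l \<and> arr l (org \<omega> l)) \<or> (\<exists>q::rat. c < ereal (of_rat q) \<and> arr l (ereal (of_rat q)))"
        then obtain t where "arr l t" "c < t" by blast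
        then show "c < tp l" unfolding tp_def by (auto simp: less_Sup_iff)
      qed
    qed
    have [measurable]: "Measurable.pred M (\<lambda>\<omega>. ?arr \<omega> l (org \<omega> l))" by (rule arr) measurable
    have [measurable]: "Measurable.pred M (\<lambda>\<omega>. ?arr \<omega> l (ereal (of_rat q)))" for q by (rule arr) measurable
    show "{\<omega> \<in> space M. c < ?tp \<omega> l} \<in> sets M" unfolding * by measurable
  qed
  show "(\<lambda>\<omega>. line_system.sg vt par (trk \<omega>) (org \<omega>) (w \<omega>) (stp \<omega>) l) \<in> borel_measurable M" for l
    unfolding line_system.sg_def by (cases "vt l") (simp_all add: borel_measurable_Pair)
qed

text \<open>A random set with a measurable enumeration, possibly with repetitions and omissions. In
  this form stability under restriction and translation is evident, and
  \<open>segment_process_measurable\<close> recovers measurability with respect to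
  \<open>segments_space\<close>.\<close>

definition segment_process :: "'w measure \<Rightarrow> ('w \<Rightarrow> segment set) \<Rightarrow> bool" where
  "segment_process M L \<longleftrightarrow> (\<exists>(s :: nat \<Rightarrow> 'w \<Rightarrow> segment) a.
     (\<forall>n. s n \<in> borel_measurable M) \<and> (\<forall>n. Measurable.pred M (a n)) \<and>
     (\<forall>\<omega>\<in>space M. L \<omega> = {s n \<omega> | n. a n \<omega>}))"

lemma segment_processE:
  fixes L :: "'w \<Rightarrow> segment set"
  assumes "segment_process M L"
  obtains s a where "\<forall>n::nat. s n \<in> borel_measurable M" "\<forall>n. Measurable.pred M (a n)"
    "\<forall>\<omega>\<in>space M. L \<omega> = {s n \<omega> | n. a n \<omega>}"
proof -
  from assms[unfolded segment_process_def] obtain s :: "nat \<Rightarrow> 'w \<Rightarrow> segment" and a where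
    "(\<forall>n. s n \<in> borel_measurable M) \<and> (\<forall>n. Measurable.pred M (a n)) \<and>
     (\<forall>\<omega>\<in>space M. L \<omega> = {s n \<omega> | n. a n \<omega>})"
    by (elim exE)
  then show thesis by (elim conjE) (rule that)
qed

lemma segment_processI:
  fixes s :: "'l::countable \<Rightarrow> 'w \<Rightarrow> segment"
  assumes "\<And>l. s l \<in> borel_measurable M" "\<And>l. Measurable.pred M (a l)"
    and L: "\<And>\<omega>. \<omega> \<in> space M \<Longrightarrow> L \<omega> = {s l \<omega> | l. a l \<omega>}"
  shows "segment_process M L"
  unfolding segment_process_def
proof (intro exI conjI allI ballI)
  show "s (from_nat n) \<in> borel_measurable M" "Measurable.pred M (a (from_nat n))" for n
    using assms by auto
  fix \<omega> assume "\<omega> \<in> space M"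
  show "L \<omega> = {s (from_nat n) \<omega> | n. a (from_nat n) \<omega>}"
    unfolding L[OF \<open>\<omega> \<in> space M\<close>]
  proof (intro set_eqI iffI)
    fix x assume "x \<in> {s l \<omega> | l. a l \<omega>}"
    then obtain l where "x = s l \<omega>" "a l \<omega>" by blast
    then show "x \<in> {s (from_nat n) \<omega> | n. a (from_nat n) \<omega>}"
      by (intro CollectI exI[of _ "to_nat l"]) simp
  qed blast
qed

lemma segment_process_image:
  assumes "segment_process M L" and f: "f \<in> borel_measurable borel" and C: "Measurable.pred borel C"
  shows "segment_process M (\<lambda>\<omega>. f ` {s \<in> L \<omega>. C s})"
proof -
  obtain s a where *: "\<forall>n::nat. s n \<in> borel_measurable M" "\<forall>n. Measurable.pred M (a n)"
      "\<forall>\<omega>\<in>space M. L \<omega> = {s n \<omega> | n. a n \<omega>}"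
    by (rule segment_processE[OF assms(1)])
  note s = *(1,2)[rule_format] and L = *(3)[rule_format]
  show ?thesis
  proof (rule segment_processI)
    show "(\<lambda>\<omega>. f (s n \<omega>)) \<in> borel_measurable M" for n by (rule measurable_compose[OF s(1) f])
    show "Measurable.pred M (\<lambda>\<omega>. a n \<omega> \<and> C (s n \<omega>))" for n
      using s(2)[of n] measurable_compose[OF s(1)[of n] C] by (rule pred_intros_logic(3))
    show "f ` {s \<in> L \<omega>. C s} = {f (s n \<omega>) | n. a n \<omega> \<and> C (s n \<omega>)}" if "\<omega> \<in> space M" for \<omega>
      unfolding L[OF that] by blast
  qed
qed

lemma restrict_quadrant_image:
  "restrict_quadrant a b L = (\<lambda>s. ((max (ereal a) (fst (fst s)), max (ereal b) (snd (fst s))), snd s)) `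
     {s \<in> L. ereal a \<le> fst (snd s) \<and> ereal b \<le> snd (snd s)}"
proof (intro set_eqI iffI)
  fix z assume "z \<in> restrict_quadrant a b L"
  then obtain x y x' y' where "z = ((max (ereal a) x, max (ereal b) y), (x', y'))"
      "((x, y), (x', y')) \<in> L" "ereal a \<le> x'" "ereal b \<le> y'"
    unfolding restrict_quadrant_def by blast
  then show "z \<in> (\<lambda>s. ((max (ereal a) (fst (fst s)), max (ereal b) (snd (fst s))), snd s)) `
     {s \<in> L. ereal a \<le> fst (snd s) \<and> ereal b \<le> snd (snd s)}"
    by (intro image_eqI[of _ _ "((x, y), (x', y'))"]) simp_all
next
  fix z assume "z \<in> (\<lambda>s. ((max (ereal a) (fst (fst s)), max (ereal b) (snd (fst s))), snd s)) `
     {s \<in> L. ereal a \<le> fst (snd s) \<and> ereal b \<le> snd (snd s)}"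
  then obtain x y x' y' where "z = ((max (ereal a) x, max (ereal b) y), (x', y'))"
      "((x, y), (x', y')) \<in> L" "ereal a \<le> x'" "ereal b \<le> y'"
    by (elim imageE CollectE) (metis prod.collapse)
  then show "z \<in> restrict_quadrant a b L"
    unfolding restrict_quadrant_def by blast
qed

lemma translate_image:
  "translate a b L = (\<lambda>s. ((fst (fst s) + ereal a, snd (fst s) + ereal b), (fst (snd s) + ereal a, snd (snd s) + ereal b))) ` {s \<in> L. True}"
proof (intro set_eqI iffI)
  fix z assume "z \<in> translate a b L"
  then obtain x y x' y' where "z = ((x + ereal a, y + ereal b), (x' + ereal a, y' + ereal b))" "((x, y), (x', y')) \<in> L"
    unfolding translate_def by blast
  then show "z \<in> (\<lambda>s. ((fst (fst s) + ereal a, snd (fst s) + ereal b), (fst (snd s) + ereal a, snd (snd s) + ereal b))) ` {s \<in> L. True}"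
    by (intro image_eqI[of _ _ "((x, y), (x', y'))"]) simp_all
next
  fix z assume "z \<in> (\<lambda>s. ((fst (fst s) + ereal a, snd (fst s) + ereal b), (fst (snd s) + ereal a, snd (snd s) + ereal b))) ` {s \<in> L. True}"
  then obtain x y x' y' where "z = ((x + ereal a, y + ereal b), (x' + ereal a, y' + ereal b))" "((x, y), (x', y')) \<in> L"
    by (elim imageE CollectE) (metis prod.collapse)
  then show "z \<in> translate a b L"
    unfolding translate_def by blast
qed

lemma borel_measurable_segment_components:
  "(\<lambda>s::segment. fst (fst s)) \<in> borel_measurable borel" "(\<lambda>s::segment. snd (fst s)) \<in> borel_measurable borel"
  "(\<lambda>s::segment. fst (snd s)) \<in> borel_measurable borel" "(\<lambda>s::segment. snd (snd s)) \<in> borel_measurable borel"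
  "(\<lambda>s::segment. snd s) \<in> borel_measurable borel"
  by (auto intro!: borel_measurable_continuous_onI continuous_intros)

lemma segment_process_restrict:
  "segment_process M L \<Longrightarrow> segment_process M (\<lambda>\<omega>. restrict_quadrant a b (L \<omega>))"
  unfolding restrict_quadrant_image
proof (erule segment_process_image)
  note [measurable (raw)] = borel_measurable_segment_components
  show "(\<lambda>s::segment. ((max (ereal a) (fst (fst s)), max (ereal b) (snd (fst s))), snd s)) \<in> borel_measurable borel"
    by (intro borel_measurable_Pair borel_measurable_max borel_measurable_segment_components) simp_all
  show "Measurable.pred borel (\<lambda>s::segment. ereal a \<le> fst (snd s) \<and> ereal b \<le> snd (snd s))"
    by measurable
qed

lemma segment_process_translate:
  "segment_process M L \<Longrightarrow> segment_process M (\<lambda>\<omega>. translate a b (L \<omega>))"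
  unfolding translate_image
  by (erule segment_process_image)
    (auto intro!: borel_measurable_Pair borel_measurable_ereal_add borel_measurable_segment_components)

lemma segment_process_measurable:
  assumes "segment_process M L" shows "L \<in> measurable M segments_space"
proof -
  obtain s a where *: "\<forall>n::nat. s n \<in> borel_measurable M" "\<forall>n. Measurable.pred M (a n)"
      "\<forall>\<omega>\<in>space M. L \<omega> = {s n \<omega> | n. a n \<omega>}"
    by (rule segment_processE[OF assms])
  note s = *(1)[rule_format] and a [measurable] = *(2)[rule_format] and L = *(3)[rule_format]
  show ?thesis
    unfolding segments_space_def
  proof (rule measurable_measure_of)
    fix Y :: "segment set set" assume "Y \<in> {{L. finite (L \<inter> B) \<and> card (L \<inter> B) = n} | B n. B \<in> sets borel}"
    then obtain B n where Y: "Y = {L. finite (L \<inter> B) \<and> card (L \<inter> B) = n}" and B [measurable]: "B \<in> sets borel" by blast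
    \<comment> \<open>Only the first index of each segment counts, since the enumeration may have repetitions.\<close>
    define I where "I \<omega> = {i. a i \<omega> \<and> s i \<omega> \<in> B \<and> (\<forall>j<i. \<not> (a j \<omega> \<and> s j \<omega> \<in> B \<and> s j \<omega> = s i \<omega>))}" for \<omega>
    have eq: "L \<omega> \<inter> B = (\<lambda>i. s i \<omega>) ` I \<omega>" if "\<omega> \<in> space M" for \<omega>
    proof (intro equalityI subsetI)
      fix x assume "x \<in> L \<omega> \<inter> B"
      then have ex: "\<exists>i. a i \<omega> \<and> s i \<omega> \<in> B \<and> s i \<omega> = x" using L[OF that] by auto
      define i where "i = (LEAST i. a i \<omega> \<and> s i \<omega> \<in> B \<and> s i \<omega> = x)"
      have i: "a i \<omega>" "s i \<omega> \<in> B" "s i \<omega> = x" using LeastI_ex[OF ex] by (auto simp: i_def)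
      moreover have "\<not> (a j \<omega> \<and> s j \<omega> \<in> B \<and> s j \<omega> = s i \<omega>)" if "j < i" for j
        using not_less_Least[of j "\<lambda>i. a i \<omega> \<and> s i \<omega> \<in> B \<and> s i \<omega> = x"] that i(3) by (simp add: i_def)
      ultimately show "x \<in> (\<lambda>i. s i \<omega>) ` I \<omega>" by (auto simp: I_def)
    next
      fix x assume "x \<in> (\<lambda>i. s i \<omega>) ` I \<omega>"
      then show "x \<in> L \<omega> \<inter> B" using L[OF that] by (auto simp: I_def)
    qed
    have inj: "inj_on (\<lambda>i. s i \<omega>) (I \<omega>)" for \<omega>
    proof (rule linorder_inj_onI')
      show "s i \<omega> \<noteq> s j \<omega>" if "i \<in> I \<omega>" "j \<in> I \<omega>" "i < j" for i j
        using that by (auto simp: I_def)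
    qed
    note sc = measurable_compose[OF s]
    have sB [measurable]: "Measurable.pred M (\<lambda>\<omega>. s i \<omega> \<in> B)" for i
      using measurable_sets_Collect[OF s, of "\<lambda>x. x \<in> B" i] by (simp add: pred_def)
    have seq [measurable]: "Measurable.pred M (\<lambda>\<omega>. s j \<omega> = s i \<omega>)" for i j
      unfolding prod_eq_iff
      using sc[OF borel_measurable_segment_components(1)] sc[OF borel_measurable_segment_components(2)]
        sc[OF borel_measurable_segment_components(3)] sc[OF borel_measurable_segment_components(4)]
      by measurable
    have mI [measurable]: "Measurable.pred M (\<lambda>\<omega>. i \<in> I \<omega>)" for i
      unfolding I_def mem_Collect_eq by measurable
    \<comment> \<open>Finiteness of a set of indices is rewritten as boundedness, a countable
      combination of the events in \<open>mI\<close>.\<close>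
    have fin: "finite (I \<omega>) \<longleftrightarrow> (\<exists>k. \<forall>i. k \<le> i \<longrightarrow> i \<notin> I \<omega>)" for \<omega>
    proof
      assume "finite (I \<omega>)"
      then obtain k where "I \<omega> \<subseteq> {..<k}" using finite_nat_iff_bounded by blast
      then show "\<exists>k. \<forall>i. k \<le> i \<longrightarrow> i \<notin> I \<omega>" by (intro exI[of _ k]) auto
    next
      assume "\<exists>k. \<forall>i. k \<le> i \<longrightarrow> i \<notin> I \<omega>"
      then obtain k where "I \<omega> \<subseteq> {..<k}" by (metis lessThan_iff not_le subsetI)
      then show "finite (I \<omega>)" by (rule finite_subset) simp
    qed
    have "L -` Y \<inter> space M = {\<omega> \<in> space M. finite (I \<omega>) \<and> card (I \<omega>) = n}"
      by (auto simp: Y eq card_image[OF inj] finite_image_iff[OF inj])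
    also have "\<dots> \<in> sets M" unfolding fin by measurable
    finally show "L -` Y \<inter> space M \<in> sets M" .
  qed auto
qed

section \<open>The tree of lines\<close>

text \<open>\<open>Axis True\<close> and \<open>Axis False\<close> are the vertical and the horizontal coordinate axis, regarded as
  lines that are never stopped; their children are the lines of the initial condition.\<close>

datatype label = Axis bool | Child label nat

instance label :: countable by countable_datatype

primrec vt :: "label \<Rightarrow> bool" where
  "vt (Axis b) = b"
| "vt (Child l k) = (\<not> vt l)"

primrec par :: "label \<Rightarrow> label option" where
  "par (Axis b) = None"
| "par (Child l k) = Some l"

primrec depth :: "label \<Rightarrow> nat" where
  "depth (Axis b) = 0"
| "depth (Child l k) = Suc (depth l)"

text \<open>An injective numbering in which parents precede their children, which makes it a rank
  for \<open>distr_triangular\<close>. The offset 2 reserves 0 and 1 for the axes.\<close>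

primrec code :: "label \<Rightarrow> nat" where
  "code (Axis b) = of_bool b"
| "code (Child l k) = 2 + prod_encode (code l, k)"

text \<open>Track and origin of the full trajectory, as in \<open>route\<close>, whether or not the
  line exists. The components swap at each birth: the coordinate at which the parent splits becomes
  the track of the child, and the track of the parent its origin.\<close>

primrec pos :: "(label \<Rightarrow> nat \<Rightarrow> real) \<Rightarrow> label \<Rightarrow> real \<times> real" where
  "pos z (Axis b) = (0, 0)"
| "pos z (Child l k) = (snd (pos z l) + psum (z l) k, fst (pos z l))"

definition trk :: "(label \<Rightarrow> nat \<Rightarrow> real) \<Rightarrow> label \<Rightarrow> real" where
  "trk z l = fst (pos z l)"

definition org :: "(label \<Rightarrow> nat \<Rightarrow> real) \<Rightarrow> label \<Rightarrow> real" where
  "org z l = snd (pos z l)"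

lemma trk_simps [simp]: "trk z (Axis b) = 0" "trk z (Child l k) = org z l + psum (z l) k"
  by (simp_all add: trk_def org_def)

lemma org_simps [simp]: "org z (Axis b) = 0" "org z (Child l k) = trk z l"
  by (simp_all add: trk_def org_def)

lemma code_inj: "inj code"
proof (rule injI)
  show "l = l'" if "code l = code l'" for l l'
    using that
  proof (induction l arbitrary: l')
    case (Axis b)
    then show ?case by (cases l') (auto simp: of_bool_def split: if_splits)
  next
    case (Child l k)
    show ?case
    proof (cases l')
      case (Axis b)
      then show ?thesis using Child.prems by (auto simp: of_bool_def split: if_splits)
    next
      case (Child m j)
      then have "prod_encode (code l, k) = prod_encode (code m, j)" using Child.prems by simp
      then have "code l = code m" "k = j" by (auto dest: injD[OF inj_prod_encode])
      then show ?thesis using Child.IH Child by simp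
    qed
  qed
qed

lemma code_Child: "code l < code (Child l k)"
  using le_prod_encode_1[of "code l" k] by simp

text \<open>Only sequences of strict ancestors enter the position, never \<open>z l\<close> itself.
  Hence the position of \<open>l\<close> and its sequence \<open>z l\<close> are independent, which
  drives the conditioning arguments on the tree.\<close>

lemma pos_cong: "(\<And>j. code j < code l \<Longrightarrow> z j = z' j) \<Longrightarrow> pos z l = pos z' l"
proof (induction l)
  case (Child l k)
  have "pos z l = pos z' l" by (rule Child.IH) (metis Child.prems code_Child less_trans)
  moreover have "z l = z' l" by (rule Child.prems) (rule code_Child)
  ultimately show ?case by simp
qed simp

lemma trk_cong: "(\<And>j. code j < code l \<Longrightarrow> z j = z' j) \<Longrightarrow> trk z l = trk z' l"
  unfolding trk_def by (metis pos_cong)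

lemma org_cong: "(\<And>j. code j < code l \<Longrightarrow> z j = z' j) \<Longrightarrow> org z l = org z' l"
  unfolding org_def by (metis pos_cong)

section \<open>The random tree and its almost sure regularity\<close>

abbreviation noise :: "(label \<Rightarrow> nat \<Rightarrow> real) measure" where
  "noise \<equiv> (\<Pi>\<^sub>M _\<in>UNIV. gap_law)"

lemma prob_space_noise: "prob_space noise"
  by (intro prob_space_PiM prob_space_gap_law)

interpretation noise: prob_space noise by (rule prob_space_noise)

lemma space_noise [simp]: "space noise = UNIV"
  by (simp add: space_PiM PiE_UNIV_domain)

lemma measurable_noise_component: "(\<lambda>z. z l) \<in> measurable noise gap_law"
  by (rule measurable_component_singleton) simp

lemma measurable_pos:
  "(\<lambda>z. trk z l) \<in> borel_measurable noise \<and> (\<lambda>z. org z l) \<in> borel_measurable noise"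
proof (induction l)
  case (Child l k)
  have "(\<lambda>z. psum (z l) k) \<in> borel_measurable noise"
    by (rule measurable_psum[OF measurable_noise_component])
  then show ?case using Child by (auto intro: borel_measurable_add)
qed simp

lemmas measurable_trk [measurable (raw)] = measurable_compose[OF _ measurable_pos[THEN conjunct1]]
  and measurable_org [measurable (raw)] = measurable_compose[OF _ measurable_pos[THEN conjunct2]]

text \<open>The deterministic requirements of the geometric arguments, almost sure by
  \<open>AE_good\<close>. The last clause also separates tracks of vertical from tracks of
  horizontal lines.\<close>

definition good :: "(label \<Rightarrow> nat \<Rightarrow> real) \<Rightarrow> bool" where
  "good z \<longleftrightarrow> (\<forall>l. good_seq (z l)) \<and> (\<forall>R. finite {l. trk z l < R \<and> org z l < R}) \<and>
     (\<forall>l l' k k'. Child l k \<noteq> Child l' k' \<longrightarrow> trk z (Child l k) \<noteq> trk z (Child l' k'))"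

lemma good_seqD: "good z \<Longrightarrow> good_seq (z l)" by (simp add: good_def)

lemma good_finite: "good z \<Longrightarrow> finite {l. trk z l < R \<and> org z l < R}" by (simp add: good_def)

lemma pos_nonneg: assumes "good z" shows "0 \<le> trk z l \<and> 0 \<le> org z l"
proof (induction l)
  case (Child l k)
  then show ?case using good_seq_psum_pos[OF good_seqD[OF assms], of l k] by simp
qed simp

lemma trk_nonneg: "good z \<Longrightarrow> 0 \<le> trk z l" and org_nonneg: "good z \<Longrightarrow> 0 \<le> org z l"
  using pos_nonneg by auto

lemma org_less_trk_Child: "good z \<Longrightarrow> org z l < trk z (Child l k)"
  using good_seq_psum_pos[OF good_seqD, of z l k] by simp

lemma trk_Child_pos: "good z \<Longrightarrow> 0 < trk z (Child l k)"
  using org_less_trk_Child[of z l k] org_nonneg[of z l] by linarith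

lemma good_distinct:
  assumes "good z" "par l \<noteq> None" "par l' \<noteq> None" "trk z l = trk z l'" shows "l = l'"
proof -
  obtain m k m' k' where l: "l = Child m k" "l' = Child m' k'"
    using assms(2,3) by (cases l; cases l') simp_all
  have "Child m k \<noteq> Child m' k' \<longrightarrow> trk z (Child m k) \<noteq> trk z (Child m' k')"
    using assms(1) unfolding good_def by blast
  then show ?thesis using assms(4) unfolding l by blast
qed

text \<open>A label with track and origin below \<open>R\<close> has weight at least
  \<open>exp (- 4 * R)\<close>, so a finite total weight leaves finitely many labels in every
  box.\<close>

definition weight :: "(label \<Rightarrow> nat \<Rightarrow> real) \<Rightarrow> label \<Rightarrow> ennreal" where
  "weight z l = ennreal (exp (- 2 * (trk z l + org z l)))"

primrec mean_weight :: "label \<Rightarrow> ennreal" where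
  "mean_weight (Axis b) = 1"
| "mean_weight (Child l k) = mean_weight l * (1/3) ^ Suc k"

lemma measurable_weight: "(\<lambda>z. weight z l) \<in> borel_measurable noise"
  using measurable_pos[of l] unfolding weight_def by measurable

text \<open>Passing from \<open>l\<close> to its child number \<open>k\<close> adds
  \<open>psum (z l) k\<close> to the sum of track and origin. Since \<open>z l\<close> is
  independent of the position of \<open>l\<close>, resampling it multiplies the mean by
  \<open>(1/3) ^ Suc k\<close>.\<close>

lemma nn_integral_weight: "(\<integral>\<^sup>+z. weight z l \<partial>noise) = mean_weight l"
proof (induction l)
  case (Axis b)
  show ?case by (simp add: weight_def noise.emeasure_space_1[simplified])
next
  case (Child l k)
  have "(\<integral>\<^sup>+z. weight z (Child l k) \<partial>noise) = (\<integral>\<^sup>+z. (\<integral>\<^sup>+x. weight (fun_upd z l x) (Child l k) \<partial>gap_law) \<partial>noise)"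
    by (rule nn_integral_PiM_resample[OF prob_space_gap_law measurable_weight])
  also have "\<dots> = (\<integral>\<^sup>+z. (\<integral>\<^sup>+x. weight z l * ennreal (exp (- 2 * psum x k)) \<partial>gap_law) \<partial>noise)"
  proof (intro nn_integral_cong)
    fix z :: "label \<Rightarrow> nat \<Rightarrow> real" and x
    have "trk (fun_upd z l x) l = trk z l" by (rule trk_cong) (auto dest: less_imp_neq)
    moreover have "org (fun_upd z l x) l = org z l" by (rule org_cong) (auto dest: less_imp_neq)
    ultimately have "weight (fun_upd z l x) (Child l k) = ennreal (exp (- 2 * (trk z l + org z l)) * exp (- 2 * psum x k))"
      by (simp add: weight_def exp_add[symmetric] algebra_simps)
    then show "weight (fun_upd z l x) (Child l k) = weight z l * ennreal (exp (- 2 * psum x k))"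
      by (simp only: weight_def ennreal_mult' exp_ge_zero)
  qed
  also have "\<dots> = (\<integral>\<^sup>+z. weight z l * (1/3) ^ Suc k \<partial>noise)"
    using nn_integral_exp_psum[of k] by (subst nn_integral_cmult) (simp_all del: power_Suc)
  also have "\<dots> = mean_weight l * (1/3) ^ Suc k"
    by (subst nn_integral_multc[OF measurable_weight]) (simp only: Child)
  finally show ?case by simp
qed

lemma nn_integral_count_space_Child:
  fixes f :: "label \<Rightarrow> ennreal"
  assumes "\<And>b. f (Axis b) = 0"
  shows "(\<integral>\<^sup>+l. f l \<partial>count_space UNIV) = (\<integral>\<^sup>+l. (\<integral>\<^sup>+k. f (Child l k) \<partial>count_space UNIV) \<partial>count_space UNIV)"
proof -
  have inj: "inj (\<lambda>x. Child (fst x) (snd x))" by (auto intro!: injI simp: prod_eq_iff)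
  have "(\<integral>\<^sup>+l. f l \<partial>count_space UNIV) = (\<integral>\<^sup>+l. f l \<partial>count_space (range (\<lambda>x. Child (fst x) (snd x))))"
  proof (rule nn_integral_count_space_eq)
    fix l assume "l \<in> UNIV - range (\<lambda>x. Child (fst x) (snd x))"
    then show "f l = 0"
    proof (cases l)
      case (Child m k)
      then have "l = (\<lambda>x. Child (fst x) (snd x)) (m, k)" by simp
      then show ?thesis using \<open>l \<in> UNIV - range (\<lambda>x. Child (fst x) (snd x))\<close> by blast
    qed (simp add: assms)
  qed simp
  also have "\<dots> = (\<integral>\<^sup>+x. f (Child (fst x) (snd x)) \<partial>count_space UNIV)"
    by (rule nn_integral_bij_count_space[symmetric]) (rule inj_on_imp_bij_betw[OF inj])
  also have "\<dots> = (\<integral>\<^sup>+l. (\<integral>\<^sup>+k. f (Child (fst (l, k)) (snd (l, k))) \<partial>count_space UNIV) \<partial>count_space UNIV)"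
    by (rule nn_integral_fst_count_space[symmetric])
  finally show ?thesis by simp
qed

text \<open>Each generation carries half of the mean weight of the previous one.\<close>

lemma nn_integral_mean_weight: "(\<integral>\<^sup>+l. mean_weight l \<partial>count_space UNIV) < \<top>"
proof -
  define U where "U n = (\<integral>\<^sup>+l. mean_weight l * indicator {n} (depth l) \<partial>count_space UNIV)" for n
  have U0: "U 0 \<le> 2"
  proof -
    have "U 0 = (\<integral>\<^sup>+l. indicator {Axis True, Axis False} l \<partial>count_space UNIV)"
      unfolding U_def
    proof (rule nn_integral_cong)
      fix l show "mean_weight l * indicator {0} (depth l) = indicator {Axis True, Axis False} l"
        by (cases l) (auto split: split_indicator)
    qed
    also have "\<dots> = emeasure (count_space UNIV) {Axis True, Axis False}"
      by (rule nn_integral_indicator) simp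
    finally show ?thesis by simp
  qed
  have USuc: "U (Suc n) = U n * (1/2)" for n
  proof -
    have "U (Suc n) = (\<integral>\<^sup>+l. (\<integral>\<^sup>+k. mean_weight (Child l k) * indicator {Suc n} (depth (Child l k)) \<partial>count_space UNIV) \<partial>count_space UNIV)"
      unfolding U_def by (rule nn_integral_count_space_Child) simp
    also have "\<dots> = (\<integral>\<^sup>+l. (mean_weight l * indicator {n} (depth l)) * (1/2) \<partial>count_space UNIV)"
    proof (rule nn_integral_cong)
      fix l
      have "(\<integral>\<^sup>+k. mean_weight (Child l k) * indicator {Suc n} (depth (Child l k)) \<partial>count_space UNIV) =
        (\<integral>\<^sup>+k. (mean_weight l * indicator {n} (depth l)) * (1/3) ^ Suc k \<partial>count_space UNIV)"
        by (rule nn_integral_cong) (simp split: split_indicator)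
      also have "\<dots> = (mean_weight l * indicator {n} (depth l)) * (\<integral>\<^sup>+k. (1/3) ^ Suc k \<partial>count_space UNIV)"
        by (rule nn_integral_cmult) simp
      also have "(\<integral>\<^sup>+k. (1/3) ^ Suc k \<partial>count_space UNIV) = (1/2 :: ennreal)"
        unfolding nn_integral_count_space_nat by (rule suminf_third)
      finally show "(\<integral>\<^sup>+k. mean_weight (Child l k) * indicator {Suc n} (depth (Child l k)) \<partial>count_space UNIV) =
        (mean_weight l * indicator {n} (depth l)) * (1/2)" .
    qed
    also have "\<dots> = U n * (1/2)"
      unfolding U_def by (rule nn_integral_multc) simp
    finally show ?thesis .
  qed
  have U: "U n \<le> ennreal (2 * (1/2) ^ n)" for n
  proof (induction n)
    case (Suc n)
    have half: "(1/2 :: ennreal) = ennreal (1/2)" using divide_ennreal[of 1 2] by simp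
    have "U (Suc n) \<le> ennreal (2 * (1/2) ^ n) * ennreal (1/2)"
      unfolding USuc half by (rule mult_right_mono[OF Suc]) simp
    also have "\<dots> = ennreal (2 * (1/2) ^ Suc n)"
      by (subst ennreal_mult'[symmetric]) (simp_all add: mult_ac)
    finally show ?case .
  qed (use U0 in simp)
  have "(\<integral>\<^sup>+l. mean_weight l \<partial>count_space UNIV) =
    (\<integral>\<^sup>+l. (\<Sum>n. mean_weight l * indicator {n} (depth l)) \<partial>count_space UNIV)"
  proof (rule nn_integral_cong)
    fix l
    have "(\<Sum>n. mean_weight l * indicator {n} (depth l)) = (\<Sum>n\<in>{depth l}. mean_weight l * indicator {n} (depth l))"
      by (rule suminf_finite) auto
    then show "mean_weight l = (\<Sum>n. mean_weight l * indicator {n} (depth l))" by simp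
  qed
  also have "\<dots> = (\<Sum>n. U n)"
    unfolding U_def by (rule nn_integral_suminf) simp
  also have "\<dots> \<le> (\<Sum>n. ennreal (2 * (1/2) ^ n))"
    by (intro suminf_le U) simp_all
  also have "\<dots> = ennreal (\<Sum>n. 2 * (1/2) ^ n)"
    by (rule suminf_ennreal2) (auto intro!: summable_mult summable_geometric)
  also have "\<dots> < \<top>" by simp
  finally show ?thesis .
qed

lemma AE_finite_box: "AE z in noise. \<forall>R. finite {l. trk z l < R \<and> org z l < R}"
proof -
  have "(\<integral>\<^sup>+z. (\<integral>\<^sup>+l. weight z l \<partial>count_space UNIV) \<partial>noise) = (\<integral>\<^sup>+l. mean_weight l \<partial>count_space UNIV)"
    by (subst nn_integral_count_space_nn_integral) (simp_all add: measurable_weight nn_integral_weight)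
  then have "(\<integral>\<^sup>+z. (\<integral>\<^sup>+l. weight z l \<partial>count_space UNIV) \<partial>noise) \<noteq> \<infinity>"
    using nn_integral_mean_weight by simp
  moreover have "(\<lambda>z. \<integral>\<^sup>+l. weight z l \<partial>count_space UNIV) \<in> borel_measurable noise"
  proof -
    \<comment> \<open>The sum over labels becomes a series over natural numbers, whose measurability
      is available; the indicator drops numbers that encode no label.\<close>
    have "(\<integral>\<^sup>+l. weight z l \<partial>count_space UNIV) = (\<integral>\<^sup>+n. weight z (from_nat n) * indicator (range (to_nat :: label \<Rightarrow> nat)) n \<partial>count_space UNIV)" for z
    proof -
      have "(\<integral>\<^sup>+n. weight z (from_nat n) * indicator (range (to_nat :: label \<Rightarrow> nat)) n \<partial>count_space UNIV) =
        (\<integral>\<^sup>+n. weight z (from_nat n) \<partial>count_space (range (to_nat :: label \<Rightarrow> nat)))"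
        by (simp add: nn_integral_count_space_indicator)
      also have "\<dots> = (\<integral>\<^sup>+l. weight z (from_nat (to_nat (l :: label))) \<partial>count_space UNIV)"
        by (rule nn_integral_bij_count_space[symmetric]) (simp add: bij_betw_def)
      finally show ?thesis by simp
    qed
    then show ?thesis
      unfolding nn_integral_count_space_nat using measurable_weight by simp
  qed
  ultimately have "AE z in noise. (\<integral>\<^sup>+l. weight z l \<partial>count_space UNIV) \<noteq> \<infinity>"
    by (intro nn_integral_noteq_infinite)
  then show ?thesis
  proof eventually_elim
    case (elim z)
    show ?case
    proof
      fix R :: real
      have "finite {l. ennreal (exp (- 4 * R)) \<le> weight z l}"
        using elim by (intro finite_level_set_of_nn_integral) (auto simp: less_top)
      then show "finite {l. trk z l < R \<and> org z l < R}"
        by (rule rev_finite_subset) (auto simp: weight_def intro!: ennreal_leI)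
    qed
  qed
qed

text \<open>Fixing the first gap \<open>s\<close> moves the level from \<open>c\<close> to
  \<open>c - s\<close>, so the absence of atoms propagates from a single gap to sums; for this
  reason the induction ranges over all levels.\<close>

lemma emeasure_psum_eq: "emeasure gap_law {x. psum x k = c} = 0"
proof (induction k arbitrary: c)
  have m: "{x. psum x k = c} \<in> sets gap_law" for k c
  proof -
    have "{x \<in> space gap_law. psum x k = c} \<in> sets gap_law" by measurable
    then show ?thesis by simp
  qed
  {
    case 0
    have "emeasure gap_law {x. psum x 0 = c} = (\<integral>\<^sup>+x. indicator {x. psum x 0 = c} x \<partial>gap_law)"
      by (rule nn_integral_indicator[OF m, symmetric])
    also have "\<dots> = (\<integral>\<^sup>+s. (\<integral>\<^sup>+x. indicator {x. psum x 0 = c} (case_nat s x) \<partial>gap_law) \<partial>exp_law)"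
      by (rule nn_integral_gap_law_Suc) (rule borel_measurable_indicator[OF m])
    also have "\<dots> = (\<integral>\<^sup>+s. indicator {c} s \<partial>exp_law)"
      by (rule nn_integral_cong) (simp add: indicator_def gap_law.emeasure_space_1[simplified])
    finally show ?case by (simp add: exp_law_singleton)
  next
    case (Suc k)
    have "emeasure gap_law {x. psum x (Suc k) = c} = (\<integral>\<^sup>+x. indicator {x. psum x (Suc k) = c} x \<partial>gap_law)"
      by (rule nn_integral_indicator[OF m, symmetric])
    also have "\<dots> = (\<integral>\<^sup>+s. (\<integral>\<^sup>+x. indicator {x. psum x (Suc k) = c} (case_nat s x) \<partial>gap_law) \<partial>exp_law)"
      by (rule nn_integral_gap_law_Suc) (rule borel_measurable_indicator[OF m])
    also have "\<dots> = (\<integral>\<^sup>+s. (\<integral>\<^sup>+x. indicator {x. psum x k = c - s} x \<partial>gap_law) \<partial>exp_law)"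
      by (intro nn_integral_cong) (auto simp: indicator_def psum_Suc_shift)
    also have "\<dots> = 0" by (simp add: m Suc)
    finally show ?case .
  }
qed

text \<open>Given all sequences except \<open>z l\<close>, both \<open>f z\<close> and the origin of
  \<open>l\<close> are constants, while \<open>psum (z l) k\<close> has no atoms.\<close>

lemma AE_trk_neq:
  assumes f: "f \<in> borel_measurable noise" and indep: "\<And>z x. f (fun_upd z l x) = f z"
  shows "AE z in noise. trk z (Child l k) \<noteq> f z"
proof -
  let ?A = "{z. trk z (Child l k) = f z}"
  have m: "?A \<in> sets noise"
  proof -
    have "(\<lambda>z. trk z (Child l k)) \<in> borel_measurable noise" using measurable_pos by blast
    then have "{z \<in> space noise. trk z (Child l k) = f z} \<in> sets noise" using f by measurable
    then show ?thesis by simp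
  qed
  have "emeasure noise ?A = (\<integral>\<^sup>+z. indicator ?A z \<partial>noise)" by (rule nn_integral_indicator[OF m, symmetric])
  also have "\<dots> = (\<integral>\<^sup>+z. (\<integral>\<^sup>+x. indicator ?A (fun_upd z l x) \<partial>gap_law) \<partial>noise)"
    by (rule nn_integral_PiM_resample[OF prob_space_gap_law]) (rule borel_measurable_indicator[OF m])
  also have "\<dots> = (\<integral>\<^sup>+z. (\<integral>\<^sup>+x. indicator {x. psum x k = f z - org z l} x \<partial>gap_law) \<partial>noise)"
  proof (intro nn_integral_cong)
    fix z :: "label \<Rightarrow> nat \<Rightarrow> real" and x
    have "org (fun_upd z l x) l = org z l" by (rule org_cong) (auto dest: less_imp_neq)
    then show "(indicator ?A (fun_upd z l x) :: ennreal) = indicator {x. psum x k = f z - org z l} x"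
      by (auto simp: indicator_def indep)
  qed
  also have "\<dots> = 0"
  proof -
    have "{x. psum x k = c} \<in> sets gap_law" for c
    proof -
      have "{x \<in> space gap_law. psum x k = c} \<in> sets gap_law" by measurable
      then show ?thesis by simp
    qed
    then show ?thesis by (simp add: emeasure_psum_eq)
  qed
  finally have "?A \<in> null_sets noise" using m by (simp add: null_sets_def)
  then show ?thesis by (rule AE_I') auto
qed

lemma AE_trk_neq_const: "AE z in noise. \<forall>l k. trk z (Child l k) \<noteq> c"
  unfolding AE_all_countable using AE_trk_neq[of "\<lambda>_. c"] by simp

lemma AE_good: "AE z in noise. good z"
proof -
  have "AE z in noise. good_seq (z l)" for l
    by (rule AE_PiM_component[OF prob_space_gap_law _ AE_good_seq]) simp
  then have gs: "AE z in noise. \<forall>l. good_seq (z l)" by (simp add: AE_all_countable)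
  have neq: "AE z in noise. trk z (Child l k) \<noteq> trk z (Child l' k')" if "code l' < code l" for l k l' k'
  proof (rule AE_trk_neq)
    show "(\<lambda>z. trk z (Child l' k')) \<in> borel_measurable noise" using measurable_pos by blast
    fix z :: "label \<Rightarrow> nat \<Rightarrow> real" and x
    have "org (fun_upd z l x) l' = org z l'" by (rule org_cong) (use that in auto)
    then show "trk (fun_upd z l x) (Child l' k') = trk z (Child l' k')" using that by auto
  qed
  have "AE z in noise. Child l k \<noteq> Child l' k' \<longrightarrow> trk z (Child l k) \<noteq> trk z (Child l' k')" for l k l' k'
  proof -
    \<comment> \<open>Of two different parents the one with the larger code is resampled, since the
      track of the other child does not depend on it. Children of one parent are separated by strict
      monotonicity of \<open>psum\<close>.\<close>
    consider "code l' < code l" | "code l < code l'" | "l = l'" using injD[OF code_inj] by fastforce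
    then show ?thesis
    proof cases
      case 1
      then show ?thesis using neq[OF 1, of k k'] by eventually_elim simp
    next
      case 2
      then show ?thesis using neq[OF 2, of k' k] by eventually_elim (simp only: not_sym)
    next
      case 3
      show ?thesis using gs
      proof eventually_elim
        case (elim z)
        have "inj (psum (z l'))" by (rule strict_mono_imp_inj_on[OF good_seq_strict_mono]) (simp add: elim)
        then show ?case using 3 by (auto dest: injD)
      qed
    qed
  qed
  then have "AE z in noise. \<forall>l l' k k'. Child l k \<noteq> Child l' k' \<longrightarrow> trk z (Child l k) \<noteq> trk z (Child l' k')"
    unfolding AE_all_countable by blast
  with gs AE_finite_box show ?thesis by eventually_elim (simp add: good_def)
qed

section \<open>Cutting the quadrant\<close>

text \<open>Infinite turning times exclude turns, and the constantly true \<open>stp\<close> makes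
  every meeting stop both lines, as p0 = 1 prescribes.\<close>

abbreviation tree_step where
  "tree_step z \<equiv> line_system.step vt par (\<lambda>l. ereal (trk z l)) (\<lambda>l. ereal (org z l)) (\<lambda>_. \<infinity>) (\<lambda>_ _. True)"

abbreviation tree_arr where
  "tree_arr z \<equiv> line_system.arr vt par (\<lambda>l. ereal (trk z l)) (\<lambda>l. ereal (org z l)) (\<lambda>_. \<infinity>) (\<lambda>_ _. True)"

abbreviation tree_sg where
  "tree_sg z \<equiv> line_system.sg vt par (\<lambda>l. ereal (trk z l)) (\<lambda>l. ereal (org z l)) (\<lambda>_. \<infinity>) (\<lambda>_ _. True)"

definition alive :: "(label \<Rightarrow> nat \<Rightarrow> real) \<Rightarrow> label \<Rightarrow> real \<Rightarrow> bool" where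
  "alive z l t \<longleftrightarrow> tree_arr z l (ereal t)"

definition tip :: "(label \<Rightarrow> nat \<Rightarrow> real) \<Rightarrow> label \<Rightarrow> ereal" where
  "tip z l = Sup (ereal ` {t. alive z l t})"

text \<open>The condition on \<open>par l\<close> removes the two axes, which are auxiliary lines
  and not segments of the model.\<close>

definition tree_diagram :: "(label \<Rightarrow> nat \<Rightarrow> real) \<Rightarrow> segment set" where
  "tree_diagram z = {tree_sg z l | l. par l \<noteq> None \<and> (\<exists>t. tree_arr z l t)}"

definition blocks :: "(label \<Rightarrow> nat \<Rightarrow> real) \<Rightarrow> label \<Rightarrow> label \<Rightarrow> bool" where
  "blocks z l l' \<longleftrightarrow> vt l \<noteq> vt l' \<and> org z l < trk z l' \<and> org z l' < trk z l"

lemma tree_step_real: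
  "tree_step z A l (ereal t) \<longleftrightarrow>
    (\<forall>p. par l = Some p \<longrightarrow> A p (ereal (trk z l))) \<and> org z l \<le> t \<and>
    (\<forall>l'. blocks z l l' \<and> trk z l' < t \<longrightarrow> \<not> A l' (ereal (trk z l)))"
  unfolding line_system.step_def blocks_def by (cases "par l") simp_all

lemma good_regular:
  assumes "good z"
  shows "regular_lines par (\<lambda>l. ereal (trk z l)) (\<lambda>l. ereal (org z l)) depth"
proof
  show "finite {l. ereal (trk z l) < ereal R \<and> ereal (org z l) < ereal R}" for R
    using good_finite[OF assms] by simp
  show "depth p < depth l \<and> ereal (org z l) = ereal (trk z p)" if "par l = Some p" for l p
    using that by (cases l) simp_all
  show "0 \<le> ereal (trk z l)" "0 \<le> ereal (org z l)" for l
    using trk_nonneg[OF assms] org_nonneg[OF assms] by simp_all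
qed

lemma alive_iff:
  assumes "good z"
  shows "alive z l t \<longleftrightarrow> (\<forall>p. par l = Some p \<longrightarrow> alive z p (trk z l)) \<and> org z l \<le> t \<and>
    (\<forall>l'. blocks z l l' \<and> trk z l' < t \<longrightarrow> \<not> alive z l' (trk z l))"
  using regular_lines.arr_step[OF good_regular[OF assms], where vt = vt and w = "\<lambda>_. \<infinity>" and stp = "\<lambda>_ _. True" and l = l and t = "ereal t"]
  unfolding alive_def by (simp only: tree_step_real ereal_less(4) simp_thms) (simp add: tree_step_real)

lemma alive_unique:
  assumes "good z"
    and A: "\<And>l t. A l t \<longleftrightarrow> (\<forall>p. par l = Some p \<longrightarrow> A p (trk z l)) \<and> org z l \<le> t \<and>
      (\<forall>l'. blocks z l l' \<and> trk z l' < t \<longrightarrow> \<not> A l' (trk z l))"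
  shows "A l t \<longleftrightarrow> alive z l t"
proof -
  \<comment> \<open>The candidate lives on real coordinates and is extended by \<open>False\<close>.
    At minus infinity this agrees with \<open>tree_step\<close>, because the origin is not below
    it.\<close>
  define A' where "A' l t \<longleftrightarrow> (\<exists>r. t = ereal r \<and> A l r)" for l and t :: ereal
  have A': "A' l (ereal r) \<longleftrightarrow> A l r" for l r by (simp add: A'_def)
  have "A' l (ereal t) \<longleftrightarrow> tree_arr z l (ereal t)"
  proof (rule regular_lines.arr_unique[OF good_regular[OF assms(1)]])
    fix l and t :: ereal assume t: "t < \<infinity>"
    show "A' l t \<longleftrightarrow> tree_step z A' l t"
    proof (cases t)
      case (real r)
      show ?thesis unfolding real tree_step_real A' by (rule A)
    next
      case MInf
      then show ?thesis by (simp add: A'_def line_system.step_def)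
    qed (use t in simp)
  qed simp
  then show ?thesis by (simp add: A' alive_def)
qed

lemma alive_org: "alive z l t \<Longrightarrow> org z l \<le> t"
  unfolding alive_def by (drule line_system.arrD) simp

lemma alive_downward: "alive z l t \<Longrightarrow> org z l \<le> s \<Longrightarrow> s \<le> t \<Longrightarrow> alive z l s"
  unfolding alive_def by (erule line_system.arr_downward) simp_all

text \<open>A line blocking an axis would have to start at a coordinate below the track 0.\<close>

lemma alive_Axis: "good z \<Longrightarrow> alive z (Axis b) t \<longleftrightarrow> 0 \<le> t"
  using org_nonneg[of z] by (subst alive_iff) (auto simp: blocks_def not_less[symmetric])

lemma alive_parent: "good z \<Longrightarrow> alive z (Child l k) t \<Longrightarrow> alive z l (trk z (Child l k))"
  by (subst (asm) alive_iff) simp_all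

lemma alive_not_blocked:
  "good z \<Longrightarrow> alive z l t \<Longrightarrow> blocks z l l' \<Longrightarrow> trk z l' < t \<Longrightarrow> \<not> alive z l' (trk z l)"
  using alive_iff[of z l t] by blast

lemma alive_extend:
  assumes "good z" "alive z l s" "s \<le> t"
    "\<And>l'. blocks z l l' \<Longrightarrow> s \<le> trk z l' \<Longrightarrow> trk z l' < t \<Longrightarrow> \<not> alive z l' (trk z l)"
  shows "alive z l t"
proof -
  have "\<not> alive z l' (trk z l)" if "blocks z l l'" "trk z l' < t" for l'
    using assms(4)[OF that(1) _ that(2)] alive_not_blocked[OF assms(1,2) that(1)] by (cases "trk z l' < s") auto
  then show ?thesis
    using assms(2,3) alive_iff[OF assms(1), of l s] alive_iff[OF assms(1), of l t] by auto
qed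

lemma tree_arr_ex: "(\<exists>t. tree_arr z l t) \<longleftrightarrow> (\<exists>t. alive z l t)"
  using line_system.arr_ex_iff[of vt par "\<lambda>l. ereal (trk z l)" "\<lambda>l. ereal (org z l)"] unfolding alive_def by blast

lemma tip_eq: "line_system.tp vt par (\<lambda>l. ereal (trk z l)) (\<lambda>l. ereal (org z l)) (\<lambda>_. \<infinity>) (\<lambda>_ _. True) l = tip z l"
  unfolding line_system.tp_def tip_def
proof (rule antisym)
  show "Sup (ereal ` {t. alive z l t}) \<le> Sup {t. tree_arr z l t}"
    by (rule Sup_subset_mono) (auto simp: alive_def)
  show "Sup {t. tree_arr z l t} \<le> Sup (ereal ` {t. alive z l t})"
  proof (rule Sup_least, clarify)
    fix t assume t: "tree_arr z l t"
    have o: "ereal (org z l) \<le> t" by (rule line_system.arrD[OF t])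
    show "t \<le> Sup (ereal ` {t. alive z l t})"
    proof (cases t)
      case (real r)
      then show ?thesis using t by (intro Sup_upper) (simp add: alive_def)
    next
      case PInf
      have "alive z l r" if "org z l \<le> r" for r
        unfolding alive_def by (rule line_system.arr_downward[OF t]) (use that PInf in simp_all)
      then have A: "ereal (max (org z l) (real n)) \<le> Sup (ereal ` {t. alive z l t})" for n :: nat
        by (intro Sup_upper imageI) simp
      have "ereal (real n) \<le> Sup (ereal ` {t. alive z l t})" for n
        by (rule order_trans[OF _ A[of n]]) simp
      then have "Sup (ereal ` {t. alive z l t}) = \<infinity>"
        by (metis ereal_infty_less(1) less_PInf_Ex_of_nat not_less)
      then show ?thesis by simp
    qed (use o in simp)
  qed
qed

lemma tree_diagram_eq:
  "tree_diagram z = {if vt l then ((ereal (trk z l), ereal (org z l)), (ereal (trk z l), tip z l))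
      else ((ereal (org z l), ereal (trk z l)), (tip z l, ereal (trk z l))) | l. par l \<noteq> None \<and> (\<exists>t. alive z l t)}"
  unfolding tree_diagram_def line_system.sg_def tip_eq tree_arr_ex by simp

lemma measurable_trk_ereal: "(\<lambda>z. ereal (trk z l)) \<in> borel_measurable noise"
  "(\<lambda>z. ereal (org z l)) \<in> borel_measurable noise"
  using measurable_pos[of l] by auto

lemma measurable_alive:
  assumes "\<tau> \<in> borel_measurable noise"
  shows "Measurable.pred noise (\<lambda>z. alive z l (\<tau> z))"
  unfolding alive_def
  by (rule measurable_arr[OF measurable_trk_ereal]) (use assms in simp_all)

lemma segment_process_tree_diagram: "segment_process noise tree_diagram"
proof (rule segment_processI)
  show "(\<lambda>z. tree_sg z l) \<in> borel_measurable noise" for l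
    by (rule measurable_sg[OF measurable_trk_ereal]) simp_all
  have "Measurable.pred noise (\<lambda>z. tree_arr z l (ereal (org z l)))" for l
    by (rule measurable_arr[OF measurable_trk_ereal]) (simp_all add: measurable_trk_ereal)
  then show "Measurable.pred noise (\<lambda>z. par l \<noteq> None \<and> (\<exists>t. tree_arr z l t))" for l
    unfolding line_system.arr_ex_iff by simp
qed (simp add: tree_diagram_def)

text \<open>Lines with \<open>vt l = d\<close> are parallel to the cut at coordinate \<open>a\<close>, the others may cross it. What
  happens before the cut is governed by \<open>z1\<close>, what happens behind it by \<open>z2\<close>.\<close>

definition cut_noise ::
  "bool \<Rightarrow> real \<Rightarrow> (label \<Rightarrow> nat \<Rightarrow> real) \<Rightarrow> (label \<Rightarrow> nat \<Rightarrow> real) \<Rightarrow> label \<Rightarrow> nat \<Rightarrow> real" where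
  "cut_noise d a z1 z2 l =
    (if vt l = d then (if trk z1 l < a then z1 l else z2 l)
     else if org z1 l < a then glue (a - org z1 l) (z1 l) (z2 l) else z2 l)"

text \<open>A label can be displaced by the recombination only if it lies behind the cut in both
  systems. The coordinate that decides is the track for lines parallel to the cut and the origin for
  crossing lines.\<close>

lemma cut_noise_pos:
  fixes a :: real and d :: bool
  assumes z: "\<forall>l. good_seq (z1 l)" "\<forall>l. good_seq (z2 l)"
  defines "z \<equiv> cut_noise d a z1 z2"
  shows "(vt l = d \<longrightarrow> (trk z l = trk z1 l \<or> a \<le> trk z l \<and> a \<le> trk z1 l) \<and> (trk z1 l < a \<longrightarrow> org z l = org z1 l)) \<and>
    (vt l \<noteq> d \<longrightarrow> (org z l = org z1 l \<or> a \<le> org z l \<and> a \<le> org z1 l) \<and> (org z1 l < a \<longrightarrow> trk z l = trk z1 l))"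
proof (induction l)
  case (Child p k)
  note pp = good_seq_psum_pos
  have zl: "z l = (if vt l = d then (if trk z1 l < a then z1 l else z2 l)
     else if org z1 l < a then glue (a - org z1 l) (z1 l) (z2 l) else z2 l)" for l
    unfolding z_def cut_noise_def ..
  show ?case
  proof (cases "vt p = d")
    case True
    show ?thesis
    proof (cases "trk z1 p < a")
      case t: True
      then have "trk z p = trk z1 p" "org z p = org z1 p" "z p = z1 p"
        using Child True by (auto simp: zl[of p])
      then show ?thesis using True by simp
    qed (use Child True in auto)
  next
    case False
    show ?thesis
    proof (cases "org z1 p < a")
      case o: True
      then have eq: "org z p = org z1 p" "trk z p = trk z1 p" "z p = glue (a - org z1 p) (z1 p) (z2 p)"
        using Child False by (auto simp: zl[of p])
      have "trk z (Child p k) = trk z1 (Child p k) \<or> a \<le> trk z (Child p k) \<and> a \<le> trk z1 (Child p k)"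
      proof (cases "k < nb (z1 p) (a - org z1 p)")
        case True
        then show ?thesis by (simp add: eq psum_glue[OF z(1)[rule_format]])
      next
        case k: False
        then have "a - org z1 p < psum (z1 p) k" by (simp add: less_nb_iff[OF z(1)[rule_format]])
        then show ?thesis
          using k pp[OF z(2)[rule_format], of p "k - nb (z1 p) (a - org z1 p)"] by (simp add: eq psum_glue[OF z(1)[rule_format]])
      qed
      then show ?thesis using False eq by simp
    next
      case o: False
      then have "a \<le> org z p" "z p = z2 p" using Child False by (auto simp: zl[of p])
      then have "a \<le> trk z (Child p k)" "a \<le> trk z1 (Child p k)"
        using o pp[OF z(1)[rule_format], of p k] pp[OF z(2)[rule_format], of p k] by auto
      then show ?thesis using False by auto
    qed
  qed
qed simp

text \<open>Whatever decides the state of a line before the cut lies itself before the cut, where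
  both noises give the same positions. Comparing the iterates, which is possible from
  \<open>good_seq\<close>, transfers the agreement to \<open>arr\<close> directly.\<close>

lemma cut_noise_arr:
  fixes a :: real and d :: bool
  assumes z: "\<forall>l. good_seq (z1 l)" "\<forall>l. good_seq (z2 l)"
  defines "z \<equiv> cut_noise d a z1 z2"
  assumes "vt l = d \<and> trk z1 l < a \<or> vt l \<noteq> d \<and> org z1 l < a \<and> t \<le> a"
  shows "(tree_step z ^^ n) (\<lambda>_ _. False) l (ereal t) = (tree_step z1 ^^ n) (\<lambda>_ _. False) l (ereal t)"
  using assms(4)
proof (induction n arbitrary: l t)
  case (Suc n)
  let ?B = "(tree_step z ^^ n) (\<lambda>_ _. False)" and ?B1 = "(tree_step z1 ^^ n) (\<lambda>_ _. False)"
  note pos = cut_noise_pos[OF z, where d = d and a = a, folded z_def]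
  have eq: "trk z l = trk z1 l" "org z l = org z1 l" using pos[of l] Suc.prems by auto
  have "?B p (ereal (trk z1 l)) = ?B1 p (ereal (trk z1 l))" if p: "par l = Some p" for p
  proof -
    obtain k where l: "l = Child p k" using p by (cases l) auto
    have "org z1 p < trk z1 l" using good_seq_psum_pos[OF z(1)[rule_format], of p k] by (simp add: l)
    then show ?thesis using Suc.prems by (intro Suc.IH) (auto simp: l)
  qed
  moreover have "(blocks z l l' \<and> trk z l' < t \<longrightarrow> \<not> ?B l' (ereal (trk z l))) \<longleftrightarrow>
      (blocks z1 l l' \<and> trk z1 l' < t \<longrightarrow> \<not> ?B1 l' (ereal (trk z1 l)))" for l'
  proof -
    \<comment> \<open>Blockers before the cut are covered by the induction hypothesis; those behind
      it can stop the line in neither system.\<close>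
    consider "vt l = vt l'" | "vt l \<noteq> vt l'" "vt l' = d" "trk z1 l' < a" | "vt l \<noteq> vt l'" "vt l' = d" "a \<le> trk z1 l'"
      | "vt l \<noteq> vt l'" "vt l' \<noteq> d" "org z1 l' < a" | "vt l \<noteq> vt l'" "vt l' \<noteq> d" "a \<le> org z1 l'" by linarith
    then show ?thesis
    proof cases
      case 2
      then have "trk z l' = trk z1 l'" "org z l' = org z1 l'" using pos[of l'] by auto
      then show ?thesis using Suc.IH[of l' "trk z1 l"] 2 by (auto simp: blocks_def eq)
    next
      case 3
      then have "a \<le> trk z l'" using pos[of l'] by auto
      then show ?thesis using Suc.prems 3 by auto
    next
      case 4
      then have e: "trk z l' = trk z1 l'" "org z l' = org z1 l'" using pos[of l'] by auto
      have "trk z1 l < a" using 4 Suc.prems by auto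
      then show ?thesis using Suc.IH[of l' "trk z1 l"] 4 e by (auto simp: blocks_def eq)
    next
      case 5
      then have "a \<le> org z l'" using pos[of l'] by auto
      then show ?thesis using Suc.prems 5 by (auto simp: blocks_def eq)
    qed (simp add: blocks_def)
  qed
  ultimately show ?case
    by (simp add: tree_step_real eq)
qed simp

lemma alive_cut_noise:
  assumes "\<forall>l. good_seq (z1 l)" "\<forall>l. good_seq (z2 l)"
    and "vt l = d \<and> trk z1 l < a \<or> vt l \<noteq> d \<and> org z1 l < a \<and> t \<le> a"
  shows "alive (cut_noise d a z1 z2) l t = alive z1 l t"
  unfolding alive_def line_system.arr_def cut_noise_arr[OF assms] ..

text \<open>The axis \<open>Axis (\<not> d)\<close> also crosses the cut but is left out: it remains
  an axis of the new system instead of becoming an initial point on the cut.\<close>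

definition exits :: "bool \<Rightarrow> real \<Rightarrow> (label \<Rightarrow> nat \<Rightarrow> real) \<Rightarrow> label set" where
  "exits d a z = {l. vt l \<noteq> d \<and> par l \<noteq> None \<and> org z l < a \<and> alive z l a}"

lemma exits_cut_noise:
  assumes z: "\<forall>l. good_seq (z1 l)" "\<forall>l. good_seq (z2 l)"
  shows "exits d a (cut_noise d a z1 z2) = exits d a z1"
    "l \<in> exits d a z1 \<Longrightarrow> trk (cut_noise d a z1 z2) l = trk z1 l"
proof -
  note pos = cut_noise_pos[OF z, where d = d and a = a]
  show "exits d a (cut_noise d a z1 z2) = exits d a z1"
  proof (rule set_eqI)
    fix l show "l \<in> exits d a (cut_noise d a z1 z2) \<longleftrightarrow> l \<in> exits d a z1"
      using pos[of l] alive_cut_noise[OF z, of l d a a] by (auto simp: exits_def)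
  qed
  show "l \<in> exits d a z1 \<Longrightarrow> trk (cut_noise d a z1 z2) l = trk z1 l"
    using pos[of l] by (auto simp: exits_def)
qed

definition exit_gaps :: "bool \<Rightarrow> real \<Rightarrow> (label \<Rightarrow> nat \<Rightarrow> real) \<Rightarrow> nat \<Rightarrow> real" where
  "exit_gaps d a z = gap_seq (\<lambda>t. card {l \<in> exits d a z. trk z l \<le> t})"

definition exit_at :: "bool \<Rightarrow> real \<Rightarrow> (label \<Rightarrow> nat \<Rightarrow> real) \<Rightarrow> nat \<Rightarrow> label" where
  "exit_at d a z k =
    from_nat (LEAST n. (from_nat n :: label) \<in> exits d a z \<and> trk z (from_nat n) = psum (exit_gaps d a z) k)"

text \<open>Almost sure by \<open>AE_regular_exits\<close>. It allows the exits to be numbered by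
  increasing track, as children of the new axis must be.\<close>

definition regular_exits :: "bool \<Rightarrow> real \<Rightarrow> (label \<Rightarrow> nat \<Rightarrow> real) \<Rightarrow> bool" where
  "regular_exits d a z \<longleftrightarrow> good_seq (exit_gaps d a z) \<and> trk z ` exits d a z = range (psum (exit_gaps d a z))"

text \<open>In the labels of the new system these are the lines that cross the cut; they start on
  the new boundary, while their old counterparts start before it. They are the lines whose sequences
  are divided between \<open>z1\<close> and \<open>z2\<close>.\<close>

definition crossing :: "bool \<Rightarrow> label \<Rightarrow> bool" where
  "crossing d l \<longleftrightarrow> l = Axis (\<not> d) \<or> par l = Some (Axis d)"

text \<open>After the cut, \<open>Axis d\<close> stands for the line along which the plane is cut, so that its children
  are the lines crossing it. \<open>old_label\<close> maps the labels of the new system to those of the old one;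
  of the children of a crossing line only those born behind the cut remain.\<close>

primrec old_label :: "bool \<Rightarrow> real \<Rightarrow> (label \<Rightarrow> nat \<Rightarrow> real) \<Rightarrow> label \<Rightarrow> label" where
  "old_label d a z (Axis b) = Axis b"
| "old_label d a z (Child l k) =
    (if l = Axis d then exit_at d a z k
     else if crossing d l
     then Child (old_label d a z l) (k + nb (z (old_label d a z l)) (a - org z (old_label d a z l)))
     else Child (old_label d a z l) k)"

text \<open>From \<open>z1\<close> come the gaps on the new axis and the relabelling; every other
  sequence is taken whole from \<open>z2\<close>. For a crossing line it is the part of its
  \<open>glue\<close> behind the cut.\<close>

definition new_noise ::
  "bool \<Rightarrow> real \<Rightarrow> (label \<Rightarrow> nat \<Rightarrow> real) \<Rightarrow> (label \<Rightarrow> nat \<Rightarrow> real) \<Rightarrow> label \<Rightarrow> nat \<Rightarrow> real" where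
  "new_noise d a z1 z2 l = (if l = Axis d then exit_gaps d a z1 else z2 (old_label d a z1 l))"

lemma exit_at:
  assumes "good z" "regular_exits d a z"
  shows "exit_at d a z k \<in> exits d a z" "trk z (exit_at d a z k) = psum (exit_gaps d a z) k"
    "l \<in> exits d a z \<Longrightarrow> trk z l = psum (exit_gaps d a z) k \<Longrightarrow> l = exit_at d a z k"
proof -
  have "psum (exit_gaps d a z) k \<in> trk z ` exits d a z"
    using assms(2) by (auto simp: regular_exits_def)
  then obtain l0 where l0: "l0 \<in> exits d a z" "trk z l0 = psum (exit_gaps d a z) k" by auto
  then have "\<exists>n. (from_nat n :: label) \<in> exits d a z \<and> trk z (from_nat n) = psum (exit_gaps d a z) k"
    by (intro exI[of _ "to_nat l0"]) simp
  from LeastI_ex[OF this]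
  show 1: "exit_at d a z k \<in> exits d a z" "trk z (exit_at d a z k) = psum (exit_gaps d a z) k"
    unfolding exit_at_def by auto
  show "l = exit_at d a z k" if "l \<in> exits d a z" "trk z l = psum (exit_gaps d a z) k"
    using that 1 by (intro good_distinct[OF assms(1)]) (auto simp: exits_def)
qed

section \<open>Pathwise identification of the two systems behind the cut\<close>

definition cut_x :: "bool \<Rightarrow> real \<Rightarrow> real" where "cut_x d a = (if d then a else 0)"
definition cut_y :: "bool \<Rightarrow> real \<Rightarrow> real" where "cut_y d a = (if d then 0 else a)"

lemma trk_crossing_child:
  assumes seq: "\<forall>l. good_seq (z1 l)" "\<forall>l. good_seq (z2 l)" and h: "vt h \<noteq> d" "org z1 h < a"
  shows "trk (cut_noise d a z1 z2) (Child h k) = (if k < nb (z1 h) (a - org z1 h) then org z1 h + psum (z1 h) k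
    else a + psum (z2 h) (k - nb (z1 h) (a - org z1 h)))"
proof -
  have "cut_noise d a z1 z2 h = glue (a - org z1 h) (z1 h) (z2 h)" using h by (simp add: cut_noise_def)
  moreover have "org (cut_noise d a z1 z2) h = org z1 h"
    using cut_noise_pos[OF seq, where d = d and a = a and l = h] h by auto
  ultimately show ?thesis using seq by (simp add: psum_glue)
qed

locale cut =
  fixes d :: bool and a :: real and z1 z2 :: "label \<Rightarrow> nat \<Rightarrow> real"
  assumes a: "0 < a" and good1: "good z1" and seq2: "\<forall>l. good_seq (z2 l)"
    and regular: "regular_exits d a z1"
begin

abbreviation "zO \<equiv> cut_noise d a z1 z2"
abbreviation "zN \<equiv> new_noise d a z1 z2"
abbreviation "old \<equiv> old_label d a z1"

lemma seq1: "\<forall>l. good_seq (z1 l)" using good1 by (simp add: good_def)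

lemma seq2': "good_seq (z2 l)" using seq2 by simp

lemmas cpos = cut_noise_pos[OF seq1 seq2, where d = d and a = a]

text \<open>Dictionary of coordinates: the one transverse to the cut is measured from the cut. The
  exception is a crossing line, whose new origin is 0 although its old origin lies before the
  cut.\<close>

lemma old_position:
  assumes "l \<noteq> Axis d"
  shows "vt (old l) = vt l \<and>
    (if vt l = d then a < trk zO (old l) \<and> trk zN l = trk zO (old l) - a \<and> org zN l = org zO (old l)
     else trk zN l = trk zO (old l) \<and>
       (if crossing d l then org zN l = 0 \<and> org z1 (old l) < a \<and> org zO (old l) < a
        else a < org zO (old l) \<and> org zN l = org zO (old l) - a))"
  using assms
proof (induction l)
  case (Axis b)
  then show ?case using a by (auto simp: crossing_def)
next
  case (Child l k)
  show ?case
  proof (cases "l = Axis d")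
    case True
    note e = exit_at(1,2)[OF good1 regular, of k]
    then have ve: "vt (exit_at d a z1 k) \<noteq> d" "org z1 (exit_at d a z1 k) < a" by (auto simp: exits_def)
    have "trk zO (exit_at d a z1 k) = trk z1 (exit_at d a z1 k)" "org zO (exit_at d a z1 k) < a"
      using cpos[of "exit_at d a z1 k"] ve by auto
    then show ?thesis using ve e(2) by (auto simp: True crossing_def new_noise_def)
  next
    case l: False
    note IH = Child.IH[OF l]
    have nl: "zN l = z2 (old l)" using l by (simp add: new_noise_def)
    show ?thesis
    proof (cases "vt l = d")
      case True
      have cr: "\<not> crossing d l" "\<not> crossing d (Child l k)"
        using True l by (cases l; auto simp: crossing_def)+
      have "\<not> trk z1 (old l) < a" using IH True cpos[of "old l"] by auto
      then have "zO (old l) = z2 (old l)" using IH True by (simp add: cut_noise_def)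
      then show ?thesis using IH True cr l nl by auto
    next
      case False
      show ?thesis
      proof (cases "crossing d l")
        case True
        \<comment> \<open>\<open>?m\<close> counts the children born before the cut; skipping them
          makes \<open>glue\<close> continue with the arrivals of \<open>z2\<close>, shifted by
          \<open>a\<close>.\<close>
        let ?m = "nb (z1 (old l)) (a - org z1 (old l))"
        have "trk zO (Child (old l) (k + ?m)) = a + psum (z2 (old l)) k"
          using IH False True by (subst trk_crossing_child[OF seq1 seq2]) auto
        moreover have "0 < psum (z2 (old l)) k" by (rule good_seq_psum_pos[OF seq2'])
        moreover have "old (Child l k) = Child (old l) (k + ?m)" using l True by simp
        moreover have "trk zN (Child l k) = psum (z2 (old l)) k" using IH False True nl by simp
        ultimately show ?thesis using IH False True by (simp del: trk_simps old_label.simps)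
      next
        case cr: False
        have "\<not> org z1 (old l) < a" using IH False cr cpos[of "old l"] by auto
        then have "zO (old l) = z2 (old l)" using IH False by (simp add: cut_noise_def)
        moreover have "0 < psum (z2 (old l)) k" by (rule good_seq_psum_pos[OF seq2'])
        ultimately show ?thesis using IH False cr l nl by auto
      qed
    qed
  qed
qed

text \<open>Ensures that distinct new labels read distinct, hence independent, coordinates of
  \<open>z2\<close>. Exits cannot be confused with other labels, because the old origin of a line
  not parallel to the cut tells whether it crosses.\<close>

lemma old_inj: "l \<noteq> Axis d \<Longrightarrow> l' \<noteq> Axis d \<Longrightarrow> old l = old l' \<Longrightarrow> l = l'"
proof (induction l arbitrary: l')
  case (Axis b)
  show ?case
  proof (cases l')
    case (Child m k)
    have "par (exit_at d a z1 k) \<noteq> None" using exit_at(1)[OF good1 regular, of k] by (simp add: exits_def)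
    then have "exit_at d a z1 k \<noteq> Axis b" by (metis par.simps(1))
    then show ?thesis using Axis.prems Child by (auto split: if_splits)
  qed (use Axis.prems in simp)
next
  case (Child l k)
  note p = old_position[OF Child.prems(1)] and p' = old_position[OF Child.prems(2)]
  have e: "par (exit_at d a z1 i) \<noteq> None" "vt (exit_at d a z1 i) \<noteq> d" for i
    using exit_at(1)[OF good1 regular, of i] by (simp_all add: exits_def)
  show ?case
  proof (cases l')
    case (Axis b)
    then show ?thesis using Child.prems e(1)[of k] by (auto split: if_splits)
  next
    case l': (Child m j)
    show ?thesis
    proof (cases "l = Axis d \<or> m = Axis d")
      case True
      have "old (Child l k) \<in> range (exit_at d a z1)"
      proof (cases "l = Axis d")
        case False
        then have "old l' = exit_at d a z1 j" using True by (simp add: l')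
        then show ?thesis using Child.prems(3) by simp
      qed simp
      then have "vt (old (Child l k)) \<noteq> d" using e(2) by (auto simp del: old_label.simps)
      then have v: "vt (Child l k) \<noteq> d" "vt (Child m j) \<noteq> d" using p p' Child.prems(3) by (auto simp: l')
      have "crossing d (Child l k) \<longleftrightarrow> crossing d (Child m j)"
        using p p' v Child.prems(3) unfolding l' by (auto split: if_splits)
      then have "l = Axis d" "m = Axis d" using True by (auto simp: crossing_def)
      then have "psum (exit_gaps d a z1) k = psum (exit_gaps d a z1) j"
        using Child.prems(3) exit_at(2)[OF good1 regular, of k] exit_at(2)[OF good1 regular, of j] by (simp add: l')
      moreover have "inj (psum (exit_gaps d a z1))"
        using regular by (intro strict_mono_imp_inj_on good_seq_strict_mono) (simp add: regular_exits_def)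
      ultimately show ?thesis using \<open>l = Axis d\<close> \<open>m = Axis d\<close> by (auto simp: l' dest: injD)
    next
      case False
      then have "old l = old m" using Child.prems(3) by (auto simp: l' split: if_splits)
      then have "l = m" using False by (intro Child.IH) auto
      then show ?thesis using Child.prems(3) False by (auto simp: l' split: if_splits)
    qed
  qed
qed

end

locale cut_good = cut +
  assumes goodO: "good (cut_noise d a z1 z2)" and goodN: "good (new_noise d a z1 z2)"
    and not_on_cut: "\<And>l k. trk (cut_noise d a z1 z2) (Child l k) \<noteq> a"
begin

text \<open>Induct along the ancestry: a parent is alive where its child is born. The decisive case
  is a child of a parallel line before the cut: if it is seen at or behind the cut, it reached the
  cut and is an exit.\<close>

lemma old_surj:
  assumes "alive zO x t" "vt x = d \<Longrightarrow> a < trk zO x" "vt x \<noteq> d \<Longrightarrow> a \<le> t"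
  shows "\<exists>l. l \<noteq> Axis d \<and> old l = x"
  using assms
proof (induction x arbitrary: t)
  case (Axis b)
  then have "b \<noteq> d" using a by auto
  then show ?case by (intro exI[of _ "Axis b"]) auto
next
  case (Child p k)
  have par: "alive zO p (trk zO (Child p k))" by (rule alive_parent[OF goodO Child.prems(1)])
  show ?case
  proof (cases "vt p = d")
    case False
    then have x: "a < trk zO (Child p k)" using Child.prems(2) by simp
    obtain l where l: "l \<noteq> Axis d" "old l = p"
      using Child.IH[OF par] False x by auto
    note pos = old_position[OF l(1)]
    show ?thesis
    proof (cases "crossing d l")
      case True
      let ?m = "nb (z1 p) (a - org z1 p)"
      have "\<not> k < ?m"
      proof
        assume *: "k < ?m"
        then have "psum (z1 p) k \<le> a - org z1 p" using less_nb_iff seq1 by blast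
        then show False using x * pos True False trk_crossing_child[OF seq1 seq2, of p d a k] by (simp add: l)
      qed
      then have "old (Child l (k - ?m)) = Child p k" using l True by simp
      then show ?thesis by (intro exI[of _ "Child l (k - ?m)"]) simp
    next
      case cr: False
      then have "old (Child l k) = Child p k" using l by simp
      then show ?thesis by (intro exI[of _ "Child l k"]) simp
    qed
  next
    case True
    then have t: "a \<le> t" using Child.prems(3) by simp
    consider "trk zO p < a" | "trk zO p = a" | "a < trk zO p" by linarith
    then show ?thesis
    proof cases
      case 1
      then have "alive zO (Child p k) a" using alive_downward[OF Child.prems(1), of a] t by simp
      then have "Child p k \<in> exits d a zO" using 1 True by (simp add: exits_def)
      then have ex: "Child p k \<in> exits d a z1" using exits_cut_noise(1)[OF seq1 seq2] by simp
      then have "trk z1 (Child p k) \<in> range (psum (exit_gaps d a z1))"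
        using regular by (auto simp: regular_exits_def simp del: trk_simps)
      then obtain j where "trk z1 (Child p k) = psum (exit_gaps d a z1) j" by auto
      then have "Child p k = exit_at d a z1 j" using exit_at(3)[OF good1 regular ex] by simp
      then show ?thesis by (intro exI[of _ "Child (Axis d) j"]) simp
    next
      \<comment> \<open>A parent lying exactly on the cut is excluded by \<open>not_on_cut\<close>,
        or by 0 < a if it is an axis.\<close>
      case 2
      then show ?thesis using not_on_cut a by (cases p) (simp_all del: trk_simps(2))
    next
      case 3
      obtain l where l: "l \<noteq> Axis d" "old l = p"
        using Child.IH[OF par] 3 True by auto
      have "\<not> crossing d l" using l True old_position[OF l(1)] by (cases l) (auto simp: crossing_def)
      then have "old (Child l k) = Child p k" using l by simp
      then show ?thesis by (intro exI[of _ "Child l k"]) simp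
    qed
  qed
qed

text \<open>Candidate for the states of the new system, obtained by transporting those of
  \<open>zO\<close>; the new axis is declared alive from 0 on.\<close>

definition alive_new :: "label \<Rightarrow> real \<Rightarrow> bool" where
  "alive_new l t \<longleftrightarrow> (if l = Axis d then 0 \<le> t else if vt l = d then alive zO (old l) t
     else 0 \<le> t \<and> alive zO (old l) (t + a))"

lemma old_child_par:
  assumes "l \<noteq> Axis d" shows "par (old (Child l k)) = Some (old l)"
  using assms by simp

lemma exit_alive: "crossing d l \<Longrightarrow> l \<noteq> Axis d \<Longrightarrow> alive zO (old l) a"
proof (cases l)
  case (Axis b)
  assume "crossing d l" "l \<noteq> Axis d"
  then show ?thesis using a alive_Axis[OF goodO] Axis by simp
next
  case (Child m k)
  assume "crossing d l"
  then have "m = Axis d" by (simp add: crossing_def Child)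
  then have "old l \<in> exits d a z1" using exit_at(1)[OF good1 regular] by (simp add: Child)
  then have "old l \<in> exits d a zO" using exits_cut_noise(1)[OF seq1 seq2] by simp
  then show ?thesis by (simp add: exits_def)
qed

text \<open>Blockers correspond under \<open>old\<close>. Old blockers of a crossing line before the
  cut have no new counterpart, hence the last condition; the new axis never blocks, since its track
  0 exceeds no origin.\<close>

lemma blocked_iff:
  fixes t :: real
  assumes l: "l \<noteq> Axis d"
  defines "t' \<equiv> (if vt l = d then t else t + a)"
  shows "(\<exists>l'. blocks zN l l' \<and> trk zN l' < t \<and> alive_new l' (trk zN l)) \<longleftrightarrow>
    (\<exists>x. blocks zO (old l) x \<and> trk zO x < t' \<and> alive zO x (trk zO (old l)) \<and> (vt l \<noteq> d \<longrightarrow> a < trk zO x))"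
    (is "?N \<longleftrightarrow> ?O")
proof
  note pos = old_position[OF l]
  have onn: "0 \<le> org zN m" "0 \<le> trk zN m" for m using org_nonneg[OF goodN] trk_nonneg[OF goodN] by auto
  {
    assume ?N
    then obtain l' where l': "blocks zN l l'" "trk zN l' < t" "alive_new l' (trk zN l)" by blast
    have nd: "l' \<noteq> Axis d" using l'(1) onn(1)[of l] by (auto simp: blocks_def)
    note pos' = old_position[OF nd]
    show ?O
    proof (intro exI[of _ "old l'"] conjI)
      have v: "vt l \<noteq> vt l'" using l'(1) by (simp add: blocks_def)
      show "alive zO (old l') (trk zO (old l))"
        using l'(3) pos pos' v nd by (auto simp: alive_new_def split: if_splits)
      show "trk zO (old l') < t'" using l'(2) pos pos' v by (auto simp: t'_def split: if_splits)
      show "blocks zO (old l) (old l')"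
        using l'(1) pos pos' v unfolding blocks_def by (auto split: if_splits)
      show "vt l \<noteq> d \<longrightarrow> a < trk zO (old l')" using pos' v by auto
    qed
  next
    assume ?O
    then obtain x where x: "blocks zO (old l) x" "trk zO x < t'" "alive zO x (trk zO (old l))"
      "vt l \<noteq> d \<longrightarrow> a < trk zO x" by blast
    have v: "vt l \<noteq> vt x" using x(1) pos by (simp add: blocks_def)
    have "\<exists>l'. l' \<noteq> Axis d \<and> old l' = x"
      by (rule old_surj[OF x(3)]) (use x(4) v pos in auto)
    then obtain l' where l': "l' \<noteq> Axis d" "old l' = x" by blast
    note pos' = old_position[OF l'(1)]
    have v': "vt l \<noteq> vt l'" using v pos' l' by simp
    show ?N
    proof (intro exI[of _ l'] conjI)
      show "alive_new l' (trk zN l)"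
        using x(3) pos pos' v' l' onn(2)[of l] by (auto simp: alive_new_def split: if_splits)
      show "trk zN l' < t" using x(2) pos pos' v' l' by (auto simp: t'_def split: if_splits)
      show "blocks zN l l'"
        using x(1) pos pos' v' l' unfolding blocks_def by (auto split: if_splits)
    qed
  }
qed

text \<open>By \<open>alive_unique\<close> it suffices that the transported states satisfy the
  evolution equation of \<open>zN\<close>.\<close>

lemma alive_new_eq: "alive_new l t \<longleftrightarrow> alive zN l t"
proof (rule alive_unique[OF goodN])
  fix l t
  have onn: "0 \<le> org zN m" "0 \<le> trk zN m" for m using org_nonneg[OF goodN] trk_nonneg[OF goodN] by auto
  show "alive_new l t \<longleftrightarrow> (\<forall>p. par l = Some p \<longrightarrow> alive_new p (trk zN l)) \<and> org zN l \<le> t \<and>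
    (\<forall>l'. blocks zN l l' \<and> trk zN l' < t \<longrightarrow> \<not> alive_new l' (trk zN l))"
  proof (cases l)
    case (Axis b)
    have "\<not> blocks zN l l'" for l' using onn(1)[of l'] by (auto simp: blocks_def Axis)
    then show ?thesis using a alive_Axis[OF goodO] by (auto simp: Axis alive_new_def)
  next
    case (Child m k)
    have l: "l \<noteq> Axis d" by (simp add: Child)
    note pos = old_position[OF l]
    have B: "(\<forall>l'. blocks zN l l' \<and> trk zN l' < t \<longrightarrow> \<not> alive_new l' (trk zN l)) \<longleftrightarrow>
      \<not> (\<exists>x. blocks zO (old l) x \<and> trk zO x < (if vt l = d then t else t + a) \<and>
        alive zO x (trk zO (old l)) \<and> (vt l \<noteq> d \<longrightarrow> a < trk zO x))"
      unfolding blocked_iff[OF l, symmetric] by blast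
    note O = alive_iff[OF goodO, of "old l"]
    show ?thesis
    proof (cases "vt l = d")
      case True
      then have m: "m \<noteq> Axis d" "vt m \<noteq> d" by (auto simp: Child)
      have "alive_new m (trk zN l) \<longleftrightarrow> alive zO (old m) (trk zO (old l))"
        using m pos True onn(2)[of l] by (simp add: alive_new_def)
      moreover have "par (old l) = Some (old m)" using old_child_par[OF m(1)] by (simp add: Child)
      ultimately show ?thesis unfolding B
        using True pos O[of t] l by (auto simp: alive_new_def Child simp del: old_label.simps)
    next
      case False
      show ?thesis
      proof (cases "crossing d l")
        case True
        then have m: "m = Axis d" by (simp add: Child crossing_def)
        \<comment> \<open>A crossing line has survived up to \<open>a\<close>, so from then on only
          blockers at or behind the cut matter; tracks equal to \<open>a\<close> are excluded
          next.\<close>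
        have ex: "alive zO (old l) a" by (rule exit_alive[OF True l])
        have ne: "trk zO x \<noteq> a" if "blocks zO (old l) x" for x
          using that not_on_cut[of _] a by (cases x) (simp_all del: trk_simps(2))
        have "alive_new l t \<longleftrightarrow> 0 \<le> t \<and> alive zO (old l) (t + a)"
          using l False by (simp add: alive_new_def)
        also have "\<dots> \<longleftrightarrow> 0 \<le> t \<and> \<not> (\<exists>x. blocks zO (old l) x \<and> trk zO x < t + a \<and>
          alive zO x (trk zO (old l)) \<and> a < trk zO x)"
        proof (intro conj_cong refl iffI notI)
          assume "alive zO (old l) (t + a)" "\<exists>x. blocks zO (old l) x \<and> trk zO x < t + a \<and>
            alive zO x (trk zO (old l)) \<and> a < trk zO x"
          then show False using alive_not_blocked[OF goodO] by blast
        next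
          assume "0 \<le> t" and *: "\<not> (\<exists>x. blocks zO (old l) x \<and> trk zO x < t + a \<and>
            alive zO x (trk zO (old l)) \<and> a < trk zO x)"
          show "alive zO (old l) (t + a)"
          proof (rule alive_extend[OF goodO ex])
            fix x assume x: "blocks zO (old l) x" "a \<le> trk zO x" "trk zO x < t + a"
            then have "a < trk zO x" using ne[OF x(1)] by simp
            then show "\<not> alive zO x (trk zO (old l))" using * x by blast
          qed (use \<open>0 \<le> t\<close> in simp)
        qed
        finally show ?thesis unfolding B
          using False True pos onn(2)[of l] by (simp add: Child m alive_new_def del: trk_simps old_label.simps)
      next
        case cr: False
        then have m: "m \<noteq> Axis d" "vt m = d" using False by (auto simp: Child crossing_def)
        have "alive_new m (trk zN l) \<longleftrightarrow> alive zO (old m) (trk zO (old l))"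
          using m pos False by (simp add: alive_new_def)
        moreover have "par (old l) = Some (old m)" using old_child_par[OF m(1)] by (simp add: Child)
        moreover have "a < trk zO x" if "blocks zO (old l) x" for x
          using that pos False cr by (auto simp: blocks_def)
        ultimately have "alive zO (old l) (t + a) \<longleftrightarrow> alive_new m (trk zN l) \<and> org zN l \<le> t \<and>
          \<not> (\<exists>x. blocks zO (old l) x \<and> trk zO x < t + a \<and> alive zO x (trk zO (old l)) \<and> a < trk zO x)"
          using pos False cr O[of "t + a"] by auto
        moreover have "alive_new l t \<longleftrightarrow> 0 \<le> t \<and> alive zO (old l) (t + a)"
          using l False by (simp add: alive_new_def)
        moreover have "org zN l \<le> t \<Longrightarrow> 0 \<le> t" using onn(1)[of l] by simp
        ultimately show ?thesis unfolding B using False by (auto simp: Child simp del: trk_simps old_label.simps org_simps)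
      qed
    qed
  qed
qed

lemma old_par: "par l \<noteq> None \<Longrightarrow> par (old l) \<noteq> None"
  using exit_at(1)[OF good1 regular] by (cases l) (auto simp: exits_def)

lemma alive_zN: "par l \<noteq> None \<Longrightarrow> alive zN l t \<longleftrightarrow> (if vt l = d then alive zO (old l) t else 0 \<le> t \<and> alive zO (old l) (t + a))"
  unfolding alive_new_eq[symmetric] alive_new_def by auto

lemma tip_new:
  assumes l: "par l \<noteq> None" and ex: "alive zN l t"
  shows "if vt l = d then tip zN l = tip zO (old l) \<and> 0 \<le> tip zO (old l)
    else tip zN l + ereal a = tip zO (old l) \<and> ereal a \<le> tip zO (old l)"
proof (cases "vt l = d")
  case True
  have "alive zO (old l) t" using ex alive_zN[OF l] True by simp
  then have "0 \<le> t" "ereal t \<le> tip zO (old l)"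
    using alive_org[of zO "old l" t] org_nonneg[OF goodO, of "old l"] unfolding tip_def by (auto intro!: Sup_upper)
  then have "0 \<le> tip zO (old l)" by (metis ereal_less_eq(5) order_trans)
  then show ?thesis using True alive_zN[OF l] by (simp add: tip_def)
next
  case False
  let ?x = "old l"
  let ?T = "{t. alive zN l t}"
  have T: "?T = {t. 0 \<le> t \<and> alive zO ?x (t + a)}" using alive_zN[OF l] False by simp
  have t: "0 \<le> t" "alive zO ?x (t + a)" using ex T by auto
  have le: "ereal (t + a) \<le> tip zO ?x" using t unfolding tip_def by (auto intro!: Sup_upper)
  have "tip zN l + ereal a = (SUP t\<in>?T. ereal t + ereal a)"
    unfolding tip_def by (rule SUP_ereal_add_left[symmetric]) (use ex in auto)
  also have "\<dots> = tip zO ?x"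
  proof (rule antisym)
    show "(SUP t\<in>?T. ereal t + ereal a) \<le> tip zO ?x"
      unfolding tip_def by (rule SUP_least) (auto simp: T intro!: Sup_upper)
    show "tip zO ?x \<le> (SUP t\<in>?T. ereal t + ereal a)"
      unfolding tip_def[of zO]
    proof (rule Sup_least, clarify)
      fix s assume s: "alive zO ?x s"
      show "ereal s \<le> (SUP t\<in>?T. ereal t + ereal a)"
      proof (cases "a \<le> s")
        case True
        then have "s - a \<in> ?T" using s by (simp add: T)
        then show ?thesis by (rule SUP_upper2) simp
      next
        case False
        then show ?thesis using ex t(1) by (intro SUP_upper2[of t]) auto
      qed
    qed
  qed
  finally show ?thesis using False le t(1) by (auto intro: order_trans[OF _ le])
qed

text \<open>A supremum need not be attained. But a line that is not alive at \<open>a\<close> has a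
  blocker with track below \<open>a\<close>, and this bounds its tip away from
  \<open>a\<close>.\<close>

lemma tip_reaches:
  assumes al: "alive zO x t" and tip: "ereal a \<le> tip zO x" and x: "par x \<noteq> None"
  shows "\<exists>s\<ge>a. alive zO x s"
proof (rule ccontr)
  assume no: "\<not> (\<exists>s\<ge>a. alive zO x s)"
  then have ta: "t < a" using al by (meson not_le)
  have "\<not> alive zO x a" using no by auto
  then obtain y where y: "blocks zO x y" "t \<le> trk zO y" "trk zO y < a" "alive zO y (trk zO x)"
    using alive_extend[OF goodO al, of a] ta by auto
  have "s \<le> trk zO y" if "alive zO x s" for s
    using alive_not_blocked[OF goodO that y(1)] y(4) by force
  then have "tip zO x \<le> ereal (trk zO y)"
    unfolding tip_def by (intro Sup_least) auto
  then have "ereal a \<le> ereal (trk zO y)" using tip by (rule order_trans[rotated])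
  then show False using y(3) by simp
qed


abbreviation tree_segment where
  "tree_segment z l \<equiv> (if vt l then ((ereal (trk z l), ereal (org z l)), (ereal (trk z l), tip z l))
      else ((ereal (org z l), ereal (trk z l)), (tip z l, ereal (trk z l))))"

abbreviation "clip s \<equiv> ((max (ereal (cut_x d a)) (fst (fst s)), max (ereal (cut_y d a)) (snd (fst s))), snd s)"
abbreviation "kept s \<equiv> ereal (cut_x d a) \<le> fst (snd s) \<and> ereal (cut_y d a) \<le> snd (snd s)"
abbreviation "moved s \<equiv> ((fst (fst s) + ereal (cut_x d a), snd (fst s) + ereal (cut_y d a)), (fst (snd s) + ereal (cut_x d a), snd (snd s) + ereal (cut_y d a)))"

lemma segment_new:
  assumes l: "par l \<noteq> None" and ex: "alive zN l t"
  shows "kept (tree_segment zO (old l)) \<and> clip (tree_segment zO (old l)) = moved (tree_segment zN l)"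
proof -
  have nd: "l \<noteq> Axis d" using l by auto
  note pos = old_position[OF nd] and tip = tip_new[OF l ex]
  have nn: "0 \<le> trk zO (old l)" "0 \<le> org zO (old l)" using trk_nonneg[OF goodO] org_nonneg[OF goodO] by auto
  show ?thesis
  proof (cases "vt l = d")
    case True
    then have eq: "vt (old l) = d" "a < trk zO (old l)" "trk zN l = trk zO (old l) - a" "org zN l = org zO (old l)"
      "tip zN l = tip zO (old l)" "0 \<le> tip zO (old l)"
      using pos tip by auto
    show ?thesis using True eq nn by (cases d) (simp_all add: cut_x_def cut_y_def max_def zero_ereal_def[symmetric])
  next
    case False
    then have eq: "vt (old l) \<noteq> d" "trk zN l = trk zO (old l)" "org zN l + a = max a (org zO (old l))"
      "tip zN l + ereal a = tip zO (old l)" "ereal a \<le> tip zO (old l)"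
      using pos tip by (auto split: if_splits)
    have "ereal (org zN l) + ereal a = max (ereal a) (ereal (org zO (old l)))" using eq(3) by (simp add: max_def)
    then show ?thesis using False eq nn by (cases d) (simp_all add: cut_x_def cut_y_def max_def zero_ereal_def[symmetric])
  qed
qed

text \<open>\<open>old_surj\<close> supplies a new label for each kept segment, and
  \<open>segment_new\<close> matches clipping of old origins with translation of new ones.\<close>

lemma restrict_cut: "restrict_quadrant (cut_x d a) (cut_y d a) (tree_diagram zO) = translate (cut_x d a) (cut_y d a) (tree_diagram zN)"
proof -
  have O: "tree_diagram zO = {tree_segment zO x | x. par x \<noteq> None \<and> (\<exists>t. alive zO x t)}"
    and N: "tree_diagram zN = {tree_segment zN x | x. par x \<noteq> None \<and> (\<exists>t. alive zN x t)}"
    by (rule tree_diagram_eq)+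
  show ?thesis
    unfolding restrict_quadrant_image translate_image
  proof (intro set_eqI iffI)
    fix s assume "s \<in> clip ` {s \<in> tree_diagram zO. kept s}"
    then obtain x t where x: "par x \<noteq> None" "alive zO x t" "kept (tree_segment zO x)" "s = clip (tree_segment zO x)"
      unfolding O by blast
    have ex: "\<exists>l. l \<noteq> Axis d \<and> old l = x \<and> (\<exists>t. alive zN l t)"
    proof (cases "vt x = d")
      case True
      obtain p k where pk: "x = Child p k" using x(1) by (cases x) auto
      have "a \<le> trk zO x" using x(3) True by (cases d) (simp_all add: cut_x_def cut_y_def)
      then have "a < trk zO x" using not_on_cut[of p k] unfolding pk by (simp del: trk_simps)
      then obtain l where l: "l \<noteq> Axis d" "old l = x" using old_surj[OF x(2)] True by auto
      have "vt l = d" using old_position[OF l(1)] l(2) True by simp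
      then have "alive zN l t" unfolding alive_new_eq[symmetric] alive_new_def using l x(2) by simp
      then show ?thesis using l by blast
    next
      case False
      then have "ereal a \<le> tip zO x" using x(3) by (cases d) (simp_all add: cut_x_def cut_y_def)
      then obtain r where r: "a \<le> r" "alive zO x r" using tip_reaches[OF x(2) _ x(1)] by blast
      obtain l where l: "l \<noteq> Axis d" "old l = x" using old_surj[OF r(2)] False r(1) by auto
      have "vt l \<noteq> d" using old_position[OF l(1)] l(2) False by simp
      then have "alive zN l (r - a)" unfolding alive_new_eq[symmetric] alive_new_def using l r by simp
      then show ?thesis using l by blast
    qed
    then obtain l t' where l: "l \<noteq> Axis d" "old l = x" "alive zN l t'" by blast
    have pl: "par l \<noteq> None" using x(1) l(2) by (cases l) auto
    have "s = moved (tree_segment zN l)" by (rule trans[OF x(4) conjunct2[OF segment_new[OF pl l(3)], unfolded l(2)]])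
    then show "s \<in> moved ` {s \<in> tree_diagram zN. True}" unfolding N using pl l(3) by blast
  next
    fix s assume "s \<in> moved ` {s \<in> tree_diagram zN. True}"
    then obtain l t where l: "par l \<noteq> None" "alive zN l t" "s = moved (tree_segment zN l)"
      unfolding N by blast
    have "\<exists>t. alive zO (old l) t" using l(2) alive_zN[OF l(1)] by (auto split: if_splits)
    moreover note segment_new[OF l(1,2)] old_par[OF l(1)]
    ultimately have "tree_segment zO (old l) \<in> {s \<in> tree_diagram zO. kept s}" "s = clip (tree_segment zO (old l))"
      unfolding O l(3) by (blast, simp)
    then show "s \<in> clip ` {s \<in> tree_diagram zO. kept s}" by (rule rev_image_eqI)
  qed
qed

end

text \<open>Presents two independent families as one family of independent pairs, the form in which
  \<open>distr_triangular\<close> can treat \<open>cut_noise\<close>.\<close>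

lemma distr_zip:
  assumes E1: "prob_space E1" and E2: "prob_space E2"
  shows "distr (PiM UNIV (\<lambda>_::'i. E1) \<Otimes>\<^sub>M PiM UNIV (\<lambda>_. E2)) (PiM UNIV (\<lambda>_. E1 \<Otimes>\<^sub>M E2)) (\<lambda>(x, y) i. (x i, y i)) =
    PiM UNIV (\<lambda>_. E1 \<Otimes>\<^sub>M E2)"
proof -
  interpret E1: prob_space E1 by fact
  interpret E2: prob_space E2 by fact
  interpret E: pair_prob_space E1 E2 ..
  let ?P1 = "PiM UNIV (\<lambda>_::'i. E1)" and ?P2 = "PiM UNIV (\<lambda>_::'i. E2)" and ?E = "E1 \<Otimes>\<^sub>M E2"
  interpret P1: prob_space ?P1 by (intro prob_space_PiM E1)
  interpret P2: prob_space ?P2 by (intro prob_space_PiM E2)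
  have comp: "(\<lambda>(x, y). (x i, y i)) \<in> measurable (?P1 \<Otimes>\<^sub>M ?P2) ?E" for i
    by measurable
  have mz: "(\<lambda>(x, y) i. (x i, y i)) \<in> measurable (?P1 \<Otimes>\<^sub>M ?P2) (PiM UNIV (\<lambda>_. ?E))"
  proof (rule measurable_PiM_single')
    show "(\<lambda>\<omega>. (case \<omega> of (x, y) \<Rightarrow> \<lambda>i. (x i, y i)) i) \<in> measurable (?P1 \<Otimes>\<^sub>M ?P2) ?E" for i
      using comp[of i] by (simp add: split_beta')
    show "(\<lambda>(x, y) i. (x i, y i)) \<in> space (?P1 \<Otimes>\<^sub>M ?P2) \<rightarrow> (\<Pi>\<^sub>E i\<in>UNIV. space ?E)"
      by (auto simp: PiE_UNIV_domain space_pair_measure space_PiM)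
  qed
  have main: "(\<integral>\<^sup>+x. (\<integral>\<^sup>+y. (\<Prod>j\<in>J. indicator (A j) (x j, y j)) \<partial>?P2) \<partial>?P1) = (\<Prod>j\<in>J. emeasure ?E (A j))"
    if "finite J" "\<forall>j\<in>J. A j \<in> sets ?E" for J :: "'i set" and A
    using that
  proof (induction J)
    case empty
    show ?case by (simp add: P1.emeasure_space_1 P2.emeasure_space_1)
  next
    case (insert i J)
    have Ai: "A i \<in> sets ?E" and AJ: "\<forall>j\<in>J. A j \<in> sets ?E" using insert.prems by auto
    have mI: "(\<lambda>(x, y). indicator (A j) (x j, y j) :: ennreal) \<in> borel_measurable (?P1 \<Otimes>\<^sub>M ?P2)" if "j \<in> insert i J" for j
    proof -
      have "(indicator (A j) :: _ \<Rightarrow> ennreal) \<in> borel_measurable ?E"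
        using insert.prems that by (intro borel_measurable_indicator) auto
      then show ?thesis using measurable_compose[OF comp[of j]] by (simp add: split_beta')
    qed
    have mP: "(\<lambda>(x, y). \<Prod>j\<in>K. indicator (A j) (x j, y j) :: ennreal) \<in> borel_measurable (?P1 \<Otimes>\<^sub>M ?P2)" if "K \<subseteq> insert i J" for K
      using mI that unfolding split_beta' by (intro borel_measurable_prod_ennreal) auto
    have mP2: "(\<lambda>y. \<Prod>j\<in>K. indicator (A j) (x j, y j) :: ennreal) \<in> borel_measurable ?P2" if "K \<subseteq> insert i J" "x \<in> space ?P1" for K x
      using measurable_Pair2[OF mP[OF that(1)] that(2)] by simp
    have mP1: "(\<lambda>x. \<integral>\<^sup>+y. (\<Prod>j\<in>K. indicator (A j) (x j, y j)) \<partial>?P2) \<in> borel_measurable ?P1" if "K \<subseteq> insert i J" for K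
      using P2.borel_measurable_nn_integral_fst[OF mP[OF that]] by simp
    have up: "fun_upd x i u \<in> space ?P1" if "x \<in> space ?P1" "u \<in> space E1" for x u
      using that by (auto simp: space_PiM PiE_UNIV_domain)
    have "(\<integral>\<^sup>+x. (\<integral>\<^sup>+y. (\<Prod>j\<in>insert i J. indicator (A j) (x j, y j)) \<partial>?P2) \<partial>?P1) =
      (\<integral>\<^sup>+x. (\<integral>\<^sup>+u. (\<integral>\<^sup>+y. (\<Prod>j\<in>insert i J. indicator (A j) (fun_upd x i u j, y j)) \<partial>?P2) \<partial>E1) \<partial>?P1)"
      by (rule nn_integral_PiM_resample[OF E1 mP1]) simp
    also have "\<dots> = (\<integral>\<^sup>+x. (\<integral>\<^sup>+u. (\<integral>\<^sup>+y. (\<integral>\<^sup>+v. (\<Prod>j\<in>insert i J. indicator (A j) (fun_upd x i u j, fun_upd y i v j)) \<partial>E2) \<partial>?P2) \<partial>E1) \<partial>?P1)"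
    proof (rule nn_integral_cong, rule nn_integral_cong)
      fix x u assume "x \<in> space ?P1" "u \<in> space E1"
      then show "(\<integral>\<^sup>+y. (\<Prod>j\<in>insert i J. indicator (A j) (fun_upd x i u j, y j)) \<partial>?P2) =
        (\<integral>\<^sup>+y. (\<integral>\<^sup>+v. (\<Prod>j\<in>insert i J. indicator (A j) (fun_upd x i u j, fun_upd y i v j)) \<partial>E2) \<partial>?P2)"
        by (intro nn_integral_PiM_resample[OF E2] mP2 up) auto
    qed
    also have "\<dots> = (\<integral>\<^sup>+x. (\<integral>\<^sup>+u. (\<integral>\<^sup>+y. (\<integral>\<^sup>+v. (\<Prod>j\<in>J. indicator (A j) (x j, y j)) * indicator (A i) (u, v) \<partial>E2) \<partial>?P2) \<partial>E1) \<partial>?P1)"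
    proof (intro nn_integral_cong)
      fix x u y v
      have "(\<Prod>j\<in>J. indicator (A j) (fun_upd x i u j, fun_upd y i v j)) = (\<Prod>j\<in>J. indicator (A j) (x j, y j) :: ennreal)"
        using insert.hyps by (intro prod.cong) auto
      then show "(\<Prod>j\<in>insert i J. indicator (A j) (fun_upd x i u j, fun_upd y i v j)) =
          (\<Prod>j\<in>J. indicator (A j) (x j, y j)) * (indicator (A i) (u, v) :: ennreal)"
        using insert.hyps by (simp add: mult.commute)
    qed
    also have "\<dots> = (\<integral>\<^sup>+x. (\<integral>\<^sup>+u. (\<integral>\<^sup>+y. (\<Prod>j\<in>J. indicator (A j) (x j, y j)) * (\<integral>\<^sup>+v. indicator (A i) (u, v) \<partial>E2) \<partial>?P2) \<partial>E1) \<partial>?P1)"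
      using measurable_Pair2[of "indicator (A i)" E1 E2 "borel :: ennreal measure"] Ai
      by (intro nn_integral_cong nn_integral_cmult) simp
    also have "\<dots> = (\<integral>\<^sup>+x. (\<integral>\<^sup>+u. (\<integral>\<^sup>+y. (\<Prod>j\<in>J. indicator (A j) (x j, y j)) \<partial>?P2) * (\<integral>\<^sup>+v. indicator (A i) (u, v) \<partial>E2) \<partial>E1) \<partial>?P1)"
      by (intro nn_integral_cong nn_integral_multc mP2) auto
    also have "\<dots> = (\<integral>\<^sup>+x. (\<integral>\<^sup>+y. (\<Prod>j\<in>J. indicator (A j) (x j, y j)) \<partial>?P2) * (\<integral>\<^sup>+u. (\<integral>\<^sup>+v. indicator (A i) (u, v) \<partial>E2) \<partial>E1) \<partial>?P1)"
      using E2.borel_measurable_nn_integral_fst[of "indicator (A i)" E1] Ai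
      by (intro nn_integral_cong nn_integral_cmult) simp
    also have "\<dots> = (\<integral>\<^sup>+x. (\<integral>\<^sup>+y. (\<Prod>j\<in>J. indicator (A j) (x j, y j)) \<partial>?P2) * emeasure ?E (A i) \<partial>?P1)"
    proof -
      have "(\<integral>\<^sup>+u. (\<integral>\<^sup>+v. indicator (A i) (u, v) \<partial>E2) \<partial>E1) = emeasure ?E (A i)"
        using E2.nn_integral_fst[of "indicator (A i)" E1] Ai by simp
      then show ?thesis by simp
    qed
    also have "\<dots> = (\<Prod>j\<in>J. emeasure ?E (A j)) * emeasure ?E (A i)"
      by (subst nn_integral_multc[OF mP1]) (auto simp: insert.IH[OF AJ])
    finally show ?case using insert.hyps by (simp add: mult.commute)
  qed
  show ?thesis
  proof (rule PiM_UNIV_eqI)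
    show "prob_space ?E" by unfold_locales
    fix J :: "'i set" and A assume J: "finite J" and A: "\<And>i. i \<in> J \<Longrightarrow> A i \<in> sets ?E"
    let ?D = "distr (?P1 \<Otimes>\<^sub>M ?P2) (PiM UNIV (\<lambda>_. ?E)) (\<lambda>(x, y) i. (x i, y i))"
    have ind: "(\<Prod>j\<in>J. indicator (A j) (w j)) = (indicator {w. \<forall>i\<in>J. w i \<in> A i} w :: ennreal)" for w
      using J by induction (auto split: split_indicator)
    have mB: "{\<omega> \<in> space ?D. \<forall>i\<in>J. \<omega> i \<in> A i} \<in> sets (PiM UNIV (\<lambda>_. ?E))"
      using J A by (auto intro!: sets.sets_Collect_finite_All sets_Collect_single')
    have "emeasure ?D {\<omega> \<in> space ?D. \<forall>i\<in>J. \<omega> i \<in> A i} =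
        (\<integral>\<^sup>+w. indicator {\<omega> \<in> space ?D. \<forall>i\<in>J. \<omega> i \<in> A i} w \<partial>?D)"
      using mB by simp
    also have "\<dots> = (\<integral>\<^sup>+z. indicator {\<omega> \<in> space ?D. \<forall>i\<in>J. \<omega> i \<in> A i} (case z of (x, y) \<Rightarrow> \<lambda>i. (x i, y i)) \<partial>(?P1 \<Otimes>\<^sub>M ?P2))"
      by (rule nn_integral_distr[OF mz]) (use mB in simp)
    also have "\<dots> = (\<integral>\<^sup>+z. (\<Prod>j\<in>J. indicator (A j) (fst z j, snd z j)) \<partial>(?P1 \<Otimes>\<^sub>M ?P2))"
    proof (rule nn_integral_cong)
      fix z assume "z \<in> space (?P1 \<Otimes>\<^sub>M ?P2)"
      then have "(case z of (x, y) \<Rightarrow> \<lambda>i. (x i, y i)) \<in> space ?D" using measurable_space[OF mz] by auto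
      then show "indicator {\<omega> \<in> space ?D. \<forall>i\<in>J. \<omega> i \<in> A i} (case z of (x, y) \<Rightarrow> \<lambda>i. (x i, y i)) =
        (\<Prod>j\<in>J. indicator (A j) (fst z j, snd z j) :: ennreal)"
        unfolding ind by (simp add: indicator_def split_beta)
    qed
    also have "\<dots> = (\<integral>\<^sup>+x. (\<integral>\<^sup>+y. (\<Prod>j\<in>J. indicator (A j) (x j, y j)) \<partial>?P2) \<partial>?P1)"
    proof (subst P2.nn_integral_fst[symmetric])
      show "(\<lambda>z. \<Prod>j\<in>J. indicator (A j) (fst z j, snd z j) :: ennreal) \<in> borel_measurable (?P1 \<Otimes>\<^sub>M ?P2)"
      proof (rule borel_measurable_prod_ennreal)
        show "(\<lambda>z. indicator (A j) (fst z j, snd z j) :: ennreal) \<in> borel_measurable (?P1 \<Otimes>\<^sub>M ?P2)" if "j \<in> J" for j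
        proof -
          have "(indicator (A j) :: _ \<Rightarrow> ennreal) \<in> borel_measurable ?E"
            by (intro borel_measurable_indicator A that)
          then show ?thesis using measurable_compose[OF comp[of j]] by (simp add: split_beta')
        qed
      qed
    qed simp
    also have "\<dots> = (\<Prod>i\<in>J. emeasure ?E (A i))" using main[OF J] A by simp
    finally show "emeasure ?D {\<omega> \<in> space ?D. \<forall>i\<in>J. \<omega> i \<in> A i} = (\<Prod>i\<in>J. emeasure ?E (A i))" .
  qed simp
qed

section \<open>Recombination at the cut preserves the law of the noise\<close>

lemma measurable_noiseI:
  assumes "\<And>l. (\<lambda>\<omega>. f \<omega> l) \<in> measurable M gap_law"
  shows "f \<in> measurable M noise"
proof (rule measurable_PiM_single'[of UNIV "\<lambda>l \<omega>. f \<omega> l" M "\<lambda>_. gap_law"])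
  show "(\<lambda>\<omega> l. f \<omega> l) \<in> space M \<rightarrow> (\<Pi>\<^sub>E l\<in>UNIV. space gap_law)"
    by (simp add: PiE_UNIV_domain)
qed (rule assms)

lemma measurable_cut_noise_component:
  assumes z: "z1 \<in> measurable M noise" "z2 \<in> measurable M noise"
  shows "(\<lambda>\<omega>. cut_noise d a (z1 \<omega>) (z2 \<omega>) l) \<in> measurable M gap_law"
proof -
  have [measurable]: "(\<lambda>\<omega>. z1 \<omega> l) \<in> measurable M gap_law" "(\<lambda>\<omega>. z2 \<omega> l) \<in> measurable M gap_law"
    using measurable_compose[OF z(1) measurable_noise_component] measurable_compose[OF z(2) measurable_noise_component] by auto
  have [measurable]: "(\<lambda>\<omega>. trk (z1 \<omega>) l) \<in> borel_measurable M" "(\<lambda>\<omega>. org (z1 \<omega>) l) \<in> borel_measurable M"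
    using measurable_trk[OF z(1)] measurable_org[OF z(1)] by auto
  show ?thesis unfolding cut_noise_def by measurable
qed

lemma measurable_cut_noise:
  "(\<lambda>(z1, z2). cut_noise d a z1 z2) \<in> measurable (noise \<Otimes>\<^sub>M noise) noise"
  unfolding split_beta' by (intro measurable_noiseI measurable_cut_noise_component measurable_fst measurable_snd)

lemma distr_fst_snd_gap:
  "distr (gap_law \<Otimes>\<^sub>M gap_law) gap_law fst = gap_law" "distr (gap_law \<Otimes>\<^sub>M gap_law) gap_law snd = gap_law"
proof -
  interpret pair_prob_space gap_law gap_law ..
  show "distr (gap_law \<Otimes>\<^sub>M gap_law) gap_law fst = gap_law" by (rule gap_law.distr_pair_fst)
  show "distr (gap_law \<Otimes>\<^sub>M gap_law) gap_law snd = gap_law"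
  proof (rule measure_eqI)
    fix A assume "A \<in> sets (distr (gap_law \<Otimes>\<^sub>M gap_law) gap_law snd)"
    then have A: "A \<in> sets gap_law" by simp
    have "snd -` A \<inter> space (gap_law \<Otimes>\<^sub>M gap_law) = space gap_law \<times> A"
      by (auto simp: space_pair_measure)
    moreover have "UNIV \<in> sets gap_law" using sets.top[of gap_law] by simp
    ultimately show "emeasure (distr (gap_law \<Otimes>\<^sub>M gap_law) gap_law snd) A = emeasure gap_law A"
      using A gap_law.emeasure_pair_measure_Times[of "space gap_law" gap_law A]
      by (simp add: emeasure_distr gap_law.emeasure_space_1[simplified])
  qed simp
qed

text \<open>Which of \<open>fst\<close>, \<open>snd\<close> and \<open>glue\<close> produces the
  sequence of \<open>l\<close> is decided by \<open>trk z1 l\<close> or \<open>org z1 l\<close>,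
  hence by labels of smaller \<open>code\<close>. Given these, each of the three maps preserves the
  law, \<open>glue\<close> by the memoryless property.\<close>

proposition distr_cut_noise:
  "distr (noise \<Otimes>\<^sub>M noise) noise (\<lambda>(z1, z2). cut_noise d a z1 z2) = noise"
proof -
  let ?E = "gap_law \<Otimes>\<^sub>M gap_law"
  let ?P = "PiM UNIV (\<lambda>_::label. ?E)"
  have E: "prob_space ?E" by (intro prob_space_pair prob_space_gap_law)
  define f where "f \<omega> = (\<lambda>l::label. fst (\<omega> l) :: nat \<Rightarrow> real)" for \<omega> :: "label \<Rightarrow> (nat \<Rightarrow> real) \<times> (nat \<Rightarrow> real)"
  define g where "g \<omega> = (\<lambda>l::label. snd (\<omega> l) :: nat \<Rightarrow> real)" for \<omega> :: "label \<Rightarrow> (nat \<Rightarrow> real) \<times> (nat \<Rightarrow> real)"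
  have mf: "f \<in> measurable ?P noise" "g \<in> measurable ?P noise"
    unfolding f_def g_def
    by (rule measurable_noiseI, rule measurable_compose[OF measurable_component_singleton], simp, simp)+
  have mz: "(\<lambda>(x, y) l. (x l, y l)) \<in> measurable (noise \<Otimes>\<^sub>M noise) ?P"
  proof (rule measurable_PiM_single')
    show "(\<lambda>\<omega>. (case \<omega> of (x, y) \<Rightarrow> \<lambda>i. (x i, y i)) i) \<in> measurable (noise \<Otimes>\<^sub>M noise) ?E" for i
      unfolding split_beta'
      by (intro measurable_Pair measurable_compose[OF measurable_fst measurable_noise_component]
        measurable_compose[OF measurable_snd measurable_noise_component])
    show "(\<lambda>(x, y) i. (x i, y i)) \<in> space (noise \<Otimes>\<^sub>M noise) \<rightarrow> (\<Pi>\<^sub>E i\<in>UNIV. space ?E)"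
      by (auto simp: PiE_UNIV_domain space_pair_measure)
  qed
  have mH: "(\<lambda>\<omega>. cut_noise d a (f \<omega>) (g \<omega>) l) \<in> measurable ?P gap_law" for l
    by (rule measurable_cut_noise_component[OF mf])
  have mHH: "(\<lambda>\<omega> l. cut_noise d a (f \<omega>) (g \<omega>) l) \<in> measurable ?P noise"
    by (rule measurable_noiseI) (rule mH)
  have "distr ?P noise (\<lambda>\<omega> l. cut_noise d a (f \<omega>) (g \<omega>) l) = noise"
  proof (rule distr_triangular[OF E prob_space_gap_law code_inj mH])
    fix l and \<omega> \<omega>' :: "label \<Rightarrow> (nat \<Rightarrow> real) \<times> (nat \<Rightarrow> real)"
    assume eq: "\<And>j. code j \<le> code l \<Longrightarrow> \<omega> j = \<omega>' j"
    have "trk (f \<omega>) l = trk (f \<omega>') l" by (rule trk_cong) (simp add: f_def eq)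
    moreover have "org (f \<omega>) l = org (f \<omega>') l" by (rule org_cong) (simp add: f_def eq)
    moreover have "f \<omega> l = f \<omega>' l" "g \<omega> l = g \<omega>' l" by (simp_all add: f_def g_def eq)
    ultimately show "cut_noise d a (f \<omega>) (g \<omega>) l = cut_noise d a (f \<omega>') (g \<omega>') l"
      by (simp add: cut_noise_def)
  next
    fix l and \<omega> :: "label \<Rightarrow> (nat \<Rightarrow> real) \<times> (nat \<Rightarrow> real)"
    have "trk (f (fun_upd \<omega> l x)) l = trk (f \<omega>) l" for x by (rule trk_cong) (auto simp: f_def)
    moreover have "org (f (fun_upd \<omega> l x)) l = org (f \<omega>) l" for x by (rule org_cong) (auto simp: f_def)
    moreover have "f (fun_upd \<omega> l x) l = fst x" "g (fun_upd \<omega> l x) l = snd x" for x by (simp_all add: f_def g_def)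
    ultimately have *: "(\<lambda>x. cut_noise d a (f (fun_upd \<omega> l x)) (g (fun_upd \<omega> l x)) l) =
      (if vt l = d then (if trk (f \<omega>) l < a then fst else snd)
       else if org (f \<omega>) l < a then (\<lambda>x. glue (a - org (f \<omega>) l) (fst x) (snd x)) else snd)"
      by (intro ext) (simp add: cut_noise_def)
    show "distr ?E gap_law (\<lambda>x. cut_noise d a (f (fun_upd \<omega> l x)) (g (fun_upd \<omega> l x)) l) = gap_law"
      unfolding * using distr_glue[of "a - org (f \<omega>) l"] distr_fst_snd_gap by (auto simp: split_beta')
  qed
  also have "distr ?P noise (\<lambda>\<omega> l. cut_noise d a (f \<omega>) (g \<omega>) l) =
      distr (distr (noise \<Otimes>\<^sub>M noise) ?P (\<lambda>(x, y) l. (x l, y l))) noise (\<lambda>\<omega> l. cut_noise d a (f \<omega>) (g \<omega>) l)"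
    by (simp add: distr_zip[OF prob_space_gap_law prob_space_gap_law])
  also have "\<dots> = distr (noise \<Otimes>\<^sub>M noise) noise (\<lambda>(z1, z2). cut_noise d a z1 z2)"
    by (subst distr_distr[OF mHH mz]) (simp add: comp_def split_beta' f_def g_def)
  finally show ?thesis .
qed

section \<open>The lines that reach the cut\<close>

text \<open>The parallel lines present in the strip at height \<open>y\<close>. The strict
  inequality for the origin means that a transverse cut at \<open>y\<close> falls inside their child
  sequences.\<close>

definition cand :: "bool \<Rightarrow> real \<Rightarrow> (label \<Rightarrow> nat \<Rightarrow> real) \<Rightarrow> real \<Rightarrow> label \<Rightarrow> bool" where
  "cand d a z y v \<longleftrightarrow> vt v = d \<and> trk z v < a \<and> org z v < y \<and> alive z v y"

definition foremost :: "bool \<Rightarrow> real \<Rightarrow> (label \<Rightarrow> nat \<Rightarrow> real) \<Rightarrow> real \<Rightarrow> label \<Rightarrow> bool" where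
  "foremost d a z y v \<longleftrightarrow> cand d a z y v \<and> (\<forall>v'. cand d a z y v' \<longrightarrow> trk z v' \<le> trk z v)"

definition front :: "bool \<Rightarrow> real \<Rightarrow> (label \<Rightarrow> nat \<Rightarrow> real) \<Rightarrow> real \<Rightarrow> label" where
  "front d a z y = from_nat (LEAST n. foremost d a z y (from_nat n))"

definition child_count :: "(label \<Rightarrow> nat \<Rightarrow> real) \<Rightarrow> label \<Rightarrow> real \<Rightarrow> nat" where
  "child_count z v t = card {k. trk z (Child v k) \<le> t}"

definition exit_count :: "bool \<Rightarrow> real \<Rightarrow> (label \<Rightarrow> nat \<Rightarrow> real) \<Rightarrow> real \<Rightarrow> nat" where
  "exit_count d a z t = card {l \<in> exits d a z. trk z l \<le> t}"

text \<open>Only the foremost line parallel to the cut can create a line that reaches the cut.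
  \<open>hybrid_count\<close> counts the children of the foremost line, which is updated at the times
  \<open>e, 2 * e, \<dots>\<close> only.\<close>

primrec hybrid_count ::
  "bool \<Rightarrow> real \<Rightarrow> real \<Rightarrow> (label \<Rightarrow> nat \<Rightarrow> real) \<Rightarrow> nat \<Rightarrow> real \<Rightarrow> nat" where
  "hybrid_count d a e z 0 = child_count z (Axis d)"
| "hybrid_count d a e z (Suc i) = (\<lambda>t. if t \<le> e * real (Suc i) then hybrid_count d a e z i t
     else hybrid_count d a e z i (e * real (Suc i)) +
       (child_count z (front d a z (e * real (Suc i))) t - child_count z (front d a z (e * real (Suc i))) (e * real (Suc i))))"

text \<open>There are finitely many candidates and the axis \<open>Axis d\<close> is always one of
  them, so the largest track is attained.\<close>

lemma front_foremost:
  assumes "good z" "0 < a" "0 < y"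
  shows "foremost d a z y (front d a z y)"
proof -
  let ?C = "Collect (cand d a z y)"
  have "finite ?C"
    by (rule finite_subset[OF _ good_finite[OF assms(1), of "max a y"]]) (auto simp: cand_def)
  moreover have "Axis d \<in> ?C" using assms by (simp add: cand_def alive_Axis)
  ultimately have "Max (trk z ` ?C) \<in> trk z ` ?C" by (intro Max_in) auto
  then obtain v where v: "v \<in> ?C" "trk z v = Max (trk z ` ?C)" by auto
  then have "foremost d a z y v" using \<open>finite ?C\<close> by (auto simp: foremost_def)
  then have "\<exists>n. foremost d a z y (from_nat n)" by (intro exI[of _ "to_nat v"]) simp
  then show ?thesis unfolding front_def by (rule LeastI_ex)
qed

lemma measurable_cand: "Measurable.pred noise (\<lambda>z. cand d a z y v)"
proof -
  have [measurable]: "(\<lambda>z. trk z v) \<in> borel_measurable noise" "(\<lambda>z. org z v) \<in> borel_measurable noise"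
    "Measurable.pred noise (\<lambda>z. alive z v y)"
    using measurable_pos[of v] measurable_alive[of "\<lambda>_. y" v] by auto
  show ?thesis unfolding cand_def by measurable
qed

lemma measurable_front: "(\<lambda>z. front d a z y) \<in> measurable noise (count_space UNIV)"
proof -
  note [measurable] = measurable_cand
  have [measurable]: "Measurable.pred noise (\<lambda>z. trk z v' \<le> trk z v)" for v v'
    unfolding pred_def using measurable_pos[of v] measurable_pos[of v'] by (intro borel_measurable_le) auto
  have [measurable]: "Measurable.pred noise (\<lambda>z. foremost d a z y v)" for v
    unfolding foremost_def by measurable
  show ?thesis unfolding front_def by measurable
qed

lemma measurable_child_count: "(\<lambda>z. child_count z v t) \<in> measurable noise (count_space UNIV)"
proof -
  have [measurable]: "(\<lambda>z. trk z (Child v k)) \<in> borel_measurable noise" for k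
    using measurable_pos[of "Child v k"] by blast
  show ?thesis unfolding child_count_def
  proof (rule measurable_card)
    have "{z \<in> space noise. trk z (Child v i) \<le> t} \<in> sets noise" for i by measurable
    then show "{z \<in> space noise. i \<in> {k. trk z (Child v k) \<le> t}} \<in> sets noise" for i by (simp only: mem_Collect_eq)
  qed
qed

lemma measurable_front_child_count:
  "(\<lambda>z. child_count z (front d a z y) t) \<in> measurable noise (count_space UNIV)"
  by (rule measurable_compose_countable[OF measurable_child_count measurable_front])

lemma measurable_hybrid_count_at:
  "(\<lambda>z. hybrid_count d a e z i t) \<in> measurable noise (count_space UNIV)"
proof (induction i arbitrary: t)
  case 0
  show ?case by (simp add: measurable_child_count)
next
  case (Suc i)
  note [measurable] = Suc measurable_front_child_count
  show ?case by simp
qed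

lemma measurable_hybrid_count: "(\<lambda>z. hybrid_count d a e z i) \<in> measurable noise cnt_space"
  by (rule measurable_cnt_spaceI) (rule measurable_hybrid_count_at)

lemma measurable_exits: "Measurable.pred noise (\<lambda>z. l \<in> exits d a z)"
proof -
  have [measurable]: "(\<lambda>z. org z l) \<in> borel_measurable noise" "Measurable.pred noise (\<lambda>z. alive z l a)"
    using measurable_pos[of l] measurable_alive[of "\<lambda>_. a" l] by auto
  show ?thesis unfolding exits_def mem_Collect_eq by measurable
qed

lemma measurable_exit_count: "exit_count d a \<in> measurable noise cnt_space"
proof (rule measurable_cnt_spaceI)
  fix t
  note [measurable] = measurable_exits
  have [measurable]: "(\<lambda>z. trk z l) \<in> borel_measurable noise" for l using measurable_pos[of l] by auto
  \<comment> \<open>Labels are counted through their numbers; the condition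
    \<open>to_nat (from_nat n) = n\<close> selects one number per label.\<close>
  have eq: "exit_count d a z t = card {n. from_nat n \<in> exits d a z \<and> trk z (from_nat n) \<le> t \<and> to_nat (from_nat n :: label) = n}" for z
  proof -
    have *: "to_nat ` {l \<in> exits d a z. trk z l \<le> t} = {n. from_nat n \<in> exits d a z \<and> trk z (from_nat n) \<le> t \<and> to_nat (from_nat n :: label) = n}"
    proof (intro equalityI subsetI)
      fix n assume "n \<in> {n. from_nat n \<in> exits d a z \<and> trk z (from_nat n) \<le> t \<and> to_nat (from_nat n :: label) = n}"
      then have "from_nat n \<in> {l \<in> exits d a z. trk z l \<le> t}" "n = to_nat (from_nat n :: label)" by simp_all
      then show "n \<in> to_nat ` {l \<in> exits d a z. trk z l \<le> t}" by (rule rev_image_eqI)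
    next
      fix n assume "n \<in> to_nat ` {l \<in> exits d a z. trk z l \<le> t}"
      then obtain l :: label where "n = to_nat l" "l \<in> exits d a z" "trk z l \<le> t" by blast
      then show "n \<in> {n. from_nat n \<in> exits d a z \<and> trk z (from_nat n) \<le> t \<and> to_nat (from_nat n :: label) = n}" by simp
    qed
    have "inj_on (to_nat :: label \<Rightarrow> nat) {l \<in> exits d a z. trk z l \<le> t}" by (rule inj_on_subset[OF inj_to_nat]) simp
    from card_image[OF this] show ?thesis unfolding exit_count_def * by (rule sym)
  qed
  show "(\<lambda>z. exit_count d a z t) \<in> measurable noise (count_space UNIV)"
    unfolding eq
  proof (rule measurable_card)
    have "{z \<in> space noise. from_nat i \<in> exits d a z \<and> trk z (from_nat i) \<le> t \<and> to_nat (from_nat i :: label) = i} \<in> sets noise" for i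
      by measurable
    then show "{z \<in> space noise. i \<in> {n. from_nat n \<in> exits d a z \<and> trk z (from_nat n) \<le> t \<and> to_nat (from_nat n :: label) = n}} \<in> sets noise" for i
      by (simp only: mem_Collect_eq)
  qed
qed

text \<open>This cut is transverse, at height \<open>y\<close>: lines with \<open>vt v = d\<close>
  cross it, so children up to \<open>y\<close> come from \<open>z1\<close> and later ones from the
  fresh \<open>z2\<close>.\<close>

lemma child_count_cut:
  assumes seq: "\<forall>l. good_seq (z1 l)" "\<forall>l. good_seq (z2 l)" and v: "vt v = d" "org z1 v < y"
  shows "s \<le> y \<Longrightarrow> child_count (cut_noise (\<not> d) y z1 z2) v s = child_count z1 v s"
    and "y \<le> s \<Longrightarrow> child_count (cut_noise (\<not> d) y z1 z2) v s = nb (z1 v) (y - org z1 v) + nb (z2 v) (s - y)"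
proof -
  let ?m = "nb (z1 v) (y - org z1 v)"
  have "vt v \<noteq> (\<not> d)" using v by simp
  note c = trk_crossing_child[OF seq this v(2)]
  have m: "k < ?m \<longleftrightarrow> org z1 v + psum (z1 v) k \<le> y" for k
    using less_nb_iff[of "z1 v" k "y - org z1 v"] seq by auto
  have p: "0 < psum (z2 v) k" for k using good_seq_psum_pos seq by blast
  {
    assume "s \<le> y"
    have "trk (cut_noise (\<not> d) y z1 z2) (Child v k) \<le> s \<longleftrightarrow> trk z1 (Child v k) \<le> s" for k
      using m[of k] p[of "k - ?m"] \<open>s \<le> y\<close> unfolding c by auto
    then show "child_count (cut_noise (\<not> d) y z1 z2) v s = child_count z1 v s"
      by (simp only: child_count_def)
  next
    assume "y \<le> s"
    have n: "k < nb (z2 v) (s - y) \<longleftrightarrow> psum (z2 v) k \<le> s - y" for k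
      using less_nb_iff[of "z2 v" k "s - y"] seq by auto
    have "trk (cut_noise (\<not> d) y z1 z2) (Child v k) \<le> s \<longleftrightarrow> k < ?m + nb (z2 v) (s - y)" for k
      using m[of k] n[of "k - ?m"] \<open>y \<le> s\<close> unfolding c by auto
    then show "child_count (cut_noise (\<not> d) y z1 z2) v s = ?m + nb (z2 v) (s - y)"
      by (simp only: child_count_def) (simp add: lessThan_def[symmetric])
  }
qed

text \<open>The candidates at heights up to \<open>y\<close>, and their tracks, are settled before
  the cut at \<open>y\<close>.\<close>

lemma front_cut:
  assumes seq: "\<forall>l. good_seq (z1 l)" "\<forall>l. good_seq (z2 l)" and y: "y' \<le> y"
  shows "front d a (cut_noise (\<not> d) y z1 z2) y' = front d a z1 y'"
proof -
  let ?z = "cut_noise (\<not> d) y z1 z2"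
  have c: "cand d a ?z y' v \<longleftrightarrow> cand d a z1 y' v" "cand d a z1 y' v \<Longrightarrow> trk ?z v = trk z1 v" for v
  proof -
    have pos: "vt v = d \<Longrightarrow> (org ?z v = org z1 v \<or> y \<le> org ?z v \<and> y \<le> org z1 v) \<and> (org z1 v < y \<longrightarrow> trk ?z v = trk z1 v)"
      using cut_noise_pos[OF seq, where d = "\<not> d" and a = y and l = v] by auto
    show "cand d a z1 y' v \<Longrightarrow> trk ?z v = trk z1 v" using pos y by (auto simp: cand_def)
    show "cand d a ?z y' v \<longleftrightarrow> cand d a z1 y' v"
    proof (cases "vt v = d \<and> org z1 v < y'")
      case True
      then have "alive ?z v y' = alive z1 v y'" using y by (intro alive_cut_noise[OF seq]) auto
      then show ?thesis using True pos y by (auto simp: cand_def)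
    next
      case False
      then show ?thesis using pos y by (auto simp: cand_def)
    qed
  qed
  then have "foremost d a ?z y' v \<longleftrightarrow> foremost d a z1 y' v" for v
    unfolding foremost_def by metis
  then show ?thesis by (simp only: front_def)
qed

lemma hybrid_count_cut:
  assumes good1: "good z1" and seq2: "\<forall>l. good_seq (z2 l)" and a: "0 < a" and e: "0 < e"
    and i: "e * real i \<le> y" "0 < y" and t: "t \<le> y"
  shows "hybrid_count d a e (cut_noise (\<not> d) y z1 z2) i t = hybrid_count d a e z1 i t"
  using i(1) t
proof (induction i arbitrary: t)
  have seq1: "\<forall>l. good_seq (z1 l)" using good1 by (simp add: good_def)
  {
    case 0
    then show ?case using i(2) child_count_cut(1)[OF seq1 seq2, of "Axis d" d y t] by simp
  next
    case (Suc i)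
    let ?s = "e * real (Suc i)"
    have s: "0 < ?s" using e by simp
    have es: "e * real i \<le> y" using Suc.prems(1) e mult_left_mono[of "real i" "real (Suc i)" e] by linarith
    have fr: "front d a (cut_noise (\<not> d) y z1 z2) ?s = front d a z1 ?s"
      by (rule front_cut[OF seq1 seq2 Suc.prems(1)])
    have "cand d a z1 ?s (front d a z1 ?s)" using front_foremost[OF good1 a s] by (simp add: foremost_def)
    then have v: "vt (front d a z1 ?s) = d" "org z1 (front d a z1 ?s) < y"
      using Suc.prems(1) by (auto simp: cand_def)
    show ?case
      using Suc.IH[OF es Suc.prems(2)] Suc.IH[OF es Suc.prems(1)]
        child_count_cut(1)[OF seq1 seq2 v Suc.prems(2)] child_count_cut(1)[OF seq1 seq2 v Suc.prems(1)]
      by (simp only: hybrid_count.simps fr)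
  }
qed

text \<open>The analogue of \<open>glue\<close> for counting functions: for good sequences, with
  \<open>c\<close> the counting function of \<open>x1\<close> and 0 \<le> y, it is that of
  \<open>glue y x1 x\<close>.\<close>

definition join_counts :: "real \<Rightarrow> (real \<Rightarrow> nat) \<Rightarrow> (nat \<Rightarrow> real) \<Rightarrow> real \<Rightarrow> nat" where
  "join_counts y c x t = (if t \<le> y then c t else c y + nb x (t - y))"

lemma measurable_join_counts:
  "(\<lambda>(c, x). join_counts y c x) \<in> measurable (cnt_space \<Otimes>\<^sub>M gap_law) cnt_space"
proof (rule measurable_cnt_spaceI)
  fix t
  have [measurable (raw)]: "(\<lambda>z. fst z s) \<in> measurable (cnt_space \<Otimes>\<^sub>M gap_law) (count_space UNIV)" for s :: real
    by (rule measurable_compose[OF measurable_fst measurable_component_singleton]) simp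
  have [measurable (raw)]: "(\<lambda>z. nb (snd z) s) \<in> measurable (cnt_space \<Otimes>\<^sub>M gap_law) (count_space UNIV)" for s
    by (rule measurable_nb) simp_all
  show "(\<lambda>\<omega>. (case \<omega> of (c, x) \<Rightarrow> join_counts y c x) t) \<in> measurable (cnt_space \<Otimes>\<^sub>M gap_law) (count_space UNIV)"
    unfolding split_beta' join_counts_def by measurable
qed

text \<open>At the new grid time the count separates into its past, a function of \<open>z1\<close>,
  and the fresh sequence of the front, a label whose choice depends on \<open>z1\<close>
  only.\<close>

lemma hybrid_count_Suc_cut:
  fixes i :: nat
  assumes good1: "good z1" and seq2: "\<forall>l. good_seq (z2 l)" and a: "0 < a" and e: "0 < e"
  defines "y \<equiv> e * real (Suc i)"
  shows "hybrid_count d a e (cut_noise (\<not> d) y z1 z2) (Suc i) =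
    join_counts y (hybrid_count d a e z1 i) (z2 (front d a z1 y))"
proof
  fix t
  have seq1: "\<forall>l. good_seq (z1 l)" using good1 by (simp add: good_def)
  have y: "0 < y" "e * real i \<le> y" using e by (simp_all add: y_def)
  let ?z = "cut_noise (\<not> d) y z1 z2" and ?v = "front d a z1 y"
  have "cand d a z1 y ?v" using front_foremost[OF good1 a y(1)] by (simp add: foremost_def)
  then have v: "vt ?v = d" "org z1 ?v < y" by (auto simp: cand_def)
  have fr: "front d a ?z y = ?v" by (rule front_cut[OF seq1 seq2]) simp
  have S: "hybrid_count d a e ?z (Suc i) t = (if t \<le> y then hybrid_count d a e ?z i t
     else hybrid_count d a e ?z i y + (child_count ?z ?v t - child_count ?z ?v y))"
    by (simp only: hybrid_count.simps y_def[symmetric] fr)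
  show "hybrid_count d a e ?z (Suc i) t = join_counts y (hybrid_count d a e z1 i) (z2 ?v) t"
  proof (cases "t \<le> y")
    case True
    then show ?thesis unfolding S join_counts_def
      using hybrid_count_cut[OF good1 seq2 a e y(2,1) True] by simp
  next
    case False
    have "nb (z2 ?v) 0 = 0" using seq2 nb_nonpos by blast
    then have "child_count ?z ?v t - child_count ?z ?v y = nb (z2 ?v) (t - y)"
      using child_count_cut(2)[OF seq1 seq2 v, of t] child_count_cut(2)[OF seq1 seq2 v, of y] False by simp
    then show ?thesis unfolding S join_counts_def
      using hybrid_count_cut[OF good1 seq2 a e y(2,1) order_refl] False by simp
  qed
qed

lemma AE_seq: "AE z in noise. \<forall>l. good_seq (z l)"
  using AE_good by eventually_elim (simp add: good_def)

text \<open>Induct over the grid times. Switching to another line costs nothing in law, because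
  after the switch its sequence is fresh whichever line it is.\<close>

proposition distr_hybrid_count:
  assumes a: "0 < a" and e: "0 < e"
  shows "distr noise cnt_space (\<lambda>z. hybrid_count d a e z i) = count_law"
proof (induction i)
  case 0
  have "distr noise cnt_space (\<lambda>z. hybrid_count d a e z 0) = distr noise cnt_space (\<lambda>z. nb (z (Axis d)))"
    by (rule distr_cong) (auto simp: child_count_def nb_def fun_eq_iff)
  also have "\<dots> = distr (distr noise gap_law (\<lambda>z. z (Axis d))) cnt_space nb"
    by (subst distr_distr[OF measurable_nb_cnt measurable_noise_component]) (simp add: comp_def)
  also have "distr noise gap_law (\<lambda>z. z (Axis d)) = gap_law"
    by (rule distr_PiM_component[OF prob_space_gap_law]) simp
  finally show ?case by (simp add: count_law_def)
next
  case (Suc i)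
  define y where "y = e * real (Suc i)"
  have y: "0 \<le> y" using e by (simp add: y_def)
  note mJ = measurable_join_counts[of y]
  show ?case
  proof (rule measure_eqI)
    fix B assume "B \<in> sets (distr noise cnt_space (\<lambda>z. hybrid_count d a e z (Suc i)))"
    then have B: "B \<in> sets cnt_space" by simp
    then have mB: "(indicator B :: _ \<Rightarrow> ennreal) \<in> borel_measurable cnt_space" by simp
    have mJB: "(\<lambda>(c, x). indicator B (join_counts y c x) :: ennreal) \<in> borel_measurable (cnt_space \<Otimes>\<^sub>M gap_law)"
      using measurable_compose[OF mJ mB] by (simp add: split_beta')
    have mJB2: "(\<lambda>x. indicator B (join_counts y c x) :: ennreal) \<in> borel_measurable gap_law" for c
      using measurable_Pair2[OF mJB, of c] by simp
    have mI: "(\<lambda>c. \<integral>\<^sup>+x. indicator B (join_counts y c x) \<partial>gap_law) \<in> borel_measurable cnt_space"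
      using gap_law.borel_measurable_nn_integral_fst[OF mJB] by simp
    have mh: "(\<lambda>z. indicator B (hybrid_count d a e z (Suc i)) :: ennreal) \<in> borel_measurable noise"
      by (rule measurable_compose[OF measurable_hybrid_count mB])
    have mfr: "(\<lambda>(z1, z2). z2 (front d a z1 y)) \<in> measurable (noise \<Otimes>\<^sub>M noise) gap_law"
      unfolding split_beta'
    proof (rule measurable_compose_countable)
      show "(\<lambda>x. snd x l) \<in> measurable (noise \<Otimes>\<^sub>M noise) gap_law" for l :: label
        by (rule measurable_compose[OF measurable_snd measurable_noise_component])
      show "(\<lambda>x. front d a (fst x) y) \<in> measurable (noise \<Otimes>\<^sub>M noise) (count_space UNIV)"
        by (rule measurable_compose[OF measurable_fst measurable_front])
    qed
    have mhf: "(\<lambda>w. hybrid_count d a e (fst w) i) \<in> measurable (noise \<Otimes>\<^sub>M noise) cnt_space"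
      by (rule measurable_compose[OF measurable_fst measurable_hybrid_count])
    have mG: "(\<lambda>(z1, z2). indicator B (join_counts y (hybrid_count d a e z1 i) (z2 (front d a z1 y))) :: ennreal)
        \<in> borel_measurable (noise \<Otimes>\<^sub>M noise)"
      using measurable_compose[OF measurable_Pair[OF mhf mfr] mJB] by (simp add: split_beta')
    have "emeasure (distr noise cnt_space (\<lambda>z. hybrid_count d a e z (Suc i))) B =
      (\<integral>\<^sup>+c. indicator B c \<partial>distr noise cnt_space (\<lambda>z. hybrid_count d a e z (Suc i)))"
      using B by simp
    also have "\<dots> = (\<integral>\<^sup>+z. indicator B (hybrid_count d a e z (Suc i)) \<partial>noise)"
      by (rule nn_integral_distr[OF measurable_hybrid_count]) (use B in simp)
    \<comment> \<open>The noise is replaced by a recombination at the grid time \<open>y\<close>,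
      which has the same law and exposes the fresh part.\<close>
    also have "\<dots> = (\<integral>\<^sup>+z. indicator B (hybrid_count d a e z (Suc i)) \<partial>distr (noise \<Otimes>\<^sub>M noise) noise (\<lambda>(z1, z2). cut_noise (\<not> d) y z1 z2))"
      by (simp only: distr_cut_noise)
    also have "\<dots> = (\<integral>\<^sup>+w. indicator B (hybrid_count d a e (case w of (z1, z2) \<Rightarrow> cut_noise (\<not> d) y z1 z2) (Suc i)) \<partial>(noise \<Otimes>\<^sub>M noise))"
      by (rule nn_integral_distr[OF measurable_cut_noise]) (use mh in simp)
    also have "\<dots> = (\<integral>\<^sup>+w. indicator B (join_counts y (hybrid_count d a e (fst w) i) (snd w (front d a (fst w) y))) \<partial>(noise \<Otimes>\<^sub>M noise))"
    proof (rule nn_integral_cong_AE)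
      show "AE w in noise \<Otimes>\<^sub>M noise. indicator B (hybrid_count d a e (case w of (z1, z2) \<Rightarrow> cut_noise (\<not> d) y z1 z2) (Suc i)) =
        (indicator B (join_counts y (hybrid_count d a e (fst w) i) (snd w (front d a (fst w) y))) :: ennreal)"
        using AE_pair_fst[OF prob_space_noise AE_good] AE_pair_snd[OF prob_space_noise prob_space_noise AE_seq]
      proof eventually_elim
        case (elim w)
        then show ?case
          using hybrid_count_Suc_cut[OF elim(1,2) a e, of d i] by (simp only: y_def split_beta')
      qed
    qed
    also have "\<dots> = (\<integral>\<^sup>+z1. (\<integral>\<^sup>+z2. indicator B (join_counts y (hybrid_count d a e z1 i) (z2 (front d a z1 y))) \<partial>noise) \<partial>noise)"
      using noise.nn_integral_fst[OF mG] by (simp add: split_beta')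
    \<comment> \<open>For fixed \<open>z1\<close> the front is a fixed label, so \<open>z2\<close>
      evaluated there has law \<open>gap_law\<close>.\<close>
    also have "\<dots> = (\<integral>\<^sup>+z1. (\<integral>\<^sup>+x. indicator B (join_counts y (hybrid_count d a e z1 i) x) \<partial>gap_law) \<partial>noise)"
    proof (rule nn_integral_cong)
      fix z1 :: "label \<Rightarrow> nat \<Rightarrow> real"
      let ?v = "front d a z1 y" and ?c = "hybrid_count d a e z1 i"
      have "(\<integral>\<^sup>+x. indicator B (join_counts y ?c x) \<partial>gap_law) =
        (\<integral>\<^sup>+x. indicator B (join_counts y ?c x) \<partial>distr noise gap_law (\<lambda>z. z ?v))"
        by (subst distr_PiM_component[OF prob_space_gap_law]) simp_all
      also have "\<dots> = (\<integral>\<^sup>+z2. indicator B (join_counts y ?c (z2 ?v)) \<partial>noise)"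
        by (rule nn_integral_distr[OF measurable_noise_component]) (use mJB2 in simp)
      finally show "(\<integral>\<^sup>+z2. indicator B (join_counts y ?c (z2 ?v)) \<partial>noise) = (\<integral>\<^sup>+x. indicator B (join_counts y ?c x) \<partial>gap_law)"
        by simp
    qed
    also have "\<dots> = (\<integral>\<^sup>+c. (\<integral>\<^sup>+x. indicator B (join_counts y c x) \<partial>gap_law) \<partial>distr noise cnt_space (\<lambda>z. hybrid_count d a e z i))"
      by (rule nn_integral_distr[OF measurable_hybrid_count, symmetric]) (use mI in simp)
    also have "\<dots> = (\<integral>\<^sup>+c. (\<integral>\<^sup>+x. indicator B (join_counts y c x) \<partial>gap_law) \<partial>distr gap_law cnt_space nb)"
      unfolding Suc count_law_def ..
    also have "\<dots> = (\<integral>\<^sup>+x1. (\<integral>\<^sup>+x. indicator B (join_counts y (nb x1) x) \<partial>gap_law) \<partial>gap_law)"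
      by (rule nn_integral_distr[OF measurable_nb_cnt]) (use mI in simp)
    \<comment> \<open>Past and future are now counted by two independent sequences, which
      \<open>distr_glue\<close> merges into one.\<close>
    also have "\<dots> = (\<integral>\<^sup>+x1. (\<integral>\<^sup>+x. indicator B (nb (glue y x1 x)) \<partial>gap_law) \<partial>gap_law)"
    proof (rule nn_integral_cong_AE, rule eventually_mono[OF AE_good_seq], rule nn_integral_cong_AE, rule eventually_mono[OF AE_good_seq])
      fix x1 x assume x: "good_seq x1" "good_seq x"
      have "join_counts y (nb x1) x = nb (glue y x1 x)"
      proof
        fix t show "join_counts y (nb x1) x t = nb (glue y x1 x) t"
          using nb_glue_le[OF x y, of t] nb_glue_ge[OF x y, of t] by (simp add: join_counts_def)
      qed
      then show "indicator B (join_counts y (nb x1) x) = (indicator B (nb (glue y x1 x)) :: ennreal)" by simp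
    qed
    also have "\<dots> = (\<integral>\<^sup>+w. indicator B (nb (case w of (x1, x) \<Rightarrow> glue y x1 x)) \<partial>(gap_law \<Otimes>\<^sub>M gap_law))"
    proof -
      have "(\<lambda>(x1, x). glue y x1 x) \<in> measurable (gap_law \<Otimes>\<^sub>M gap_law) gap_law" by measurable
      from measurable_compose[OF measurable_compose[OF this measurable_nb_cnt] mB]
      show ?thesis using gap_law.nn_integral_fst[of "\<lambda>w. indicator B (nb (case w of (x1, x) \<Rightarrow> glue y x1 x))" gap_law] by simp
    qed
    also have "\<dots> = (\<integral>\<^sup>+x. indicator B (nb x) \<partial>distr (gap_law \<Otimes>\<^sub>M gap_law) gap_law (\<lambda>(x, y'). glue y x y'))"
    proof (rule nn_integral_distr[symmetric])
      show "(\<lambda>(x, y'). glue y x y') \<in> measurable (gap_law \<Otimes>\<^sub>M gap_law) gap_law" by measurable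
      show "(\<lambda>x. indicator B (nb x) :: ennreal) \<in> borel_measurable (distr (gap_law \<Otimes>\<^sub>M gap_law) gap_law (\<lambda>(x, y'). glue y x y'))"
        using measurable_compose[OF measurable_nb_cnt mB] by simp
    qed
    also have "\<dots> = (\<integral>\<^sup>+x. indicator B (nb x) \<partial>gap_law)" unfolding distr_glue[OF y] ..
    also have "\<dots> = (\<integral>\<^sup>+c. indicator B c \<partial>count_law)"
      unfolding count_law_def by (rule nn_integral_distr[OF measurable_nb_cnt, symmetric]) (use B in simp)
    also have "\<dots> = emeasure count_law B" using B by (simp add: count_law_def)
    finally show "emeasure (distr noise cnt_space (\<lambda>z. hybrid_count d a e z (Suc i))) B = emeasure count_law B" .
  qed (simp add: count_law_def)
qed

section \<open>Exactness of the grid approximation for a fine mesh\<close>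

lemma trk_inj_same:
  assumes "good z" "vt v = vt v'" "trk z v = trk z v'" shows "v = v'"
proof (cases v)
  case (Axis b)
  show ?thesis
  proof (cases v')
    case (Child l k)
    then show ?thesis using Axis assms(3) trk_Child_pos[OF assms(1), of l k] by simp
  qed (use Axis assms(2) in simp)
next
  case (Child l k)
  show ?thesis
  proof (cases v')
    case (Axis b)
    then show ?thesis using Child assms(3) trk_Child_pos[OF assms(1), of l k] by simp
  next
    case (Child l' k')
    then show ?thesis using \<open>v = Child l k\<close> assms by (intro good_distinct[OF assms(1)]) simp_all
  qed
qed

text \<open>Positions only, alive or not: it contains the exits up to height \<open>t\<close> and
  every line that could block a parallel line of the strip there, apart from the axis.\<close>

definition visible :: "bool \<Rightarrow> real \<Rightarrow> (label \<Rightarrow> nat \<Rightarrow> real) \<Rightarrow> real \<Rightarrow> label set" where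
  "visible d a z t = {l. vt l \<noteq> d \<and> par l \<noteq> None \<and> org z l < a \<and> trk z l \<le> t}"

lemma finite_visible: "good z \<Longrightarrow> finite (visible d a z t)"
  by (rule finite_subset[OF _ good_finite[of z "max a (t + 1)"]]) (auto simp: visible_def)

text \<open>If at most one line is created or stopped during \<open>[y, t]\<close>, then the lines reaching the cut
  in \<open>(y, t]\<close> are the children of the line that is foremost at time \<open>y\<close>.\<close>

lemma exits_cell:
  assumes z: "good z" and a: "0 < a" and y: "0 < y" "y < t"
    and one: "\<And>h h'. h \<in> visible d a z t \<Longrightarrow> h' \<in> visible d a z t \<Longrightarrow> y \<le> trk z h \<Longrightarrow> y \<le> trk z h' \<Longrightarrow> h = h'"
  shows "{l \<in> exits d a z. y < trk z l \<and> trk z l \<le> t} =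
    (\<lambda>k. Child (front d a z y) k) ` {k. y < trk z (Child (front d a z y) k) \<and> trk z (Child (front d a z y) k) \<le> t}"
proof -
  \<comment> \<open>A parallel line born at or after \<open>y\<close> would be the child of a
    visible line in the window. That line would be \<open>l\<close> itself, contradicting
    \<open>org z v < trk z l\<close>.\<close>
  have early: "org z v < y" if v: "vt v = d" "trk z v < a" "org z v < trk z l" and
    l: "l \<in> visible d a z t" "y \<le> trk z l" for v l
  proof (rule ccontr)
    assume n: "\<not> org z v < y"
    obtain p j where p: "v = Child p j" using n y by (cases v) auto
    have "par p \<noteq> None" using n y p by (cases p) auto
    moreover have "org z p < a" using org_less_trk_Child[OF z, of p j] v(2) p by simp
    ultimately have "p \<in> visible d a z t" using v l p by (auto simp: visible_def)
    then have "p = l" using one[OF _ l(1) _ l(2)] n p by simp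
    then show False using v(3) p by simp
  qed
  \<comment> \<open>A blocker met between \<open>y\<close> and \<open>trk z l\<close> would be a
    second visible line in the window.\<close>
  have survive: "alive z v (trk z l)" if v: "cand d a z y v" and l: "l \<in> visible d a z t" "y \<le> trk z l" for v l
  proof (rule alive_extend[OF z _ l(2)])
    show "alive z v y" using v by (simp add: cand_def)
    fix h assume h: "blocks z v h" "y \<le> trk z h" "trk z h < trk z l"
    have "par h \<noteq> None" using h(2) y by (cases h) auto
    then have "h \<in> visible d a z t" using h v l by (auto simp: visible_def blocks_def cand_def)
    then have "h = l" using one[OF _ l(1) h(2) l(2)] by simp
    then show "\<not> alive z h (trk z v)" using h(3) by simp
  qed
  have fm: "foremost d a z y (front d a z y)" by (rule front_foremost[OF z a y(1)])
  show ?thesis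
  proof (intro equalityI subsetI)
    fix l assume "l \<in> {l \<in> exits d a z. y < trk z l \<and> trk z l \<le> t}"
    then have l: "l \<in> exits d a z" "y < trk z l" "trk z l \<le> t" by auto
    then obtain v k where vk: "l = Child v k" by (cases l) (auto simp: exits_def)
    have e: "vt v = d" "trk z v < a" "alive z l a" using l(1) by (auto simp: exits_def vk)
    have lv: "l \<in> visible d a z t" using l by (auto simp: exits_def visible_def)
    have ov: "org z v < trk z l" unfolding vk by (rule org_less_trk_Child[OF z])
    have "alive z v (trk z l)" using alive_parent[OF z] e(3) unfolding vk by blast
    moreover have oy: "org z v < y" by (rule early[OF e(1,2) ov lv]) (use l in simp)
    ultimately have cv: "cand d a z y v" using e l(2) alive_downward[of z v "trk z l" y] by (simp add: cand_def)
    \<comment> \<open>A candidate further towards the cut survives until \<open>l\<close> arrives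
      and would block it before \<open>a\<close>.\<close>
    have "trk z v' \<le> trk z v" if v': "cand d a z y v'" for v'
    proof (rule ccontr)
      assume n: "\<not> trk z v' \<le> trk z v"
      have "alive z v' (trk z l)" by (rule survive[OF v' lv]) (use l in simp)
      moreover have "blocks z l v'" using n v' e(1) l(2) by (auto simp: blocks_def cand_def vk)
      moreover have "trk z v' < a" using v' by (simp add: cand_def)
      ultimately show False using alive_not_blocked[OF z e(3)] by blast
    qed
    then have "trk z v = trk z (front d a z y)" using cv fm by (auto simp: foremost_def intro: antisym)
    then have "v = front d a z y" using e(1) fm by (intro trk_inj_same[OF z]) (auto simp: foremost_def cand_def)
    then show "l \<in> (\<lambda>k. Child (front d a z y) k) ` {k. y < trk z (Child (front d a z y) k) \<and> trk z (Child (front d a z y) k) \<le> t}"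
      using l vk by blast
  next
    fix l assume "l \<in> (\<lambda>k. Child (front d a z y) k) ` {k. y < trk z (Child (front d a z y) k) \<and> trk z (Child (front d a z y) k) \<le> t}"
    then obtain k where l: "l = Child (front d a z y) k" "y < trk z l" "trk z l \<le> t" by blast
    let ?v = "front d a z y"
    have c: "cand d a z y ?v" using fm by (simp add: foremost_def)
    then have v: "vt ?v = d" "trk z ?v < a" by (auto simp: cand_def)
    have lv: "l \<in> visible d a z t" using l v by (auto simp: visible_def simp del: trk_simps)
    have "alive z l a"
    proof (rule iffD2[OF alive_iff[OF z]], intro conjI allI impI)
      show "alive z p (trk z l)" if "par l = Some p" for p
        using survive[OF c lv] l(2) that by (simp add: l(1) del: trk_simps)
      show "org z l \<le> a" using v by (simp add: l(1))
      fix v' assume b: "blocks z l v' \<and> trk z v' < a"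
      show "\<not> alive z v' (trk z l)"
      proof
        assume al: "alive z v' (trk z l)"
        have v': "vt v' = d" "trk z ?v < trk z v'" "org z v' < trk z l" using b v by (auto simp: blocks_def l(1) simp del: trk_simps)
        have "org z v' < y" by (rule early[OF v'(1) _ v'(3) lv]) (use b l in auto)
        then have "cand d a z y v'" using v' b al l(2) alive_downward[OF al, of y] by (simp add: cand_def)
        then show False using fm v'(2) by (auto simp: foremost_def)
      qed
    qed
    then show "l \<in> {l \<in> exits d a z. y < trk z l \<and> trk z l \<le> t}"
      using l v by (auto simp: exits_def simp del: trk_simps)
  qed
qed

lemma finite_children: assumes "good z" shows "finite {k. trk z (Child v k) \<le> t}"
proof -
  have "{k. trk z (Child v k) \<le> t} = {k. k < nb (z v) (t - org z v)}"
    using less_nb_iff[OF good_seqD[OF assms]] by (auto simp: algebra_simps)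
  then show ?thesis by simp
qed

lemma child_count_diff:
  assumes "good z" "y \<le> t"
  shows "child_count z v t = child_count z v y + card {k. y < trk z (Child v k) \<and> trk z (Child v k) \<le> t}"
proof -
  have "{k. trk z (Child v k) \<le> t} = {k. trk z (Child v k) \<le> y} \<union> {k. y < trk z (Child v k) \<and> trk z (Child v k) \<le> t}"
    using assms(2) by auto
  moreover have "card ({k. trk z (Child v k) \<le> y} \<union> {k. y < trk z (Child v k) \<and> trk z (Child v k) \<le> t}) =
      card {k. trk z (Child v k) \<le> y} + card {k. y < trk z (Child v k) \<and> trk z (Child v k) \<le> t}"
  proof (rule card_Un_disjoint)
    show "finite {k. y < trk z (Child v k) \<and> trk z (Child v k) \<le> t}"
      by (rule finite_subset[OF _ finite_children[OF assms(1), of v t]]) auto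
  qed (use finite_children[OF assms(1), of v y] in auto)
  ultimately show ?thesis by (simp only: child_count_def)
qed

lemma finite_exits: "good z \<Longrightarrow> finite {l \<in> exits d a z. trk z l \<le> t}"
  by (rule finite_subset[OF _ finite_visible[of z d a t]]) (auto simp: exits_def visible_def)

lemma exit_count_diff:
  assumes "good z" "y \<le> t"
  shows "exit_count d a z t = exit_count d a z y + card {l \<in> exits d a z. y < trk z l \<and> trk z l \<le> t}"
proof -
  have "{l \<in> exits d a z. trk z l \<le> t} = {l \<in> exits d a z. trk z l \<le> y} \<union> {l \<in> exits d a z. y < trk z l \<and> trk z l \<le> t}"
    using assms(2) by auto
  moreover have "card ({l \<in> exits d a z. trk z l \<le> y} \<union> {l \<in> exits d a z. y < trk z l \<and> trk z l \<le> t}) =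
      card {l \<in> exits d a z. trk z l \<le> y} + card {l \<in> exits d a z. y < trk z l \<and> trk z l \<le> t}"
  proof (rule card_Un_disjoint)
    show "finite {l \<in> exits d a z. y < trk z l \<and> trk z l \<le> t}"
      by (rule finite_subset[OF _ finite_exits[OF assms(1), of d a t]]) auto
  qed (use finite_exits[OF assms(1), of d a y] in auto)
  ultimately show ?thesis by (simp only: exit_count_def)
qed

text \<open>\<open>sep\<close> leaves at most one visible track per cell of length \<open>e\<close>,
  as \<open>exits_cell\<close> requires; \<open>first\<close> keeps the initial cell empty, where
  the count still refers to the axis.\<close>

lemma hybrid_count_exact:
  assumes z: "good z" and a: "0 < a" and e: "0 < e"
    and sep: "\<And>h h'. h \<in> visible d a z T \<Longrightarrow> h' \<in> visible d a z T \<Longrightarrow> \<bar>trk z h - trk z h'\<bar> \<le> e \<Longrightarrow> h = h'"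
    and first: "\<And>h. h \<in> visible d a z T \<Longrightarrow> e < trk z h"
  shows "t \<le> T \<Longrightarrow> t \<le> e * real (Suc i) \<Longrightarrow> hybrid_count d a e z i t = exit_count d a z t"
proof (induction i arbitrary: t)
  case 0
  have "{l \<in> exits d a z. trk z l \<le> t} = {}"
  proof (rule equals0I)
    fix l assume "l \<in> {l \<in> exits d a z. trk z l \<le> t}"
    then have "l \<in> visible d a z T" "trk z l \<le> e" using 0 by (auto simp: exits_def visible_def)
    then show False using first[of l] by simp
  qed
  moreover have "{k. trk z (Child (Axis d) k) \<le> t} = {}"
  proof (rule equals0I)
    fix k assume "k \<in> {k. trk z (Child (Axis d) k) \<le> t}"
    then have "Child (Axis d) k \<in> visible d a z T" "trk z (Child (Axis d) k) \<le> e" using 0 a by (auto simp: visible_def)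
    then show False using first[of "Child (Axis d) k"] by simp
  qed
  ultimately have "card {k. trk z (Child (Axis d) k) \<le> t} = card {l \<in> exits d a z. trk z l \<le> t}" by (simp only: card.empty)
  then show ?case by (simp only: hybrid_count.simps child_count_def exit_count_def)
next
  case (Suc i)
  let ?y = "e * real (Suc i)"
  have y: "0 < ?y" using e by simp
  show ?case
  proof (cases "t \<le> ?y")
    case True
    then show ?thesis using Suc.IH[OF Suc.prems(1) True] by simp
  next
    case False
    then have yt: "?y < t" by simp
    let ?v = "front d a z ?y"
    have te: "t \<le> ?y + e" using Suc.prems(2) by (simp add: algebra_simps)
    have "{l \<in> exits d a z. ?y < trk z l \<and> trk z l \<le> t} = Child ?v ` {k. ?y < trk z (Child ?v k) \<and> trk z (Child ?v k) \<le> t}"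
    proof (rule exits_cell[OF z a y yt])
      fix h h' assume h: "h \<in> visible d a z t" "h' \<in> visible d a z t" "?y \<le> trk z h" "?y \<le> trk z h'"
      then have "trk z h \<le> t" "trk z h' \<le> t" by (simp_all add: visible_def)
      then have "\<bar>trk z h - trk z h'\<bar> \<le> e" using h(3,4) te by linarith
      then show "h = h'" using h(1,2) Suc.prems(1) by (intro sep) (auto simp: visible_def)
    qed
    then have "card {l \<in> exits d a z. ?y < trk z l \<and> trk z l \<le> t} = card {k. ?y < trk z (Child ?v k) \<and> trk z (Child ?v k) \<le> t}"
      by (simp only:) (rule card_image, simp add: inj_on_def)
    moreover have "hybrid_count d a e z i ?y = exit_count d a z ?y"
      by (rule Suc.IH) (use yt Suc.prems in simp_all)
    moreover have "hybrid_count d a e z (Suc i) t = hybrid_count d a e z i ?y + (child_count z ?v t - child_count z ?v ?y)"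
      using False by simp
    ultimately show ?thesis
      using child_count_diff[OF z less_imp_le[OF yt], of ?v] exit_count_diff[OF z less_imp_le[OF yt], of d a] by linarith
  qed
qed

lemma hybrid_count_eventually:
  assumes z: "good z" and a: "0 < a"
  shows "\<forall>\<^sub>F n in sequentially. hybrid_count d a (1 / real (Suc n)) z (Suc n * Suc n) t = exit_count d a z t"
proof -
  let ?V = "visible d a z t"
  \<comment> \<open>\<open>D\<close> collects the tracks and their mutual distances; a mesh below
    its minimum satisfies both hypotheses of \<open>hybrid_count_exact\<close>. The element 1 keeps
    \<open>D\<close> nonempty.\<close>
  define D where "D = insert 1 (trk z ` ?V \<union> (\<lambda>x. \<bar>trk z (fst x) - trk z (snd x)\<bar>) ` {x \<in> ?V \<times> ?V. fst x \<noteq> snd x})"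
  have fin: "finite D" using finite_visible[OF z] by (simp add: D_def)
  have pos: "0 < x" if "x \<in> D" for x
  proof -
    have "0 < trk z h" if "h \<in> ?V" for h
      using that trk_Child_pos[OF z] by (cases h) (auto simp: visible_def simp del: trk_simps(2))
    moreover have "trk z h \<noteq> trk z h'" if "h \<in> ?V" "h' \<in> ?V" "h \<noteq> h'" for h h'
      using that good_distinct[OF z, of h h'] by (auto simp: visible_def)
    ultimately show ?thesis using that by (auto simp: D_def)
  qed
  have m: "0 < Min D" using fin pos Min_in[OF fin] by (auto simp: D_def)
  obtain n0 where n0: "inverse (real (Suc n0)) < Min D" using reals_Archimedean[OF m] by blast
  obtain n1 :: nat where n1: "t \<le> real n1" using real_arch_simple by blast
  show ?thesis
    unfolding eventually_sequentially
  proof (intro exI[of _ "max n0 n1"] allI impI)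
    fix n assume n: "max n0 n1 \<le> n"
    define e where "e = 1 / real (Suc n)"
    have "e \<le> inverse (real (Suc n0))" using n by (simp add: e_def inverse_eq_divide frac_le)
    then have e: "0 < e" "e < Min D" using n0 by (simp_all add: e_def)
    have eD: "e < x" if "x \<in> D" for x using e(2) Min_le[OF fin that] by simp
    \<comment> \<open>The square of \<open>Suc n\<close> grid steps of mesh 1 / Suc n reach height
      Suc n; one more mesh is added because exactness includes the next cell.\<close>
    have "e * real (Suc (Suc n * Suc n)) = real (Suc n) + e" by (simp add: e_def field_simps)
    then have te: "t \<le> e * real (Suc (Suc n * Suc n))" using n1 n e(1) by simp
    have "hybrid_count d a e z (Suc n * Suc n) t = exit_count d a z t"
    proof (rule hybrid_count_exact[OF z a e(1) _ _ order_refl te])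
      show "e < trk z h" if "h \<in> ?V" for h using that by (intro eD) (auto simp: D_def)
      show "h = h'" if "h \<in> ?V" "h' \<in> ?V" "\<bar>trk z h - trk z h'\<bar> \<le> e" for h h'
      proof (rule ccontr)
        assume "h \<noteq> h'"
        then have "\<bar>trk z h - trk z h'\<bar> \<in> (\<lambda>x. \<bar>trk z (fst x) - trk z (snd x)\<bar>) ` {x \<in> ?V \<times> ?V. fst x \<noteq> snd x}"
          using that(1,2) by (intro image_eqI[of _ _ "(h, h')"]) auto
        then have "e < \<bar>trk z h - trk z h'\<bar>" by (intro eD) (auto simp: D_def)
        then show False using that(3) by simp
      qed
    qed
    then show "hybrid_count d a (1 / real (Suc n)) z (Suc n * Suc n) t = exit_count d a z t" by (simp only: e_def)
  qed
qed

text \<open>Every approximation has law \<open>count_law\<close> exactly and eventually equals the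
  exit count at the finitely many times of \<open>J\<close>. By dominated convergence the
  probability of a cylinder is the limit of a constant sequence.\<close>

proposition distr_exit_count:
  assumes a: "0 < a" shows "distr noise cnt_space (exit_count d a) = count_law"
proof (rule cnt_measure_eqI)
  show "finite_measure (distr noise cnt_space (exit_count d a))"
    by (rule noise.finite_measure_distr[OF measurable_exit_count])
  fix J :: "real set" and K :: "real \<Rightarrow> nat" assume J: "finite J"
  let ?h = "\<lambda>n z. hybrid_count d a (1 / real (Suc n)) z (Suc n * Suc n)"
  let ?B = "{c. \<forall>t\<in>J. c t = K t}"
  have B: "?B \<in> sets cnt_space"
  proof -
    have "{c \<in> space cnt_space. \<forall>t\<in>J. c t = K t} \<in> sets cnt_space"
      using J by (intro sets.sets_Collect_finite_All) measurable
    then show ?thesis by simp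
  qed
  define A where "A n = ?h n -` ?B" for n
  define A' where "A' = exit_count d a -` ?B"
  have mA: "A n \<in> sets noise" for n
    using measurable_sets[OF measurable_hybrid_count B] by (simp only: A_def space_noise Int_UNIV_right)
  have mA': "A' \<in> sets noise"
    using measurable_sets[OF measurable_exit_count B] by (simp add: A'_def)
  have "AE z in noise. \<forall>\<^sub>F n in sequentially. z \<in> A n \<longleftrightarrow> z \<in> A'"
    using AE_good
  proof eventually_elim
    case (elim z)
    have "\<forall>\<^sub>F n in sequentially. \<forall>t\<in>J. ?h n z t = exit_count d a z t"
      using J hybrid_count_eventually[OF elim a] by (intro eventually_ball_finite) auto
    then show ?case by eventually_elim (simp only: A_def A'_def vimage_eq mem_Collect_eq cong: ball_cong)
  qed
  then have "AE z in noise. (\<lambda>n. indicat_real (A n) z) \<longlonglongrightarrow> indicat_real A' z"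
  proof eventually_elim
    case (elim z)
    show ?case by (rule tendsto_eventually) (use elim in \<open>eventually_elim, simp add: indicator_def\<close>)
  qed
  then have "(\<lambda>n. integral\<^sup>L noise (indicat_real (A n))) \<longlonglongrightarrow> integral\<^sup>L noise (indicat_real A')"
    by (intro integral_dominated_convergence[where w = "\<lambda>_. 1"]) (use mA mA' in \<open>auto simp: indicator_def\<close>)
  then have lim: "(\<lambda>n. measure noise (A n)) \<longlonglongrightarrow> measure noise A'"
    using mA mA' by simp
  have An: "measure noise (A n) = measure count_law ?B" for n
  proof -
    have "measure count_law ?B = measure (distr noise cnt_space (?h n)) ?B"
      by (subst distr_hybrid_count[OF a]) (simp_all only: of_nat_0_less_iff zero_less_Suc zero_less_divide_1_iff)
    also have "\<dots> = measure noise (A n)"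
      by (subst measure_distr[OF measurable_hybrid_count B]) (simp only: A_def space_noise Int_UNIV_right)
    finally show ?thesis by simp
  qed
  have "measure noise A' = measure count_law ?B"
    using lim unfolding An by (simp add: LIMSEQ_const_iff)
  moreover have "emeasure (distr noise cnt_space (exit_count d a)) ?B = ennreal (measure noise A')"
    by (subst emeasure_distr[OF measurable_exit_count B]) (simp add: A'_def noise.emeasure_eq_measure)
  moreover interpret cl: prob_space count_law
    unfolding count_law_def by (rule gap_law.prob_space_distr[OF measurable_nb_cnt])
  have "emeasure count_law ?B = ennreal (measure count_law ?B)" by (rule cl.emeasure_eq_measure)
  ultimately show "emeasure (distr noise cnt_space (exit_count d a)) ?B = emeasure count_law ?B" by simp
qed (simp_all add: count_law_def)

lemma exit_gaps_eq: "exit_gaps d a z = gap_seq (exit_count d a z)"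
  unfolding exit_gaps_def exit_count_def ..

lemma measurable_exit_gaps: "exit_gaps d a \<in> measurable noise gap_law"
  using measurable_compose[OF measurable_exit_count measurable_gap_seq] unfolding exit_gaps_eq[abs_def] .

lemma distr_exit_gaps: "0 < a \<Longrightarrow> distr noise gap_law (exit_gaps d a) = gap_law"
  using distr_gap_seq[OF measurable_exit_count distr_exit_count] unfolding exit_gaps_eq[abs_def] .

text \<open>The law yields the counts at rational times; since the exits have distinct tracks and
  are locally finite, these counts determine the set of tracks.\<close>

lemma AE_regular_exits:
  assumes a: "0 < a" shows "AE z in noise. regular_exits d a z"
  using AE_gap_seq[OF measurable_exit_count distr_exit_count[OF a], of d] AE_good
proof eventually_elim
  case (elim z)
  let ?x = "exit_gaps d a z"
  have g: "good_seq ?x" "exit_count d a z (of_rat q) = nb ?x (of_rat q)" for q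
    using elim(1) by (auto simp: exit_gaps_eq)
  have im: "trk z ` exits d a z \<inter> {..t} = trk z ` {l \<in> exits d a z. trk z l \<le> t}" for t by auto
  have inj: "inj_on (trk z) {l \<in> exits d a z. trk z l \<le> t}" for t
    using good_distinct[OF elim(2)] by (auto simp: inj_on_def exits_def)
  have "trk z ` exits d a z = range (psum ?x)"
  proof (rule eq_range_psum[OF g(1)])
    show "finite (trk z ` exits d a z \<inter> {..t})" for t
      unfolding im by (rule finite_imageI[OF finite_exits[OF elim(2)]])
    show "card (trk z ` exits d a z \<inter> {..of_rat q}) = nb ?x (of_rat q)" for q
      unfolding im card_image[OF inj] g(2)[symmetric] exit_count_def ..
  qed
  then show ?case using g(1) by (simp add: regular_exits_def)
qed

section \<open>Stationarity of the tree\<close>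

lemma measurable_exit_at: "(\<lambda>z. exit_at d a z k) \<in> measurable noise (count_space UNIV)"
proof -
  note [measurable] = measurable_exits
  have [measurable]: "Measurable.pred noise (\<lambda>z. trk z l = psum (exit_gaps d a z) k)" for l
  proof -
    have "(\<lambda>z. psum (exit_gaps d a z) k) \<in> borel_measurable noise" by (rule measurable_psum[OF measurable_exit_gaps])
    then show ?thesis unfolding pred_def using measurable_pos[of l] by (intro borel_measurable_eq) auto
  qed
  show ?thesis unfolding exit_at_def by measurable
qed

lemma measurable_old_label: "(\<lambda>z. old_label d a z l) \<in> measurable noise (count_space UNIV)"
proof (induction l)
  case (Axis b)
  show ?case by simp
next
  case (Child l k)
  have "(\<lambda>z. Child m (k + nb (z m) (a - org z m))) \<in> measurable noise (count_space UNIV)" for m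
  proof -
    have "(\<lambda>z. nb (z m) (a - org z m)) \<in> measurable noise (count_space UNIV)"
      using measurable_pos[of m] by (intro measurable_nb measurable_noise_component) simp
    then show ?thesis by (rule measurable_compose) simp
  qed
  from measurable_compose_countable[OF this Child]
  have 1: "(\<lambda>z. Child (old_label d a z l) (k + nb (z (old_label d a z l)) (a - org z (old_label d a z l)))) \<in> measurable noise (count_space UNIV)" .
  have 2: "(\<lambda>z. Child (old_label d a z l) k) \<in> measurable noise (count_space UNIV)"
    by (rule measurable_compose[OF Child]) simp
  show ?case
  proof (cases "l = Axis d")
    case True
    then show ?thesis using measurable_exit_at by simp
  next
    case False
    then show ?thesis using 1 2 by (cases "crossing d l") simp_all
  qed
qed

lemma measurable_new_noise:
  "(\<lambda>(z1, z2). new_noise d a z1 z2) \<in> measurable (noise \<Otimes>\<^sub>M noise) noise"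
  unfolding split_beta'
proof (rule measurable_noiseI)
  fix l
  show "(\<lambda>w. new_noise d a (fst w) (snd w) l) \<in> measurable (noise \<Otimes>\<^sub>M noise) gap_law"
  proof (cases "l = Axis d")
    case True
    then show ?thesis using measurable_compose[OF measurable_fst measurable_exit_gaps] by (simp add: new_noise_def)
  next
    case False
    have "(\<lambda>w. snd w (old_label d a (fst w) l)) \<in> measurable (noise \<Otimes>\<^sub>M noise) gap_law"
    proof (rule measurable_compose_countable)
      show "(\<lambda>w. snd w m) \<in> measurable (noise \<Otimes>\<^sub>M noise) gap_law" for m :: label
        by (rule measurable_compose[OF measurable_snd measurable_noise_component])
      show "(\<lambda>w. old_label d a (fst w) l) \<in> measurable (noise \<Otimes>\<^sub>M noise) (count_space UNIV)"
        by (rule measurable_compose[OF measurable_fst measurable_old_label])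
    qed
    then show ?thesis using False by (simp add: new_noise_def)
  qed
qed

lemma nn_integral_PiM_prod_inj:
  assumes M: "prob_space M" and J: "finite J" and inj: "inj_on f J" and A: "\<And>j. j \<in> J \<Longrightarrow> A j \<in> sets M"
  shows "(\<integral>\<^sup>+\<omega>. (\<Prod>j\<in>J. indicator (A j) (\<omega> (f j))) \<partial>PiM UNIV (\<lambda>_::'i. M)) = (\<Prod>j\<in>J. emeasure M (A j))"
proof -
  let ?P = "PiM UNIV (\<lambda>_::'i. M)"
  define g where "g = the_inv_into J f"
  have g: "g (f j) = j" if "j \<in> J" for j unfolding g_def by (rule the_inv_into_f_f[OF inj that])
  let ?S = "{\<omega> \<in> space ?P. \<forall>i\<in>f ` J. \<omega> i \<in> A (g i)}"
  have S: "?S \<in> sets ?P"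
    using J A by (intro sets.sets_Collect_finite_All) (auto intro!: sets_Collect_single' simp: g)
  have "(\<integral>\<^sup>+\<omega>. (\<Prod>j\<in>J. indicator (A j) (\<omega> (f j))) \<partial>?P) = (\<integral>\<^sup>+\<omega>. indicator ?S \<omega> \<partial>?P)"
  proof (rule nn_integral_cong)
    fix \<omega> assume \<omega>: "\<omega> \<in> space ?P"
    have "(\<Prod>j\<in>J. indicator (A j) (\<omega> (f j))) = (indicator {\<omega>. \<forall>j\<in>J. \<omega> (f j) \<in> A j} \<omega> :: ennreal)"
      using J by induction (auto split: split_indicator)
    then show "(\<Prod>j\<in>J. indicator (A j) (\<omega> (f j))) = (indicator ?S \<omega> :: ennreal)"
      using \<omega> g by (auto simp: indicator_def)
  qed
  also have "\<dots> = emeasure ?P ?S" using S by simp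
  also have "\<dots> = (\<Prod>i\<in>f ` J. emeasure M (A (g i)))"
    using J A g by (intro emeasure_PiM_UNIV_Collect[OF M]) auto
  also have "\<dots> = (\<Prod>j\<in>J. emeasure M (A j))"
    using g by (simp add: prod.reindex[OF inj])
  finally show ?thesis .
qed

text \<open>For fixed \<open>z1\<close> the sequences off the new axis are coordinates of
  \<open>z2\<close> picked by an injection, so their joint law is the same for almost every
  \<open>z1\<close>. The gaps on the axis depend on \<open>z1\<close> alone and have law
  \<open>gap_law\<close> by \<open>distr_exit_gaps\<close>.\<close>

proposition distr_new_noise:
  assumes a: "0 < a"
  shows "distr (noise \<Otimes>\<^sub>M noise) noise (\<lambda>(z1, z2). new_noise d a z1 z2) = noise"
proof (rule PiM_UNIV_eqI[OF prob_space_gap_law])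
  let ?D = "distr (noise \<Otimes>\<^sub>M noise) noise (\<lambda>(z1, z2). new_noise d a z1 z2)"
  fix J :: "label set" and A assume J: "finite J" and A: "\<And>i. i \<in> J \<Longrightarrow> A i \<in> sets gap_law"
  define B where "B = (if Axis d \<in> J then A (Axis d) else UNIV)"
  define J' where "J' = J - {Axis d}"
  have U: "UNIV \<in> sets gap_law" using sets.top[of gap_law] by simp
  have B: "B \<in> sets gap_law" using A U by (simp add: B_def)
  have J': "finite J'" "\<And>j. j \<in> J' \<Longrightarrow> A j \<in> sets gap_law" using J A by (auto simp: J'_def)
  have split: "(\<Prod>j\<in>J. indicator (A j) (w j)) = indicator B (w (Axis d)) * (\<Prod>j\<in>J'. indicator (A j) (w j) :: ennreal)" for w
    using J by (cases "Axis d \<in> J") (simp_all add: B_def J'_def prod.remove)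
  have eB: "(\<Prod>j\<in>J. emeasure gap_law (A j)) = emeasure gap_law B * (\<Prod>j\<in>J'. emeasure gap_law (A j))"
    using J by (cases "Axis d \<in> J") (simp_all add: B_def J'_def prod.remove gap_law.emeasure_space_1[simplified])
  let ?S = "{w. \<forall>i\<in>J. w i \<in> A i}"
  have S: "?S \<in> sets noise"
  proof -
    have "{w \<in> space noise. \<forall>i\<in>J. w i \<in> A i} \<in> sets noise"
      using J A by (intro sets.sets_Collect_finite_All) (auto intro!: sets_Collect_single' simp del: space_noise)
    then show ?thesis by simp
  qed
  have ind: "indicator ?S w = (\<Prod>j\<in>J. indicator (A j) (w j) :: ennreal)" for w
    using J by induction (auto split: split_indicator)
  have mS: "(\<lambda>(z1, z2). indicator ?S (new_noise d a z1 z2) :: ennreal) \<in> borel_measurable (noise \<Otimes>\<^sub>M noise)"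
    using measurable_compose[OF measurable_new_noise borel_measurable_indicator[OF S]] by (simp add: split_beta')
  have "emeasure ?D {\<omega> \<in> space ?D. \<forall>i\<in>J. \<omega> i \<in> A i} = (\<integral>\<^sup>+w. indicator ?S w \<partial>?D)"
    using S by simp
  also have "\<dots> = (\<integral>\<^sup>+w. indicator ?S (case w of (z1, z2) \<Rightarrow> new_noise d a z1 z2) \<partial>(noise \<Otimes>\<^sub>M noise))"
    by (rule nn_integral_distr[OF measurable_new_noise]) (use S in simp)
  also have "\<dots> = (\<integral>\<^sup>+z1. (\<integral>\<^sup>+z2. indicator ?S (new_noise d a z1 z2) \<partial>noise) \<partial>noise)"
    using noise.nn_integral_fst[OF mS] by (simp add: split_beta')
  also have "\<dots> = (\<integral>\<^sup>+z1. indicator B (exit_gaps d a z1) * (\<Prod>j\<in>J'. emeasure gap_law (A j)) \<partial>noise)"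
  proof (rule nn_integral_cong_AE)
    show "AE z1 in noise. (\<integral>\<^sup>+z2. indicator ?S (new_noise d a z1 z2) \<partial>noise) =
      indicator B (exit_gaps d a z1) * (\<Prod>j\<in>J'. emeasure gap_law (A j))"
      using AE_good AE_regular_exits[OF a, of d]
    proof eventually_elim
      case (elim z1)
      \<comment> \<open>The injectivity wanted here concerns \<open>old_label d a z1\<close>;
        \<open>z1\<close> itself serves as the second noise of the locale.\<close>
      interpret cut d a z1 z1
        by unfold_locales (use a elim in \<open>simp_all add: good_def\<close>)
      have inj: "inj_on (old_label d a z1) J'"
        using old_inj by (auto simp: inj_on_def J'_def)
      have m: "(\<lambda>z2. \<Prod>j\<in>J'. indicator (A j) (z2 (old_label d a z1 j)) :: ennreal) \<in> borel_measurable noise"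
        by (intro borel_measurable_prod_ennreal measurable_compose[OF measurable_noise_component] borel_measurable_indicator J'(2))
      have "(\<integral>\<^sup>+z2. indicator ?S (new_noise d a z1 z2) \<partial>noise) =
        (\<integral>\<^sup>+z2. indicator B (exit_gaps d a z1) * (\<Prod>j\<in>J'. indicator (A j) (z2 (old_label d a z1 j))) \<partial>noise)"
      proof (rule nn_integral_cong)
        fix z2
        have "(\<Prod>j\<in>J'. indicator (A j) (new_noise d a z1 z2 j)) = (\<Prod>j\<in>J'. indicator (A j) (z2 (old_label d a z1 j)) :: ennreal)"
          by (intro prod.cong) (auto simp: J'_def new_noise_def)
        then show "indicator ?S (new_noise d a z1 z2) =
            indicator B (exit_gaps d a z1) * (\<Prod>j\<in>J'. indicator (A j) (z2 (old_label d a z1 j)) :: ennreal)"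
          unfolding ind split by (simp add: new_noise_def)
      qed
      also have "\<dots> = indicator B (exit_gaps d a z1) * (\<integral>\<^sup>+z2. (\<Prod>j\<in>J'. indicator (A j) (z2 (old_label d a z1 j))) \<partial>noise)"
        by (rule nn_integral_cmult[OF m])
      also have "(\<integral>\<^sup>+z2. (\<Prod>j\<in>J'. indicator (A j) (z2 (old_label d a z1 j))) \<partial>noise) = (\<Prod>j\<in>J'. emeasure gap_law (A j))"
        by (rule nn_integral_PiM_prod_inj[OF prob_space_gap_law J'(1) inj J'(2)])
      finally show ?case .
    qed
  qed
  also have "\<dots> = (\<integral>\<^sup>+z1. indicator B (exit_gaps d a z1) \<partial>noise) * (\<Prod>j\<in>J'. emeasure gap_law (A j))"
    by (rule nn_integral_multc) (rule measurable_compose[OF measurable_exit_gaps borel_measurable_indicator[OF B]])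
  also have "(\<integral>\<^sup>+z1. indicator B (exit_gaps d a z1) \<partial>noise) = (\<integral>\<^sup>+x. indicator B x \<partial>distr noise gap_law (exit_gaps d a))"
    by (rule nn_integral_distr[OF measurable_exit_gaps, symmetric]) (use B in simp)
  also have "\<dots> = emeasure gap_law B"
    unfolding distr_exit_gaps[OF a] using B by simp
  finally show "emeasure ?D {\<omega> \<in> space ?D. \<forall>i\<in>J. \<omega> i \<in> A i} = (\<Prod>i\<in>J. emeasure gap_law (A i))"
    unfolding eB .
qed simp

lemma AE_restrict_cut:
  assumes a: "0 < a"
  shows "AE w in noise \<Otimes>\<^sub>M noise.
    restrict_quadrant (cut_x d a) (cut_y d a) (tree_diagram (case w of (z1, z2) \<Rightarrow> cut_noise d a z1 z2)) =
    translate (cut_x d a) (cut_y d a) (tree_diagram (case w of (z1, z2) \<Rightarrow> new_noise d a z1 z2))"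
proof -
  \<comment> \<open>\<open>cut_noise\<close> and \<open>new_noise\<close> have the law
    \<open>noise\<close>, so almost sure properties of a single noise carry over to both.\<close>
  have O: "AE w in noise \<Otimes>\<^sub>M noise. good (case w of (z1, z2) \<Rightarrow> cut_noise d a z1 z2)"
    by (rule AE_distrD[OF measurable_cut_noise]) (simp only: distr_cut_noise AE_good)
  have N: "AE w in noise \<Otimes>\<^sub>M noise. good (case w of (z1, z2) \<Rightarrow> new_noise d a z1 z2)"
    by (rule AE_distrD[OF measurable_new_noise]) (simp only: distr_new_noise[OF a] AE_good)
  have C: "AE w in noise \<Otimes>\<^sub>M noise. \<forall>l k. trk (case w of (z1, z2) \<Rightarrow> cut_noise d a z1 z2) (Child l k) \<noteq> a"
    by (rule AE_distrD[OF measurable_cut_noise]) (simp only: distr_cut_noise AE_trk_neq_const)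
  show ?thesis
    using AE_pair_fst[OF prob_space_noise AE_good] AE_pair_fst[OF prob_space_noise AE_regular_exits[OF a, of d]]
      AE_pair_snd[OF prob_space_noise prob_space_noise AE_seq] O N C
  proof eventually_elim
    case (elim w)
    interpret cut_good d a "fst w" "snd w"
      using a elim by unfold_locales (simp_all add: split_beta' del: trk_simps)
    show ?case using restrict_cut by (simp only: split_beta')
  qed
qed

text \<open>Both sides are functions of the same pair of noises, which turns the pathwise identity
  into equality of laws. The map \<open>F\<close> makes room for the operation in the other
  coordinate.\<close>

lemma distr_restrict_cut:
  assumes a: "0 < a"
    and m: "segment_process noise (\<lambda>z. F (restrict_quadrant (cut_x d a) (cut_y d a) (tree_diagram z)))"
      "segment_process noise (\<lambda>z. F (translate (cut_x d a) (cut_y d a) (tree_diagram z)))"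
  shows "distr noise segments_space (\<lambda>z. F (restrict_quadrant (cut_x d a) (cut_y d a) (tree_diagram z))) =
    distr noise segments_space (\<lambda>z. F (translate (cut_x d a) (cut_y d a) (tree_diagram z)))"
    (is "distr _ _ ?R = distr _ _ ?T")
proof -
  note mR = segment_process_measurable[OF m(1)] and mT = segment_process_measurable[OF m(2)]
  have "distr noise segments_space ?R =
    distr (distr (noise \<Otimes>\<^sub>M noise) noise (\<lambda>(z1, z2). cut_noise d a z1 z2)) segments_space ?R"
    by (simp only: distr_cut_noise)
  also have "\<dots> = distr (noise \<Otimes>\<^sub>M noise) segments_space (\<lambda>w. ?R (case w of (z1, z2) \<Rightarrow> cut_noise d a z1 z2))"
    by (subst distr_distr[OF mR measurable_cut_noise]) (simp only: comp_def)
  also have "\<dots> = distr (noise \<Otimes>\<^sub>M noise) segments_space (\<lambda>w. ?T (case w of (z1, z2) \<Rightarrow> new_noise d a z1 z2))"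
  proof (rule distr_cong_AE)
    show "AE w in noise \<Otimes>\<^sub>M noise. ?R (case w of (z1, z2) \<Rightarrow> cut_noise d a z1 z2) = ?T (case w of (z1, z2) \<Rightarrow> new_noise d a z1 z2)"
      using AE_restrict_cut[OF a, of d] by eventually_elim (simp only:)
  qed (use measurable_compose[OF measurable_cut_noise mR] measurable_compose[OF measurable_new_noise mT] in simp_all)
  also have "\<dots> = distr (distr (noise \<Otimes>\<^sub>M noise) noise (\<lambda>(z1, z2). new_noise d a z1 z2)) segments_space ?T"
    by (subst distr_distr[OF mT measurable_new_noise]) (simp only: comp_def)
  also have "\<dots> = distr noise segments_space ?T"
    by (simp only: distr_new_noise[OF a])
  finally show ?thesis .
qed

section \<open>Composition of the two cuts\<close>

lemma image_filter_image:
  "f ` {s \<in> g ` {s \<in> L. P s}. Q s} = (\<lambda>s. f (g s)) ` {s \<in> L. P s \<and> Q (g s)}"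
  by auto

lemma restrict_restrict:
  assumes "0 \<le> b" shows "restrict_quadrant a b (restrict_quadrant a 0 L) = restrict_quadrant a b L"
  unfolding restrict_quadrant_image image_filter_image
proof (rule image_cong)
  have *: "0 \<le> y \<and> ereal b \<le> y \<longleftrightarrow> ereal b \<le> y" for y :: ereal
    using assms order_trans[of 0 "ereal b" y] by auto
  show "{s \<in> L. (ereal a \<le> fst (snd s) \<and> ereal 0 \<le> snd (snd s)) \<and>
      ereal a \<le> fst (snd ((max (ereal a) (fst (fst s)), max (ereal 0) (snd (fst s))), snd s)) \<and>
      ereal b \<le> snd (snd ((max (ereal a) (fst (fst s)), max (ereal 0) (snd (fst s))), snd s))} =
    {s \<in> L. ereal a \<le> fst (snd s) \<and> ereal b \<le> snd (snd s)}"
    using * by (auto simp: zero_ereal_def[symmetric])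
  have "max (ereal b) (max 0 y) = max (ereal b) y" for y using assms by (simp add: max.assoc[symmetric] max_absorb1)
  then show "((max (ereal a) (fst (fst ((max (ereal a) (fst (fst s)), max (ereal 0) (snd (fst s))), snd s))),
      max (ereal b) (snd (fst ((max (ereal a) (fst (fst s)), max (ereal 0) (snd (fst s))), snd s)))),
      snd ((max (ereal a) (fst (fst s)), max (ereal 0) (snd (fst s))), snd s)) =
    ((max (ereal a) (fst (fst s)), max (ereal b) (snd (fst s))), snd s)" for s :: segment
    by (simp add: zero_ereal_def[symmetric])
qed

lemma restrict_translate: "restrict_quadrant a b (translate a 0 L) = translate a 0 (restrict_quadrant 0 b L)"
  unfolding restrict_quadrant_image translate_image image_filter_image
proof (rule image_cong)
  have 1: "ereal a \<le> x + ereal a \<longleftrightarrow> 0 \<le> x" for x by (cases x) auto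
  have 2: "max (ereal a) (x + ereal a) = max 0 x + ereal a" for x by (cases x) (auto simp: max_def)
  show "{s \<in> L. True \<and>
      ereal a \<le> fst (snd ((fst (fst s) + ereal a, snd (fst s) + ereal 0), fst (snd s) + ereal a, snd (snd s) + ereal 0)) \<and>
      ereal b \<le> snd (snd ((fst (fst s) + ereal a, snd (fst s) + ereal 0), fst (snd s) + ereal a, snd (snd s) + ereal 0))} =
    {s \<in> L. (ereal 0 \<le> fst (snd s) \<and> ereal b \<le> snd (snd s)) \<and> True}"
    by (simp add: 1 zero_ereal_def[symmetric])
  show "((max (ereal a) (fst (fst ((fst (fst s) + ereal a, snd (fst s) + ereal 0), fst (snd s) + ereal a, snd (snd s) + ereal 0))),
      max (ereal b) (snd (fst ((fst (fst s) + ereal a, snd (fst s) + ereal 0), fst (snd s) + ereal a, snd (snd s) + ereal 0)))),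
      snd ((fst (fst s) + ereal a, snd (fst s) + ereal 0), fst (snd s) + ereal a, snd (snd s) + ereal 0)) =
    ((fst (fst ((max (ereal 0) (fst (fst s)), max (ereal b) (snd (fst s))), snd s)) + ereal a,
      snd (fst ((max (ereal 0) (fst (fst s)), max (ereal b) (snd (fst s))), snd s)) + ereal 0),
      fst (snd ((max (ereal 0) (fst (fst s)), max (ereal b) (snd (fst s))), snd s)) + ereal a,
      snd (snd ((max (ereal 0) (fst (fst s)), max (ereal b) (snd (fst s))), snd s)) + ereal 0)" for s :: segment
    by (simp add: 2 zero_ereal_def[symmetric])
qed

lemma translate_translate: "translate a 0 (translate 0 b L) = translate a b L"
  unfolding translate_image image_filter_image by (simp add: zero_ereal_def[symmetric])

proposition tree_stationary:
  assumes "0 < a" "0 < b"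
  shows "distr noise segments_space (\<lambda>z. restrict_quadrant a b (tree_diagram z)) =
    distr noise segments_space (\<lambda>z. translate a b (tree_diagram z))"
proof -
  note sp = segment_process_restrict segment_process_translate segment_process_tree_diagram
  have "distr noise segments_space (\<lambda>z. restrict_quadrant a b (tree_diagram z)) =
    distr noise segments_space (\<lambda>z. restrict_quadrant a b (restrict_quadrant a 0 (tree_diagram z)))"
    using assms by (simp add: restrict_restrict)
  also have "\<dots> = distr noise segments_space (\<lambda>z. restrict_quadrant a b (translate a 0 (tree_diagram z)))"
    using distr_restrict_cut[OF assms(1), where d = True and F = "restrict_quadrant a b"]
    by (simp add: cut_x_def cut_y_def sp)
  \<comment> \<open>Translation along one axis commutes with restriction along the other, which
    moves the second restriction next to the diagram.\<close>
  also have "\<dots> = distr noise segments_space (\<lambda>z. translate a 0 (restrict_quadrant 0 b (tree_diagram z)))"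
    by (simp only: restrict_translate)
  also have "\<dots> = distr noise segments_space (\<lambda>z. translate a 0 (translate 0 b (tree_diagram z)))"
    using distr_restrict_cut[OF assms(2), where d = False and F = "translate a 0"]
    by (simp add: cut_x_def cut_y_def sp)
  finally show ?thesis by (simp only: translate_translate)
qed

section \<open>Measurability of the graphical construction\<close>

text \<open>Measurability in \<open>config_space\<close> rests on counts, so the choice of the n-th
  point is expressed by counts at rational levels: \<open>n\<close> points lie below
  \<open>p\<close>, one more lies below \<open>q\<close>, and \<open>P\<close> is tested on the
  single point between.\<close>

lemma diag_rank_eq_iff:
  assumes fin: "\<And>s. finite {w \<in> C. fst w + snd w < s}"
  shows "(\<exists>!z. z \<in> C \<and> diag_rank C z = n) \<and> P (THE z. z \<in> C \<and> diag_rank C z = n) \<longleftrightarrow>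
    (\<exists>p q::rat. card {w \<in> C. fst w + snd w < of_rat p} = n \<and> card {w \<in> C. fst w + snd w < of_rat q} = Suc n \<and>
      card {w \<in> C. P w \<and> of_rat p \<le> fst w + snd w \<and> fst w + snd w < of_rat q} = 1)"
    (is "?L \<longleftrightarrow> (\<exists>p q. ?R p q)")
proof
  assume L: ?L
  define z where "z = (THE z. z \<in> C \<and> diag_rank C z = n)"
  have ex1: "\<exists>!z. z \<in> C \<and> diag_rank C z = n" and "P z" using L by (simp_all add: z_def)
  have z: "z \<in> C" "diag_rank C z = n" using theI'[OF ex1] by (simp_all add: z_def)
  have uniq: "w = z" if "w \<in> C" "diag_rank C w = n" for w using ex1 z that by blast
  define s where "s = fst z + snd z"
  define F where "F = (\<lambda>w. fst w + snd w) ` {w \<in> C. fst w + snd w < s + 1} - {s}"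
  have "finite F" using fin[of "s + 1"] by (simp add: F_def)
  then obtain e where e: "0 < e" "\<And>y. y \<in> F \<Longrightarrow> e \<le> dist s y"
    using finite_set_avoid[of F s] by (auto simp: F_def)
  obtain p where p: "s - min e 1 < of_rat p" "of_rat p < s" using of_rat_dense[of "s - min e 1" s] e by auto
  obtain q where q: "s < of_rat q" "of_rat q < s + min e 1" using of_rat_dense[of s "s + min e 1"] e by auto
  have near: "fst w + snd w = s" if "w \<in> C" "of_rat p \<le> fst w + snd w" "fst w + snd w < of_rat q" for w
  proof (rule ccontr)
    assume "fst w + snd w \<noteq> s"
    then have "fst w + snd w \<in> F" using that q by (auto simp: F_def)
    then have "e \<le> dist s (fst w + snd w)" by (rule e)
    then show False using that p q by (auto simp: dist_real_def)
  qed
  \<comment> \<open>Points on the same diagonal level have the same rank, so uniqueness rules out a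
    tie.\<close>
  have "w = z" if "w \<in> C" "fst w + snd w = s" for w
    using that z(2) by (intro uniq) (simp_all add: diag_rank_def s_def)
  then have single: "w = z" if "w \<in> C" "of_rat p \<le> fst w + snd w" "fst w + snd w < of_rat q" for w
    using near that by blast
  have low: "fst w + snd w < of_rat p" if "w \<in> C" "fst w + snd w < s" for w
  proof (rule ccontr)
    assume "\<not> fst w + snd w < of_rat p"
    then have "fst w + snd w = s" using that q by (intro near) simp_all
    then show False using that(2) by simp
  qed
  have "{w \<in> C. fst w + snd w < of_rat p} = {w \<in> C. fst w + snd w < s}"
    using low p(2) by (intro Collect_cong conj_cong refl) (meson less_trans)
  then have n: "card {w \<in> C. fst w + snd w < of_rat p} = n"
    using z(2) by (simp only: diag_rank_def s_def)
  have zs: "of_rat p \<le> fst z + snd z" "fst z + snd z < of_rat q" using p q by (simp_all add: s_def)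
  have ins: "{w \<in> C. fst w + snd w < of_rat q} = insert z {w \<in> C. fst w + snd w < of_rat p}"
  proof (intro equalityI subsetI)
    fix w assume "w \<in> {w \<in> C. fst w + snd w < of_rat q}"
    then show "w \<in> insert z {w \<in> C. fst w + snd w < of_rat p}"
      using single[of w] by (cases "fst w + snd w < of_rat p") simp_all
  next
    fix w assume "w \<in> insert z {w \<in> C. fst w + snd w < of_rat p}"
    then show "w \<in> {w \<in> C. fst w + snd w < of_rat q}"
    proof
      assume "w = z" then show ?thesis using z(1) zs(2) by simp
    qed (use p q in simp)
  qed
  have "z \<notin> {w \<in> C. fst w + snd w < of_rat p}" using zs(1) by simp
  then have Sn: "card {w \<in> C. fst w + snd w < of_rat q} = Suc n"
    unfolding ins using card_insert_disjoint[OF fin] n by simp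
  have "{w \<in> C. P w \<and> of_rat p \<le> fst w + snd w \<and> fst w + snd w < of_rat q} = {z}"
  proof (intro equalityI subsetI)
    fix w assume "w \<in> {w \<in> C. P w \<and> of_rat p \<le> fst w + snd w \<and> fst w + snd w < of_rat q}"
    then show "w \<in> {z}" using single[of w] by simp
  qed (use z(1) \<open>P z\<close> zs in simp)
  then have "?R p q" using n Sn by simp
  then show "\<exists>p q. ?R p q" by blast
next
  assume "\<exists>p q. ?R p q"
  then obtain p q where n: "card {w \<in> C. fst w + snd w < of_rat p} = n"
    and Sn: "card {w \<in> C. fst w + snd w < of_rat q} = Suc n"
    and one: "card {w \<in> C. P w \<and> of_rat p \<le> fst w + snd w \<and> fst w + snd w < of_rat q} = 1" by blast
  let ?S = "\<lambda>s::real. {w \<in> C. fst w + snd w < s}"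
  have pq: "?S (of_rat p) \<subseteq> ?S (of_rat q)"
  proof (rule ccontr)
    assume "\<not> ?S (of_rat p) \<subseteq> ?S (of_rat q)"
    then have "?S (of_rat q) \<subseteq> ?S (of_rat p)" by auto
    then have "card (?S (of_rat q)) \<le> card (?S (of_rat p))" by (intro card_mono fin)
    then show False using n Sn by simp
  qed
  have "card (?S (of_rat q) - ?S (of_rat p)) = 1"
    using card_Diff_subset[OF fin pq] n Sn by simp
  then obtain z where z: "?S (of_rat q) - ?S (of_rat p) = {z}" by (rule card_1_singletonE)
  obtain z' where z': "{w \<in> C. P w \<and> of_rat p \<le> fst w + snd w \<and> fst w + snd w < of_rat q} = {z'}"
    using one by (rule card_1_singletonE)
  have single: "w = z \<longleftrightarrow> w \<in> C \<and> of_rat p \<le> fst w + snd w \<and> fst w + snd w < of_rat q" for w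
  proof -
    have "w = z \<longleftrightarrow> w \<in> ?S (of_rat q) - ?S (of_rat p)" by (simp add: z)
    also have "\<dots> \<longleftrightarrow> w \<in> C \<and> of_rat p \<le> fst w + snd w \<and> fst w + snd w < of_rat q"
      by (auto simp: not_less)
    finally show ?thesis .
  qed
  have "z' \<in> {w \<in> C. P w \<and> of_rat p \<le> fst w + snd w \<and> fst w + snd w < of_rat q}" unfolding z' by simp
  then have "z' = z" "P z'" using single[of z'] by simp_all
  then have Pz: "P z" by simp
  have zC: "z \<in> C" "of_rat p \<le> fst z + snd z" "fst z + snd z < of_rat q" using single[of z] by simp_all
  have rz: "diag_rank C z = n"
  proof -
    have "{w \<in> C. fst w + snd w < fst z + snd z} = ?S (of_rat p)"
    proof (rule set_eqI)
      fix w show "w \<in> {w \<in> C. fst w + snd w < fst z + snd z} \<longleftrightarrow> w \<in> ?S (of_rat p)"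
        using zC single[of w] by (cases "of_rat p \<le> fst w + snd w") auto
    qed
    then show ?thesis using n by (simp add: diag_rank_def)
  qed
  have uniq: "w = z" if w: "w \<in> C" "diag_rank C w = n" for w
  proof (rule ccontr)
    assume "w \<noteq> z"
    then consider "fst w + snd w < of_rat p" | "of_rat q \<le> fst w + snd w" using single[of w] w by linarith
    then show False
    proof cases
      case 1
      then have "{v \<in> C. fst v + snd v < fst w + snd w} \<subset> ?S (of_rat p)" using w by auto
      then have "diag_rank C w < n" unfolding diag_rank_def n[symmetric] by (rule psubset_card_mono[OF fin])
      then show False using w by simp
    next
      case 2
      then have "?S (of_rat q) \<subseteq> {v \<in> C. fst v + snd v < fst w + snd w}" by auto
      then have "Suc n \<le> diag_rank C w" unfolding diag_rank_def Sn[symmetric] by (rule card_mono[OF fin])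
      then show False using w by simp
    qed
  qed
  have ex1: "\<exists>!z. z \<in> C \<and> diag_rank C z = n" using zC(1) rz uniq by blast
  moreover have "(THE z. z \<in> C \<and> diag_rank C z = n) = z"
    using zC(1) rz uniq by (intro the_equality) blast+
  ultimately show ?L using Pz by simp
qed

lemma borel_measurable_map_prod_ereal: "map_prod ereal ereal \<in> borel_measurable borel"
proof -
  have "(\<lambda>z::real \<times> real. (ereal (fst z), ereal (snd z))) \<in> borel_measurable borel"
    by (intro borel_measurable_Pair borel_measurable_ereal borel_measurable_continuous_onI continuous_intros)
  then show ?thesis by (simp add: map_prod_def split_beta')
qed

lemma bounded_triangle: "bounded {w::real \<times> real. 0 \<le> fst w \<and> 0 \<le> snd w \<and> fst w + snd w < s}"
  by (rule bounded_subset[OF bounded_cbox[of "(0,0)" "(s,s)"]]) (auto simp: mem_box Basis_prod_def)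

text \<open>In the quadrant the points below a diagonal level lie in a bounded triangle, so the
  counts in \<open>diag_rank_eq_iff\<close> are counts in bounded Borel sets.\<close>

lemma measurable_nth_point:
  assumes C: "\<And>\<omega>. \<omega> \<in> space M \<Longrightarrow> C \<omega> \<subseteq> {0..} \<times> {0..}"
    and fin: "\<And>\<omega> B. \<omega> \<in> space M \<Longrightarrow> bounded B \<Longrightarrow> finite (C \<omega> \<inter> B)"
    and card: "\<And>B. B \<in> sets borel \<Longrightarrow> bounded B \<Longrightarrow> (\<lambda>\<omega>. card (C \<omega> \<inter> B)) \<in> measurable M (count_space UNIV)"
  shows "(\<lambda>\<omega>. nth_point (C \<omega>) n) \<in> borel_measurable M"
proof (rule measurableI)
  let ?T = "\<lambda>s::real. {w::real \<times> real. 0 \<le> fst w \<and> 0 \<le> snd w \<and> fst w + snd w < s}"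
  have [measurable]: "fst \<in> borel_measurable (borel :: (real \<times> real) measure)" "snd \<in> borel_measurable (borel :: (real \<times> real) measure)"
    by (auto intro!: borel_measurable_continuous_onI continuous_intros)
  have T [measurable]: "?T s \<in> sets borel" for s
    by measurable
  have eq: "{w \<in> C \<omega>. fst w + snd w < s} = C \<omega> \<inter> ?T s" if "\<omega> \<in> space M" for \<omega> s
    using C[OF that] by force
  have fin': "finite {w \<in> C \<omega>. fst w + snd w < s}" if "\<omega> \<in> space M" for \<omega> s
    unfolding eq[OF that] by (rule fin[OF that bounded_triangle])
  define E where "E P \<omega> \<longleftrightarrow> (\<exists>!z. z \<in> C \<omega> \<and> diag_rank (C \<omega>) z = n) \<and> P (THE z. z \<in> C \<omega> \<and> diag_rank (C \<omega>) z = n)" for P \<omega>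
  have E: "{\<omega> \<in> space M. E P \<omega>} \<in> sets M" if P [measurable]: "Measurable.pred borel P" for P
  proof -
    let ?B = "\<lambda>p q::rat. {w. P w \<and> of_rat p \<le> fst w + snd w} \<inter> ?T (of_rat q)"
    have B: "?B p q \<in> sets borel" for p q
      by measurable
    have bB: "bounded (?B p q)" for p q by (rule bounded_subset[OF bounded_triangle]) auto
    note [measurable] = card[OF T bounded_triangle] card[OF B bB]
    have "{\<omega> \<in> space M. E P \<omega>} = {\<omega> \<in> space M. \<exists>p q. card (C \<omega> \<inter> ?T (of_rat p)) = n \<and>
      card (C \<omega> \<inter> ?T (of_rat q)) = Suc n \<and> card (C \<omega> \<inter> ?B p q) = 1}"
    proof (rule Collect_cong, rule conj_cong[OF refl])
      fix \<omega> assume \<omega>: "\<omega> \<in> space M"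
      have "{w \<in> C \<omega>. P w \<and> of_rat p \<le> fst w + snd w \<and> fst w + snd w < of_rat q} = C \<omega> \<inter> ?B p q" for p q :: rat
        using eq[OF \<omega>, of "of_rat q"] by blast
      then show "E P \<omega> \<longleftrightarrow> (\<exists>p q. card (C \<omega> \<inter> ?T (of_rat p)) = n \<and>
        card (C \<omega> \<inter> ?T (of_rat q)) = Suc n \<and> card (C \<omega> \<inter> ?B p q) = 1)"
        unfolding E_def diag_rank_eq_iff[OF fin'[OF \<omega>]] by (simp add: eq[OF \<omega>])
    qed
    also have "\<dots> \<in> sets M" by measurable
    finally show ?thesis .
  qed
  fix A :: "(ereal \<times> ereal) set" assume A: "A \<in> sets borel"
  have P: "Measurable.pred borel (\<lambda>z. map_prod ereal ereal z \<in> A)"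
    using measurable_sets_Collect[OF borel_measurable_map_prod_ereal, of "\<lambda>z. z \<in> A"] A by (simp add: pred_def)
  note [measurable] = E[OF P] E[of "\<lambda>_. True", simplified]
  have "nth_point (C \<omega>) n \<in> A \<longleftrightarrow>
      E (\<lambda>z. map_prod ereal ereal z \<in> A) \<omega> \<or> \<not> E (\<lambda>_. True) \<omega> \<and> (\<infinity>, \<infinity>) \<in> A" for \<omega>
    unfolding nth_point_def E_def
    by (cases "\<exists>!z. z \<in> C \<omega> \<and> diag_rank (C \<omega>) z = n") (simp_all only: if_True if_False simp_thms)
  then have "(\<lambda>\<omega>. nth_point (C \<omega>) n) -` A \<inter> space M =
    {\<omega> \<in> space M. E (\<lambda>z. map_prod ereal ereal z \<in> A) \<omega> \<or> \<not> E (\<lambda>_. True) \<omega> \<and> (\<infinity>, \<infinity>) \<in> A}"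
    by blast
  also have "\<dots> \<in> sets M" by measurable
  finally show "(\<lambda>\<omega>. nth_point (C \<omega>) n) -` A \<inter> space M \<in> sets M" .
qed simp

lemma card_init_X: "card (init_X X \<inter> B) = card (X \<inter> {x. 0 \<le> x \<and> (x, 0) \<in> B})"
proof -
  have "init_X X \<inter> B = (\<lambda>x. (x, 0)) ` (X \<inter> {x. 0 \<le> x \<and> (x, 0) \<in> B})" by (auto simp: init_X_def)
  then show ?thesis by (simp add: card_image inj_on_def)
qed

lemma card_init_Y: "card (init_Y X \<inter> B) = card (X \<inter> {x. x < 0 \<and> (0, - x) \<in> B})"
proof -
  have "init_Y X \<inter> B = (\<lambda>x. (0, - x)) ` (X \<inter> {x. x < 0 \<and> (0, - x) \<in> B})" by (auto simp: init_Y_def)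
  then show ?thesis by (simp add: card_image inj_on_def)
qed

lemma bounded_axis_section:
  assumes "bounded (B :: (real \<times> real) set)"
  shows "bounded {x. 0 \<le> x \<and> (x, 0) \<in> B}" "bounded {x. x < 0 \<and> (0, - x) \<in> B}"
proof -
  obtain r where r: "\<And>w. w \<in> B \<Longrightarrow> norm w \<le> r" using assms by (auto simp: bounded_iff)
  show "bounded {x. 0 \<le> x \<and> (x, 0) \<in> B}"
    unfolding bounded_iff by (rule exI[of _ r]) (auto dest!: r simp: norm_Pair)
  show "bounded {x. x < 0 \<and> (0, - x) \<in> B}"
    unfolding bounded_iff by (rule exI[of _ r]) (auto dest!: r simp: norm_Pair)
qed

lemma finite_init:
  assumes "X \<in> space (config_space UNIV)" "bounded B"
  shows "finite (init_X X \<inter> B)" "finite (init_Y X \<inter> B)"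
proof -
  have "init_X X \<inter> B = (\<lambda>x. (x, 0)) ` (X \<inter> {x. 0 \<le> x \<and> (x, 0) \<in> B})" by (auto simp: init_X_def)
  then show "finite (init_X X \<inter> B)"
    using assms(1) bounded_axis_section(1)[OF assms(2)] by (auto simp: space_config_space)
  have "init_Y X \<inter> B = (\<lambda>x. (0, - x)) ` (X \<inter> {x. x < 0 \<and> (0, - x) \<in> B})" by (auto simp: init_Y_def)
  then show "finite (init_Y X \<inter> B)"
    using assms(1) bounded_axis_section(2)[OF assms(2)] by (auto simp: space_config_space)
qed

lemma measurable_nth_point_init:
  "(\<lambda>X. nth_point (init_X X) n) \<in> borel_measurable (config_space UNIV)"
  "(\<lambda>X. nth_point (init_Y X) n) \<in> borel_measurable (config_space UNIV)"
proof -
  have [measurable]: "(\<lambda>x::real. (x, 0::real)) \<in> borel_measurable borel" "(\<lambda>x::real. (0::real, - x)) \<in> borel_measurable borel"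
    by (auto intro!: borel_measurable_continuous_onI continuous_intros)
  show "(\<lambda>X. nth_point (init_X X) n) \<in> borel_measurable (config_space UNIV)"
  proof (rule measurable_nth_point)
    fix B :: "(real \<times> real) set" assume B [measurable]: "B \<in> sets borel" and b: "bounded B"
    have "{x. 0 \<le> x \<and> (x, 0) \<in> B} \<in> sets borel" by measurable
    then show "(\<lambda>X. card (init_X X \<inter> B)) \<in> measurable (config_space UNIV) (count_space UNIV)"
      unfolding card_init_X by (rule measurable_card_config_space[OF _ bounded_axis_section(1)[OF b]])
  qed (auto simp: init_X_def intro: finite_init(1)[unfolded init_X_def])
  show "(\<lambda>X. nth_point (init_Y X) n) \<in> borel_measurable (config_space UNIV)"
  proof (rule measurable_nth_point)
    fix B :: "(real \<times> real) set" assume B [measurable]: "B \<in> sets borel" and b: "bounded B"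
    have "{x. x < 0 \<and> (0, - x) \<in> B} \<in> sets borel" by measurable
    then show "(\<lambda>X. card (init_Y X \<inter> B)) \<in> measurable (config_space UNIV) (count_space UNIV)"
      unfolding card_init_Y by (rule measurable_card_config_space[OF _ bounded_axis_section(2)[OF b]])
  qed (auto simp: init_Y_def intro: finite_init(2)[unfolded init_Y_def])
qed

lemma measurable_nth_point_planar:
  "(\<lambda>\<Xi>. nth_point \<Xi> n) \<in> borel_measurable (config_space ({0<..} \<times> {0<..}))"
  by (rule measurable_nth_point)
    (use measurable_card_config_space in \<open>auto simp: space_config_space\<close>)

text \<open>The parent relation behind \<open>born\<close>, which makes \<open>bullet_graph\<close>
  an instance of \<open>line_system\<close>.\<close>

primrec bpar :: "line \<Rightarrow> line option" where
  "bpar (FromX n) = None"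
| "bpar (FromY n) = None"
| "bpar (NucV n) = None"
| "bpar (NucH n) = None"
| "bpar (Split l k) = Some l"
| "bpar (Turn l) = Some l"

context bullet_graph
begin

sublocale lines: line_system vert bpar track orig w stopped_by .

lemma evolve_eq: "evolve = lines.step"
proof (intro ext)
  fix A l t
  have "born A l = (case bpar l of None \<Rightarrow> True | Some p \<Rightarrow> A p (track l))" by (cases l) simp_all
  then show "evolve A l t = lines.step A l t"
    unfolding evolve_def lines.step_def crosses_def by simp
qed

lemma arrives_eq: "arrives = lines.arr"
  by (intro ext) (simp add: arrives_def lines.arr_def evolve_eq)

lemma segments_eq: "segments = {lines.sg l | l. lines.arr l (orig l)}"
proof -
  have "segment_of = lines.sg"
    by (intro ext) (simp add: segment_of_def lines.sg_def tip_def lines.tp_def arrives_eq)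
  then show ?thesis
    unfolding segments_def arrives_eq lines.arr_ex_iff by (simp only:) blast
qed

end

lemma sets_waiting_time [simp]: "sets (waiting_time r) = sets borel"
  by (simp add: waiting_time_def)

context
  fixes p :: bullet_param and N :: "real set measure" and Q :: "(real \<times> real) set measure"
  assumes N: "sets N = sets (config_space UNIV)" and Q: "sets Q = sets (config_space ({0<..} \<times> {0<..}))"
begin

abbreviation "marks \<equiv> (\<Pi>\<^sub>M vh\<in>(UNIV :: (line \<times> line) set). uniform_measure lborel {0..1::real})"
abbreviation "turns \<equiv> (\<Pi>\<^sub>M l\<in>UNIV. waiting_time (turn_rate p l))"
abbreviation "splits \<equiv> (\<Pi>\<^sub>M lk\<in>(UNIV :: (line \<times> nat) set). waiting_time (split_rate p (fst lk)))"

lemma measurable_marks: "(\<lambda>u. u vh) \<in> borel_measurable marks"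
  using measurable_component_singleton[of vh UNIV "\<lambda>_. uniform_measure lborel {0..1::real}"]
  by (simp add: measurable_cong_sets[OF refl sets_uniform_measure] )

lemma measurable_turns: "(\<lambda>w. w l) \<in> borel_measurable turns"
  using measurable_component_singleton[of l UNIV "\<lambda>l. waiting_time (turn_rate p l)"]
  by (simp add: measurable_cong_sets[OF refl sets_waiting_time])

lemma measurable_splits: "(\<lambda>g. g lk) \<in> borel_measurable splits"
  using measurable_component_singleton[of lk UNIV "\<lambda>lk. waiting_time (split_rate p (fst lk))"]
  by (simp add: measurable_cong_sets[OF refl sets_waiting_time])

lemma measurable_drive:
  defines "D \<equiv> driving_measure p N Q"
  shows "fst \<in> measurable D N" "(\<lambda>\<omega>. fst (snd \<omega>)) \<in> measurable D Q"
    "(\<lambda>\<omega>. fst (snd (snd \<omega>))) \<in> measurable D splits" "(\<lambda>\<omega>. fst (snd (snd (snd \<omega>)))) \<in> measurable D turns"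
    "(\<lambda>\<omega>. snd (snd (snd (snd \<omega>)))) \<in> measurable D marks"
  unfolding D_def driving_measure_def by measurable

abbreviation "drive_route \<omega> \<equiv>
  bullet_graph.route (fst \<omega>) (fst (snd \<omega>)) (fst (snd (snd \<omega>))) (fst (snd (snd (snd \<omega>))))"

lemma measurable_route:
  "(\<lambda>\<omega>. fst (drive_route \<omega> l)) \<in> borel_measurable (driving_measure p N Q) \<and>
    (\<lambda>\<omega>. snd (drive_route \<omega> l)) \<in> borel_measurable (driving_measure p N Q)"
proof -
  let ?D = "driving_measure p N Q"
  have fs: "fst \<in> borel_measurable (borel :: (ereal \<times> ereal) measure)" "snd \<in> borel_measurable (borel :: (ereal \<times> ereal) measure)"
    by (auto intro!: borel_measurable_continuous_onI continuous_intros)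
  have cong: "measurable N borel = measurable (config_space UNIV) borel"
    "measurable Q borel = measurable (config_space ({0<..} \<times> {0<..})) borel"
    by (auto intro!: measurable_cong_sets N Q)
  note X = measurable_compose[OF measurable_drive(1) measurable_nth_point_init(1)[folded cong(1)]]
  note Y = measurable_compose[OF measurable_drive(1) measurable_nth_point_init(2)[folded cong(1)]]
  note Z = measurable_compose[OF measurable_drive(2) measurable_nth_point_planar[folded cong(2)]]
  note G = measurable_compose[OF measurable_drive(3) measurable_splits]
  note W = measurable_compose[OF measurable_drive(4) measurable_turns]
  note XYZ = X[THEN measurable_compose, OF fs(1)] X[THEN measurable_compose, OF fs(2)]
    Y[THEN measurable_compose, OF fs(1)] Y[THEN measurable_compose, OF fs(2)]
    Z[THEN measurable_compose, OF fs(1)] Z[THEN measurable_compose, OF fs(2)]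
  show ?thesis
  proof (induction l)
    case (Split l k)
    show ?case
      unfolding bullet_graph.route.simps fst_conv snd_conv
      by (intro conjI borel_measurable_ereal_add borel_measurable_ereal_sum G Split[THEN conjunct1] Split[THEN conjunct2])
  next
    case (Turn l)
    show ?case
      unfolding bullet_graph.route.simps fst_conv snd_conv
      by (intro conjI borel_measurable_ereal_add W Turn[THEN conjunct1] Turn[THEN conjunct2])
  qed (unfold bullet_graph.route.simps fst_swap snd_swap, (intro conjI XYZ)+)
qed

lemma segment_process_diagram: "segment_process (driving_measure p N Q) (diagram p)"
proof -
  let ?D = "driving_measure p N Q"
  define trk where "trk \<omega> l = fst (drive_route \<omega> l)" for \<omega> :: driving and l
  define org where "org \<omega> l = snd (drive_route \<omega> l)" for \<omega> :: driving and l
  define w where "w \<omega> = fst (snd (snd (snd \<omega>)))" for \<omega> :: driving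
  define stp where "stp \<omega> = bullet_graph.stopped_by p (snd (snd (snd (snd \<omega>))))" for \<omega> :: driving
  have m: "(\<lambda>\<omega>. trk \<omega> l) \<in> borel_measurable ?D" "(\<lambda>\<omega>. org \<omega> l) \<in> borel_measurable ?D"
    "(\<lambda>\<omega>. w \<omega> l) \<in> borel_measurable ?D" for l
    using measurable_route[of l] measurable_compose[OF measurable_drive(4) measurable_turns[of l]]
    by (simp_all only: trk_def org_def w_def)
  have s: "Measurable.pred ?D (\<lambda>\<omega>. stp \<omega> l l')" for l l'
  proof -
    note [measurable] = measurable_compose[OF measurable_drive(5) measurable_marks]
    show ?thesis
      unfolding stp_def bullet_graph.stopped_by_def by (cases "vert l"; simp only: if_True if_False; measurable)
  qed
  show ?thesis
  proof (rule segment_processI)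
    show "(\<lambda>\<omega>. line_system.sg vert bpar (trk \<omega>) (org \<omega>) (w \<omega>) (stp \<omega>) l) \<in> borel_measurable ?D" for l
      by (rule measurable_sg[OF m s])
    show "Measurable.pred ?D (\<lambda>\<omega>. line_system.arr vert bpar (trk \<omega>) (org \<omega>) (w \<omega>) (stp \<omega>) l (org \<omega> l))" for l
      by (rule measurable_arr[OF m s m(2)])
    have "bullet_graph.track (fst \<omega>) (fst (snd \<omega>)) (fst (snd (snd \<omega>))) (fst (snd (snd (snd \<omega>)))) = trk \<omega>"
      "bullet_graph.orig (fst \<omega>) (fst (snd \<omega>)) (fst (snd (snd \<omega>))) (fst (snd (snd (snd \<omega>)))) = org \<omega>" for \<omega> :: driving
      by (intro ext, simp only: bullet_graph.track_def bullet_graph.orig_def trk_def org_def)+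
    then show "diagram p \<omega> = {line_system.sg vert bpar (trk \<omega>) (org \<omega>) (w \<omega>) (stp \<omega>) l | l.
        line_system.arr vert bpar (trk \<omega>) (org \<omega>) (w \<omega>) (stp \<omega>) l (org \<omega> l)}" for \<omega>
      unfolding diagram_def split_beta' bullet_graph.segments_eq by (simp only: w_def stp_def)
  qed
qed

end

section \<open>From the graphical construction to the tree\<close>

context line_system
begin

lemma arr_parent: "arr l t \<Longrightarrow> par l = Some p \<Longrightarrow> arr p (trk l)"
  unfolding arr_Suc[of l t] arr_def[of p] by (erule eventually_mono) (simp add: step_def)

text \<open>A line that arrives at infinity also arrives at arbitrarily large finite coordinates.
  The restriction matters because states are compared at finite coordinates in
  \<open>arr_eq\<close>.\<close>

lemma tp_finite:
  assumes "org l < \<infinity>" shows "tp l = Sup {t. t < \<infinity> \<and> arr l t}"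
  unfolding tp_def
proof (rule antisym)
  show "Sup {t. t < \<infinity> \<and> arr l t} \<le> Sup {t. arr l t}" by (rule Sup_subset_mono) blast
  show "Sup {t. arr l t} \<le> Sup {t. t < \<infinity> \<and> arr l t}"
  proof (rule Sup_least)
    fix t assume "t \<in> {t. arr l t}"
    then have t: "arr l t" by simp
    show "t \<le> Sup {t. t < \<infinity> \<and> arr l t}"
    proof (cases "t < \<infinity>")
      case True
      then show ?thesis using t by (intro Sup_upper) simp
    next
      case False
      show ?thesis
      proof (rule ccontr)
        assume "\<not> t \<le> Sup {t. t < \<infinity> \<and> arr l t}"
        then have "Sup {t. t < \<infinity> \<and> arr l t} < \<infinity>" using False by simp
        then have "max (org l) (Sup {t. t < \<infinity> \<and> arr l t}) < \<infinity>" using assms by (simp only: max_less_iff_conj simp_thms)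
        from this[THEN less_imp_neq, unfolded less_PInf_Ex_of_nat]
        obtain n :: nat where n: "max (org l) (Sup {t. t < \<infinity> \<and> arr l t}) < ereal (real n)" ..
        then have "org l \<le> ereal (real n)" by (simp only: max_less_iff_conj less_imp_le)
        then have "arr l (ereal (real n))"
          by (rule arr_downward[OF t]) (use False in simp)
        then have "ereal (real n) \<le> Sup {t. t < \<infinity> \<and> arr l t}" by (intro Sup_upper) simp
        also have "\<dots> < ereal (real n)" using n by (simp only: max_less_iff_conj)
        finally show False by simp
      qed
    qed
  qed
qed

end

section \<open>Waiting times indexed by pairs and sequences indexed by lines\<close>

lemma space_waiting_time [simp]: "space (waiting_time r) = UNIV"
  using sets_eq_imp_space_eq[OF sets_waiting_time] by simp

lemma waiting_time_1: "waiting_time 1 = distr exp_law borel ereal"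
  by (simp add: waiting_time_def exp_law_def)

lemma measurable_ereal_exp_law: "ereal \<in> borel_measurable exp_law"
  by (simp add: measurable_cong_sets[OF sets_exp_law refl])

lemma prob_space_waiting_time_1: "prob_space (waiting_time 1)"
  unfolding waiting_time_1 by (rule exp_law.prob_space_distr[OF measurable_ereal_exp_law])

lemma emeasure_waiting_time_1:
  "A \<in> sets borel \<Longrightarrow> emeasure (waiting_time 1) A = emeasure exp_law {x. ereal x \<in> A}"
  unfolding waiting_time_1 by (subst emeasure_distr[OF measurable_ereal_exp_law]) (auto simp: vimage_def)

abbreviation split_law :: "(line \<times> nat \<Rightarrow> ereal) measure" where
  "split_law \<equiv> (\<Pi>\<^sub>M _\<in>UNIV. waiting_time 1)"

abbreviation line_law :: "(line \<Rightarrow> nat \<Rightarrow> real) measure" where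
  "line_law \<equiv> (\<Pi>\<^sub>M _\<in>UNIV. gap_law)"

lemma prob_space_split_law: "prob_space split_law"
  by (intro prob_space_PiM prob_space_waiting_time_1)

lemma space_line_law [simp]: "space line_law = UNIV"
  by (simp add: space_PiM PiE_UNIV_domain)

lemma space_split_law [simp]: "space split_law = UNIV"
  using sets_eq_imp_space_eq[OF sets_waiting_time[of 1]] by (simp add: space_PiM PiE_UNIV_domain)

lemma measurable_split_law_component: "(\<lambda>g. g lk) \<in> borel_measurable split_law"
  using measurable_component_singleton[of lk UNIV "\<lambda>_. waiting_time 1"]
  by (simp add: measurable_cong_sets[OF refl sets_waiting_time])

lemma measurable_uncurry: "(\<lambda>x lk. ereal (x (fst lk) (snd lk))) \<in> measurable line_law split_law"
proof (rule measurable_PiM_single')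
  fix lk :: "line \<times> nat"
  have "(\<lambda>x. x (fst lk) (snd lk)) \<in> borel_measurable line_law"
    by (rule measurable_gap_app[OF measurable_component_singleton[of "fst lk" UNIV "\<lambda>_. gap_law"]]) simp
  then show "(\<lambda>x. ereal (x (fst lk) (snd lk))) \<in> measurable line_law (waiting_time 1)"
    by (simp add: measurable_cong_sets[OF refl sets_waiting_time])
qed (simp add: PiE_UNIV_domain sets_eq_imp_space_eq[OF sets_waiting_time])

lemma measurable_curry: "(\<lambda>g l j. real_of_ereal (g (l, j))) \<in> measurable split_law line_law"
proof (rule measurable_PiM_single')
  show "(\<lambda>g j. real_of_ereal (g (l, j))) \<in> measurable split_law gap_law" for l
    by (rule measurable_gap_lawI) (intro borel_measurable_real_of_ereal measurable_split_law_component)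
qed (simp add: PiE_UNIV_domain)

text \<open>A finite set of constrained pairs is sorted by lines; the probability factors over lines
  and, within a line \<open>l\<close>, over the indices in \<open>K l\<close>.\<close>

lemma distr_uncurry: "distr line_law split_law (\<lambda>x lk. ereal (x (fst lk) (snd lk))) = split_law"
proof (rule PiM_UNIV_eqI[OF prob_space_waiting_time_1])
  fix J :: "(line \<times> nat) set" and A
  assume J: "finite J" and "\<And>i. i \<in> J \<Longrightarrow> A i \<in> sets (waiting_time 1)"
  then have A: "A i \<in> sets borel" if "i \<in> J" for i using that by simp
  define K where "K l = {k. (l, k) \<in> J}" for l
  have JK: "Sigma (fst ` J) K = J" by (auto simp: K_def intro: rev_image_eqI)
  have K: "finite (K l)" for l
    by (rule finite_subset[of _ "snd ` J"]) (use J in \<open>auto simp: K_def intro: rev_image_eqI\<close>)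
  define B where "B l = {x \<in> space gap_law. \<forall>k\<in>K l. x k \<in> {x. ereal x \<in> A (l, k)}}" for l
  have E: "{x. ereal x \<in> A (l, k)} \<in> sets exp_law" if "k \<in> K l" for l k
    using measurable_sets[OF measurable_ereal_exp_law A[of "(l, k)"]] that by (simp add: K_def vimage_def)
  have B: "B l \<in> sets gap_law" for l
    unfolding B_def by (intro sets.sets_Collect_finite_All K sets_Collect_single') (simp_all add: E[unfolded sets_exp_law])
  let ?D = "distr line_law split_law (\<lambda>x lk. ereal (x (fst lk) (snd lk)))"
  have "{\<omega> \<in> space split_law. \<forall>i\<in>J. \<omega> i \<in> A i} \<in> sets split_law"
    by (intro sets.sets_Collect_finite_All J sets_Collect_single') (simp_all add: A)
  then have "emeasure ?D {\<omega> \<in> space ?D. \<forall>i\<in>J. \<omega> i \<in> A i} =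
      emeasure line_law {x \<in> space line_law. \<forall>i\<in>J. ereal (x (fst i) (snd i)) \<in> A i}"
    by (simp add: emeasure_distr[OF measurable_uncurry] vimage_def)
  also have "\<dots> = emeasure line_law {x \<in> space line_law. \<forall>l\<in>fst ` J. x l \<in> B l}"
  proof -
    have "(\<forall>i\<in>J. ereal (x (fst i) (snd i)) \<in> A i) \<longleftrightarrow> (\<forall>l\<in>fst ` J. x l \<in> B l)" for x
      unfolding B_def K_def by auto
    then show ?thesis by (simp only:)
  qed
  also have "\<dots> = (\<Prod>l\<in>fst ` J. emeasure gap_law (B l))"
    by (rule emeasure_PiM_UNIV_Collect[OF prob_space_gap_law]) (use J B in simp_all)
  also have "\<dots> = (\<Prod>l\<in>fst ` J. \<Prod>k\<in>K l. emeasure (waiting_time 1) (A (l, k)))"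
  proof (rule prod.cong[OF refl])
    fix l assume "l \<in> fst ` J"
    have "emeasure gap_law (B l) = (\<Prod>k\<in>K l. emeasure exp_law {x. ereal x \<in> A (l, k)})"
      unfolding B_def by (rule emeasure_PiM_UNIV_Collect[OF prob_space_exp_law K E])
    also have "\<dots> = (\<Prod>k\<in>K l. emeasure (waiting_time 1) (A (l, k)))"
      by (intro prod.cong refl emeasure_waiting_time_1[symmetric] A) (simp add: K_def)
    finally show "emeasure gap_law (B l) = (\<Prod>k\<in>K l. emeasure (waiting_time 1) (A (l, k)))" .
  qed
  also have "\<dots> = (\<Prod>i\<in>J. emeasure (waiting_time 1) (A i))"
    by (subst prod.Sigma) (use J K in \<open>simp_all add: JK\<close>)
  finally show "emeasure ?D {\<omega> \<in> space ?D. \<forall>i\<in>J. \<omega> i \<in> A i} = (\<Prod>i\<in>J. emeasure (waiting_time 1) (A i))" .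
qed simp

text \<open>Currying undoes the map of \<open>distr_uncurry\<close>, so its law needs no second
  computation.\<close>

lemma distr_curry: "distr split_law line_law (\<lambda>g l j. real_of_ereal (g (l, j))) = line_law"
proof -
  have "distr split_law line_law (\<lambda>g l j. real_of_ereal (g (l, j))) =
    distr (distr line_law split_law (\<lambda>x lk. ereal (x (fst lk) (snd lk)))) line_law (\<lambda>g l j. real_of_ereal (g (l, j)))"
    by (simp only: distr_uncurry)
  also have "\<dots> = distr line_law line_law (\<lambda>x. x)"
    by (subst distr_distr[OF measurable_curry measurable_uncurry]) (simp add: comp_def)
  finally show ?thesis by (simp add: distr_id)
qed

text \<open>Points on the vertical axis start horizontal lines, hence children of
  \<open>Axis True\<close> are the lines \<open>FromY\<close>. The axes have no counterpart in the
  model; \<open>Turn (FromX 0)\<close> is a placeholder that is not \<open>pure\<close>.\<close>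

fun line_of :: "label \<Rightarrow> line" where
  "line_of (Axis b) = Turn (FromX 0)"
| "line_of (Child (Axis b) n) = (if b then FromY n else FromX n)"
| "line_of (Child (Child l k) n) = Split (line_of (Child l k)) n"

fun label_of :: "line \<Rightarrow> label" where
  "label_of (FromX n) = Child (Axis False) n"
| "label_of (FromY n) = Child (Axis True) n"
| "label_of (Split l k) = Child (label_of l) k"
| "label_of _ = Axis True"

text \<open>Without planar points and turns, only these labels carry a line.\<close>

fun pure :: "line \<Rightarrow> bool" where
  "pure (FromX n) = True"
| "pure (FromY n) = True"
| "pure (Split l k) = pure l"
| "pure _ = False"

lemma label_of_line_of: "par m \<noteq> None \<Longrightarrow> pure (line_of m) \<and> label_of (line_of m) = m"
  by (induction m rule: line_of.induct) auto

lemma par_label_of: "pure l \<Longrightarrow> par (label_of l) \<noteq> None"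
  by (induction l rule: pure.induct) auto

lemma line_of_label_of: "pure l \<Longrightarrow> line_of (label_of l) = l"
proof (induction l rule: pure.induct)
  case (3 l k)
  then obtain m j where m: "label_of l = Child m j" using par_label_of[of l] by (cases "label_of l") auto
  then show ?case using 3 by simp
qed auto

definition axis_points :: "bool \<Rightarrow> real set \<Rightarrow> real set" where
  "axis_points b X = (if b then snd ` init_Y X else fst ` init_X X)"

definition axis_count :: "bool \<Rightarrow> real set \<Rightarrow> real \<Rightarrow> nat" where
  "axis_count b X t = card (axis_points b X \<inter> {..t})"

primrec noise_of :: "real set \<Rightarrow> (line \<times> nat \<Rightarrow> ereal) \<Rightarrow> label \<Rightarrow> nat \<Rightarrow> real" where
  "noise_of X g (Axis b) = gap_seq (axis_count b X)"
| "noise_of X g (Child l k) = (\<lambda>j. real_of_ereal (g (line_of (Child l k), j)))"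

context
  fixes N :: "real set measure" assumes ppp: "is_N_PPP 1 1 N"
begin

lemma prob_space_N: "prob_space N"
  using ppp by (simp add: is_N_PPP_def point_process_law_def)

lemma axis_points_poisson: "poisson_process N {0..} 1 (axis_points b)"
  using ppp by (cases b) (simp_all add: is_N_PPP_def axis_points_def[abs_def])

lemma measurable_axis_points: "axis_points b \<in> measurable N (config_space {0..})"
  using axis_points_poisson[of b] by (simp add: poisson_process_def)

lemma measurable_axis_count: "axis_count b \<in> measurable N cnt_space"
  using measurable_halfline_counts[OF measurable_axis_points] by (simp add: axis_count_def[abs_def])

lemma distr_axis_count: "distr N cnt_space (axis_count b) = count_law"
  using distr_poisson_process[OF axis_points_poisson] by (simp add: axis_count_def[abs_def])

lemma measurable_axis_gaps: "(\<lambda>X. gap_seq (axis_count b X)) \<in> measurable N gap_law"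
  by (rule measurable_compose[OF measurable_axis_count measurable_gap_seq])

lemma distr_axis_gaps:
  "distr N (gap_law \<Otimes>\<^sub>M gap_law) (\<lambda>X. (gap_seq (axis_count False X), gap_seq (axis_count True X))) =
    gap_law \<Otimes>\<^sub>M gap_law"
proof -
  interpret N: prob_space N by (rule prob_space_N)
  have m: "(\<lambda>C. gap_seq (\<lambda>t. card (C \<inter> {..t}))) \<in> measurable (config_space {0::real..}) gap_law"
    by (rule measurable_compose[OF measurable_halfline_counts[OF measurable_ident_sets[OF refl]] measurable_gap_seq])
  have "N.indep_var (config_space {0..}) (axis_points False) (config_space {0..}) (axis_points True)"
    using ppp by (simp add: is_N_PPP_def axis_points_def[abs_def])
  from N.indep_var_compose[OF this m m]
  have "N.indep_var gap_law (\<lambda>X. gap_seq (axis_count False X)) gap_law (\<lambda>X. gap_seq (axis_count True X))"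
    by (simp add: comp_def axis_count_def[abs_def])
  then show ?thesis
    unfolding N.indep_var_distribution_eq
    by (simp add: distr_gap_seq[OF measurable_axis_count distr_axis_count])
qed

lemma AE_axis_points:
  "AE X in N. \<forall>b. good_seq (gap_seq (axis_count b X)) \<and> axis_points b X = range (psum (gap_seq (axis_count b X)))"
proof -
  have "AE X in N. good_seq (gap_seq (axis_count b X)) \<and> axis_points b X = range (psum (gap_seq (axis_count b X)))" for b
    using AE_gap_seq[OF measurable_axis_count distr_axis_count, of b] AE_space
  proof eventually_elim
    case (elim X)
    have "axis_points b X = range (psum (gap_seq (axis_count b X)))"
    proof (rule eq_range_psum[OF elim(1)[THEN conjunct1]])
      show "finite (axis_points b X \<inter> {..t})" for t
        by (rule halfline_config(2)[OF measurable_space[OF measurable_axis_points elim(2)]])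
      show "card (axis_points b X \<inter> {..of_rat q}) = nb (gap_seq (axis_count b X)) (of_rat q)" for q
        using elim(1)[THEN conjunct2, rule_format, of q] by (simp only: axis_count_def)
    qed
    with elim(1) show ?case by (simp only:)
  qed
  then show ?thesis unfolding AE_all_countable ..
qed

lemma measurable_noise_of: "(\<lambda>(X, g). noise_of X g) \<in> measurable (N \<Otimes>\<^sub>M split_law) noise"
proof (rule measurable_PiM_single')
  fix l :: label
  show "(\<lambda>x. (case x of (X, g) \<Rightarrow> noise_of X g) l) \<in> measurable (N \<Otimes>\<^sub>M split_law) gap_law"
  proof (cases l)
    case (Axis b)
    then show ?thesis
      using measurable_compose[OF measurable_fst measurable_axis_gaps] by (simp add: split_beta')
  next
    case (Child m k)
    have "(\<lambda>x. real_of_ereal (snd x (line_of l, j))) \<in> borel_measurable (N \<Otimes>\<^sub>M split_law)" for j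
      by (rule borel_measurable_real_of_ereal[OF measurable_compose[OF measurable_snd measurable_split_law_component]])
    then show ?thesis
      unfolding Child split_beta' noise_of.simps by (rule measurable_gap_lawI)
  qed
qed (simp add: PiE_UNIV_domain)

lemma distr_noise_of: "distr (N \<Otimes>\<^sub>M split_law) noise (\<lambda>(X, g). noise_of X g) = noise"
proof (rule PiM_UNIV_eqI[OF prob_space_gap_law])
  interpret N: prob_space N by (rule prob_space_N)
  interpret G: prob_space split_law by (rule prob_space_split_law)
  let ?D = "distr (N \<Otimes>\<^sub>M split_law) noise (\<lambda>(X, g). noise_of X g)"
  fix J :: "label set" and A assume J: "finite J" and A: "\<And>i. i \<in> J \<Longrightarrow> A i \<in> sets gap_law"
  \<comment> \<open>Padding lets both axes be constrained in every case, so that the event splits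
    into \<open>S1\<close>, about the initial points, and \<open>S2\<close>, about the split
    times.\<close>
  define A' where "A' i = (if i \<in> J then A i else space gap_law)" for i
  have A': "A' i \<in> sets gap_law" for i using A by (simp add: A'_def sets.top[of gap_law, simplified])
  define J' where "J' = {l \<in> J. par l \<noteq> None}"
  have J': "finite J'" using J by (simp add: J'_def)
  define S1 where "S1 = {X \<in> space N. gap_seq (axis_count False X) \<in> A' (Axis False) \<and> gap_seq (axis_count True X) \<in> A' (Axis True)}"
  define S2 where "S2 = {g \<in> space split_law. \<forall>l\<in>line_of ` J'. (\<lambda>j. real_of_ereal (g (l, j))) \<in> A (label_of l)}"
  have AJ: "A (label_of l) \<in> sets gap_law" if "l \<in> line_of ` J'" for l
    using that label_of_line_of A by (auto simp: J'_def)
  have m1: "(\<lambda>X. (gap_seq (axis_count False X), gap_seq (axis_count True X))) \<in> measurable N (gap_law \<Otimes>\<^sub>M gap_law)"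
    by (intro measurable_Pair measurable_axis_gaps)
  have S1: "S1 = (\<lambda>X. (gap_seq (axis_count False X), gap_seq (axis_count True X))) -` (A' (Axis False) \<times> A' (Axis True)) \<inter> space N"
    by (auto simp: S1_def)
  have AA: "A' (Axis False) \<times> A' (Axis True) \<in> sets (gap_law \<Otimes>\<^sub>M gap_law)" using A' by simp
  have S1m: "S1 \<in> sets N" unfolding S1 by (rule measurable_sets[OF m1 AA])
  have e1: "emeasure N S1 = emeasure gap_law (A' (Axis False)) * emeasure gap_law (A' (Axis True))"
    unfolding S1 emeasure_distr[OF m1 AA, symmetric] distr_axis_gaps
    by (rule gap_law.emeasure_pair_measure_Times) (rule A')+
  let ?C = "{x \<in> space line_law. \<forall>l\<in>line_of ` J'. x l \<in> A (label_of l)}"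
  have C: "?C \<in> sets line_law"
    by (intro sets.sets_Collect_finite_All sets_Collect_single') (use J' AJ in simp_all)
  have S2: "S2 = (\<lambda>g l j. real_of_ereal (g (l, j))) -` ?C \<inter> space split_law"
    by (auto simp: S2_def)
  have S2m: "S2 \<in> sets split_law" unfolding S2 by (rule measurable_sets[OF measurable_curry C])
  have inj: "inj_on line_of J'"
    by (rule inj_on_inverseI[where g = label_of]) (simp add: J'_def label_of_line_of)
  have "emeasure split_law S2 = (\<Prod>l\<in>line_of ` J'. emeasure gap_law (A (label_of l)))"
    unfolding S2 emeasure_distr[OF measurable_curry C, symmetric] distr_curry
    by (rule emeasure_PiM_UNIV_Collect[OF prob_space_gap_law]) (use J' AJ in simp_all)
  also have "\<dots> = (\<Prod>l\<in>J'. emeasure gap_law (A l))"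
    unfolding prod.reindex[OF inj] by (intro prod.cong) (auto simp: J'_def label_of_line_of)
  finally have e2: "emeasure split_law S2 = (\<Prod>l\<in>J'. emeasure gap_law (A l))" .
  have set: "{\<omega> \<in> space ?D. \<forall>i\<in>J. \<omega> i \<in> A i} \<in> sets noise"
    unfolding space_distr by (intro sets.sets_Collect_finite_All J sets_Collect_single') (simp_all add: A)
  have "emeasure ?D {\<omega> \<in> space ?D. \<forall>i\<in>J. \<omega> i \<in> A i} =
    emeasure (N \<Otimes>\<^sub>M split_law) ((\<lambda>(X, g). noise_of X g) -` {\<omega> \<in> space ?D. \<forall>i\<in>J. \<omega> i \<in> A i} \<inter> space (N \<Otimes>\<^sub>M split_law))"
    by (rule emeasure_distr[OF measurable_noise_of set])
  also have "(\<lambda>(X, g). noise_of X g) -` {\<omega> \<in> space ?D. \<forall>i\<in>J. \<omega> i \<in> A i} \<inter> space (N \<Otimes>\<^sub>M split_law) = S1 \<times> S2"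
  proof (rule set_eqI, clarify)
    fix X g
    have "(\<forall>i\<in>J. noise_of X g i \<in> A i) \<longleftrightarrow>
      (gap_seq (axis_count False X) \<in> A' (Axis False) \<and> gap_seq (axis_count True X) \<in> A' (Axis True)) \<and>
      (\<forall>i\<in>J'. (\<lambda>j. real_of_ereal (g (line_of i, j))) \<in> A i)"
    proof (intro iffI conjI ballI)
      assume *: "\<forall>i\<in>J. noise_of X g i \<in> A i"
      show "gap_seq (axis_count False X) \<in> A' (Axis False)" "gap_seq (axis_count True X) \<in> A' (Axis True)"
        using *[rule_format, of "Axis False"] *[rule_format, of "Axis True"] by (simp_all add: A'_def)
      show "(\<lambda>j. real_of_ereal (g (line_of i, j))) \<in> A i" if "i \<in> J'" for i
        using that *[rule_format, of i] by (cases i) (simp_all add: J'_def)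
    next
      fix i
      assume *: "(gap_seq (axis_count False X) \<in> A' (Axis False) \<and> gap_seq (axis_count True X) \<in> A' (Axis True)) \<and>
        (\<forall>i\<in>J'. (\<lambda>j. real_of_ereal (g (line_of i, j))) \<in> A i)" and i: "i \<in> J"
      show "noise_of X g i \<in> A i"
      proof (cases i)
        case (Axis b)
        then show ?thesis using * i by (cases b) (simp_all add: A'_def)
      next
        case (Child l k)
        then show ?thesis using *[THEN conjunct2, rule_format, of i] i by (simp add: J'_def)
      qed
    qed
    moreover have "(\<forall>i\<in>J'. (\<lambda>j. real_of_ereal (g (line_of i, j))) \<in> A i) \<longleftrightarrow> g \<in> S2"
      by (auto simp: S2_def J'_def label_of_line_of)
    ultimately show "(X, g) \<in> (\<lambda>(X, g). noise_of X g) -` {\<omega> \<in> space ?D. \<forall>i\<in>J. \<omega> i \<in> A i} \<inter> space (N \<Otimes>\<^sub>M split_law) \<longleftrightarrow>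
        (X, g) \<in> S1 \<times> S2"
      unfolding S1_def by (auto simp: space_pair_measure)
  qed
  also have "emeasure (N \<Otimes>\<^sub>M split_law) (S1 \<times> S2) = emeasure N S1 * emeasure split_law S2"
    by (rule G.emeasure_pair_measure_Times[OF S1m S2m])
  also have "\<dots> = (\<Prod>i\<in>insert (Axis False) (insert (Axis True) J'). emeasure gap_law (A' i))"
  proof -
    have "(\<Prod>l\<in>J'. emeasure gap_law (A l)) = (\<Prod>l\<in>J'. emeasure gap_law (A' l))"
      by (intro prod.cong) (auto simp: J'_def A'_def)
    then show ?thesis using J' unfolding e1 e2 by (simp add: J'_def mult.assoc)
  qed
  also have "\<dots> = (\<Prod>i\<in>J. emeasure gap_law (A' i))"
  proof (rule prod.mono_neutral_right)
    show "J \<subseteq> insert (Axis False) (insert (Axis True) J')"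
    proof
      fix i assume "i \<in> J"
      then show "i \<in> insert (Axis False) (insert (Axis True) J')"
        by (cases i rule: label.exhaust) (auto simp: J'_def)
    qed
    show "\<forall>i\<in>insert (Axis False) (insert (Axis True) J') - J. emeasure gap_law (A' i) = 1"
      using gap_law.emeasure_space_1 by (auto simp: A'_def)
  qed (use J' in simp)
  also have "\<dots> = (\<Prod>i\<in>J. emeasure gap_law (A i))"
    by (intro prod.cong) (auto simp: A'_def)
  finally show "emeasure ?D {\<omega> \<in> space ?D. \<forall>i\<in>J. \<omega> i \<in> A i} = (\<Prod>i\<in>J. emeasure gap_law (A i))" .
qed simp

end

text \<open>\<open>e\<close> embeds the half-line so that the coordinate sum is the parameter; the
  diagonal rank of a point is then its index among the increasing arrivals.\<close>

lemma nth_point_range_psum: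
  fixes e :: "real \<Rightarrow> real \<times> real"
  assumes e: "\<And>x. fst (e x) + snd (e x) = x" and s: "good_seq s"
  shows "nth_point (e ` range (psum s)) n = map_prod ereal ereal (e (psum s n))"
proof -
  let ?C = "e ` range (psum s)"
  have inj: "inj (\<lambda>k. e (psum s k))"
  proof (rule injI)
    fix j k assume "e (psum s j) = e (psum s k)"
    then have "psum s j = psum s k" by (metis e)
    then show "j = k" by (rule injD[OF strict_mono_imp_inj_on[OF good_seq_strict_mono[OF s]]])
  qed
  have rank: "diag_rank ?C (e (psum s k)) = k" for k
  proof -
    have "{w \<in> ?C. fst w + snd w < psum s k} = (\<lambda>k. e (psum s k)) ` {..<k}"
      by (auto simp: e strict_mono_less[OF good_seq_strict_mono[OF s]])
    then show ?thesis
      unfolding diag_rank_def e by (simp add: card_image[OF inj_on_subset[OF inj]])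
  qed
  have uniq: "z = e (psum s n)" if "z \<in> ?C \<and> diag_rank ?C z = n" for z
  proof -
    have "z \<in> range (\<lambda>k. e (psum s k))" using that by (simp only: image_image)
    then obtain k where "z = e (psum s k)" by (rule rangeE)
    then show ?thesis using that rank[of k] by simp
  qed
  have mem: "e (psum s n) \<in> ?C \<and> diag_rank ?C (e (psum s n)) = n" using rank by simp
  have "\<exists>!z. z \<in> ?C \<and> diag_rank ?C z = n" by (rule ex1I, rule mem, rule uniq)
  moreover have "(THE z. z \<in> ?C \<and> diag_rank ?C z = n) = e (psum s n)" by (rule the_equality, rule mem, rule uniq)
  ultimately show ?thesis by (simp only: nth_point_def if_True)
qed

lemma nth_point_empty: "nth_point {} n = (\<infinity>, \<infinity>)"
  by (simp add: nth_point_def Ex1_def)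

lemma init_axis_points:
  "init_X X = (\<lambda>x. (x, 0)) ` axis_points False X" "init_Y X = (\<lambda>y. (0, y)) ` axis_points True X"
  by (auto simp: init_X_def init_Y_def axis_points_def image_iff)

text \<open>Deterministic situation that holds almost surely: no planar points, no turns, finite
  positive split times. Marks lie strictly below 1 because the interval for stopping both lines is
  half-open.\<close>

locale cbmc = bullet_graph p_CBMC X "{}" g "\<lambda>_. \<infinity>" u
  for X :: "real set" and g :: "line \<times> nat \<Rightarrow> ereal" and u :: "line \<times> line \<Rightarrow> real" +
  assumes mark: "0 \<le> u vh \<and> u vh < 1"
    and gap: "\<exists>r>0. g lk = ereal r"
    and points: "axis_points b X = range (psum (noise_of X g (Axis b)))"
    and good: "good (noise_of X g)"
begin

abbreviation "z \<equiv> noise_of X g"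

lemma stopped: "stopped_by l l'"
  unfolding stopped_by_def using mark[of "(l, l')"] mark[of "(l', l)"] by (simp add: p_CBMC_def)

lemma nth_init:
  "nth_point (init_X X) n = (ereal (psum (z (Axis False)) n), 0)"
  "nth_point (init_Y X) n = (0, ereal (psum (z (Axis True)) n))"
proof -
  show "nth_point (init_X X) n = (ereal (psum (z (Axis False)) n), 0)"
    unfolding init_axis_points points by (subst nth_point_range_psum) (simp_all add: good_seqD[OF good] del: noise_of.simps)
  show "nth_point (init_Y X) n = (0, ereal (psum (z (Axis True)) n))"
    unfolding init_axis_points points by (subst nth_point_range_psum) (simp_all add: good_seqD[OF good] del: noise_of.simps)
qed

lemma g_noise: "pure l \<Longrightarrow> g (l, j) = ereal (z (label_of l) j)"
proof -
  assume l: "pure l"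
  obtain m k where m: "label_of l = Child m k" using par_label_of[OF l] by (cases "label_of l") auto
  have "z (label_of l) j = real_of_ereal (g (line_of (label_of l), j))" unfolding m by (simp only: noise_of.simps)
  then show ?thesis using gap[of "(l, j)"] by (auto simp: line_of_label_of[OF l])
qed

lemma route_pure:
  "pure l \<Longrightarrow> track l = ereal (trk z (label_of l)) \<and> orig l = ereal (org z (label_of l)) \<and> vert l = vt (label_of l)"
proof (induction l rule: pure.induct)
  case (1 n)
  show ?case by (simp add: track_def orig_def nth_init del: noise_of.simps)
next
  case (2 n)
  show ?case by (simp add: track_def orig_def nth_init del: noise_of.simps)
next
  case (3 l k)
  then have l: "pure l" by simp
  note IH = 3(1)[OF l]
  have "(\<Sum>j\<le>k. g (l, j)) = ereal (psum (z (label_of l)) k)"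
    by (simp add: g_noise[OF l] psum_def del: noise_of.simps)
  then have "track (Split l k) = ereal (trk z (label_of (Split l k)))"
    using IH by (simp add: track_def orig_def del: noise_of.simps)
  moreover have "orig (Split l k) = ereal (org z (label_of (Split l k)))"
    using IH by (simp add: track_def orig_def del: noise_of.simps)
  ultimately show ?case using IH by simp
qed simp_all

text \<open>There are no planar points, and the waiting time before a turn is infinite, so such
  labels sit at infinity; splits inherit this.\<close>

lemma route_impure: "\<not> pure l \<Longrightarrow> track l = \<infinity> \<or> orig l = \<infinity>"
proof (induction l)
  case (Split l k)
  then show ?case by (auto simp: track_def orig_def)
qed (simp_all add: track_def orig_def nth_point_empty)

lemma route_nonneg: "0 \<le> track l \<and> 0 \<le> orig l"
proof (induction l)
  case (FromX n)
  show ?case using route_pure[of "FromX n"] trk_nonneg[OF good] org_nonneg[OF good] by (simp del: noise_of.simps trk_simps org_simps)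
next
  case (FromY n)
  show ?case using route_pure[of "FromY n"] trk_nonneg[OF good] org_nonneg[OF good] by (simp del: noise_of.simps trk_simps org_simps)
next
  case (Split l k)
  have "0 \<le> g (l, j)" for j using gap[of "(l, j)"] by auto
  then have "0 \<le> (\<Sum>j\<le>k. g (l, j))" by (intro sum_nonneg)
  then show ?case using Split by (simp add: track_def orig_def)
next
  case (Turn l)
  then show ?case by (simp add: track_def orig_def)
qed (simp_all add: track_def orig_def nth_point_empty)

lemma regular: "regular_lines bpar track orig size"
proof
  fix R :: real
  have "{l. track l < R \<and> orig l < R} \<subseteq> line_of ` {m. trk z m < R \<and> org z m < R}"
  proof
    fix l assume l: "l \<in> {l. track l < R \<and> orig l < R}"
    have "pure l" by (rule ccontr) (use l route_impure[of l] in auto)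
    then show "l \<in> line_of ` {m. trk z m < R \<and> org z m < R}"
      using l route_pure[of l] line_of_label_of[of l] by (intro image_eqI[of _ _ "label_of l"]) simp_all
  qed
  then show "finite {l. track l < R \<and> orig l < R}"
    by (rule finite_subset) (rule finite_imageI, rule good_finite[OF good])
next
  show "size p < size l \<and> orig l = track p" if "bpar l = Some p" for l p
    using that by (cases l) (simp_all add: track_def orig_def)
qed (use route_nonneg in simp_all)

lemma tree_arr_Axis: "tree_arr z (Axis b) (ereal (trk z m))"
  using alive_Axis[OF good, of b "trk z m"] trk_nonneg[OF good, of m] unfolding alive_def by simp

text \<open>The two equations differ in two places: initial lines have no parent in the model but an
  always living axis in the tree, and axes are formally possible blockers in the tree.\<close>

lemma arr_step_pure:
  assumes l: "pure l"
  shows "lines.step (\<lambda>l t. pure l \<and> tree_arr z (label_of l) t) l t = tree_step z (tree_arr z) (label_of l) t"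
proof -
  note rl = route_pure[OF l]
  have parent: "(case bpar l of None \<Rightarrow> True | Some p \<Rightarrow> pure p \<and> tree_arr z (label_of p) (ereal (trk z (label_of l)))) =
    (case par (label_of l) of None \<Rightarrow> True | Some p \<Rightarrow> tree_arr z p (ereal (trk z (label_of l))))"
  proof (cases l)
    case (FromX n)
    show ?thesis using tree_arr_Axis[of False "label_of l"] unfolding FromX by (simp del: trk_simps)
  next
    case (FromY n)
    show ?thesis using tree_arr_Axis[of True "label_of l"] unfolding FromY by (simp del: trk_simps)
  qed (use l in \<open>simp_all del: trk_simps\<close>)
  have meet: "(\<forall>l'. (vert l \<noteq> vert l' \<and> orig l < track l' \<and> orig l' < track l) \<and> track l' < t \<and> stopped_by l l' \<longrightarrow>
      \<not> (pure l' \<and> tree_arr z (label_of l') (track l))) \<longleftrightarrow>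
    (\<forall>m'. (vt (label_of l) \<noteq> vt m' \<and> ereal (org z (label_of l)) < ereal (trk z m') \<and>
      ereal (org z m') < ereal (trk z (label_of l))) \<and> ereal (trk z m') < t \<and> True \<longrightarrow>
      \<not> tree_arr z m' (ereal (trk z (label_of l))))" (is "?L \<longleftrightarrow> ?R")
  proof
    assume L: ?L
    show ?R
    proof (intro allI impI)
      fix m'
      assume m': "(vt (label_of l) \<noteq> vt m' \<and> ereal (org z (label_of l)) < ereal (trk z m') \<and>
        ereal (org z m') < ereal (trk z (label_of l))) \<and> ereal (trk z m') < t \<and> True"
      show "\<not> tree_arr z m' (ereal (trk z (label_of l)))"
      proof (cases "par m'")
        case None
        \<comment> \<open>An axis cannot block: its track 0 exceeds no origin.\<close>
        then obtain b where b: "m' = Axis b" by (cases m') simp_all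
        have "org z (label_of l) < 0" using m' by (simp add: b)
        then show ?thesis using org_nonneg[OF good, of "label_of l"] by simp
      next
        case (Some p)
        then have p: "pure (line_of m')" "label_of (line_of m') = m'" using label_of_line_of[of m'] by simp_all
        show ?thesis
          using L[rule_format, of "line_of m'"] m' p rl route_pure[OF p(1)] stopped[of l "line_of m'"] by simp
      qed
    qed
  next
    assume R: ?R
    show ?L
    proof (intro allI impI notI)
      fix l'
      assume l': "(vert l \<noteq> vert l' \<and> orig l < track l' \<and> orig l' < track l) \<and> track l' < t \<and> stopped_by l l'"
        and p: "pure l' \<and> tree_arr z (label_of l') (track l)"
      show False
        using R[rule_format, of "label_of l'"] l' p rl route_pure[of l'] by simp
    qed
  qed
  show ?thesis
    unfolding lines.step_def line_system.step_def meet
    by (simp only: rl[THEN conjunct1] rl[THEN conjunct2, THEN conjunct1] parent)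
qed

lemma arr_eq:
  assumes t: "t < \<infinity>"
  shows "lines.arr l t \<longleftrightarrow> pure l \<and> tree_arr z (label_of l) t"
proof (rule regular_lines.arr_unique[OF regular _ t, symmetric])
  fix l and t :: ereal assume t: "t < \<infinity>"
  show "(pure l \<and> tree_arr z (label_of l) t) = lines.step (\<lambda>l t. pure l \<and> tree_arr z (label_of l) t) l t"
  proof (cases "pure l")
    case True
    show ?thesis
      unfolding arr_step_pure[OF True]
      using True regular_lines.arr_step[OF good_regular[OF good] t, where l = "label_of l"] by simp
  next
    case False
    then show ?thesis using route_impure[of l] t by (auto simp: lines.step_def)
  qed
qed

text \<open>Includes infinite coordinates, which \<open>arr_eq\<close> leaves open. Going up the
  splits ends at an initial line or at a label with infinite track.\<close>

lemma arr_pure: "lines.arr l t \<Longrightarrow> pure l"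
proof (induction l arbitrary: t)
  case (Split l k)
  from lines.arr_parent[OF Split.prems, of l] show ?case using Split.IH by simp
next
  case (Turn l)
  then show ?case using lines.arrD(2)[OF Turn.prems] by (simp add: track_def)
next
  case (NucV n)
  then show ?case using lines.arrD(2)[OF NucV] by (simp add: track_def nth_point_empty)
next
  case (NucH n)
  then show ?case using lines.arrD(2)[OF NucH] by (simp add: track_def nth_point_empty)
qed simp_all

lemma sg_eq:
  assumes "pure l" shows "lines.sg l = tree_sg z (label_of l)"
proof -
  note rl = route_pure[OF assms]
  have "lines.tp l = Sup {t. t < \<infinity> \<and> lines.arr l t}"
    by (rule lines.tp_finite) (simp add: rl)
  also have "\<dots> = Sup {t. t < \<infinity> \<and> tree_arr z (label_of l) t}"
    by (intro arg_cong[where f=Sup] Collect_cong conj_cong refl) (simp add: arr_eq assms)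
  also have "\<dots> = line_system.tp vt par (\<lambda>l. ereal (trk z l)) (\<lambda>l. ereal (org z l)) (\<lambda>_. \<infinity>) (\<lambda>_ _. True) (label_of l)"
    by (rule line_system.tp_finite[symmetric]) simp
  finally show ?thesis unfolding lines.sg_def line_system.sg_def by (simp only: rl)
qed

lemma segments_tree_diagram: "segments = tree_diagram z"
proof (rule set_eqI)
  fix s
  have "s \<in> segments \<longleftrightarrow> (\<exists>l. s = lines.sg l \<and> pure l \<and> lines.arr l (orig l))"
    unfolding segments_eq using arr_pure by blast
  also have "\<dots> \<longleftrightarrow> (\<exists>l. pure l \<and> s = tree_sg z (label_of l) \<and> tree_arr z (label_of l) (ereal (org z (label_of l))))"
    by (intro ex_cong1) (auto simp: sg_eq arr_eq route_pure)
  also have "\<dots> \<longleftrightarrow> (\<exists>m. par m \<noteq> None \<and> s = tree_sg z m \<and> tree_arr z m (ereal (org z m)))"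
  proof (intro iffI; elim exE conjE)
    fix l assume "pure l" "s = tree_sg z (label_of l)" "tree_arr z (label_of l) (ereal (org z (label_of l)))"
    then show "\<exists>m. par m \<noteq> None \<and> s = tree_sg z m \<and> tree_arr z m (ereal (org z m))"
      by (intro exI[of _ "label_of l"] conjI par_label_of)
  next
    fix m assume m: "par m \<noteq> None" "s = tree_sg z m" "tree_arr z m (ereal (org z m))"
    show "\<exists>l. pure l \<and> s = tree_sg z (label_of l) \<and> tree_arr z (label_of l) (ereal (org z (label_of l)))"
      by (rule exI[of _ "line_of m"]) (simp only: label_of_line_of[OF m(1)] m simp_thms)
  qed
  also have "\<dots> \<longleftrightarrow> s \<in> tree_diagram z"
    unfolding tree_diagram_def line_system.arr_ex_iff by blast
  finally show "s \<in> segments \<longleftrightarrow> s \<in> tree_diagram z" .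
qed

end

section \<open>Almost sure identification of the diagram with that of the tree\<close>

lemma AE_waiting_time_1: "AE r in waiting_time 1. \<exists>s>0. r = ereal s"
  unfolding waiting_time_1
proof (subst AE_distr_iff[OF measurable_ereal_exp_law])
  have "{r :: ereal. \<exists>s>0. r = ereal s} = {0<..<\<infinity>}"
  proof (intro set_eqI iffI)
    fix r :: ereal assume "r \<in> {0<..<\<infinity>}"
    then show "r \<in> {r. \<exists>s>0. r = ereal s}" by (cases r) simp_all
  qed auto
  then show "{r \<in> space borel. \<exists>s>0. r = ereal s} \<in> sets borel" by simp
  show "AE s in exp_law. \<exists>s'>0. ereal s = ereal s'"
    using AE_exp_law_pos by eventually_elim simp
qed

text \<open>At intensity 0 each bounded square is almost surely empty, and countably many squares
  exhaust the open quadrant.\<close>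

lemma AE_no_planar_points:
  assumes "sets Q = sets (config_space ({0<..} \<times> {0<..}))" "poisson_process Q ({0<..} \<times> {0<..}) 0 (\<lambda>\<Xi>. \<Xi>)"
  shows "AE \<Xi> in Q. \<Xi> = ({} :: (real \<times> real) set)"
proof -
  interpret Q: prob_space Q using assms(2) by (simp add: poisson_process_def)
  have sp: "space Q = space (config_space ({0<..} \<times> {0<..}))" by (rule sets_eq_imp_space_eq[OF assms(1)])
  let ?B = "\<lambda>n::nat. {0<..<real n} \<times> {0<..<real n}"
  have B: "?B n \<in> sets borel" "bounded (?B n)" "?B n \<subseteq> {0<..} \<times> {0<..}" for n
    by (auto intro!: borel_open open_Times bounded_Times)
  have "AE \<Xi> in Q. card (\<Xi> \<inter> ?B n) = 0" for n
  proof -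
    have "measure Q {\<Xi> \<in> space Q. card (\<Xi> \<inter> ?B n) = 0} = 1"
      using assms(2) B[of n]
      unfolding poisson_process_def by (elim conjE) (drule spec[of _ "?B n"], drule mp, (intro conjI B), drule spec[of _ 0], simp)
    moreover have "{\<Xi> \<in> space (config_space ({0<..} \<times> {0<..})). card (\<Xi> \<inter> ?B n) \<in> {0}} \<in> sets (config_space ({0<..} \<times> {0<..}))"
      by (rule measurable_sets_Collect[OF measurable_card_config_space[OF B(1,2)]]) simp
    then have "{\<Xi> \<in> space Q. card (\<Xi> \<inter> ?B n) = 0} \<in> sets Q"
      by (simp only: sp assms(1) singleton_iff)
    ultimately have "AE \<Xi> in Q. \<Xi> \<in> {\<Xi> \<in> space Q. card (\<Xi> \<inter> ?B n) = 0}"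
      by (simp only: Q.AE_in_set_eq_1)
    then show ?thesis by eventually_elim (simp only: mem_Collect_eq)
  qed
  then have "AE \<Xi> in Q. \<forall>n. card (\<Xi> \<inter> ?B n) = 0" unfolding AE_all_countable ..
  then show ?thesis using AE_space
  proof eventually_elim
    case (elim \<Xi>)
    have \<Xi>: "\<Xi> \<subseteq> {0<..} \<times> {0<..}" "\<And>B. bounded B \<Longrightarrow> finite (\<Xi> \<inter> B)"
      using elim(2) by (auto simp: sp space_config_space)
    show ?case
    proof (rule equals0I)
      fix w assume w: "w \<in> \<Xi>"
      obtain n :: nat where n: "max (fst w) (snd w) < real n" using reals_Archimedean2 by blast
      have "w \<in> \<Xi> \<inter> ?B n" using w n subsetD[OF \<Xi>(1) w] by (simp add: mem_Times_iff)
      \<comment> \<open>Local finiteness is used because \<open>card\<close> is 0 on infinite sets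
        too.\<close>
      moreover have "finite (\<Xi> \<inter> ?B n)" by (rule \<Xi>(2)[OF B(2)])
      ultimately show False using elim(1)[rule_format, of n] by auto
    qed
  qed
qed

lemma AE_unit_mark: "AE x in uniform_measure lborel {0..1::real}. 0 \<le> x \<and> x < 1"
  by (rule AE_uniform_measureI) (use AE_lborel_singleton[of "1::real"] in \<open>auto elim: eventually_mono\<close>)

lemma driving_measure_CBMC:
  "driving_measure p_CBMC N Q =
     N \<Otimes>\<^sub>M Q \<Otimes>\<^sub>M split_law \<Otimes>\<^sub>M (\<Pi>\<^sub>M l\<in>(UNIV :: line set). return borel (\<infinity> :: ereal)) \<Otimes>\<^sub>M
     (\<Pi>\<^sub>M vh\<in>(UNIV :: (line \<times> line) set). uniform_measure lborel {0..1::real})"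
proof -
  have "split_rate p_CBMC l = 1" "turn_rate p_CBMC l = 0" for l
    by (simp_all add: split_rate_def turn_rate_def p_CBMC_def)
  then show ?thesis by (simp add: driving_measure_def waiting_time_def[of 0])
qed

lemma distr_first_third:
  assumes "prob_space N" "prob_space Q" "prob_space G" "prob_space R"
  shows "distr (N \<Otimes>\<^sub>M Q \<Otimes>\<^sub>M G \<Otimes>\<^sub>M R) (N \<Otimes>\<^sub>M G) (\<lambda>\<omega>. (fst \<omega>, fst (snd (snd \<omega>)))) = N \<Otimes>\<^sub>M G"
proof -
  interpret N: prob_space N by fact
  interpret Q: prob_space Q by fact
  interpret G: prob_space G by fact
  interpret R: prob_space R by fact
  interpret GR: pair_prob_space G R ..
  interpret QGR: pair_prob_space Q "G \<Otimes>\<^sub>M R" ..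
  let ?P = "N \<Otimes>\<^sub>M Q \<Otimes>\<^sub>M G \<Otimes>\<^sub>M R" and ?f = "\<lambda>\<omega>. (fst \<omega>, fst (snd (snd \<omega>)))"
  have f: "?f \<in> measurable ?P (N \<Otimes>\<^sub>M G)" by measurable
  have "N \<Otimes>\<^sub>M G = distr ?P (N \<Otimes>\<^sub>M G) ?f"
  proof (rule pair_measure_eqI)
    fix A B assume A: "A \<in> sets N" and B: "B \<in> sets G"
    have AB: "A \<times> B \<in> sets (N \<Otimes>\<^sub>M G)" using A B by (rule pair_measureI)
    have "?f -` (A \<times> B) \<inter> space ?P = A \<times> (space Q \<times> (B \<times> space R))"
      using sets.sets_into_space[OF A] sets.sets_into_space[OF B] by (auto simp: space_pair_measure)
    then have "emeasure (distr ?P (N \<Otimes>\<^sub>M G) ?f) (A \<times> B) = emeasure ?P (A \<times> (space Q \<times> (B \<times> space R)))"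
      by (simp add: emeasure_distr[OF f AB])
    also have "\<dots> = emeasure N A * (emeasure Q (space Q) * (emeasure G B * emeasure R (space R)))"
      using A B by (simp add: QGR.emeasure_pair_measure_Times GR.emeasure_pair_measure_Times R.emeasure_pair_measure_Times)
    finally show "emeasure N A * emeasure G B = emeasure (distr ?P (N \<Otimes>\<^sub>M G) ?f) (A \<times> B)"
      by (simp add: Q.emeasure_space_1 R.emeasure_space_1)
  qed (auto intro: N.sigma_finite_measure_axioms G.sigma_finite_measure_axioms)
  then show ?thesis ..
qed

context
  fixes N :: "real set measure" and Q :: "(real \<times> real) set measure"
  assumes ppp: "is_N_PPP 1 1 N" and Q: "sets Q = sets (config_space ({0<..} \<times> {0<..}))"
    "poisson_process Q ({0<..} \<times> {0<..}) 0 (\<lambda>\<Xi>. \<Xi>)"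
begin

abbreviation "turn_law \<equiv> (\<Pi>\<^sub>M l\<in>(UNIV :: line set). return borel (\<infinity> :: ereal))"
abbreviation "mark_law \<equiv> (\<Pi>\<^sub>M vh\<in>(UNIV :: (line \<times> line) set). uniform_measure lborel {0..1::real})"
abbreviation "driving_law \<equiv> driving_measure p_CBMC N Q"
abbreviation "drive_noise \<equiv> \<lambda>\<omega>::driving. noise_of (fst \<omega>) (fst (snd (snd \<omega>)))"

lemma prob_space_Q: "prob_space Q"
  using Q(2) by (simp add: poisson_process_def)

lemma prob_space_unit_mark: "prob_space (uniform_measure lborel {0..1::real})"
  by (rule prob_space_uniform_measure) simp_all

lemma prob_space_parts: "prob_space turn_law" "prob_space mark_law"
  by (intro prob_space_PiM prob_space_return prob_space_unit_mark; simp)+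

lemma prob_space_rest: "prob_space (turn_law \<Otimes>\<^sub>M mark_law)"
  "prob_space (split_law \<Otimes>\<^sub>M turn_law \<Otimes>\<^sub>M mark_law)"
  "prob_space (Q \<Otimes>\<^sub>M split_law \<Otimes>\<^sub>M turn_law \<Otimes>\<^sub>M mark_law)"
  using prob_space_parts prob_space_split_law prob_space_Q by (auto intro!: prob_space_pair)

lemma measurable_drive_noise: "drive_noise \<in> measurable driving_law noise"
proof -
  have "(\<lambda>\<omega>. (fst \<omega>, fst (snd (snd \<omega>)))) \<in> measurable driving_law (N \<Otimes>\<^sub>M split_law)"
    unfolding driving_measure_CBMC by measurable
  from measurable_compose[OF this measurable_noise_of[OF ppp]] show ?thesis by simp
qed

lemma distr_drive_noise: "distr driving_law noise drive_noise = noise"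
proof -
  have m: "(\<lambda>\<omega>. (fst \<omega>, fst (snd (snd \<omega>)))) \<in> measurable driving_law (N \<Otimes>\<^sub>M split_law)"
    unfolding driving_measure_CBMC by measurable
  have "distr driving_law noise drive_noise = distr (distr driving_law (N \<Otimes>\<^sub>M split_law) (\<lambda>\<omega>. (fst \<omega>, fst (snd (snd \<omega>))))) noise (\<lambda>(X, g). noise_of X g)"
    by (subst distr_distr[OF measurable_noise_of[OF ppp] m]) (simp add: comp_def)
  also have "distr driving_law (N \<Otimes>\<^sub>M split_law) (\<lambda>\<omega>. (fst \<omega>, fst (snd (snd \<omega>)))) = N \<Otimes>\<^sub>M split_law"
    unfolding driving_measure_CBMC
    by (rule distr_first_third[OF prob_space_N[OF ppp] prob_space_Q prob_space_split_law prob_space_rest(1)])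
  finally show ?thesis by (simp only: distr_noise_of[OF ppp])
qed

text \<open>Each driving component almost surely meets its requirement in the locale
  \<open>cbmc\<close>, which then gives the identity pathwise.\<close>

lemma AE_diagram: "AE \<omega> in driving_law. diagram p_CBMC \<omega> = tree_diagram (drive_noise \<omega>)"
proof -
  have 1: "AE \<omega> in driving_law. \<forall>b. axis_points b (fst \<omega>) = range (psum (gap_seq (axis_count b (fst \<omega>))))"
    unfolding driving_measure_CBMC
    by (rule AE_pair_fst[OF prob_space_rest(3)]) (use AE_axis_points[OF ppp] in \<open>eventually_elim, simp\<close>)
  have 2: "AE \<omega> in driving_law. fst (snd \<omega>) = {}"
    unfolding driving_measure_CBMC
    by (rule AE_pair_snd[OF prob_space_N[OF ppp] prob_space_rest(3)], rule AE_pair_fst[OF prob_space_rest(2)],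
        rule AE_no_planar_points[OF Q])
  have 3: "AE \<omega> in driving_law. \<forall>lk. \<exists>r>0. fst (snd (snd \<omega>)) lk = ereal r"
    unfolding driving_measure_CBMC
  proof (rule AE_pair_snd[OF prob_space_N[OF ppp] prob_space_rest(3)], rule AE_pair_snd[OF prob_space_Q prob_space_rest(2)],
      rule AE_pair_fst[OF prob_space_rest(1)])
    have "AE g in split_law. \<exists>r>0. g lk = ereal r" for lk
      by (rule AE_PiM_component[OF prob_space_waiting_time_1 _ AE_waiting_time_1]) simp
    then show "AE g in split_law. \<forall>lk. \<exists>r>0. g lk = ereal r" unfolding AE_all_countable ..
  qed
  have 4: "AE \<omega> in driving_law. \<forall>l. fst (snd (snd (snd \<omega>))) l = \<infinity>"
    unfolding driving_measure_CBMC
  proof (rule AE_pair_snd[OF prob_space_N[OF ppp] prob_space_rest(3)], rule AE_pair_snd[OF prob_space_Q prob_space_rest(2)],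
      rule AE_pair_snd[OF prob_space_split_law prob_space_rest(1)], rule AE_pair_fst[OF prob_space_parts(2)])
    have inf: "AE r in return borel (\<infinity> :: ereal). r = \<infinity>" by (subst AE_return) simp_all
    have "AE w in turn_law. w l = \<infinity>" for l
      by (rule AE_PiM_component[where M = "\<lambda>_. return borel (\<infinity> :: ereal)"], rule prob_space_return, simp, rule UNIV_I, rule inf)
    then show "AE w in turn_law. \<forall>l. w l = \<infinity>" unfolding AE_all_countable ..
  qed
  have 5: "AE \<omega> in driving_law. \<forall>vh. 0 \<le> snd (snd (snd (snd \<omega>))) vh \<and> snd (snd (snd (snd \<omega>))) vh < 1"
    unfolding driving_measure_CBMC
  proof (rule AE_pair_snd[OF prob_space_N[OF ppp] prob_space_rest(3)], rule AE_pair_snd[OF prob_space_Q prob_space_rest(2)],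
      rule AE_pair_snd[OF prob_space_split_law prob_space_rest(1)], rule AE_pair_snd[OF prob_space_parts])
    have "AE u in mark_law. 0 \<le> u vh \<and> u vh < 1" for vh
      by (rule AE_PiM_component[OF prob_space_unit_mark _ AE_unit_mark]) simp
    then show "AE u in mark_law. \<forall>vh. 0 \<le> u vh \<and> u vh < 1" unfolding AE_all_countable ..
  qed
  have 6: "AE \<omega> in driving_law. good (drive_noise \<omega>)"
    by (rule AE_distrD[OF measurable_drive_noise]) (simp only: distr_drive_noise AE_good)
  show ?thesis
    using 1 2 3 4 5 6
  proof eventually_elim
    case (elim \<omega>)
    obtain X \<Xi> g w u where \<omega>: "\<omega> = (X, \<Xi>, g, w, u)" by (cases \<omega>) auto
    have w: "w = (\<lambda>_. \<infinity>)" and \<Xi>: "\<Xi> = {}" using elim(2,4) by (auto simp: \<omega>)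
    interpret cbmc X g u
    proof
      show "0 \<le> u vh \<and> u vh < 1" for vh using elim(5)[rule_format, of vh] by (simp only: \<omega> snd_conv)
      show "\<exists>r>0. g lk = ereal r" for lk using elim(3)[rule_format, of lk] by (simp only: \<omega> fst_conv snd_conv)
      show "axis_points b X = range (psum (noise_of X g (Axis b)))" for b using elim(1) by (simp add: \<omega>)
      show "good (noise_of X g)" using elim(6) by (simp add: \<omega>)
    qed
    show ?case using segments_tree_diagram by (simp add: \<omega> w \<Xi> diagram_def)
  qed
qed

lemma distr_diagram:
  assumes "segment_process driving_law (\<lambda>\<omega>. F (diagram p_CBMC \<omega>))" "segment_process noise (\<lambda>z. F (tree_diagram z))"
  shows "distr driving_law segments_space (\<lambda>\<omega>. F (diagram p_CBMC \<omega>)) = distr noise segments_space (\<lambda>z. F (tree_diagram z))"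
proof -
  note m = segment_process_measurable[OF assms(1)] segment_process_measurable[OF assms(2)]
  have "distr driving_law segments_space (\<lambda>\<omega>. F (diagram p_CBMC \<omega>)) = distr driving_law segments_space (\<lambda>\<omega>. F (tree_diagram (drive_noise \<omega>)))"
  proof (rule distr_cong_AE)
    show "AE \<omega> in driving_law. F (diagram p_CBMC \<omega>) = F (tree_diagram (drive_noise \<omega>))"
      using AE_diagram by eventually_elim (simp only:)
  qed (use m(1) measurable_compose[OF measurable_drive_noise m(2)] in simp_all)
  also have "\<dots> = distr (distr driving_law noise drive_noise) segments_space (\<lambda>z. F (tree_diagram z))"
    by (subst distr_distr[OF m(2) measurable_drive_noise]) (simp only: comp_def)
  finally show ?thesis by (simp only: distr_drive_noise)
qed

lemma eq_in_law_diagram: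
  assumes "0 < a" "0 < b"
  shows "eq_in_law driving_law segments_space (\<lambda>\<omega>. restrict_quadrant a b (diagram p_CBMC \<omega>)) (\<lambda>\<omega>. translate a b (diagram p_CBMC \<omega>))"
proof -
  have "sets N = sets (config_space UNIV)" using ppp by (simp add: is_N_PPP_def point_process_law_def)
  note sp = segment_process_diagram[OF this Q(1), of p_CBMC]
  note R = segment_process_restrict[OF sp, of a b] and T = segment_process_translate[OF sp, of a b]
  have "distr driving_law segments_space (\<lambda>\<omega>. restrict_quadrant a b (diagram p_CBMC \<omega>)) =
    distr driving_law segments_space (\<lambda>\<omega>. translate a b (diagram p_CBMC \<omega>))"
    unfolding distr_diagram[OF R segment_process_restrict[OF segment_process_tree_diagram]]
      distr_diagram[OF T segment_process_translate[OF segment_process_tree_diagram]]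
    by (rule tree_stationary[OF assms])
  then show ?thesis
    unfolding eq_in_law_def using segment_process_measurable[OF R] segment_process_measurable[OF T] by simp
qed

end

theorem proposition2:
  fixes N :: "real set measure"
  assumes "is_N_PPP 1 1 N"
  shows "stationary p_CBMC N"
proof -
  \<comment> \<open>The cuts require positive \<open>a\<close> and \<open>b\<close>; the coordinate
    lines form a null set, which the almost everywhere quantifier absorbs.\<close>
  have ab: "AE x in lborel. fst x \<noteq> (0::real) \<and> snd x \<noteq> (0::real)"
  proof (rule AE_conjI)
    have "{0::real} \<times> (UNIV :: real set) \<in> null_sets (lborel \<Otimes>\<^sub>M lborel)"
      "(UNIV :: real set) \<times> {0::real} \<in> null_sets (lborel \<Otimes>\<^sub>M lborel)"
      by (auto intro!: null_setsI pair_measureI simp: lborel.emeasure_pair_measure_Times)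
    then have null: "{0::real} \<times> (UNIV :: real set) \<in> null_sets lborel" "(UNIV :: real set) \<times> {0::real} \<in> null_sets lborel"
      by (simp_all only: lborel_prod)
    show "AE x in (lborel :: (real \<times> real) measure). fst x \<noteq> (0::real)" by (rule AE_I'[OF null(1)]) auto
    show "AE x in (lborel :: (real \<times> real) measure). snd x \<noteq> (0::real)" by (rule AE_I'[OF null(2)]) auto
  qed
  show ?thesis
    unfolding stationary_def
  proof (intro conjI allI impI)
    show "valid_param p_CBMC" by (simp add: valid_param_def p_CBMC_def)
    show "point_process_law N" using assms by (simp add: is_N_PPP_def)
    fix Q :: "(real \<times> real) set measure"
    assume "sets Q = sets (config_space ({0<..} \<times> {0<..})) \<and> poisson_process Q ({0<..} \<times> {0<..}) (lam0 p_CBMC) (\<lambda>\<Xi>. \<Xi>)"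
    then have Q: "sets Q = sets (config_space ({0<..} \<times> {0<..}))" "poisson_process Q ({0<..} \<times> {0<..}) 0 (\<lambda>\<Xi>. \<Xi>)"
      by (simp_all add: p_CBMC_def)
    show "AE (a, b) in lborel. 0 \<le> a \<and> 0 \<le> b \<longrightarrow>
      eq_in_law (driving_measure p_CBMC N Q) segments_space
        (\<lambda>\<omega>. restrict_quadrant a b (diagram p_CBMC \<omega>)) (\<lambda>\<omega>. translate a b (diagram p_CBMC \<omega>))"
      using ab
    proof eventually_elim
      case (elim x)
      then show ?case using eq_in_law_diagram[OF assms Q] by (auto simp: less_le split: prod.split)
    qed
  qed
qed

end
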